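(* Assume $\sigma>0$, $\int_{(-1,1)\setminus\{0\}}|z|\,\nu(dz)<\infty$, $\nu(dz)=s(z)\,dz$ for some continuous function $s$ on $\mathbb{R}\setminus\{0\}$, and $d<0$. Let $b(T):=\lim_{t\to T^-}b(t)$, $\lambda=\nu(\{\ln(K/b(T))\})$, $\bar\delta=\delta+\int_{(\ln(K/b(T)),\infty)}e^z\nu(dz)$ and $\beta=K/(b(T)\bar\delta)$. Then for any $a\in(-\infty,0)$, $$P\big(T-\theta,b(T)e^{a\sqrt\theta}\big)=\big(K-b(T)e^{a\sqrt\theta}\big)^++\sigma b(T)\bar\delta e^{\lambda}v_{\lambda,\beta}(a/\sigma)\theta^{3/2}+o(\theta^{3/2}),\quad \theta\to0^+.$$
   Context: Let $(\Omega,\mathscr{F},\mathbb{F},\mathbb{P})$ be a complete filtered probability space. Fix $r\ge0$, $\delta\ge0$, $K>0$, $T>0$. Let $X$ be a Lévy process with Lévy triplet $(b,\sigma^2,\nu)$ such that: (i) $\sigma\neq0$, or $\nu((-\infty,0))>0$, or $\int_{(0,1]}z\,\nu(dz)=\infty$; (ii) $\sigma\neq0$, or $\nu((0,\infty))>0$, or $\int_{[-1,0)}|z|\,\nu(dz)=\infty$; (iii) $\int_1^\infty e^z\nu(dz)<\infty$ and $b=-\frac{\sigma^2}{2}-\int_{\mathbb{R}\setminus\{0\}}(e^z-1-z\mathbf 1_{\{|z|\le1\}})\nu(dz)$. The asset price is $S_t=S_0e^{(r-\delta)t+X_t}$. The American put price is $P(t,s)=\sup_{\tau}\mathbb{E}\big(e^{-r\tau}(K-se^{(r-\delta)\tau+X_\tau})^+\big)$,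 supremum over $\mathbb{F}$-stopping times with values in $[0,T-t]$, and the critical price is $b(t)=\inf\{s\ge0:P(t,s)>(K-s)^+\}$ (nondecreasing, so the limit $b(T)$ exists). Define $d:=r-\delta-\int_{(0,\infty)}(e^z-1)\nu(dz)$. For $\lambda,\beta\ge0$ and $y\in\mathbb{R}$, let $W$ be a standard Brownian motion with local time $L^W_t(x)$ at level $x$, $\overline N$ a Poisson process of intensity $\lambda$ independent of $W$ with first jump time $\overline T_1$, $f_a(x):=x+ax^+$, and $$v_{\lambda,\beta}(y):=\sup_{\tau}\mathbb{E}\Big(e^{-\lambda\tau}\mathbf 1_{\{\overline N_\tau=0\}}\int_0^\tau f_{\lambda\beta}(y+W_s)\,ds+\frac{\beta e^{\lambda\tau}}{2}\mathbf 1_{\{\overline N_\tau=1\}}\big(L^W_\tau(-y)-L^W_{\overline T_1}(-y)\big)\Big),$$ supremum over stopping times of the filtration generated by $(W,\overline N)$ with values in $[0,1]$. *)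

theory Defs
  imports "HOL-Probability.Probability" "HOL-Library.Landau_Symbols"
begin

definition complete_prob_space :: "'a measure \<Rightarrow> bool" where
  "complete_prob_space M \<longleftrightarrow> prob_space M \<and>
     (\<forall>N \<in> null_sets M. \<forall>A. A \<subseteq> N \<longrightarrow> A \<in> sets M)"

definition is_filtration :: "'a measure \<Rightarrow> (real \<Rightarrow> 'a measure) \<Rightarrow> bool" where
  "is_filtration M F \<longleftrightarrow> (\<forall>t. subalgebra M (F t)) \<and>
     (\<forall>s t. s \<le> t \<longrightarrow> sets (F s) \<subseteq> sets (F t))"

definition rv_events :: "'a measure \<Rightarrow> ('a \<Rightarrow> real) \<Rightarrow> 'a set set" where
  "rv_events M Y = {Y -` A \<inter> space M | A. A \<in> sets borel}"

definition levy_measure :: "real measure \<Rightarrow> bool" where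
  "levy_measure \<nu> \<longleftrightarrow> sets \<nu> = sets borel \<and> emeasure \<nu> {0} = 0 \<and>
     (\<integral>\<^sup>+ z. ennreal (min 1 (z\<^sup>2)) \<partial>\<nu>) < \<infinity>"

definition levy_exponent :: "real \<Rightarrow> real \<Rightarrow> real measure \<Rightarrow> real \<Rightarrow> complex" where
  "levy_exponent b \<sigma> \<nu> u =
     \<i> * complex_of_real (b * u) - complex_of_real (\<sigma>\<^sup>2 * u\<^sup>2 / 2)
     + (CLINT z | \<nu>. iexp (u * z) - 1 - \<i> * complex_of_real (u * z * indicator {-1..1} z))"

definition levy_process ::
  "'a measure \<Rightarrow> (real \<Rightarrow> 'a measure) \<Rightarrow> (real \<Rightarrow> 'a \<Rightarrow> real) \<Rightarrow> real \<Rightarrow> real \<Rightarrow> real measure \<Rightarrow> bool" where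
  "levy_process M F X b \<sigma> \<nu> \<longleftrightarrow>
     prob_space M \<and> is_filtration M F \<and> levy_measure \<nu> \<and>
     (\<forall>t\<ge>0. X t \<in> borel_measurable (F t)) \<and>
     (AE \<omega> in M. X 0 \<omega> = 0) \<and>
     (AE \<omega> in M. \<forall>t\<ge>0. ((\<lambda>u. X u \<omega>) \<longlongrightarrow> X t \<omega>) (at_right t) \<and>
                       (t > 0 \<longrightarrow> (\<exists>l. ((\<lambda>u. X u \<omega>) \<longlongrightarrow> l) (at_left t)))) \<and>
     (\<forall>s t. 0 \<le> s \<longrightarrow> s \<le> t \<longrightarrow>
        prob_space.indep_set M (sets (F s)) (rv_events M (\<lambda>\<omega>. X t \<omega> - X s \<omega>)) \<and>
        distr M borel (\<lambda>\<omega>. X t \<omega> - X s \<omega>) = distr M borel (X (t - s))) \<and>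
     (\<forall>t\<ge>0. \<forall>u. char (distr M borel (X t)) u = exp (complex_of_real t * levy_exponent b \<sigma> \<nu> u))"

definition american_put ::
  "'a measure \<Rightarrow> (real \<Rightarrow> 'a measure) \<Rightarrow> (real \<Rightarrow> 'a \<Rightarrow> real) \<Rightarrow> real \<Rightarrow> real \<Rightarrow> real \<Rightarrow> real
     \<Rightarrow> real \<Rightarrow> real \<Rightarrow> real" where
  "american_put M F X r \<delta> K T t s =
     (SUP \<tau> \<in> {\<tau>. stopping_time F \<tau> \<and> (\<forall>\<omega>\<in>space M. 0 \<le> \<tau> \<omega> \<and> \<tau> \<omega> \<le> T - t)}.
        prob_space.expectation M
          (\<lambda>\<omega>. exp (- r * \<tau> \<omega>) * max 0 (K - s * exp ((r - \<delta>) * \<tau> \<omega> + X (\<tau> \<omega>) \<omega>))))"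

definition critical_price ::
  "'a measure \<Rightarrow> (real \<Rightarrow> 'a measure) \<Rightarrow> (real \<Rightarrow> 'a \<Rightarrow> real) \<Rightarrow> real \<Rightarrow> real \<Rightarrow> real \<Rightarrow> real
     \<Rightarrow> real \<Rightarrow> real" where
  "critical_price M F X r \<delta> K T t =
     Inf {s. 0 \<le> s \<and> american_put M F X r \<delta> K T t s > max 0 (K - s)}"

definition f_aux :: "real \<Rightarrow> real \<Rightarrow> real" where
  "f_aux a x = x + a * max 0 x"

definition std_brownian_motion :: "'b measure \<Rightarrow> (real \<Rightarrow> 'b \<Rightarrow> real) \<Rightarrow> bool" where
  "std_brownian_motion M W \<longleftrightarrow>
     (\<forall>t. W t \<in> borel_measurable M) \<and>
     (\<forall>\<omega>\<in>space M. W 0 \<omega> = 0 \<and> continuous_on {0..} (\<lambda>t. W t \<omega>)) \<and>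
     (\<forall>s t. 0 \<le> s \<longrightarrow> s < t \<longrightarrow>
        distr M borel (\<lambda>\<omega>. W t \<omega> - W s \<omega>) = density lborel (normal_density 0 (sqrt (t - s))) \<and>
        prob_space.indep_set M
          (sigma_sets (space M) (\<Union>u\<in>{0..s}. rv_events M (W u)))
          (rv_events M (\<lambda>\<omega>. W t \<omega> - W s \<omega>)))"

definition poisson_process :: "'b measure \<Rightarrow> real \<Rightarrow> (real \<Rightarrow> 'b \<Rightarrow> nat) \<Rightarrow> bool" where
  "poisson_process M lam N \<longleftrightarrow>
     (\<forall>t. N t \<in> measurable M (count_space UNIV)) \<and>
     (\<forall>\<omega>\<in>space M. N 0 \<omega> = 0 \<and> mono_on {0..} (\<lambda>t. N t \<omega>) \<and>
        (\<forall>t\<ge>0. eventually (\<lambda>u. N u \<omega> = N t \<omega>) (at_right t))) \<and>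
     (\<forall>s t. 0 \<le> s \<longrightarrow> s \<le> t \<longrightarrow>
        (\<forall>k::nat. prob_space.prob M {\<omega>\<in>space M. N t \<omega> - N s \<omega> = k}
            = exp (- lam * (t - s)) * (lam * (t - s)) ^ k / fact k) \<and>
        prob_space.indep_set M
          (sigma_sets (space M) (\<Union>u\<in>{0..s}. {N u -` A \<inter> space M | A. A \<subseteq> UNIV}))
          ({(\<lambda>\<omega>. N t \<omega> - N s \<omega>) -` A \<inter> space M | A. A \<subseteq> UNIV}))"

definition local_time_of ::
  "'b measure \<Rightarrow> (real \<Rightarrow> 'b \<Rightarrow> real) \<Rightarrow> (real \<Rightarrow> real \<Rightarrow> 'b \<Rightarrow> real) \<Rightarrow> bool" where
  "local_time_of M W L \<longleftrightarrow>
     (\<forall>t x. L t x \<in> borel_measurable M) \<and>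
     (\<forall>\<omega>\<in>space M. \<forall>x. continuous_on {0..} (\<lambda>t. L t x \<omega>)) \<and>
     (AE \<omega> in M. \<forall>t\<ge>0. \<forall>x.
        ((\<lambda>\<epsilon>. 1 / (2 * \<epsilon>) * measure lborel {s \<in> {0..t}. \<bar>W s \<omega> - x\<bar> < \<epsilon>}) \<longlongrightarrow> L t x \<omega>)
          (at_right 0))"

definition nat_filtration ::
  "'b measure \<Rightarrow> (real \<Rightarrow> 'b \<Rightarrow> real) \<Rightarrow> (real \<Rightarrow> 'b \<Rightarrow> nat) \<Rightarrow> real \<Rightarrow> 'b measure" where
  "nat_filtration M W N t = sigma (space M)
     ((\<Union>u\<in>{0..t}. rv_events M (W u)) \<union> (\<Union>u\<in>{0..t}. {N u -` A \<inter> space M | A. A \<subseteq> UNIV}))"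

definition first_jump :: "(real \<Rightarrow> 'b \<Rightarrow> nat) \<Rightarrow> 'b \<Rightarrow> real" where
  "first_jump N \<omega> = Inf {t. 0 \<le> t \<and> 1 \<le> N t \<omega>}"

definition aux_space ::
  "'b measure \<Rightarrow> real \<Rightarrow> (real \<Rightarrow> 'b \<Rightarrow> real) \<Rightarrow> (real \<Rightarrow> 'b \<Rightarrow> nat) \<Rightarrow> (real \<Rightarrow> real \<Rightarrow> 'b \<Rightarrow> real) \<Rightarrow> bool" where
  "aux_space M lam W N L \<longleftrightarrow> prob_space M \<and> std_brownian_motion M W \<and> poisson_process M lam N \<and>
     local_time_of M W L \<and>
     prob_space.indep_var M (PiM UNIV (\<lambda>_::real. borel)) (\<lambda>\<omega> t. W t \<omega>)
                            (PiM UNIV (\<lambda>_::real. count_space UNIV)) (\<lambda>\<omega> t. N t \<omega>)"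

definition v_aux ::
  "'b measure \<Rightarrow> (real \<Rightarrow> 'b \<Rightarrow> real) \<Rightarrow> (real \<Rightarrow> 'b \<Rightarrow> nat) \<Rightarrow> (real \<Rightarrow> real \<Rightarrow> 'b \<Rightarrow> real)
     \<Rightarrow> real \<Rightarrow> real \<Rightarrow> real \<Rightarrow> real" where
  "v_aux M W N L lam \<beta> y =
     (SUP \<tau> \<in> {\<tau>. stopping_time (nat_filtration M W N) \<tau> \<and> (\<forall>\<omega>\<in>space M. 0 \<le> \<tau> \<omega> \<and> \<tau> \<omega> \<le> 1)}.
        prob_space.expectation M (\<lambda>\<omega>.
          exp (- lam * \<tau> \<omega>) * (if N (\<tau> \<omega>) \<omega> = 0 then 1 else 0) *
             integral {0..\<tau> \<omega>} (\<lambda>s. f_aux (lam * \<beta>) (y + W s \<omega>))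
          + \<beta> * exp (lam * \<tau> \<omega>) / 2 * (if N (\<tau> \<omega>) \<omega> = 1 then 1 else 0) *
             (L (\<tau> \<omega>) (- y) \<omega> - L (first_jump N \<omega>) (- y) \<omega>)))"

end

theory Submission
  imports Defs
begin

text \<open>
  Since \<open>\<nu>\<close> has a density, \<open>\<lambda> = 0\<close> and \<open>v\<close> is the value of stopping the integral of \<open>y + W\<close>. No stochastic
  calculus is needed: all stopping problems are compared with dynamic programs on finite grids.

  Write \<open>Y\<close> for the log-price. Applied to a smoothed payoff, the discounted generator at a point \<open>x < K\<close> of the
  exercise region is \<open>- \<phi>(x)\<close> with \<open>\<phi>(x) = r K - \<delta> x - \<integral> max 0 (x e\<^sup>z - K) \<nu>(dz)\<close>. This concave function identifies
  \<open>b(T)\<close> as its root in \<open>(0, K)\<close> if \<open>r > 0\<close>; if \<open>r = 0\<close>, the discounted price is a supermartingale and reaches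
  every level with positive probability, so that \<open>b(T) = 0\<close> and the claim is trivial. At the root \<open>\<phi>\<close> is
  linear to first order with slope \<open>- \<delta>bar\<close>, so the Dynkin formula on a grid turns the early exercise gain into
  \<open>b(T) \<delta>bar\<close> times the value of stopping a sum of the values of \<open>a \<surd>\<theta> + Y\<close>. On the time scale \<open>\<theta>\<close> the process
  \<open>Y / \<surd>\<theta>\<close> converges in law to \<open>\<sigma> W\<close>; finite-horizon dynamic programs with bounded Lipschitz running rewards are continuous under
  weak convergence of the step law, and the Brownian problem is approximated by the same kind of programs.
  With \<open>\<theta> = p\<^sup>8\<close> all scales (\<open>\<surd>\<theta> = p\<^sup>4\<close>, smoothing width \<open>p\<^sup>3\<close>, error \<open>p\<^sup>1\<^sup>2\<close>) become natural powers of \<open>p\<close>.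
\<close>


text \<open>The log-price is known only through its characteristic exponent, and the put has a kink
  at \<open>ln K\<close>. So small-time limits are extracted from the exponent (via the weight
  \<open>gw\<close>), and the payoff is replaced by a C1 majorant for the upper bound and a C1
  minorant for the lower bound, both exact at distance \<open>eta\<close> from the kink. Near
  \<open>b(T)\<close> the kink is felt only through jumps, at cost \<open>eta\<^sup>2\<close> by the
  density bound. Away from \<open>b(T)\<close> the drift is of order \<open>1 / eta\<close>, but the
  process is there only with probability of order \<open>\<theta>\<close>. Over the horizon the
  errors are \<open>\<theta> * eta\<^sup>2\<close> and \<open>\<theta>\<^sup>2 / eta\<close>; with
  \<open>eta = \<theta> powr \<kappa>\<close> both are \<open>o(\<theta> powr (3/2))\<close> exactly
  if \<kappa> lies strictly between 1/4 and 1/2, and \<open>p\<^sup>3\<close> is the midpoint 3/8.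
  Drift limits need a mesh tending to 0 for fixed \<theta>, whereas weak convergence of the dynamic
  program needs a fixed number of steps. Hence two nested grids: the fine mesh vanishes first, then
  \<theta>, and the number of coarse steps and the truncation level grow last.\<close>

section \<open>Optimal stopping of random walks on a finite grid\<close>

lemma rv_events_eq_vimage:
 "rv_events M Y = sets (vimage_algebra (space M) Y borel)"
 unfolding rv_events_def by (subst sets_vimage_algebra2) auto

text \<open>Independence makes the joint law of \<open>V\<close> and \<open>\<xi>\<close> a product,
  so Fubini integrates out \<open>\<xi>\<close> with \<open>V\<close> frozen. \<open>V\<close> is a
  pair because it has to carry an event indicator together with a position.\<close>

lemma (in prob_space) expectation_indep_eq:
 fixes \<phi> :: "(real \<times> real) \<times> real \<Rightarrow> real" and V :: "'a \<Rightarrow> real \<times> real"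
 assumes sub: "subalgebra M G" and V: "V \<in> borel_measurable G"
  and \<xi>: "\<xi> \<in> borel_measurable M"
  and ind: "indep_set (sets G) (rv_events M \<xi>)"
  and \<phi>[measurable]: "\<phi> \<in> borel_measurable borel"
  and bdd: "!!p. \<bar>\<phi> p\<bar> <= B"
 shows "expectation (%om. \<phi> (V om, \<xi> om)) = expectation (%om. LINT z|distr M borel \<xi>. \<phi> (V om, z))"
proof -
 have VM[measurable]: "V \<in> borel_measurable M"
  using measurable_from_subalg[OF sub V] .
 note \<xi>[measurable]
 \<comment> \<open>Both arguments of \<open>indep_var\<close> take values in one common type, so
   \<open>\<xi>\<close> is padded with a constant coordinate to match the pair
   \<open>V\<close>.\<close>
 define \<zeta> where "\<zeta> om = (\<xi> om, 0::real)" for om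
 have \<zeta>[measurable]: "\<zeta> \<in> borel_measurable M" unfolding \<zeta>_def by simp
 define \<phi>' where "\<phi>' p = \<phi> (fst p, fst (snd p))" for p :: "(real \<times> real) \<times> (real \<times> real)"
 have \<phi>'[measurable]: "\<phi>' \<in> borel_measurable borel" unfolding \<phi>'_def
  by (rule measurable_compose[OF _ \<phi>]) (auto intro!: borel_measurable_continuous_onI continuous_intros)
 have bdd': "\<bar>\<phi>' p\<bar> <= B" for p unfolding \<phi>'_def by (rule bdd)
 have "indep_set (sigma_sets (space M) {V -` A \<inter> space M |A. A \<in> sets borel})
   (sigma_sets (space M) {\<zeta> -` A \<inter> space M |A. A \<in> sets borel})"
 proof -
  have sp: "space G = space M" using sub by (auto simp: subalgebra_def)
  have 1: "sigma_sets (space M) {V -` A \<inter> space M |A. A \<in> sets borel} \<subseteq> sets G"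
  proof -
   have "{V -` A \<inter> space M |A. A \<in> sets borel} \<subseteq> sets G"
   proof safe
    fix A :: "(real \<times> real) set" assume "A \<in> sets borel"
    then show "V -` A \<inter> space M \<in> sets G" using measurable_sets[OF V, of A] by (simp add: sp)
   qed
   from sets.sigma_sets_subset[OF this] show ?thesis by (simp add: sp)
  qed
  have 2: "sigma_sets (space M) {\<zeta> -` A \<inter> space M |A. A \<in> sets borel} \<subseteq> rv_events M \<xi>"
  proof -
   have "{\<zeta> -` A \<inter> space M |A. A \<in> sets borel} \<subseteq> rv_events M \<xi>"
   proof safe
    fix A :: "(real \<times> real) set" assume A[measurable]: "A \<in> sets borel"
    have "(%x. (x, 0)) -` A \<inter> space borel \<in> sets (borel :: real measure)"
     by (rule measurable_sets[OF _ A]) simp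
    then have "(%x. (x, 0)) -` A \<in> sets (borel :: real measure)" by simp
    moreover have "\<zeta> -` A \<inter> space M = \<xi> -` ((%x. (x, 0)) -` A) \<inter> space M"
     by (auto simp: \<zeta>_def)
    ultimately show "\<zeta> -` A \<inter> space M \<in> rv_events M \<xi>" unfolding rv_events_def by blast
   qed
   then show ?thesis
    using sets.sigma_sets_subset[of _ "vimage_algebra (space M) \<xi> borel"]
    unfolding rv_events_eq_vimage by simp
  qed
  show ?thesis unfolding indep_set_def
   by (rule indep_sets_mono_sets[OF ind[unfolded indep_set_def]]) (use 1 2 in \<open>simp split: bool.split\<close>)
 qed
 then have iv: "indep_var borel V borel \<zeta>"
  unfolding indep_var_eq by simp
 interpret D1: prob_space "distr M borel V" by (rule prob_space_distr) simp
 interpret D2: prob_space "distr M borel \<zeta>" by (rule prob_space_distr) simp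
 interpret P: pair_prob_space "distr M borel V" "distr M borel \<zeta>" ..
 have m: "\<phi>' \<in> borel_measurable (borel \<Otimes>\<^sub>M borel)" using \<phi>' by (simp add: borel_prod)
 have "expectation (%om. \<phi> (V om, \<xi> om)) = expectation (%om. \<phi>' (V om, \<zeta> om))"
  by (simp add: \<phi>'_def \<zeta>_def)
 also have "... = (LINT p|distr M (borel \<Otimes>\<^sub>M borel) (%om. (V om, \<zeta> om)). \<phi>' p)"
  using m by (intro integral_distr[symmetric]) auto
 also have "distr M (borel \<Otimes>\<^sub>M borel) (%om. (V om, \<zeta> om)) = distr M borel V \<Otimes>\<^sub>M distr M borel \<zeta>"
  using iv unfolding indep_var_distribution_eq by simp
 also have "(LINT p|(distr M borel V \<Otimes>\<^sub>M distr M borel \<zeta>). \<phi>' p) = (LINT v|distr M borel V. LINT z|distr M borel \<zeta>. \<phi>' (v, z))"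
 proof (rule P.integral_fst'[symmetric])
  have "\<phi>' \<in> borel_measurable (distr M borel V \<Otimes>\<^sub>M distr M borel \<zeta>)"
   unfolding measurable_cong_sets[OF sets_pair_measure_cong[OF sets_distr sets_distr] refl] by fact
  then show "integrable (distr M borel V \<Otimes>\<^sub>M distr M borel \<zeta>) \<phi>'"
   by (intro P.integrable_const_bound[of _ B]) (use bdd' in auto)
 qed
 also have "... = expectation (%om. LINT z|distr M borel \<zeta>. \<phi>' (V om, z))"
 proof (rule integral_distr)
  have "\<phi>' \<in> borel_measurable (borel \<Otimes>\<^sub>M distr M borel \<zeta>)"
   unfolding measurable_cong_sets[OF sets_pair_measure_cong[OF refl sets_distr] refl] by fact
  then show "(%v. LINT z|distr M borel \<zeta>. \<phi>' (v, z)) \<in> borel_measurable borel"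
   by (intro D2.borel_measurable_lebesgue_integral) (simp add: case_prod_beta')
 qed fact
 also have "... = expectation (%om. LINT z|distr M borel \<xi>. \<phi> (V om, z))"
 proof -
  have "(LINT z|distr M borel \<zeta>. \<phi>' (v, z)) = (LINT z|distr M borel \<xi>. \<phi> (v, z))" for v
  proof -
   have "(%z. \<phi>' (v, z)) \<in> borel_measurable borel" "(%z. \<phi> (v, z)) \<in> borel_measurable borel"
    by (rule measurable_compose[OF _ \<phi>'] measurable_compose[OF _ \<phi>],
      auto intro!: borel_measurable_continuous_onI continuous_intros)+
   then show ?thesis by (simp add: integral_distr \<phi>'_def \<zeta>_def)
  qed
  then show ?thesis by simp
 qed
 finally show ?thesis .
qed

definition step_op :: "real measure \<Rightarrow> (real \<Rightarrow> real) \<Rightarrow> real \<Rightarrow> real" where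
 "step_op mu f x = (LINT z|mu. f (x + z))"

context real_distribution
begin

lemma step_op_measurable[measurable]:
 "f \<in> borel_measurable borel ==> step_op M f \<in> borel_measurable borel"
 unfolding step_op_def
 by (intro borel_measurable_lebesgue_integral) simp

lemma step_op_integrable:
 fixes B :: real
 shows "f \<in> borel_measurable borel ==> (!!x. \<bar>f x\<bar> <= B) ==> integrable M (%z. f (x + z))"
 by (intro integrable_const_bound[of _ B]) auto

lemma step_op_bound:
 assumes "f \<in> borel_measurable borel" "!!x. \<bar>f x\<bar> <= B"
 shows "\<bar>step_op M f x\<bar> <= B"
proof -
 have "\<bar>step_op M f x\<bar> <= (LINT z|M. \<bar>f (x + z)\<bar>)"
  unfolding step_op_def by (rule integral_abs_bound)
 also have "... <= (LINT z|M. B)"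
  using step_op_integrable[OF assms] assms(2) by (intro integral_mono) (auto intro: integrable_abs)
 finally show ?thesis using prob_space by simp
qed

end

text \<open>Stopping pays nothing and every further step pays \<open>c\<close> at the point it
  leaves from, so the maximum with 0 is the decision to stop; \<open>n\<close> counts the steps
  still allowed.\<close>

fun stop_value :: "real measure \<Rightarrow> (real \<Rightarrow> real) \<Rightarrow> nat \<Rightarrow> real \<Rightarrow> real" where
 "stop_value mu c 0 x = 0"
| "stop_value mu c (Suc n) x = max 0 (c x + step_op mu (stop_value mu c n) x)"

lemma stop_value_nonneg: "0 <= stop_value mu c n x"
 by (cases n) auto

context real_distribution
begin

lemma stop_value_measurable[measurable]:
 "c \<in> borel_measurable borel ==> stop_value M c n \<in> borel_measurable borel"
proof (induction n)
 case 0
 have "stop_value M c 0 = (%x. 0)" by auto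
 then show ?case by simp
next
 case (Suc n)
 then have [measurable]: "stop_value M c n \<in> borel_measurable borel" "c \<in> borel_measurable borel" by auto
 have "stop_value M c (Suc n) = (%x. max 0 (c x + step_op M (stop_value M c n) x))" by auto
 then show ?case by simp
qed

lemma stop_value_bound:
 assumes "c \<in> borel_measurable borel" "!!x. \<bar>c x\<bar> <= B"
 shows "\<bar>stop_value M c n x\<bar> <= real n * B"
proof (induction n arbitrary: x)
 case (Suc n)
 have B: "0 <= B" using assms(2)[of 0] by linarith
 have "\<bar>step_op M (stop_value M c n) x\<bar> <= real n * B"
  by (rule step_op_bound) (use Suc assms in auto)
 moreover have "real (Suc n) * B = B + real n * B" by (simp add: algebra_simps)
 moreover have "0 <= real n * B" using B by simp
 ultimately show ?case unfolding stop_value.simps using assms(2)[of x] B by linarith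
qed simp

end

locale random_walk = prob_space M for M :: "'a measure" +
 fixes G :: "nat \<Rightarrow> 'a measure" and Z :: "nat \<Rightarrow> 'a \<Rightarrow> real" and mu :: "real measure"
 assumes sub: "!!k. subalgebra M (G k)"
  and G_mono: "!!i j. i <= j ==> sets (G i) \<subseteq> sets (G j)"
  and Z_meas: "!!k. Z k \<in> borel_measurable (G k)"
  and incr_indep: "!!k. indep_set (sets (G k)) (rv_events M (%om. Z (Suc k) om - Z k om))"
  and incr_law: "!!k. distr M borel (%om. Z (Suc k) om - Z k om) = mu"
begin

lemma Z_measM[measurable]: "Z k \<in> borel_measurable M"
 using measurable_from_subalg[OF sub Z_meas] .

sublocale law: real_distribution mu
proof -
 have "real_distribution (distr M borel (%om. Z (Suc 0) om - Z 0 om))"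
  by (rule real_distribution_distr) simp
 then show "real_distribution mu" unfolding incr_law .
qed

lemma sets_G: "A \<in> sets (G k) ==> A \<in> sets M"
 using sub[of k] by (auto simp: subalgebra_def)

lemma space_G: "space (G k) = space M"
 using sub[of k] by (auto simp: subalgebra_def)

lemma markov_step:
 assumes A: "A \<in> sets (G k)" and f[measurable]: "f \<in> borel_measurable borel" and bdd: "!!x. \<bar>f x\<bar> <= B"
 shows "expectation (%om. indicator A om * f (Z (Suc k) om)) = expectation (%om. indicator A om * step_op mu f (Z k om))"
proof -
 have B0: "0 <= B" using bdd[of 0] by linarith
 \<comment> \<open>The indicator coordinate is cut off outside \<open>[-1, 1]\<close> only to make
   \<open>\<phi>\<close> bounded on the whole space; on the values 0 and 1 nothing changes.\<close>
 define \<phi> where "\<phi> p = (if \<bar>fst (fst p)\<bar> <= 1 then fst (fst p) else 0) * f (snd (fst p) + snd p)" for p :: "(real \<times> real) \<times> real"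
 define V where "V om = (indicator A om :: real, Z k om)" for om
 have V: "V \<in> borel_measurable (G k)"
  unfolding V_def using A Z_meas by (intro borel_measurable_Pair borel_measurable_indicator) auto
 have \<phi>: "\<phi> \<in> borel_measurable borel"
  unfolding \<phi>_def borel_prod[symmetric] by measurable
 have "\<bar>\<phi> p\<bar> <= B" for p
 proof -
  have "\<bar>\<phi> p\<bar> <= 1 * B" unfolding \<phi>_def abs_mult by (intro mult_mono bdd) (auto simp: B0)
  then show ?thesis by simp
 qed
 from expectation_indep_eq[OF sub V _ incr_indep \<phi> this]
 have "expectation (%om. \<phi> (V om, Z (Suc k) om - Z k om)) = expectation (%om. LINT z|mu. \<phi> (V om, z))"
  by (simp add: incr_law)
 moreover have "\<phi> (V om, Z (Suc k) om - Z k om) = indicator A om * f (Z (Suc k) om)" for om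
  by (auto simp: \<phi>_def V_def indicator_def)
 moreover have "(LINT z|mu. \<phi> (V om, z)) = indicator A om * step_op mu f (Z k om)" for om
  by (auto simp: \<phi>_def V_def indicator_def step_op_def)
 ultimately show ?thesis by simp
qed

definition grid_stopping :: "nat \<Rightarrow> ('a \<Rightarrow> nat) \<Rightarrow> bool" where
 "grid_stopping n kp \<longleftrightarrow> (\<forall>k. {om \<in> space M. kp om <= k} \<in> sets (G k)) \<and> (\<forall>om\<in>space M. kp om <= n)"

lemma grid_stopping_gt:
 assumes "grid_stopping n kp" shows "{om \<in> space M. k < kp om} \<in> sets (G k)"
proof -
 have "{om \<in> space M. k < kp om} = space (G k) - {om \<in> space M. kp om <= k}" by (auto simp: space_G)
 moreover have "{om \<in> space M. kp om <= k} \<in> sets (G k)" using assms by (simp add: grid_stopping_def)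
 ultimately show ?thesis by simp
qed

lemma grid_stopping_measurable:
 assumes "grid_stopping n kp" shows "kp \<in> measurable M (count_space UNIV)"
proof -
 have le: "{om \<in> space M. kp om <= a} \<in> sets M" for a
  using assms sets_G unfolding grid_stopping_def by blast
 have "kp -` {a} \<inter> space M \<in> sets M" for a
 proof (cases a)
  case 0
  then have "kp -` {a} \<inter> space M = {om \<in> space M. kp om <= 0}" by auto
  then show ?thesis using le[of 0] by simp
 next
  case (Suc b)
  then have "kp -` {a} \<inter> space M = {om \<in> space M. kp om <= Suc b} - {om \<in> space M. kp om <= b}" by auto
  then show ?thesis using le by simp
 qed
 then show ?thesis by (subst measurable_count_space_eq2_countable) auto
qed

text \<open>Discrete Dynkin formula. The stopped value telescopes over the steps taken, and
  continuing past step \<open>k\<close> is decided at step \<open>k\<close>, so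
  \<open>markov_step\<close> turns each increment into its conditional drift. The dependence of
  \<open>f\<close> on the step accommodates discounting and remaining time.\<close>

lemma stopped_expectation:
 assumes kp: "grid_stopping n kp"
  and f[measurable]: "!!k. f k \<in> borel_measurable borel" and bdd: "!!k x. \<bar>f k x\<bar> <= B"
 shows "expectation (%om. f (kp om) (Z (kp om) om)) = expectation (%om. f 0 (Z 0 om))
   + (\<Sum>k<n. expectation (%om. indicator {om\<in>space M. k < kp om} om * (step_op mu (f (Suc k)) (Z k om) - f k (Z k om))))"
proof -
 have [measurable]: "{om\<in>space M. k < kp om} \<in> sets M" for k
  using grid_stopping_gt[OF kp] sets_G by blast
 have B: "0 <= B" using bdd[of 0 0] by linarith
 have sb: "\<bar>step_op mu (f k) x\<bar> <= B" for k x
  by (rule law.step_op_bound) (use bdd in auto)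
 have ib: "\<bar>indicator S x * y\<bar> <= B" if "\<bar>y\<bar> <= B" for y and x :: 'a and S
  using that B by (auto simp: indicator_def)
 have i1: "integrable M (%om. indicator {om\<in>space M. k < kp om} om * f j (Z l om))" for j k l
  by (rule integrable_const_bound[of _ B]) (unfold real_norm_def, intro AE_I2 ib bdd, simp)
 have i2: "integrable M (%om. indicator {om\<in>space M. k < kp om} om * step_op mu (f j) (Z l om))" for j k l
  by (rule integrable_const_bound[of _ B]) (unfold real_norm_def, intro AE_I2 ib sb, simp)
 have i0: "integrable M (%om. f 0 (Z 0 om))"
  by (rule integrable_const_bound[of _ B]) (use bdd in auto)
 have tel: "f (kp om) (Z (kp om) om) = f 0 (Z 0 om) + (\<Sum>k<n. indicator {om\<in>space M. k < kp om} om * f (Suc k) (Z (Suc k) om)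
    - indicator {om\<in>space M. k < kp om} om * f k (Z k om))" if "om \<in> space M" for om
 proof -
  have le: "kp om <= n" using kp that by (auto simp: grid_stopping_def)
  have "(\<Sum>k<n. indicator {om\<in>space M. k < kp om} om * f (Suc k) (Z (Suc k) om)
    - indicator {om\<in>space M. k < kp om} om * f k (Z k om)) = (\<Sum>k<n. if k < kp om then f (Suc k) (Z (Suc k) om) - f k (Z k om) else 0)"
   using that by (intro sum.cong) auto
  also have "... = (\<Sum>k<kp om. f (Suc k) (Z (Suc k) om) - f k (Z k om))"
   using le by (intro sum.mono_neutral_cong_right) auto
  also have "... = f (kp om) (Z (kp om) om) - f 0 (Z 0 om)"
   by (rule sum_lessThan_telescope)
  finally show ?thesis by simp
 qed
 have "expectation (%om. f (kp om) (Z (kp om) om)) = expectation (%om. f 0 (Z 0 om) + (\<Sum>k<n. indicator {om\<in>space M. k < kp om} om * f (Suc k) (Z (Suc k) om)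
    - indicator {om\<in>space M. k < kp om} om * f k (Z k om)))"
  by (intro Bochner_Integration.integral_cong refl tel)
 also have "... = expectation (%om. f 0 (Z 0 om)) + (\<Sum>k<n. expectation (%om. indicator {om\<in>space M. k < kp om} om * f (Suc k) (Z (Suc k) om))
    - expectation (%om. indicator {om\<in>space M. k < kp om} om * f k (Z k om)))"
  using i0 i1 by (simp add: Bochner_Integration.integral_add Bochner_Integration.integral_sum Bochner_Integration.integral_diff)
 also have "... = expectation (%om. f 0 (Z 0 om)) + (\<Sum>k<n. expectation (%om. indicator {om\<in>space M. k < kp om} om * step_op mu (f (Suc k)) (Z k om))
    - expectation (%om. indicator {om\<in>space M. k < kp om} om * f k (Z k om)))"
  by (simp add: markov_step[OF grid_stopping_gt[OF kp] f bdd])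
 also have "... = expectation (%om. f 0 (Z 0 om)) + (\<Sum>k<n. expectation (%om. indicator {om\<in>space M. k < kp om} om * (step_op mu (f (Suc k)) (Z k om) - f k (Z k om))))"
  using i1 i2 by (simp add: right_diff_distrib Bochner_Integration.integral_diff)
 finally show ?thesis .
qed

definition reward :: "(real \<Rightarrow> real) \<Rightarrow> nat \<Rightarrow> ('a \<Rightarrow> nat) \<Rightarrow> real" where
 "reward c n kp = (\<Sum>k<n. expectation (%om. indicator {om\<in>space M. k < kp om} om * c (Z k om)))"

lemma reward_aux:
 assumes kp: "grid_stopping n kp"
  and c[measurable]: "c \<in> borel_measurable borel" and bdd: "!!x. \<bar>c x\<bar> <= B"
 shows "reward c n kp = expectation (%om. stop_value mu c n (Z 0 om)) - expectation (%om. stop_value mu c (n - kp om) (Z (kp om) om))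
   - (\<Sum>k<n. expectation (%om. indicator {om\<in>space M. k < kp om} om * (stop_value mu c (n - k) (Z k om) - c (Z k om) - step_op mu (stop_value mu c (n - Suc k)) (Z k om))))"
proof -
 have B: "0 <= B" using bdd[of 0] by linarith
 have ub: "\<bar>stop_value mu c (n - k) x\<bar> <= real n * B" for k x
  by (rule order_trans[OF law.stop_value_bound[OF c bdd]]) (use B in \<open>auto intro!: mult_right_mono\<close>)
 have [measurable]: "{om\<in>space M. k < kp om} \<in> sets M" for k
  using grid_stopping_gt[OF kp] sets_G by blast
 have sb: "\<bar>step_op mu (stop_value mu c (n - k)) x\<bar> <= real n * B" for k x
  by (rule law.step_op_bound) (use ub in auto)
 let ?I = "%k. indicator {om\<in>space M. k < kp om} :: 'a \<Rightarrow> real"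
 have ib: "\<bar>indicator S x * y\<bar> <= D" if "\<bar>y\<bar> <= D" for y D :: real and x :: 'a and S
  using that by (auto simp: indicator_def)
 have i1: "integrable M (%om. ?I k om * (step_op mu (stop_value mu c (n - Suc k)) (Z k om) - stop_value mu c (n - k) (Z k om)))" for k
 proof (rule integrable_const_bound[of _ "2 * (real n * B)"])
  have "\<bar>step_op mu (stop_value mu c (n - Suc k)) x - stop_value mu c (n - k) x\<bar> <= 2 * (real n * B)" for x
   using sb[of "Suc k" x] ub[of k x] by linarith
  then show "AE x in M. norm (?I k x * (step_op mu (stop_value mu c (n - Suc k)) (Z k x) - stop_value mu c (n - k) (Z k x))) <= 2 * (real n * B)"
   unfolding real_norm_def by (intro AE_I2 ib)
 qed simp
 have i2: "integrable M (%om. ?I k om * c (Z k om))" for k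
  by (rule integrable_const_bound[of _ B]) (unfold real_norm_def, intro AE_I2 ib bdd, simp)
 have "expectation (%om. stop_value mu c (n - kp om) (Z (kp om) om)) = expectation (%om. stop_value mu c (n - 0) (Z 0 om))
   + (\<Sum>k<n. expectation (%om. ?I k om * (step_op mu (stop_value mu c (n - Suc k)) (Z k om) - stop_value mu c (n - k) (Z k om))))"
  by (rule stopped_expectation[OF kp, where f="%k. stop_value mu c (n - k)" and B="real n * B"]) (use ub in auto)
 moreover have "(\<Sum>k<n. expectation (%om. ?I k om * (stop_value mu c (n - k) (Z k om) - c (Z k om) - step_op mu (stop_value mu c (n - Suc k)) (Z k om))))
   = - (\<Sum>k<n. expectation (%om. ?I k om * (step_op mu (stop_value mu c (n - Suc k)) (Z k om) - stop_value mu c (n - k) (Z k om)))) - reward c n kp"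
 proof -
  have "expectation (%om. ?I k om * (stop_value mu c (n - k) (Z k om) - c (Z k om) - step_op mu (stop_value mu c (n - Suc k)) (Z k om)))
   = - expectation (%om. ?I k om * (step_op mu (stop_value mu c (n - Suc k)) (Z k om) - stop_value mu c (n - k) (Z k om))) - expectation (%om. ?I k om * c (Z k om))" for k
  proof -
   have "expectation (%om. ?I k om * (stop_value mu c (n - k) (Z k om) - c (Z k om) - step_op mu (stop_value mu c (n - Suc k)) (Z k om)))
    = expectation (%om. - (?I k om * (step_op mu (stop_value mu c (n - Suc k)) (Z k om) - stop_value mu c (n - k) (Z k om))) - ?I k om * c (Z k om))"
    by (intro Bochner_Integration.integral_cong refl) (simp add: algebra_simps)
   also have "... = expectation (%om. - (?I k om * (step_op mu (stop_value mu c (n - Suc k)) (Z k om) - stop_value mu c (n - k) (Z k om)))) - expectation (%om. ?I k om * c (Z k om))"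
    using i1[of k] i2[of k] by (intro Bochner_Integration.integral_diff) auto
   finally show ?thesis by simp
  qed
  then show ?thesis by (simp add: reward_def sum_subtractf sum_negf)
 qed
 ultimately show ?thesis by simp
qed

lemma reward_le_stop_value:
 assumes kp: "grid_stopping n kp"
  and c[measurable]: "c \<in> borel_measurable borel" and bdd: "!!x. \<bar>c x\<bar> <= B"
 shows "reward c n kp <= expectation (%om. stop_value mu c n (Z 0 om))"
proof -
 have "0 <= expectation (%om. stop_value mu c (n - kp om) (Z (kp om) om))"
  by (intro Bochner_Integration.integral_nonneg stop_value_nonneg)
 moreover have "0 <= (\<Sum>k<n. expectation (%om. indicator {om\<in>space M. k < kp om} om * (stop_value mu c (n - k) (Z k om) - c (Z k om) - step_op mu (stop_value mu c (n - Suc k)) (Z k om))))"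
 proof (intro sum_nonneg Bochner_Integration.integral_nonneg mult_nonneg_nonneg)
  fix k om assume "k \<in> {..<n}"
  then have "n - k = Suc (n - Suc k)" by auto
  then show "0 <= stop_value mu c (n - k) (Z k om) - c (Z k om) - step_op mu (stop_value mu c (n - Suc k)) (Z k om)"
   by simp
 qed auto
 ultimately show ?thesis unfolding reward_aux[OF kp c bdd] by linarith
qed

lemma stop_value_attained:
 assumes c[measurable]: "c \<in> borel_measurable borel" and bdd: "!!x. \<bar>c x\<bar> <= B"
 obtains kp where "grid_stopping n kp" "reward c n kp = expectation (%om. stop_value mu c n (Z 0 om))"
proof -
 \<comment> \<open>Stop when the value first vanishes, which happens at step \<open>n\<close> at the
   latest. Before that the value is positive, so the maximum is attained by continuing and the
   Bellman slack is 0.\<close>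
 define kp where "kp om = (LEAST k. stop_value mu c (n - k) (Z k om) = 0)" for om
 have ex: "stop_value mu c (n - n) (Z n om) = 0" for om by simp
 have zero: "stop_value mu c (n - kp om) (Z (kp om) om) = 0" for om
  unfolding kp_def by (rule LeastI[of _ n]) simp
 have len: "kp om <= n" for om unfolding kp_def by (rule Least_le) simp
 have pos: "stop_value mu c (n - k) (Z k om) \<noteq> 0" if "k < kp om" for k om
  using not_less_Least that unfolding kp_def by blast
 have gs: "grid_stopping n kp"
  unfolding grid_stopping_def
 proof (intro conjI allI ballI len)
  fix k
  have "{om \<in> space M. kp om <= k} = (\<Union>i\<in>{..k}. {om \<in> space M. stop_value mu c (n - i) (Z i om) = 0})"
  proof safe
   fix om assume "kp om <= k" "om \<in> space M"
   then show "om \<in> (\<Union>i\<in>{..k}. {om \<in> space M. stop_value mu c (n - i) (Z i om) = 0})"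
    using zero[of om] by auto
  next
   fix om i assume "i <= k" "stop_value mu c (n - i) (Z i om) = 0"
   then show "kp om <= k" unfolding kp_def by (meson Least_le order_trans)
  qed
  moreover have "{om \<in> space M. stop_value mu c (n - i) (Z i om) = 0} \<in> sets (G k)" if "i <= k" for i
  proof -
   have "(%om. stop_value mu c (n - i) (Z i om)) \<in> borel_measurable (G i)"
    using Z_meas by measurable
   then have "{om \<in> space (G i). stop_value mu c (n - i) (Z i om) = 0} \<in> sets (G i)"
    by measurable
   then show ?thesis using G_mono[OF that] by (auto simp: space_G)
  qed
  ultimately show "{om \<in> space M. kp om <= k} \<in> sets (G k)"
   by (auto intro!: sets.finite_UN)
 qed
 have "(\<Sum>k<n. expectation (%om. indicator {om\<in>space M. k < kp om} om * (stop_value mu c (n - k) (Z k om) - c (Z k om) - step_op mu (stop_value mu c (n - Suc k)) (Z k om)))) = 0"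
 proof (intro sum.neutral ballI)
  fix k assume "k \<in> {..<n}"
  then have s: "n - k = Suc (n - Suc k)" by auto
  have "indicator {om\<in>space M. k < kp om} om * (stop_value mu c (n - k) (Z k om) - c (Z k om) - step_op mu (stop_value mu c (n - Suc k)) (Z k om)) = 0" for om
   using pos[of k om] unfolding s by (auto simp: indicator_def max_def)
  then show "expectation (%om. indicator {om\<in>space M. k < kp om} om * (stop_value mu c (n - k) (Z k om) - c (Z k om) - step_op mu (stop_value mu c (n - Suc k)) (Z k om))) = 0"
   by (simp only: Bochner_Integration.integral_zero)
 qed
 then have "reward c n kp = expectation (%om. stop_value mu c n (Z 0 om))"
  unfolding reward_aux[OF gs c bdd] by (simp add: zero)
 with gs show ?thesis using that by blast
qed

end

section \<open>Stability of dynamic programs under weak convergence and scaling\<close>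

text \<open>In a Skorohod coupling the single rate \<open>e n\<close>, the mean of
  \<open>min 1 \<bar>Yn n - Y\<bar>\<close>, serves all test functions with given sup and Lipschitz
  bounds. This uniformity is needed because the integrand of a dynamic program changes with the
  starting point.\<close>

lemma weak_conv_bounded_Lipschitz:
 fixes mu :: "nat \<Rightarrow> real measure" and \<nu> :: "real measure"
 assumes mu: "!!n. real_distribution (mu n)" and \<nu>: "real_distribution \<nu>" and conv: "weak_conv_m mu \<nu>"
 obtains e :: "nat \<Rightarrow> real" where "e \<longlonglongrightarrow> 0"
  "!!n f L B. (!!x y. \<bar>f x - f y\<bar> <= L * \<bar>x - y\<bar>) ==> (!!x. \<bar>f x\<bar> <= B) ==> 0 <= L ==> f \<in> borel_measurable borel ==>
    \<bar>(LINT x|mu n. f x) - (LINT x|\<nu>. f x)\<bar> <= (L + 2 * B) * e n"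
proof -
 obtain \<Omega> :: "real measure" and Yn :: "nat \<Rightarrow> real \<Rightarrow> real" and Y :: "real \<Rightarrow> real" where
  \<Omega>: "prob_space \<Omega>" and Yn[measurable]: "!!n. Yn n \<in> borel_measurable \<Omega>" and dn: "!!n. distr \<Omega> borel (Yn n) = mu n"
  and Y: "Y \<in> measurable \<Omega> lborel" and d: "distr \<Omega> borel Y = \<nu>" and lim: "!!x. x \<in> space \<Omega> ==> (%n. Yn n x) \<longlonglongrightarrow> Y x"
  using Skorohod[OF mu \<nu> conv] by blast
 interpret prob_space \<Omega> by (rule \<Omega>)
 have Y'[measurable]: "Y \<in> borel_measurable \<Omega>" using Y by simp
 define e where "e n = expectation (%x. min 1 \<bar>Yn n x - Y x\<bar>)" for n
 have int: "integrable \<Omega> (%x. min 1 \<bar>Yn n x - Y x\<bar>)" for n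
  by (rule integrable_const_bound[of _ 1]) auto
 have "(%n. expectation (%x. min 1 \<bar>Yn n x - Y x\<bar>)) \<longlonglongrightarrow> expectation (%x. 0)"
 proof (rule integral_dominated_convergence[where w="%_. 1"])
  have "(%n. min 1 \<bar>Yn n x - Y x\<bar>) \<longlonglongrightarrow> min 1 \<bar>Y x - Y x\<bar>" if "x \<in> space \<Omega>" for x
   by (intro tendsto_intros lim that)
  then show "AE x in \<Omega>. (%n. min 1 \<bar>Yn n x - Y x\<bar>) \<longlonglongrightarrow> 0" by (intro AE_I2) simp
 qed auto
 then have e0: "e \<longlonglongrightarrow> 0" by (simp add: e_def[abs_def])
 have "\<bar>(LINT x|mu n. f x) - (LINT x|\<nu>. f x)\<bar> <= (L + 2 * B) * e n"
  if L: "!!x y. \<bar>f x - f y\<bar> <= L * \<bar>x - y\<bar>" and B: "!!x. \<bar>f x\<bar> <= B" and L0: "0 <= L"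
   and [measurable]: "f \<in> borel_measurable borel" for n L B and f :: "real \<Rightarrow> real"
 proof -
  have B0: "0 <= B" using B[of 0] by linarith
  have pt: "\<bar>f x - f y\<bar> <= (L + 2 * B) * min 1 \<bar>x - y\<bar>" for x y
  proof (cases "\<bar>x - y\<bar> <= 1")
   case True
   then have "(L + 2 * B) * min 1 \<bar>x - y\<bar> = L * \<bar>x - y\<bar> + 2 * B * \<bar>x - y\<bar>" by (simp add: algebra_simps)
   moreover have "0 <= 2 * B * \<bar>x - y\<bar>" using B0 by simp
   ultimately show ?thesis using L[of x y] by linarith
  next
   case False then show ?thesis using B[of x] B[of y] L0 by simp
  qed
  have i: "integrable \<Omega> (%x. f (Yn n x))" "integrable \<Omega> (%x. f (Y x))"
   by (rule integrable_const_bound[of _ B]; use B in simp)+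
  have "(LINT x|mu n. f x) - (LINT x|\<nu>. f x) = expectation (%x. f (Yn n x)) - expectation (%x. f (Y x))"
   unfolding dn[symmetric] d[symmetric] by (simp add: integral_distr)
  also have "... = expectation (%x. f (Yn n x) - f (Y x))" using i by simp
  finally have "\<bar>(LINT x|mu n. f x) - (LINT x|\<nu>. f x)\<bar> <= expectation (%x. \<bar>f (Yn n x) - f (Y x)\<bar>)"
   by (simp add: integral_abs_bound)
  also have "... <= expectation (%x. (L + 2 * B) * min 1 \<bar>Yn n x - Y x\<bar>)"
   using i int pt by (intro integral_mono) auto
  also have "... = (L + 2 * B) * e n" by (simp add: e_def)
  finally show ?thesis .
 qed
 with e0 show ?thesis using that by blast
qed

lemma max0_lipschitz: "\<bar>max 0 x - max 0 y\<bar> <= \<bar>x - y\<bar>" for x y :: real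
 by linarith

lemma (in real_distribution) stop_value_Lipschitz:
 assumes c[measurable]: "c \<in> borel_measurable borel" and B: "!!x. \<bar>c x\<bar> <= B"
  and L: "!!x y. \<bar>c x - c y\<bar> <= L * \<bar>x - y\<bar>"
 shows "\<bar>stop_value M c n x - stop_value M c n y\<bar> <= real n * L * \<bar>x - y\<bar>"
proof (induction n arbitrary: x y)
 case (Suc n)
 have i: "integrable M (%z. stop_value M c n (x + z))" for x
  by (rule step_op_integrable[OF _ stop_value_bound[OF c B]]) simp
 have "\<bar>step_op M (stop_value M c n) x - step_op M (stop_value M c n) y\<bar>
   = \<bar>LINT z|M. stop_value M c n (x + z) - stop_value M c n (y + z)\<bar>"
  unfolding step_op_def using i by simp
 also have "... <= (LINT z|M. \<bar>stop_value M c n (x + z) - stop_value M c n (y + z)\<bar>)"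
  by (rule integral_abs_bound)
 also have "... <= (LINT z|M. real n * L * \<bar>x - y\<bar>)"
 proof (intro integral_mono)
  show "\<bar>stop_value M c n (x + z) - stop_value M c n (y + z)\<bar> <= real n * L * \<bar>x - y\<bar>" for z
   using Suc[of "x + z" "y + z"] by simp
 qed (use i in auto)
 also have "... = real n * L * \<bar>x - y\<bar>" using prob_space by simp
 finally have "\<bar>step_op M (stop_value M c n) x - step_op M (stop_value M c n) y\<bar> <= real n * L * \<bar>x - y\<bar>" .
 moreover have "real (Suc n) * L * \<bar>x - y\<bar> = L * \<bar>x - y\<bar> + real n * L * \<bar>x - y\<bar>" by (simp add: algebra_simps)
 ultimately show ?case unfolding stop_value.simps
  using L[of x y] max0_lipschitz[of "c x + step_op M (stop_value M c n) x" "c y + step_op M (stop_value M c n) y"]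
  by linarith
qed simp

text \<open>Induction on the horizon with an error \<open>C * e i\<close> uniform in the starting
  point: the error inherited from the previous stage passes through the mean unchanged, and changing
  the step law costs the coupling rate times the bounds of a value function that is itself bounded
  and Lipschitz.\<close>

lemma stop_value_tendsto:
 fixes mu :: "nat \<Rightarrow> real measure" and \<nu> :: "real measure"
 assumes mu: "!!n. real_distribution (mu n)" and \<nu>: "real_distribution \<nu>" and conv: "weak_conv_m mu \<nu>"
  and c[measurable]: "c \<in> borel_measurable borel" and B: "!!x. \<bar>c x\<bar> <= B"
  and L: "!!x y. \<bar>c x - c y\<bar> <= L * \<bar>x - y\<bar>"
 shows "(%i. stop_value (mu i) c n x) \<longlonglongrightarrow> stop_value \<nu> c n x"
proof -
 interpret mu: real_distribution "mu i" for i by (rule mu)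
 interpret nu: real_distribution \<nu> by (rule \<nu>)
 have "L * \<bar>0 - 1\<bar> = L" by simp
 then have L0: "0 <= L" using L[of 0 1] by linarith
 obtain e where e: "e \<longlonglongrightarrow> 0" and E: "!!n f L B. (!!x y. \<bar>f x - f y\<bar> <= L * \<bar>x - y\<bar>) ==> (!!x. \<bar>f x\<bar> <= B) ==> 0 <= L ==> f \<in> borel_measurable borel ==>
    \<bar>(LINT x|mu n. f x) - (LINT x|\<nu>. f x)\<bar> <= (L + 2 * B) * e n"
  using weak_conv_bounded_Lipschitz[OF mu \<nu> conv] by blast
 have "\<exists>C. \<forall>i x. \<bar>stop_value (mu i) c n x - stop_value \<nu> c n x\<bar> <= C * e i"
 proof (induction n)
  case (Suc n)
  then obtain C where C: "!!i x. \<bar>stop_value (mu i) c n x - stop_value \<nu> c n x\<bar> <= C * e i" by blast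
  show ?case
  proof (intro exI[of _ "C + (real n * L + 2 * (real n * B))"] allI)
   fix i x
   have i1: "integrable (mu i) (%z. stop_value (mu i) c n (x + z))"
    by (rule mu.step_op_integrable[OF _ mu.stop_value_bound[OF c B]]) simp
   have i2: "integrable (mu i) (%z. stop_value \<nu> c n (x + z))"
    by (rule mu.step_op_integrable[OF _ nu.stop_value_bound[OF c B]]) simp
   have "\<bar>step_op (mu i) (stop_value (mu i) c n) x - step_op (mu i) (stop_value \<nu> c n) x\<bar>
     = \<bar>LINT z|mu i. stop_value (mu i) c n (x + z) - stop_value \<nu> c n (x + z)\<bar>"
    unfolding step_op_def using i1 i2 by simp
   also have "... <= (LINT z|mu i. \<bar>stop_value (mu i) c n (x + z) - stop_value \<nu> c n (x + z)\<bar>)"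
    by (rule integral_abs_bound)
   also have "... <= (LINT z|mu i. C * e i)"
    using i1 i2 C[of i "x + _"] by (intro integral_mono) auto
   also have "... = C * e i" using mu.prob_space by simp
   finally have 1: "\<bar>step_op (mu i) (stop_value (mu i) c n) x - step_op (mu i) (stop_value \<nu> c n) x\<bar> <= C * e i" .
   have 2: "\<bar>step_op (mu i) (stop_value \<nu> c n) x - step_op \<nu> (stop_value \<nu> c n) x\<bar> <= (real n * L + 2 * (real n * B)) * e i"
    unfolding step_op_def
   proof (rule E)
    fix y z show "\<bar>stop_value \<nu> c n (x + y) - stop_value \<nu> c n (x + z)\<bar> <= real n * L * \<bar>y - z\<bar>"
     using nu.stop_value_Lipschitz[OF c B L, of n "x + y" "x + z"] by simp
   qed (use nu.stop_value_bound[OF c B] L0 in auto)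
   have "(C + (real n * L + 2 * (real n * B))) * e i = C * e i + (real n * L + 2 * (real n * B)) * e i"
    by (simp add: algebra_simps)
   with 1 2 show "\<bar>stop_value (mu i) c (Suc n) x - stop_value \<nu> c (Suc n) x\<bar> <= (C + (real n * L + 2 * (real n * B))) * e i"
    unfolding stop_value.simps
    using max0_lipschitz[of "c x + step_op (mu i) (stop_value (mu i) c n) x" "c x + step_op \<nu> (stop_value \<nu> c n) x"]
    by linarith
  qed
 qed (auto intro: exI[of _ 0])
 then obtain C where C: "!!i. \<bar>stop_value (mu i) c n x - stop_value \<nu> c n x\<bar> <= C * e i" by blast
 have "(%i. stop_value (mu i) c n x - stop_value \<nu> c n x) \<longlonglongrightarrow> 0"
 proof (rule Lim_null_comparison)
  show "\<forall>\<^sub>F i in sequentially. norm (stop_value (mu i) c n x - stop_value \<nu> c n x) <= C * e i" using C by simp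
  show "(%i. C * e i) \<longlonglongrightarrow> 0" using tendsto_mult_right_zero[OF e] by simp
 qed
 then show ?thesis by (simp add: LIM_zero_iff)
qed

text \<open>Rescaling space transports the step law, and a nonnegative factor \<open>rho\<close>
  commutes with the maximum. This takes the problem on a short horizon to unit scale.\<close>

lemma (in real_distribution) stop_value_scale:
 assumes c[measurable]: "c \<in> borel_measurable borel" and s: "0 < s" and rho: "0 <= rho"
 shows "stop_value M (%x. rho * c (x / s)) n x = rho * stop_value (distr M borel (%x. x / s)) c n (x / s)"
proof (induction n arbitrary: x)
 case (Suc n)
 interpret D: real_distribution "distr M borel (%x. x / s)" by (rule real_distribution_distr) simp
 have "step_op M (stop_value M (%x. rho * c (x / s)) n) x
   = rho * (LINT z|M. stop_value (distr M borel (%x. x / s)) c n ((x + z) / s))"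
  unfolding step_op_def Suc by simp
 also have "(LINT z|M. stop_value (distr M borel (%x. x / s)) c n ((x + z) / s))
   = step_op (distr M borel (%x. x / s)) (stop_value (distr M borel (%x. x / s)) c n) (x / s)"
  unfolding step_op_def by (subst integral_distr) (auto simp: add_divide_distrib)
 finally have st: "step_op M (stop_value M (%x. rho * c (x / s)) n) x
   = rho * step_op (distr M borel (%x. x / s)) (stop_value (distr M borel (%x. x / s)) c n) (x / s)" .
 show ?case
  unfolding stop_value.simps st distrib_left[symmetric] using rho
  by (auto simp: max_def mult_le_0_iff zero_le_mult_iff not_le)
qed simp

section \<open>Small-time behaviour of the laws from the characteristic exponent\<close>

text \<open>The exponent without compensator: for jumps of finite variation the truncation term is
  integrable by itself and is absorbed into the drift \<open>gam\<close>.\<close>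

definition cf_exponent :: "real \<Rightarrow> real \<Rightarrow> real measure \<Rightarrow> real \<Rightarrow> complex" where
 "cf_exponent gam \<sigma> \<nu> u = \<i> * complex_of_real (gam * u) - complex_of_real (\<sigma>\<^sup>2 * u\<^sup>2 / 2)
   + (CLINT z|\<nu>. iexp (u * z) - 1)"

lemma norm_exp_minus_one_le:
 fixes z :: complex
 assumes "Re z <= 0"
 shows "norm (exp z - 1) <= norm z"
proof -
 have "norm (exp z - exp 0) <= 1 * norm (z - 0)"
 proof (rule field_differentiable_bound[where S="{z. Re z <= 0}" and f'="exp"])
  show "convex {z. Re z <= 0}" by (rule convex_halfspace_Re_le)
  show "(exp has_field_derivative exp x) (at x within {z. Re z <= 0})" for x :: complex
   by (auto intro!: derivative_eq_intros)
 qed (use assms in auto)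
 then show ?thesis by simp
qed

lemma norm_iexp_minus_one_le: "norm (iexp (u * z) - 1) <= (2 + \<bar>u\<bar>) * min 1 \<bar>z\<bar>"
proof (cases "\<bar>z\<bar> <= 1")
 case True
 have "norm (iexp (u * z) - 1) <= \<bar>u * z\<bar>"
  using iexp_approx1[of "u * z" 0] by simp
 also have "... <= (2 + \<bar>u\<bar>) * min 1 \<bar>z\<bar>"
  using True by (simp add: abs_mult algebra_simps)
 finally show ?thesis .
next
 case False
 have "norm (iexp (u * z) - 1) <= norm (iexp (u * z)) + norm (1::complex)" by (rule norm_triangle_ineq4)
 also have "... <= 2" by simp
 finally show ?thesis using False by simp
qed

text \<open>One minus the characteristic function of the standard Gaussian. It is comparable to
  \<open>min 1 (x\<^sup>2)\<close>, and at the same time integrals of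
  \<open>gw x * iexp (v * x)\<close> against a law are explicit in the characteristic function of
  that law.\<close>

definition gw :: "real \<Rightarrow> real" where
 "gw x = 1 - exp (- x\<^sup>2 / 2)"

lemma gw_measurable[measurable]: "gw \<in> borel_measurable borel"
 unfolding gw_def[abs_def] by measurable

lemma gw_nonneg: "0 <= gw x" and gw_le_1: "gw x <= 1"
 by (auto simp: gw_def)

lemma gw_0[simp]: "gw 0 = 0" by (simp add: gw_def)

lemma gw_pos: "x \<noteq> 0 ==> 0 < gw x" by (simp add: gw_def)

lemma gw_mono: "\<bar>x\<bar> <= \<bar>y\<bar> ==> gw x <= gw y"
 by (simp add: gw_def abs_le_square_iff)

lemma gw_ge: "min 1 (x\<^sup>2) <= 3 * gw x"
proof -
 \<comment> \<open>With \<open>t = x\<^sup>2 / 2\<close> this gives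
   \<open>gw x >= 3 * x\<^sup>2 / 8\<close> for \<open>\<bar>x\<bar> <= 1\<close> and
   \<open>gw x >= 3 / 8\<close> beyond; the factor 8/3 is rounded up to 3.\<close>
 have e: "exp (- t) <= 1 - 3 * t / 4" if "0 <= t" "t <= 1/2" for t :: real
 proof -
  have "1 + t <= exp t" by (rule exp_ge_add_one_self)
  moreover have "1 + t + t\<^sup>2 / 2 <= exp t" using exp_lower_Taylor_quadratic[OF that(1)] by simp
  moreover have "1 <= (1 - 3 * t / 4) * (1 + t + t\<^sup>2 / 2)"
  proof -
   have "(1 - 3 * t / 4) * (1 + t + t\<^sup>2 / 2) - 1 = t * (2 - 2 * t - 3 * t\<^sup>2) / 8"
    by (simp add: field_simps power2_eq_square)
   moreover have "t\<^sup>2 <= (1/2)\<^sup>2" using that by (intro power_mono) auto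
   then have "0 <= 2 - 2 * t - 3 * t\<^sup>2" using that by (simp add: power2_eq_square)
   then have "0 <= t * (2 - 2 * t - 3 * t\<^sup>2)" using that by simp
   ultimately show ?thesis by linarith
  qed
  moreover have "0 <= 1 - 3 * t / 4" using that by simp
  ultimately have "1 <= (1 - 3 * t / 4) * exp t" by (meson mult_left_mono order_trans)
  then have "exp (- t) * 1 <= exp (- t) * ((1 - 3 * t / 4) * exp t)" by (intro mult_left_mono) auto
  also have "... = 1 - 3 * t / 4" by (simp add: exp_minus field_simps)
  finally show ?thesis by simp
 qed
 show ?thesis
 proof (cases "x\<^sup>2 <= 1")
  case True
  then have "exp (- x\<^sup>2 / 2) <= 1 - 3 * x\<^sup>2 / 8" using e[of "x\<^sup>2 / 2"] by simp
  moreover have "min 1 (x\<^sup>2) = x\<^sup>2" using True by simp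
  moreover define E t where "E = exp (- x\<^sup>2 / 2)" and "t = x\<^sup>2"
  ultimately have "E <= 1 - 3 * t / 8" "min 1 t = t" "0 <= t" by auto
  then have "t <= 3 * (1 - E)" by (simp add: field_simps)
  with \<open>min 1 t = t\<close> have "min 1 t <= 3 * (1 - E)" by simp
  then show ?thesis by (simp add: gw_def E_def t_def)
 next
  case False
  have "exp (- x\<^sup>2 / 2) <= exp (- (1 / 2))" using False by simp
  also have "... <= 5 / 8" using e[of "1/2"] by simp
  finally have "3 * exp (- x\<^sup>2 / 2) <= 2" by simp
  then show ?thesis using False by (simp add: gw_def)
 qed
qed

lemma gw_le: "gw x <= x\<^sup>2 / 2"
 using exp_ge_add_one_self[of "- x\<^sup>2 / 2"] by (simp add: gw_def)

abbreviation "gauss \<equiv> std_normal_distribution"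

interpretation gauss: real_distribution gauss by (rule real_dist_normal_dist)

lemma integral_gauss_iexp: "(CLINT u|gauss. iexp ((v + u) * x)) = iexp (v * x) * complex_of_real (exp (- x\<^sup>2 / 2))"
proof -
 have "(CLINT u|gauss. iexp ((v + u) * x)) = (CLINT u|gauss. iexp (v * x) * iexp (x * u))"
  by (intro Bochner_Integration.integral_cong refl) (simp add: algebra_simps exp_add[symmetric])
 also have "... = iexp (v * x) * char gauss x"
  unfolding char_def by simp
 finally show ?thesis unfolding char_std_normal_distribution by simp
qed

text \<open>Averaging the frequency over a standard Gaussian multiplies the integrand by
  \<open>exp (- x\<^sup>2 / 2)\<close>; Fubini then moves the average onto the characteristic
  function.\<close>

lemma (in real_distribution) integral_gw_iexp:
 "(CLINT x|M. gw x * iexp (v * x)) = char M v - (CLINT u|gauss. char M (v + u))"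
proof -
 interpret P: pair_prob_space M gauss ..
 have meas: "(%p. iexp ((v + snd p) * fst p)) \<in> borel_measurable (M \<Otimes>\<^sub>M gauss)"
  by measurable
 have int: "integrable (M \<Otimes>\<^sub>M gauss) (%(x, u). iexp ((v + u) * x))"
  by (rule P.integrable_const_bound[of _ 1]) (use meas in \<open>auto simp: case_prod_beta'\<close>)
 have "(CLINT u|gauss. char M (v + u)) = (CLINT x|M. CLINT u|gauss. iexp ((v + u) * x))"
  unfolding char_def using P.Fubini_integral[OF int] by simp
 also have "... = (CLINT x|M. iexp (v * x) * complex_of_real (exp (- x\<^sup>2 / 2)))"
  by (simp only: integral_gauss_iexp)
 finally have eq: "(CLINT u|gauss. char M (v + u)) = (CLINT x|M. iexp (v * x) * complex_of_real (exp (- x\<^sup>2 / 2)))" .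
 have i1: "integrable M (%x. iexp (v * x))"
  by (rule integrable_const_bound[of _ 1]) auto
 have i2: "integrable M (%x. iexp (v * x) * complex_of_real (exp (- x\<^sup>2 / 2)))"
  by (rule integrable_const_bound[of _ 1]) (auto simp: norm_mult)
 have "(CLINT x|M. gw x * iexp (v * x)) = (CLINT x|M. iexp (v * x) - iexp (v * x) * complex_of_real (exp (- x\<^sup>2 / 2)))"
  by (intro Bochner_Integration.integral_cong refl) (simp add: gw_def algebra_simps)
 also have "... = (CLINT x|M. iexp (v * x)) - (CLINT x|M. iexp (v * x) * complex_of_real (exp (- x\<^sup>2 / 2)))"
  using i1 i2 by (rule Bochner_Integration.integral_diff)
 finally show ?thesis unfolding eq by (simp only: char_def)
qed

text \<open>Only one-dimensional laws occur here, through their characteristic functions; paths come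
  later. Integrability of \<open>min 1 \<bar>z\<bar>\<close> expresses that the jumps have finite
  variation.\<close>

locale levy_law =
 fixes gam \<sigma> :: real and s :: "real \<Rightarrow> real" and \<nu> :: "real measure" and mu :: "real \<Rightarrow> real measure"
 assumes s_meas[measurable]: "s \<in> borel_measurable borel" and s_nonneg: "!!z. 0 <= s z"
  and nu_eq: "\<nu> = density lborel (%z. ennreal (s z))"
  and \<sigma>_pos: "0 < \<sigma>"
  and nu_int: "integrable \<nu> (%z. min 1 \<bar>z\<bar>)"
  and law: "!!h. 0 <= h ==> real_distribution (mu h)"
  and char_law: "!!h u. 0 <= h ==> char (mu h) u = exp (complex_of_real h * cf_exponent gam \<sigma> \<nu> u)"
begin

abbreviation "\<psi> \<equiv> cf_exponent gam \<sigma> \<nu>"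

lemma sets_nu[simp, measurable_cong]: "sets \<nu> = sets borel" by (simp add: nu_eq)

lemma space_nu[simp]: "space \<nu> = UNIV" by (simp add: nu_eq)

sublocale nu: sigma_finite_measure \<nu>
 unfolding nu_eq by (subst sigma_finite_measure.sigma_finite_iff_density_finite[OF lborel.sigma_finite_measure_axioms]) auto

lemma integrable_iexp_nu: "integrable \<nu> (%z. iexp (u * z) - 1)"
proof (rule Bochner_Integration.integrable_bound[where f="%z. (2 + \<bar>u\<bar>) * min 1 \<bar>z\<bar>"])
 show "AE x in \<nu>. norm (iexp (u * x) - 1) <= norm ((2 + \<bar>u\<bar>) * min 1 \<bar>x\<bar>)"
 proof (rule AE_I2)
  fix x show "norm (iexp (u * x) - 1) <= norm ((2 + \<bar>u\<bar>) * min 1 \<bar>x\<bar>)"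
   using norm_iexp_minus_one_le[of u x] by simp
 qed
qed (use nu_int in simp_all)

text \<open>Read off from the bound 1 on the modulus of the characteristic function at time
  1.\<close>

lemma Re_psi: "Re (\<psi> u) <= 0"
proof -
 interpret real_distribution "mu 1" by (rule law) simp
 have "exp (Re (\<psi> u)) <= 1" using cmod_char_le_1[of u] by (simp add: char_law)
 then show ?thesis by simp
qed

lemma norm_exp_psi: "0 <= h ==> norm (exp (complex_of_real h * \<psi> u) - 1) <= h * norm (\<psi> u)"
 using norm_exp_minus_one_le[of "complex_of_real h * \<psi> u"] Re_psi[of u]
 by (simp add: norm_mult mult_nonneg_nonpos)

definition "nu_mass = (LINT z|\<nu>. min 1 \<bar>z\<bar>)"

lemma nu_mass_nonneg: "0 <= nu_mass"
 unfolding nu_mass_def by (intro Bochner_Integration.integral_nonneg) auto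

lemma norm_nu_part: "norm (CLINT z|\<nu>. iexp (u * z) - 1) <= (2 + \<bar>u\<bar>) * nu_mass"
proof -
 have "norm (CLINT z|\<nu>. iexp (u * z) - 1) <= (LINT z|\<nu>. norm (iexp (u * z) - 1))"
  by (rule integral_norm_bound)
 also have "... <= (LINT z|\<nu>. (2 + \<bar>u\<bar>) * min 1 \<bar>z\<bar>)"
 proof (rule integral_mono)
  show "integrable \<nu> (%z. norm (iexp (u * z) - 1))" by (rule integrable_norm[OF integrable_iexp_nu])
  show "integrable \<nu> (%z. (2 + \<bar>u\<bar>) * min 1 \<bar>z\<bar>)" by (rule integrable_mult_right[OF nu_int])
 qed (rule norm_iexp_minus_one_le)
 finally show ?thesis by (simp add: nu_mass_def)
qed

definition "psi_const = \<bar>gam\<bar> + \<sigma>\<^sup>2 + 3 * nu_mass"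

lemma norm_psi: "norm (\<psi> u) <= psi_const * (1 + u\<^sup>2)"
proof -
 have u: "\<bar>u\<bar> <= 1 + u\<^sup>2"
  using zero_le_power2[of "\<bar>u\<bar> - 1"] by (simp add: power2_eq_square algebra_simps)
 have "norm (\<psi> u) <= norm (\<i> * complex_of_real (gam * u) - complex_of_real (\<sigma>\<^sup>2 * u\<^sup>2 / 2)) + norm (CLINT z|\<nu>. iexp (u * z) - 1)"
  unfolding cf_exponent_def by (rule norm_triangle_ineq)
 also have "norm (\<i> * complex_of_real (gam * u) - complex_of_real (\<sigma>\<^sup>2 * u\<^sup>2 / 2)) <= norm (\<i> * complex_of_real (gam * u)) + norm (complex_of_real (\<sigma>\<^sup>2 * u\<^sup>2 / 2))"
  by (rule norm_triangle_ineq4)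
 also have "norm (\<i> * complex_of_real (gam * u)) = \<bar>gam\<bar> * \<bar>u\<bar>" by (simp add: norm_mult abs_mult)
 also have "norm (complex_of_real (\<sigma>\<^sup>2 * u\<^sup>2 / 2)) = \<sigma>\<^sup>2 * u\<^sup>2 / 2" unfolding norm_of_real by simp
 finally have "norm (\<psi> u) <= \<bar>gam\<bar> * \<bar>u\<bar> + \<sigma>\<^sup>2 * u\<^sup>2 / 2 + (2 + \<bar>u\<bar>) * nu_mass"
  using norm_nu_part[of u] by simp
 moreover have "\<bar>gam\<bar> * \<bar>u\<bar> <= \<bar>gam\<bar> * (1 + u\<^sup>2)" using u by (intro mult_left_mono) auto
 moreover have "\<sigma>\<^sup>2 * u\<^sup>2 / 2 <= \<sigma>\<^sup>2 * (1 + u\<^sup>2)"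
  using mult_nonneg_nonneg[of "\<sigma>\<^sup>2" "u\<^sup>2"] zero_le_power2[of \<sigma>] zero_le_power2[of u]
  unfolding distrib_left by linarith
 moreover have "(2 + \<bar>u\<bar>) * nu_mass <= 3 * (1 + u\<^sup>2) * nu_mass"
 proof (intro mult_right_mono nu_mass_nonneg)
  show "2 + \<bar>u\<bar> <= 3 * (1 + u\<^sup>2)" using u zero_le_power2[of u] unfolding distrib_left by linarith
 qed
 moreover have "psi_const * (1 + u\<^sup>2) = \<bar>gam\<bar> * (1 + u\<^sup>2) + \<sigma>\<^sup>2 * (1 + u\<^sup>2) + 3 * (1 + u\<^sup>2) * nu_mass"
  by (simp add: psi_const_def algebra_simps)
 ultimately show ?thesis by linarith
qed

lemma psi_const_pos: "0 < psi_const"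
 using \<sigma>_pos nu_mass_nonneg unfolding psi_const_def by (smt (verit) zero_less_power)

lemma psi_measurable[measurable]: "\<psi> \<in> borel_measurable borel"
 unfolding cf_exponent_def[abs_def] by measurable

lemma gauss_moment2: "integrable gauss (%u. 1 + (v + u)\<^sup>2)"
proof -
 have "(%u. 1 + (v + u)\<^sup>2) = (%u. (1 + v\<^sup>2) + 2 * v * u ^ 1 + u ^ 2)"
  by (auto simp: power2_eq_square algebra_simps)
 moreover have "integrable gauss (%u. (1 + v\<^sup>2) + 2 * v * u ^ 1 + u ^ 2)"
  by (intro Bochner_Integration.integrable_add integrable_mult_right integrable_std_normal_distribution_moment gauss.integrable_const)
 ultimately show ?thesis by simp
qed

lemma integrable_psi_gauss: "integrable gauss (%u. \<psi> (v + u))"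
proof (rule Bochner_Integration.integrable_bound[OF integrable_mult_right[OF gauss_moment2[of v], of psi_const]])
 show "AE u in gauss. norm (\<psi> (v + u)) <= norm (psi_const * (1 + (v + u)\<^sup>2))"
 proof (rule AE_I2)
  fix u show "norm (\<psi> (v + u)) <= norm (psi_const * (1 + (v + u)\<^sup>2))"
   using norm_psi[of "v + u"] psi_const_pos by (smt (verit) norm_ge_zero real_norm_def)
 qed
qed simp

text \<open>The first summand controls the mean of \<open>gw\<close> and the second the mean of
  \<open>sin\<close>, so one constant bounds spread and drift of a step per unit time.\<close>

definition "step_const = (LINT u|gauss. norm (\<psi> u)) + norm (\<psi> 1)"

lemma step_const_nonneg: "0 <= step_const"
 unfolding step_const_def by (intro add_nonneg_nonneg Bochner_Integration.integral_nonneg) auto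

text \<open>At frequency 0 the mean of \<open>gw\<close> is a Gaussian average of
  \<open>1 - exp (h * \<psi> u)\<close>, and \<open>norm_exp_psi\<close> makes this linear in
  \<open>h\<close>. It replaces a bound on the second moment, which may be infinite.\<close>

lemma expectation_gw_le:
 assumes h: "0 <= h" shows "(LINT x|mu h. gw x) <= step_const * h"
proof -
 interpret real_distribution "mu h" by (rule law[OF h])
 have "complex_of_real (LINT x|mu h. gw x) = (CLINT x|mu h. gw x * iexp (0 * x))"
  by simp
 also have "... = 1 - (CLINT u|gauss. exp (complex_of_real h * \<psi> u))"
  unfolding integral_gw_iexp char_zero by (simp add: char_law[OF h])
 also have "... = (CLINT u|gauss. 1 - exp (complex_of_real h * \<psi> u))"
 proof -
  have "integrable gauss (%u. exp (complex_of_real h * \<psi> u))"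
  proof (rule gauss.integrable_const_bound[of _ 1])
   have "norm (exp (complex_of_real h * \<psi> u)) <= 1" for u
    using Re_psi[of u] h by (simp add: mult_nonneg_nonpos)
   then show "AE x in gauss. norm (exp (complex_of_real h * \<psi> x)) <= 1" by simp
  qed simp
  then show ?thesis using gauss.prob_space by (simp add: Bochner_Integration.integral_diff)
 qed
 finally have "norm (complex_of_real (LINT x|mu h. gw x)) <= (LINT u|gauss. norm (1 - exp (complex_of_real h * \<psi> u)))"
  by (simp only:) (rule integral_norm_bound)
 also have "... <= (LINT u|gauss. h * norm (\<psi> u))"
 proof (rule integral_mono')
  show "integrable gauss (%u. h * norm (\<psi> u))" using integrable_psi_gauss[of 0] by simp
  show "norm (1 - exp (complex_of_real h * \<psi> u)) <= h * norm (\<psi> u)" for u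
   using norm_exp_psi[OF h, of u] by (simp add: norm_minus_commute)
 qed (use h in auto)
 also have "... = h * (LINT u|gauss. norm (\<psi> u))" by simp
 also have "... <= h * step_const" using h unfolding step_const_def by (intro mult_left_mono) auto
 finally show ?thesis by (simp add: mult.commute)
qed

text \<open>The bounded function \<open>sin\<close> stands in for the identity, whose mean may not
  exist; its mean is the imaginary part of the characteristic function at 1.\<close>

lemma expectation_sin_le:
 assumes h: "0 <= h" shows "\<bar>LINT x|mu h. sin x\<bar> <= step_const * h"
proof -
 interpret real_distribution "mu h" by (rule law[OF h])
 have i: "integrable (mu h) (%x. iexp (1 * x))" by (rule integrable_const_bound[of _ 1]) auto
 have "(LINT x|mu h. sin x) = (LINT x|mu h. Im (iexp (1 * x)))" by (simp add: Im_exp)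
 also have "... = Im (char (mu h) 1)" unfolding char_def by (rule integral_Im[OF i])
 also have "... = Im (char (mu h) 1 - 1)" by simp
 finally have "\<bar>LINT x|mu h. sin x\<bar> <= norm (char (mu h) 1 - 1)" by (metis abs_Im_le_cmod)
 also have "... <= h * norm (\<psi> 1)" unfolding char_law[OF h] by (rule norm_exp_psi[OF h])
 also have "... <= h * step_const" using h unfolding step_const_def by (intro mult_left_mono) auto
 finally show ?thesis by (simp add: mult.commute)
qed

end

lemma gauss_mean: "(LINT u|gauss. u) = 0" and gauss_int1: "integrable gauss (%u. u)"
 and gauss_var: "(LINT u|gauss. u\<^sup>2) = 1" and gauss_int2: "integrable gauss (%u. u\<^sup>2)"
 using integral_std_normal_distribution_moment_odd[of 1] integrable_std_normal_distribution_moment[of 1]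
  std_normal_distribution_even_moments[of 1] by auto

context levy_law
begin

lemma gw_int_nu: "integrable \<nu> gw"
proof (rule Bochner_Integration.integrable_bound[OF nu_int])
 show "AE x in \<nu>. norm (gw x) <= norm (min 1 \<bar>x\<bar>)"
 proof (rule AE_I2)
  fix x show "norm (gw x) <= norm (min 1 \<bar>x\<bar>)"
  proof (cases "\<bar>x\<bar> <= 1")
   case True
   have "\<bar>x\<bar>\<^sup>2 <= \<bar>x\<bar>" using True mult_left_mono[OF True, of "\<bar>x\<bar>"] by (simp add: power2_eq_square)
   moreover have "gw x <= x\<^sup>2 / 2" by (rule gw_le)
   moreover have "0 <= x\<^sup>2" by simp
   ultimately have "gw x <= \<bar>x\<bar>" unfolding power2_abs by linarith
   then show ?thesis using True gw_nonneg[of x] by simp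
  next
   case False then show ?thesis using gw_nonneg[of x] gw_le_1[of x] by simp
  qed
 qed
qed simp

text \<open>The Fubini identity behind \<open>integral_gw_iexp\<close>, now for a measure that may
  be infinite. The Gaussian average multiplies \<open>iexp (v * z)\<close> by
  \<open>exp (- z\<^sup>2 / 2)\<close> and leaves the subtracted 1 alone, so the two constants
  cancel in the difference.\<close>

lemma nu_part_gauss:
 "(CLINT z|\<nu>. iexp (v * z) - 1) - (CLINT u|gauss. CLINT z|\<nu>. iexp ((v + u) * z) - 1) = (CLINT z|\<nu>. gw z * iexp (v * z))"
proof -
 interpret P: pair_sigma_finite \<nu> gauss ..
 have m: "(%p. iexp ((v + snd p) * fst p) - 1) \<in> borel_measurable (\<nu> \<Otimes>\<^sub>M gauss)" by measurable
 have iu: "integrable gauss (%u. 2 + \<bar>v + u\<bar>)"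
  using gauss_int1 by auto
 have int: "integrable (\<nu> \<Otimes>\<^sub>M gauss) (%(z, u). iexp ((v + u) * z) - 1)"
 proof (rule P.Fubini_integrable)
  show "AE z in \<nu>. integrable gauss (%u. case (z, u) of (z, u) \<Rightarrow> iexp ((v + u) * z) - 1)"
  proof (rule AE_I2)
   fix z
   have "norm (iexp ((v + u) * z) - 1) <= 2" for u
    using norm_triangle_ineq4[of "iexp ((v + u) * z)" 1] by simp
   then show "integrable gauss (%u. case (z, u) of (z, u) \<Rightarrow> iexp ((v + u) * z) - 1)"
    by (intro gauss.integrable_const_bound[of _ 2]) auto
  qed
  show "integrable \<nu> (%z. LINT u|gauss. norm (case (z, u) of (z, u) \<Rightarrow> iexp ((v + u) * z) - 1))"
  proof (rule Bochner_Integration.integrable_bound[OF integrable_mult_right[OF nu_int, of "LINT u|gauss. 2 + \<bar>v + u\<bar>"]])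
   show "AE z in \<nu>. norm (LINT u|gauss. norm (case (z, u) of (z, u) \<Rightarrow> iexp ((v + u) * z) - 1))
     <= norm ((LINT u|gauss. 2 + \<bar>v + u\<bar>) * min 1 \<bar>z\<bar>)"
   proof (rule AE_I2)
    fix z
    have "(LINT u|gauss. norm (iexp ((v + u) * z) - 1)) <= (LINT u|gauss. (2 + \<bar>v + u\<bar>) * min 1 \<bar>z\<bar>)"
    proof (rule integral_mono')
     show "integrable gauss (%u. (2 + \<bar>v + u\<bar>) * min 1 \<bar>z\<bar>)" using iu by (rule integrable_mult_left)
     show "norm (iexp ((v + u) * z) - 1) <= (2 + \<bar>v + u\<bar>) * min 1 \<bar>z\<bar>" for u
      by (rule norm_iexp_minus_one_le)
    qed auto
    then have 1: "(LINT u|gauss. norm (iexp ((v + u) * z) - 1)) <= (LINT u|gauss. (2 + \<bar>v + u\<bar>)) * min 1 \<bar>z\<bar>"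
     by simp
    have "0 <= (LINT u|gauss. norm (iexp ((v + u) * z) - 1))" by simp
    with 1 show "norm (LINT u|gauss. norm (case (z, u) of (z, u) \<Rightarrow> iexp ((v + u) * z) - 1))
     <= norm ((LINT u|gauss. 2 + \<bar>v + u\<bar>) * min 1 \<bar>z\<bar>)" by simp
   qed
   show "(%z. LINT u|gauss. norm (case (z, u) of (z, u) \<Rightarrow> iexp ((v + u) * z) - 1)) \<in> borel_measurable \<nu>"
    by measurable
  qed
 qed (use m in \<open>simp add: case_prod_beta'\<close>)
 have "(CLINT u|gauss. CLINT z|\<nu>. iexp ((v + u) * z) - 1) = (CLINT z|\<nu>. CLINT u|gauss. iexp ((v + u) * z) - 1)"
  using P.Fubini_integral[OF int] by simp
 also have "... = (CLINT z|\<nu>. iexp (v * z) * complex_of_real (exp (- z\<^sup>2 / 2)) - 1)"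
 proof (intro Bochner_Integration.integral_cong refl)
  fix z
  have "integrable gauss (%u. iexp ((v + u) * z))"
   by (rule gauss.integrable_const_bound[of _ 1]) auto
  then have "(CLINT u|gauss. iexp ((v + u) * z) - 1) = (CLINT u|gauss. iexp ((v + u) * z)) - (CLINT u|gauss. 1)"
   by (rule Bochner_Integration.integral_diff) simp
  then show "(CLINT u|gauss. iexp ((v + u) * z) - 1) = iexp (v * z) * complex_of_real (exp (- z\<^sup>2 / 2)) - 1"
   unfolding integral_gauss_iexp using gauss.prob_space by simp
 qed
 finally have A: "(CLINT u|gauss. CLINT z|\<nu>. iexp ((v + u) * z) - 1) = (CLINT z|\<nu>. iexp (v * z) * complex_of_real (exp (- z\<^sup>2 / 2)) - 1)" .
 have i3: "integrable \<nu> (%z. gw z * iexp (v * z))"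
  by (rule Bochner_Integration.integrable_bound[OF gw_int_nu]) (auto simp: norm_mult)
 have eq: "iexp (v * z) * complex_of_real (exp (- z\<^sup>2 / 2)) - 1 = (iexp (v * z) - 1) - gw z * iexp (v * z)" for z
  by (simp add: gw_def algebra_simps)
 show ?thesis unfolding A eq using integrable_iexp_nu[of v] i3 by simp
qed

text \<open>Gaussian averaging kills the linear drift and shifts the quadratic part by a constant.
  What remains is the Fourier transform of the finite measure with an atom of mass
  \<open>\<sigma>\<^sup>2 / 2\<close> at 0 and density \<open>gw\<close> with respect to
  \<open>\<nu>\<close>, the small-time limit of the laws weighted by \<open>gw\<close>.\<close>

lemma psi_gauss:
 "\<psi> v - (CLINT u|gauss. \<psi> (v + u)) = complex_of_real (\<sigma>\<^sup>2 / 2) + (CLINT z|\<nu>. gw z * iexp (v * z))"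
proof -
 define J where "J u = (CLINT z|\<nu>. iexp (u * z) - 1)" for u
 have J[measurable]: "J \<in> borel_measurable borel" unfolding J_def by measurable
 have J_int: "integrable gauss (%u. J (v + u))"
 proof (rule Bochner_Integration.integrable_bound[where f="%u. (2 + \<bar>v + u\<bar>) * nu_mass"])
  show "integrable gauss (%u. (2 + \<bar>v + u\<bar>) * nu_mass)" using gauss_int1 by auto
  have "norm (J (v + u)) <= (2 + \<bar>v + u\<bar>) * nu_mass" for u
   unfolding J_def by (rule norm_nu_part)
  then have "norm (J (v + u)) <= norm ((2 + \<bar>v + u\<bar>) * nu_mass)" for u
   by (metis abs_ge_self order_trans real_norm_def)
  then show "AE u in gauss. norm (J (v + u)) <= norm ((2 + \<bar>v + u\<bar>) * nu_mass)" by simp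
 qed simp
 have r1: "(LINT u|gauss. gam * (v + u)) = gam * v" and i1: "integrable gauss (%u. gam * (v + u))"
  using gauss_int1 gauss_mean gauss.prob_space by auto
 have sq: "(v + u)\<^sup>2 = v\<^sup>2 + 2 * v * u + u\<^sup>2" for u by (simp add: power2_eq_square algebra_simps)
 have i2: "integrable gauss (%u. \<sigma>\<^sup>2 * (v + u)\<^sup>2 / 2)"
  unfolding sq using gauss_int1 gauss_int2 by (intro integrable_divide integrable_mult_right Bochner_Integration.integrable_add) auto
 have "(LINT u|gauss. (v\<^sup>2 + 2 * v * u) + u\<^sup>2) = v\<^sup>2 + 1"
  using gauss_int1 gauss_int2 gauss_mean gauss_var gauss.prob_space by simp
 then have r2: "(LINT u|gauss. \<sigma>\<^sup>2 * (v + u)\<^sup>2 / 2) = \<sigma>\<^sup>2 * (v\<^sup>2 + 1) / 2"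
  unfolding sq by simp
 have c1: "integrable gauss (%u. \<i> * complex_of_real (gam * (v + u)))"
  by (rule integrable_mult_right[OF integrable_of_real[OF i1]])
 have c2: "integrable gauss (%u. complex_of_real (\<sigma>\<^sup>2 * (v + u)\<^sup>2 / 2))"
  using i2 by (rule integrable_of_real)
 have "(CLINT u|gauss. \<psi> (v + u)) = (CLINT u|gauss. \<i> * complex_of_real (gam * (v + u)) - complex_of_real (\<sigma>\<^sup>2 * (v + u)\<^sup>2 / 2) + J (v + u))"
  by (simp only: cf_exponent_def J_def)
 also have "... = (CLINT u|gauss. \<i> * complex_of_real (gam * (v + u)) - complex_of_real (\<sigma>\<^sup>2 * (v + u)\<^sup>2 / 2)) + (CLINT u|gauss. J (v + u))"
  by (rule Bochner_Integration.integral_add[OF Bochner_Integration.integrable_diff[OF c1 c2] J_int])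
 also have "(CLINT u|gauss. \<i> * complex_of_real (gam * (v + u)) - complex_of_real (\<sigma>\<^sup>2 * (v + u)\<^sup>2 / 2))
   = (CLINT u|gauss. \<i> * complex_of_real (gam * (v + u))) - (CLINT u|gauss. complex_of_real (\<sigma>\<^sup>2 * (v + u)\<^sup>2 / 2))"
  by (rule Bochner_Integration.integral_diff[OF c1 c2])
 also have "(CLINT u|gauss. \<i> * complex_of_real (gam * (v + u))) = \<i> * complex_of_real (gam * v)"
 proof -
  have "(CLINT u|gauss. \<i> * complex_of_real (gam * (v + u))) = \<i> * complex_of_real (LINT u|gauss. gam * (v + u))"
   by (simp only: integral_mult_right_zero integral_complex_of_real)
  then show ?thesis unfolding r1 .
 qed
 also have "(CLINT u|gauss. complex_of_real (\<sigma>\<^sup>2 * (v + u)\<^sup>2 / 2)) = complex_of_real (\<sigma>\<^sup>2 * (v\<^sup>2 + 1) / 2)"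
  unfolding integral_complex_of_real r2 ..
 finally have A: "(CLINT u|gauss. \<psi> (v + u)) = \<i> * complex_of_real (gam * v) - complex_of_real (\<sigma>\<^sup>2 * (v\<^sup>2 + 1) / 2) + (CLINT u|gauss. J (v + u))" .
 have B: "J v - (CLINT u|gauss. J (v + u)) = (CLINT z|\<nu>. gw z * iexp (v * z))"
  unfolding J_def by (rule nu_part_gauss)
 have C: "\<psi> v = \<i> * complex_of_real (gam * v) - complex_of_real (\<sigma>\<^sup>2 * v\<^sup>2 / 2) + J v"
  by (simp only: cf_exponent_def J_def)
 have "\<sigma>\<^sup>2 * (v\<^sup>2 + 1) / 2 = \<sigma>\<^sup>2 * v\<^sup>2 / 2 + \<sigma>\<^sup>2 / 2" by (simp add: field_simps)
 then have D: "complex_of_real (\<sigma>\<^sup>2 * (v\<^sup>2 + 1) / 2) = complex_of_real (\<sigma>\<^sup>2 * v\<^sup>2 / 2) + complex_of_real (\<sigma>\<^sup>2 / 2)"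
  by (simp only: of_real_add)
 show ?thesis unfolding A B[symmetric] C D by (simp only: diff_add_eq diff_diff_eq2 add_diff_eq) simp
qed

lemma exp_diff_quotient_tendsto:
 fixes c :: complex and h :: "nat \<Rightarrow> real"
 assumes h: "h \<longlonglongrightarrow> 0" "!!i. 0 < h i"
 shows "(%i. (exp (complex_of_real (h i) * c) - 1) / complex_of_real (h i)) \<longlonglongrightarrow> c"
proof -
 have "((%z. exp (z * c)) has_field_derivative exp (0 * c) * c) (at 0)"
  by (auto intro!: derivative_eq_intros)
 then have "((%z. (exp (z * c) - 1) / z) \<longlongrightarrow> c) (at 0)"
  unfolding has_field_derivative_iff by simp
 moreover have "filterlim (%i. complex_of_real (h i)) (at 0) sequentially"
 proof (rule filterlim_atI)
  show "(%i. complex_of_real (h i)) \<longlonglongrightarrow> 0" using tendsto_of_real[OF h(1), where 'a=complex] by simp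
  show "\<forall>\<^sub>F i in sequentially. complex_of_real (h i) \<noteq> 0"
   using h(2) by (auto intro!: always_eventually simp: less_imp_neq[symmetric])
 qed
 ultimately show ?thesis by (rule filterlim_compose)
qed

text \<open>The quotients \<open>(exp (h * \<psi> u) - 1) / h\<close> are dominated by
  \<open>norm (\<psi> u)\<close>, whose quadratic growth is integrable under the Gaussian.\<close>

lemma gw_transform_tendsto:
 assumes h: "h \<longlonglongrightarrow> 0" "!!i. 0 < h i"
 shows "(%i. (CLINT x|mu (h i). gw x * iexp (v * x)) / complex_of_real (h i)) \<longlonglongrightarrow> \<psi> v - (CLINT u|gauss. \<psi> (v + u))"
proof -
 define D where "D i u = (exp (complex_of_real (h i) * \<psi> u) - 1) / complex_of_real (h i)" for i u
 have D[measurable]: "D i \<in> borel_measurable borel" for i unfolding D_def by measurable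
 have Dn: "norm (D i u) <= norm (\<psi> u)" for i u
  using norm_exp_psi[of "h i" u] h(2)[of i] unfolding D_def norm_divide by (simp add: field_simps)
 have Dl: "(%i. D i u) \<longlonglongrightarrow> \<psi> u" for u
  unfolding D_def by (rule exp_diff_quotient_tendsto[OF h])
 have Di: "integrable gauss (%u. D i (v + u))" for i
  by (rule Bochner_Integration.integrable_bound[OF integrable_psi_gauss[of v]]) (use Dn in auto)
 have "(%i. CLINT u|gauss. D i (v + u)) \<longlonglongrightarrow> (CLINT u|gauss. \<psi> (v + u))"
 proof (rule integral_dominated_convergence[where w="%u. norm (\<psi> (v + u))"])
  show "integrable gauss (%u. norm (\<psi> (v + u)))" using integrable_psi_gauss by (rule integrable_norm)
 qed (use Dn Dl in auto)
 then have "(%i. D i v - (CLINT u|gauss. D i (v + u))) \<longlonglongrightarrow> \<psi> v - (CLINT u|gauss. \<psi> (v + u))"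
  by (intro tendsto_diff Dl)
 moreover have "(CLINT x|mu (h i). gw x * iexp (v * x)) / complex_of_real (h i) = D i v - (CLINT u|gauss. D i (v + u))" for i
 proof -
  have h0: "complex_of_real (h i) \<noteq> 0" "0 <= h i" using h(2)[of i] by auto
  interpret real_distribution "mu (h i)" by (rule law[OF h0(2)])
  have E: "exp (complex_of_real (h i) * \<psi> u) = 1 + complex_of_real (h i) * D i u" for u
   using h0(1) by (simp add: D_def)
  have "(CLINT u|gauss. exp (complex_of_real (h i) * \<psi> (v + u))) = (CLINT u|gauss. 1) + complex_of_real (h i) * (CLINT u|gauss. D i (v + u))"
   unfolding E using Di[of i] by simp
  also have "(CLINT u|gauss. 1) = (1::complex)" using gauss.prob_space by simp
  finally have "(CLINT x|mu (h i). gw x * iexp (v * x)) = complex_of_real (h i) * (D i v - (CLINT u|gauss. D i (v + u)))"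
   unfolding integral_gw_iexp char_law[OF h0(2)] by (simp add: E algebra_simps)
  then show ?thesis using h0(1) by simp
 qed
 ultimately show ?thesis by simp
qed

end

context levy_law
begin

definition "kap_mass = \<sigma>\<^sup>2 / 2 + (LINT z|\<nu>. gw z)"

lemma kap_mass_pos: "0 < kap_mass"
proof -
 have "0 <= (LINT z|\<nu>. gw z)" by (intro Bochner_Integration.integral_nonneg gw_nonneg)
 then show ?thesis using \<sigma>_pos unfolding kap_mass_def by (simp add: add_pos_nonneg)
qed

text \<open>An atom encoded by a density: on the sheet \<open>False\<close> the mass
  \<open>\<sigma>\<^sup>2 / 2\<close> is spread uniformly over \<open>{0..1}\<close>, and the map in
  \<open>kap\<close> collapses this sheet to one point.\<close>

definition kap_dens :: "bool \<times> real \<Rightarrow> real" where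
 "kap_dens p = (if fst p then gw (snd p) * s (snd p) else \<sigma>\<^sup>2 / 2 * indicator {0..1} (snd p)) / kap_mass"

text \<open>The first component selects between the Gaussian atom at 0 and the jump part.\<close>

definition kap :: "real measure" where
 "kap = distr (density (count_space UNIV \<Otimes>\<^sub>M lborel) (%p. ennreal (kap_dens p))) borel (%p. if fst p then snd p else 0)"

lemma kap_dens_nonneg: "0 <= kap_dens p"
 unfolding kap_dens_def using kap_mass_pos gw_nonneg s_nonneg by auto

lemma kap_dens_measurable[measurable]: "kap_dens \<in> borel_measurable (count_space UNIV \<Otimes>\<^sub>M lborel)"
 unfolding kap_dens_def[abs_def] by measurable

lemma gw_s_integrable: "integrable lborel (%z. gw z * s z)"
proof -
 have "integrable (density lborel (%z. ennreal (s z))) gw" using gw_int_nu by (simp add: nu_eq)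
 then show ?thesis by (subst (asm) integrable_density) (auto simp: s_nonneg mult.commute)
qed

lemma gw_s_integral: "(LINT z|lborel. gw z * s z) = (LINT z|\<nu>. gw z)"
 unfolding nu_eq by (subst integral_density) (auto simp: s_nonneg mult.commute)

lemma kap_section_integrable: "integrable lborel (%z. kap_dens (b, z))"
proof (cases b)
 case True
 then show ?thesis unfolding kap_dens_def using gw_s_integrable by simp
next
 case False
 have "integrable lborel (indicator {0..1::real} :: real \<Rightarrow> real)" by simp
 with False show ?thesis unfolding kap_dens_def by simp
qed

lemma kap_section_integral:
 "(LINT z|lborel. kap_dens (True, z)) + (LINT z|lborel. kap_dens (False, z)) = 1"
proof -
 have "(LINT z|lborel. kap_dens (True, z)) = (LINT z|\<nu>. gw z) / kap_mass"
  unfolding kap_dens_def by (simp add: gw_s_integral)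
 moreover have "(LINT z|lborel. kap_dens (False, z)) = (\<sigma>\<^sup>2 / 2) / kap_mass"
  unfolding kap_dens_def by simp
 ultimately have "(LINT z|lborel. kap_dens (True, z)) + (LINT z|lborel. kap_dens (False, z)) = ((LINT z|\<nu>. gw z) + \<sigma>\<^sup>2 / 2) / kap_mass"
  by (simp only: add_divide_distrib)
 also have "(LINT z|\<nu>. gw z) + \<sigma>\<^sup>2 / 2 = kap_mass" by (simp add: kap_mass_def)
 finally have "(LINT z|lborel. kap_dens (True, z)) + (LINT z|lborel. kap_dens (False, z)) = kap_mass / kap_mass" .
 then show ?thesis using kap_mass_pos by simp
qed

interpretation cb: sigma_finite_measure "count_space (UNIV :: bool set)"
 by (rule sigma_finite_measure_count_space_finite) simp

interpretation Q: pair_sigma_finite "count_space (UNIV :: bool set)" lborel ..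

lemma kap_map_measurable[measurable]:
 "(%p. if fst p then snd p else 0) \<in> borel_measurable (count_space (UNIV::bool set) \<Otimes>\<^sub>M lborel)"
 by measurable

lemma kap_real_distribution: "real_distribution kap"
proof -
 have "emeasure (density (count_space UNIV \<Otimes>\<^sub>M lborel) (%p. ennreal (kap_dens p))) UNIV
   = (\<integral>\<^sup>+ p. ennreal (kap_dens p) \<partial>(count_space UNIV \<Otimes>\<^sub>M lborel))"
  by (subst emeasure_density) (auto simp: space_pair_measure intro: sets.top[of "count_space UNIV \<Otimes>\<^sub>M lborel", simplified space_pair_measure, simplified])
 also have "... = (\<integral>\<^sup>+ b. \<integral>\<^sup>+ z. ennreal (kap_dens (b, z)) \<partial>lborel \<partial>count_space UNIV)"
  by (rule lborel.nn_integral_fst[symmetric]) simp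
 also have "... = (\<Sum>b\<in>UNIV. \<integral>\<^sup>+ z. ennreal (kap_dens (b, z)) \<partial>lborel)"
  by (rule nn_integral_count_space_finite) simp
 also have "... = (\<Sum>b\<in>UNIV. ennreal (LINT z|lborel. kap_dens (b, z)))"
  by (intro sum.cong refl nn_integral_eq_integral kap_section_integrable) (simp add: kap_dens_nonneg)
 also have "... = ennreal ((LINT z|lborel. kap_dens (True, z)) + (LINT z|lborel. kap_dens (False, z)))"
  by (simp add: UNIV_bool ennreal_plus[symmetric] kap_dens_nonneg add.commute del: ennreal_plus)
 finally have e: "emeasure (density (count_space UNIV \<Otimes>\<^sub>M lborel) (%p. ennreal (kap_dens p))) UNIV = 1"
  unfolding kap_section_integral by simp
 have "prob_space (density (count_space UNIV \<Otimes>\<^sub>M lborel) (%p. ennreal (kap_dens p)))"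
  by (rule prob_spaceI) (use e in \<open>simp add: space_pair_measure\<close>)
 then show ?thesis unfolding kap_def
  by (intro prob_space.real_distribution_distr) auto
qed

lemma kap_integral:
 fixes F :: "real \<Rightarrow> 'b::{banach,second_countable_topology}"
 assumes F[measurable]: "F \<in> borel_measurable borel" and B: "!!x. norm (F x) <= B"
 shows "integral\<^sup>L kap F = (1 / kap_mass) *\<^sub>R ((\<sigma>\<^sup>2 / 2) *\<^sub>R F 0 + (LINT z|\<nu>. gw z *\<^sub>R F z))"
proof -
 define H where "H p = kap_dens p *\<^sub>R F (if fst p then snd p else 0)" for p
 have H[measurable]: "H \<in> borel_measurable (count_space UNIV \<Otimes>\<^sub>M lborel)" unfolding H_def by measurable
 have "norm (H p) <= B * kap_dens p" for p
  unfolding H_def norm_scaleR mult.commute[of B] using kap_dens_nonneg[of p]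
  by (simp only: abs_of_nonneg) (intro mult_left_mono B)
 then have sec: "integrable lborel (%z. H (b, z))" for b
  by (intro Bochner_Integration.integrable_bound[OF integrable_mult_right[OF kap_section_integrable[of b], of B]])
   (auto intro!: AE_I2 intro: order_trans[OF _ abs_ge_self])
 have intH: "integrable (count_space UNIV \<Otimes>\<^sub>M lborel) H"
  by (rule Q.Fubini_integrable) (use sec in \<open>auto intro!: integrable_count_space\<close>)
 have "integral\<^sup>L kap F = (LINT p|density (count_space UNIV \<Otimes>\<^sub>M lborel) (%p. ennreal (kap_dens p)). F (if fst p then snd p else 0))"
  unfolding kap_def by (rule integral_distr) auto
 also have "... = (LINT p|(count_space UNIV \<Otimes>\<^sub>M lborel). H p)"
  unfolding H_def by (rule integral_density) (auto simp: kap_dens_nonneg)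
 also have "... = (LINT b|count_space UNIV. LINT z|lborel. H (b, z))"
  by (rule Q.integral_fst'[symmetric, OF intH])
 also have "... = (\<Sum>b\<in>UNIV. LINT z|lborel. H (b, z))"
  by (rule lebesgue_integral_count_space_finite) simp
 also have "... = (LINT z|lborel. H (False, z)) + (LINT z|lborel. H (True, z))" by (simp add: UNIV_bool)
 also have "(LINT z|lborel. H (True, z)) = (1 / kap_mass) *\<^sub>R (LINT z|\<nu>. gw z *\<^sub>R F z)"
 proof -
  have "(LINT z|\<nu>. gw z *\<^sub>R F z) = (LINT z|lborel. s z *\<^sub>R (gw z *\<^sub>R F z))"
   by (subst nu_eq, rule integral_density) (auto simp: s_nonneg)
  then show ?thesis unfolding H_def kap_dens_def
   by (simp add: mult.commute flip: integral_scaleR_right)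
 qed
 also have "(LINT z|lborel. H (False, z)) = (1 / kap_mass) *\<^sub>R ((\<sigma>\<^sup>2 / 2) *\<^sub>R F 0)"
 proof -
  have "(LINT z|lborel. H (False, z)) = (LINT z|lborel. kap_dens (False, z) *\<^sub>R F 0)"
   unfolding H_def by simp
  also have "... = (LINT z|lborel. kap_dens (False, z)) *\<^sub>R F 0"
   by (rule integral_scaleR_left) (rule kap_section_integrable)
  also have "(LINT z|lborel. kap_dens (False, z)) = \<sigma>\<^sup>2 / 2 / kap_mass" unfolding kap_dens_def by simp
  finally show ?thesis by simp
 qed
 finally show ?thesis by (simp add: scaleR_add_right)
qed

text \<open>Otherwise the law is concentrated at 0 and its characteristic function is constantly 1,
  which contradicts \<open>Re (\<psi> 1) <= - \<sigma>\<^sup>2 / 2\<close>. Positivity is what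
  permits normalising the weighted law.\<close>

lemma gw_moment_pos: assumes h: "0 < h" shows "0 < (LINT x|mu h. gw x)"
proof -
 interpret real_distribution "mu h" using h by (intro law) simp
 have nn: "0 <= (LINT x|mu h. gw x)" by (intro Bochner_Integration.integral_nonneg gw_nonneg)
 have i: "integrable (mu h) gw" by (rule integrable_const_bound[of _ 1]) (use gw_nonneg gw_le_1 in auto)
 have "(LINT x|mu h. gw x) \<noteq> 0"
 proof
  assume "(LINT x|mu h. gw x) = 0"
  then have "AE x in mu h. gw x = 0"
   using integral_nonneg_eq_0_iff_AE[OF i] gw_nonneg by auto
  then have "AE x in mu h. x = 0" by eventually_elim (metis gw_pos less_irrefl)
  then have "char (mu h) u = (CLINT x|mu h. 1)" for u
   unfolding char_def by (intro integral_cong_AE) auto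
  then have "exp (complex_of_real h * \<psi> u) = 1" for u using prob_space h by (simp add: char_law)
  then have "norm (exp (complex_of_real h * \<psi> 1)) = 1" by (metis norm_one)
  then have R: "Re (\<psi> 1) = 0" using h by simp
  have "Re (CLINT z|\<nu>. iexp (1 * z) - 1) = (LINT z|\<nu>. Re (iexp (1 * z) - 1))"
   by (rule integral_Re[symmetric, OF integrable_iexp_nu])
  also have "... <= (LINT z|\<nu>. 0)" by (rule integral_mono') (auto simp: Re_exp)
  finally have "Re (\<psi> 1) <= - \<sigma>\<^sup>2 / 2" unfolding cf_exponent_def by simp
  with R \<sigma>_pos show False by simp
 qed
 with nn show ?thesis by simp
qed

text \<open>The law weighted by \<open>gw\<close> is normalised to a probability
  \<open>kp i\<close>. Its characteristic function is the quotient of two limits from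
  \<open>gw_transform_tendsto\<close>, so Levy's continuity theorem gives weak convergence to
  \<open>kap\<close>; multiplying by the asymptotic mass undoes the normalisation.\<close>

lemma scaled_law_integral_tendsto:
 fixes F :: "real \<Rightarrow> real"
 assumes h: "h \<longlonglongrightarrow> 0" "!!i. 0 < h i" and cont: "!!x. isCont F x" and B: "!!x. \<bar>F x\<bar> <= B"
 shows "(%i. (LINT x|mu (h i). gw x * F x) / h i) \<longlonglongrightarrow> \<sigma>\<^sup>2 / 2 * F 0 + (LINT z|\<nu>. gw z * F z)"
proof -
 have [measurable]: "F \<in> borel_measurable borel"
  using cont by (intro borel_measurable_continuous_onI continuous_at_imp_continuous_on) auto
 define m where "m i = (LINT x|mu (h i). gw x)" for i
 have m: "0 < m i" for i unfolding m_def by (rule gw_moment_pos[OF h(2)])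
 have rd: "real_distribution (mu (h i))" for i using h(2)[of i] by (intro law) simp
 define kp where "kp i = density (mu (h i)) (%x. ennreal (gw x / m i))" for i
 have setsm[simp, measurable_cong]: "sets (mu (h i)) = sets borel" for i
  using rd[of i] by (simp add: real_distribution_def real_distribution_axioms_def)
 have gi: "integrable (mu (h i)) gw" for i
 proof -
  interpret real_distribution "mu (h i)" by (rule rd)
  show ?thesis by (rule integrable_const_bound[of _ 1]) (use gw_nonneg gw_le_1 in auto)
 qed
 have kp: "real_distribution (kp i)" for i
 proof -
  have sp: "space (mu (h i)) = UNIV" using sets_eq_imp_space_eq[OF setsm[of i]] by simp
  have "emeasure (kp i) (space (kp i)) = (\<integral>\<^sup>+ x. ennreal (gw x / m i) \<partial>mu (h i))"
   unfolding kp_def by (subst emeasure_density) (auto simp: sp)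
  also have "... = ennreal (LINT x|mu (h i). gw x / m i)"
   using m[of i] gw_nonneg gi[of i] by (intro nn_integral_eq_integral) (auto simp: less_imp_le)
  also have "... = 1" using m[of i] by (simp add: m_def)
  finally show ?thesis
   unfolding real_distribution_def real_distribution_axioms_def by (auto intro: prob_spaceI simp: kp_def sp)
 qed
 have kp_int: "integral\<^sup>L (kp i) G = (1 / m i) *\<^sub>R (LINT x|mu (h i). gw x *\<^sub>R G x)"
  if [measurable]: "G \<in> borel_measurable borel" for i and G :: "real \<Rightarrow> 'c::{banach,second_countable_topology}"
  unfolding kp_def using m[of i] gw_nonneg
  by (subst integral_density) (auto simp: less_imp_le simp flip: integral_scaleR_right)
 have tr: "(%i. (CLINT x|mu (h i). gw x * iexp (v * x)) / complex_of_real (h i)) \<longlonglongrightarrow> complex_of_real kap_mass * char kap v" for v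
 proof -
  have "char kap v = (1 / kap_mass) *\<^sub>R ((\<sigma>\<^sup>2 / 2) *\<^sub>R iexp (v * 0) + (CLINT z|\<nu>. gw z *\<^sub>R iexp (v * z)))"
   unfolding char_def by (rule kap_integral[where B=1]) auto
  then have "complex_of_real kap_mass * char kap v = complex_of_real (\<sigma>\<^sup>2 / 2) + (CLINT z|\<nu>. gw z * iexp (v * z))"
   using kap_mass_pos by (simp add: scaleR_conv_of_real)
  then show ?thesis using gw_transform_tendsto[OF h, of v] unfolding psi_gauss by simp
 qed
 \<comment> \<open>The transform at frequency 0 is the total mass, so the normalising constants
   behave like \<open>kap_mass * h i\<close>.\<close>
 have mh: "(%i. m i / h i) \<longlonglongrightarrow> kap_mass"
 proof -
  interpret K: real_distribution kap by (rule kap_real_distribution)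
  have "(%i. complex_of_real (m i / h i)) \<longlonglongrightarrow> complex_of_real kap_mass"
   using tr[of 0] by (simp add: K.char_zero m_def)
  then show ?thesis by (simp only: tendsto_of_real_iff)
 qed
 have conv: "weak_conv_m kp kap"
 proof (rule levy_continuity[OF kp kap_real_distribution])
  fix v
  have "(%i. ((CLINT x|mu (h i). gw x * iexp (v * x)) / complex_of_real (h i)) / complex_of_real (m i / h i)) \<longlonglongrightarrow> complex_of_real kap_mass * char kap v / complex_of_real kap_mass"
   using kap_mass_pos by (intro tendsto_divide tr tendsto_of_real mh) simp
  moreover have "char (kp i) v = ((CLINT x|mu (h i). gw x * iexp (v * x)) / complex_of_real (h i)) / complex_of_real (m i / h i)" for i
   unfolding char_def using h(2)[of i] m[of i] by (subst kp_int) (auto simp: scaleR_conv_of_real field_simps)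
  ultimately show "(%i. char (kp i) v) \<longlonglongrightarrow> char kap v" using kap_mass_pos by simp
 qed
 have "(%i. integral\<^sup>L (kp i) F) \<longlonglongrightarrow> integral\<^sup>L kap F"
  by (rule weak_conv_imp_integral_bdd_continuous_conv[OF kp kap_real_distribution conv cont, of B]) (use B in simp)
 then have "(%i. (m i / h i) * integral\<^sup>L (kp i) F) \<longlonglongrightarrow> kap_mass * integral\<^sup>L kap F"
  by (intro tendsto_mult mh)
 moreover have "(m i / h i) * integral\<^sup>L (kp i) F = (LINT x|mu (h i). gw x * F x) / h i" for i
  using m[of i] by (subst kp_int) auto
 moreover have "kap_mass * integral\<^sup>L kap F = \<sigma>\<^sup>2 / 2 * F 0 + (LINT z|\<nu>. gw z * F z)"
  using kap_mass_pos by (subst kap_integral[where B=B]) (use B in auto)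
 ultimately show ?thesis by (simp only:)
qed

end

lemma sin_minus_id_bound: "\<bar>x - sin x\<bar> <= \<bar>x\<bar> ^ 3 / 6" for x :: real
proof -
 have e: "(\<Sum>m<3. sin_coeff m * x ^ m) = x"
  by (simp add: eval_nat_numeral sin_coeff_def)
 have "fact 3 = (6::real)" by (simp add: eval_nat_numeral)
 then have "\<bar>sin x - x\<bar> <= inverse 6 * \<bar>x\<bar> ^ 3"
  using Maclaurin_sin_bound[of x 3] unfolding e by metis
 then show ?thesis unfolding abs_minus_commute[of x] by (simp add: field_simps)
qed

lemma gw_quotient_tendsto: "((%x. gw x / x\<^sup>2) \<longlongrightarrow> 1 / 2) (at 0)"
proof -
 have "((%t. (exp t - 1) / t) \<longlongrightarrow> 1) (at (0::real))"
  using DERIV_exp[of "0::real"] unfolding has_field_derivative_iff by simp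
 moreover have "filterlim (%x. - x\<^sup>2 / 2 :: real) (at 0) (at 0)"
 proof (rule filterlim_atI)
  have "((%x. - x\<^sup>2 / 2 :: real) \<longlongrightarrow> - 0\<^sup>2 / 2) (at 0)" by (intro tendsto_intros) auto
  then show "((%x. - x\<^sup>2 / 2 :: real) \<longlongrightarrow> 0) (at 0)" by simp
  show "\<forall>\<^sub>F x in at 0. - x\<^sup>2 / 2 \<noteq> (0::real)" by (auto simp: eventually_at_filter)
 qed
 ultimately have "((%x. (exp (- x\<^sup>2 / 2) - 1) / (- x\<^sup>2 / 2)) \<longlongrightarrow> (1::real)) (at 0)" by (rule filterlim_compose)
 then have "((%x. (1 / 2) * ((exp (- x\<^sup>2 / 2) - 1) / (- x\<^sup>2 / 2))) \<longlongrightarrow> (1 / 2) * (1::real)) (at 0)" by (intro tendsto_intros)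
 moreover have "(1 / 2) * ((exp (- x\<^sup>2 / 2) - 1) / (- x\<^sup>2 / 2)) = gw x / x\<^sup>2" for x
  by (cases "x = 0") (simp_all add: gw_def field_simps)
 ultimately show ?thesis by simp
qed

lemma sin_quotient_tendsto: "((%x. (x - sin x) / x\<^sup>2) \<longlongrightarrow> (0::real)) (at 0)"
proof (rule Lim_null_comparison)
 show "\<forall>\<^sub>F x in at 0. norm ((x - sin x) / x\<^sup>2) <= \<bar>x\<bar> / 6" for x :: real
  unfolding eventually_at_filter
 proof (intro always_eventually allI impI)
  fix x :: real assume "x \<noteq> 0"
  then show "norm ((x - sin x) / x\<^sup>2) <= \<bar>x\<bar> / 6"
  proof -
   have "\<bar>x - sin x\<bar> / x\<^sup>2 <= (\<bar>x\<bar> ^ 3 / 6) / x\<^sup>2" by (intro divide_right_mono sin_minus_id_bound) simp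
   also have "\<bar>x\<bar> ^ 3 = \<bar>x\<bar> * x\<^sup>2" by (simp add: power3_eq_cube power2_eq_square)
   finally show ?thesis using \<open>x \<noteq> 0\<close> by (simp add: abs_divide)
  qed
 qed
 show "((%x. \<bar>x\<bar> / 6) \<longlongrightarrow> (0::real)) (at 0)"
  using tendsto_divide[OF tendsto_rabs[OF tendsto_ident_at[of "0::real" UNIV]] tendsto_const, of 6] by simp
qed

context levy_law
begin

lemma sin_int_nu: "integrable \<nu> sin"
proof (rule Bochner_Integration.integrable_bound[OF nu_int])
 have "norm (sin x) <= norm (min 1 \<bar>x\<bar>)" for x :: real using abs_sin_x_le_abs_x[of x] by simp
 then show "AE x in \<nu>. norm (sin x) <= norm (min 1 \<bar>x\<bar>)" by (intro AE_I2)
qed simp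

lemma sin_moment_tendsto:
 assumes h: "h \<longlonglongrightarrow> 0" "!!i. 0 < h i"
 shows "(%i. (LINT x|mu (h i). sin x) / h i) \<longlonglongrightarrow> gam + (LINT z|\<nu>. sin z)"
proof -
 have "(%i. Im ((exp (complex_of_real (h i) * \<psi> 1) - 1) / complex_of_real (h i))) \<longlonglongrightarrow> Im (\<psi> 1)"
  by (intro tendsto_intros exp_diff_quotient_tendsto[OF h])
 moreover have "Im ((exp (complex_of_real (h i) * \<psi> 1) - 1) / complex_of_real (h i)) = (LINT x|mu (h i). sin x) / h i" for i
 proof -
  have hi: "0 <= h i" using h(2)[of i] by simp
  interpret real_distribution "mu (h i)" by (rule law[OF hi])
  have i: "integrable (mu (h i)) (%x. iexp (1 * x))" by (rule integrable_const_bound[of _ 1]) auto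
  have "(LINT x|mu (h i). sin x) = (LINT x|mu (h i). Im (iexp (1 * x)))" by (simp add: Im_exp)
  also have "... = Im (char (mu (h i)) 1)" unfolding char_def by (rule integral_Im[OF i])
  finally show ?thesis unfolding char_law[OF hi] by (simp add: Im_divide_of_real)
 qed
 moreover have "Im (\<psi> 1) = gam + (LINT z|\<nu>. sin z)"
 proof -
  have "Im (CLINT z|\<nu>. iexp (1 * z) - 1) = (LINT z|\<nu>. Im (iexp (1 * z) - 1))"
   by (rule integral_Im[symmetric, OF integrable_iexp_nu])
  also have "... = (LINT z|\<nu>. sin z)" by (simp add: Im_exp)
  finally show ?thesis unfolding cf_exponent_def by simp
 qed
 ultimately show ?thesis by (simp only:)
qed

text \<open>The increment of \<open>f\<close> is split as \<open>f1 * sin x + gw x * F x\<close>.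
  The first part is handled by the exponent at 1, the second by weak convergence, because
  \<open>F\<close> extends to a bounded continuous function. Thus \<open>f\<close> needs a
  second-order expansion only at the single point \<open>y\<close>, which suits a payoff that is
  merely C1 elsewhere.\<close>

lemma generator_limit:
 assumes cont: "!!x. isCont f x" and A: "!!x. \<bar>f x\<bar> <= A"
  and f2: "((%x. (f (y + x) - f y - f1 * x) / x\<^sup>2) \<longlongrightarrow> f2 / 2) (at 0)"
 shows "((%h. (step_op (mu h) f y - f y) / h) \<longlongrightarrow> gam * f1 + \<sigma>\<^sup>2 / 2 * f2 + (LINT z|\<nu>. f (y + z) - f y)) (at_right 0)"
proof -
 have fm[measurable]: "f \<in> borel_measurable borel"
  using cont by (intro borel_measurable_continuous_onI continuous_at_imp_continuous_on) auto
 define N where "N x = f (y + x) - f y - f1 * sin x" for x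
 define F where "F x = (if x = 0 then f2 else N x / gw x)" for x
 have Nc: "isCont N x" for x
  unfolding N_def by (intro continuous_intros isCont_o2[OF _ cont])
 have gc: "isCont gw x" for x unfolding gw_def[abs_def] by (intro continuous_intros) auto
 have NF: "gw x * F x = N x" for x
  using gw_pos[of x] by (auto simp: F_def N_def)
 have Fc: "isCont F x" for x
 proof (cases "x = 0")
  case False
  have "isCont (%x. N x / gw x) x" using gw_pos[OF False] by (intro continuous_intros Nc gc) simp
  moreover have "\<forall>\<^sub>F z in nhds x. F z = N z / gw z"
   using t1_space_nhds[OF False] by eventually_elim (simp add: F_def)
  ultimately show ?thesis by (simp only: isCont_cong)
 next
  case True
  \<comment> \<open>Dividing numerator and denominator of \<open>N x / gw x\<close> by
    \<open>x\<^sup>2\<close> leaves the limits \<open>f2 / 2\<close> and \<open>1 / 2\<close>, hence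
    the value \<open>f2\<close> of \<open>F\<close> at 0.\<close>
  have "((%x. ((f (y + x) - f y - f1 * x) / x\<^sup>2 + f1 * ((x - sin x) / x\<^sup>2)) / (gw x / x\<^sup>2)) \<longlongrightarrow> (f2 / 2 + f1 * 0) / (1 / 2)) (at 0)"
   by (intro tendsto_divide tendsto_add tendsto_mult f2 tendsto_const sin_quotient_tendsto gw_quotient_tendsto) simp
  then have "((%x. ((f (y + x) - f y - f1 * x) / x\<^sup>2 + f1 * ((x - sin x) / x\<^sup>2)) / (gw x / x\<^sup>2)) \<longlongrightarrow> f2) (at 0)" by simp
  moreover have "\<forall>\<^sub>F x in at 0. ((f (y + x) - f y - f1 * x) / x\<^sup>2 + f1 * ((x - sin x) / x\<^sup>2)) / (gw x / x\<^sup>2) = F x"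
   unfolding eventually_at_filter
  proof (intro always_eventually allI impI)
   fix x :: real assume x: "x \<noteq> 0"
   have "(f (y + x) - f y - f1 * x) / x\<^sup>2 + f1 * ((x - sin x) / x\<^sup>2) = N x / x\<^sup>2"
    by (simp add: N_def add_divide_distrib[symmetric] algebra_simps)
   then show "((f (y + x) - f y - f1 * x) / x\<^sup>2 + f1 * ((x - sin x) / x\<^sup>2)) / (gw x / x\<^sup>2) = F x"
    using x by (simp add: F_def)
  qed
  ultimately have "(F \<longlongrightarrow> f2) (at 0)" by (rule Lim_transform_eventually)
  then show ?thesis unfolding True isCont_def by (simp add: F_def)
 qed
 \<comment> \<open>Near 0 boundedness of \<open>F\<close> comes from continuity on a compact
   interval; farther out the denominator is at least \<open>gw 1\<close>.\<close>
 have "compact (F ` {-1..1})"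
  by (intro compact_continuous_image continuous_at_imp_continuous_on) (auto simp: Fc)
 then obtain b where b: "!!x. x \<in> {-1..1} ==> \<bar>F x\<bar> <= b"
  by (metis bounded_iff compact_imp_bounded image_eqI real_norm_def)
 have g1: "0 < gw 1" by (rule gw_pos) simp
 have FB: "\<bar>F x\<bar> <= max b ((2 * A + \<bar>f1\<bar>) / gw 1)" for x
 proof (cases "x \<in> {-1..1}")
  case True then show ?thesis using b[OF True] by simp
 next
  case False
  then have g: "gw 1 <= gw x" by (intro gw_mono) auto
  have "\<bar>f1 * sin x\<bar> <= \<bar>f1\<bar> * 1" unfolding abs_mult by (intro mult_left_mono) auto
  then have n: "\<bar>N x\<bar> <= 2 * A + \<bar>f1\<bar>" unfolding N_def using A[of "y + x"] A[of y] by linarith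
  have "\<bar>F x\<bar> = \<bar>N x\<bar> / gw x" using False gw_nonneg[of x] by (auto simp: F_def abs_divide)
  also have "... <= (2 * A + \<bar>f1\<bar>) / gw 1" using n g g1 by (intro frac_le) auto
  finally show ?thesis by simp
 qed
 have gF: "integrable \<nu> (%z. gw z * F z)"
 proof (rule Bochner_Integration.integrable_bound[OF integrable_mult_right[OF gw_int_nu, of "max b ((2 * A + \<bar>f1\<bar>) / gw 1)"]])
  show "AE x in \<nu>. norm (gw x * F x) <= norm (max b ((2 * A + \<bar>f1\<bar>) / gw 1) * gw x)"
  proof (rule AE_I2)
   fix x
   have "\<bar>F x\<bar> * gw x <= max b ((2 * A + \<bar>f1\<bar>) / gw 1) * gw x" by (intro mult_right_mono FB gw_nonneg)
   moreover have "norm (gw x * F x) = \<bar>F x\<bar> * gw x" using gw_nonneg[of x] by (simp add: abs_mult)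
   ultimately show "norm (gw x * F x) <= norm (max b ((2 * A + \<bar>f1\<bar>) / gw 1) * gw x)"
    using abs_ge_self[of "max b ((2 * A + \<bar>f1\<bar>) / gw 1) * gw x"] unfolding real_norm_def by linarith
  qed
  show "(%z. gw z * F z) \<in> borel_measurable \<nu>" unfolding NF N_def by measurable
 qed
 have nuint: "(LINT z|\<nu>. gw z * F z) + f1 * (LINT z|\<nu>. sin z) = (LINT z|\<nu>. f (y + z) - f y)"
 proof -
  have "(LINT z|\<nu>. gw z * F z) + f1 * (LINT z|\<nu>. sin z) = (LINT z|\<nu>. gw z * F z + f1 * sin z)"
   using gF sin_int_nu by simp
  also have "... = (LINT z|\<nu>. f (y + z) - f y)" unfolding NF N_def by simp
  finally show ?thesis .
 qed
 show ?thesis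
  unfolding tendsto_at_iff_sequentially
 proof (intro allI impI)
  fix h :: "nat \<Rightarrow> real" assume hh: "\<forall>i. h i \<in> {0<..} - {0}" "h \<longlonglongrightarrow> 0"
  then have h: "h \<longlonglongrightarrow> 0" "!!i. 0 < h i" by auto
  have "(%i. (LINT x|mu (h i). gw x * F x) / h i + f1 * ((LINT x|mu (h i). sin x) / h i))
    \<longlonglongrightarrow> (\<sigma>\<^sup>2 / 2 * F 0 + (LINT z|\<nu>. gw z * F z)) + f1 * (gam + (LINT z|\<nu>. sin z))"
   by (intro tendsto_intros scaled_law_integral_tendsto[OF h Fc FB] sin_moment_tendsto[OF h])
  moreover have "(LINT x|mu (h i). gw x * F x) / h i + f1 * ((LINT x|mu (h i). sin x) / h i) = (step_op (mu (h i)) f y - f y) / h i" for i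
  proof -
   have hi: "0 <= h i" using h(2)[of i] by simp
   interpret real_distribution "mu (h i)" by (rule law[OF hi])
   have i1: "integrable (mu (h i)) (%x. f (y + x))" by (rule integrable_const_bound[of _ A]) (use A in auto)
   have i2: "integrable (mu (h i)) (%x. sin x)" by (rule integrable_const_bound[of _ 1]) auto
   have "(LINT x|mu (h i). gw x * F x) = (LINT x|mu (h i). f (y + x)) - f y - f1 * (LINT x|mu (h i). sin x)"
    unfolding NF N_def using i1 i2 prob_space by simp
   then show ?thesis by (simp add: step_op_def diff_divide_distrib add_divide_distrib)
  qed
  moreover have "(\<sigma>\<^sup>2 / 2 * F 0 + (LINT z|\<nu>. gw z * F z)) + f1 * (gam + (LINT z|\<nu>. sin z))
   = gam * f1 + \<sigma>\<^sup>2 / 2 * f2 + (LINT z|\<nu>. f (y + z) - f y)"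
   unfolding nuint[symmetric] by (simp add: F_def algebra_simps)
  ultimately show "((%h. (step_op (mu h) f y - f y) / h) \<circ> h) \<longlonglongrightarrow> gam * f1 + \<sigma>\<^sup>2 / 2 * f2 + (LINT z|\<nu>. f (y + z) - f y)"
   unfolding comp_def by simp
 qed
qed

lemma trunc_second_moment:
 assumes h: "0 <= h" shows "(LINT x|mu h. min 1 (x\<^sup>2)) <= 3 * step_const * h"
proof -
 interpret real_distribution "mu h" by (rule law[OF h])
 have "(LINT x|mu h. min 1 (x\<^sup>2)) <= (LINT x|mu h. 3 * gw x)"
 proof (rule integral_mono)
  show "integrable (mu h) (%x. min 1 (x\<^sup>2))" by (rule integrable_const_bound[of _ 1]) auto
  show "integrable (mu h) (%x. 3 * gw x)" by (rule integrable_const_bound[of _ 3]) (use gw_nonneg gw_le_1 in auto)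
 qed (rule gw_ge)
 also have "... = 3 * (LINT x|mu h. gw x)" by simp
 also have "... <= 3 * (step_const * h)" using expectation_gw_le[OF h] by simp
 finally show ?thesis by simp
qed

text \<open>The quantitative version of the same splitting, valid for every \<open>h\<close>. After
  removing \<open>f1 * sin x\<close> the remainder is at most
  \<open>(3 * A + B) * min 1 (x\<^sup>2)\<close>, whose mean is at most
  \<open>3 * step_const * h\<close> times this factor; the \<open>sin\<close> part adds
  \<open>A\<close>, which explains \<open>10 * A + 3 * B\<close>.\<close>

lemma step_bound:
 assumes h: "0 <= h" and f[measurable]: "f \<in> borel_measurable borel" and A: "!!x. \<bar>f x\<bar> <= A" and f1: "\<bar>f1\<bar> <= A"
  and B: "!!x. \<bar>f (y + x) - f y - f1 * x\<bar> <= B * x\<^sup>2"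
 shows "\<bar>step_op (mu h) f y - f y\<bar> <= h * step_const * (10 * A + 3 * B)"
proof -
 interpret real_distribution "mu h" by (rule law[OF h])
 have A0: "0 <= A" using A[of 0] by linarith
 have B0: "0 <= B" using B[of 1] by simp
 have pt: "\<bar>f (y + x) - f y - f1 * sin x\<bar> <= (3 * A + B) * min 1 (x\<^sup>2)" for x
 proof (cases "\<bar>x\<bar> <= 1")
  case True
  have x3: "\<bar>x\<bar> ^ 3 <= x\<^sup>2"
   using True mult_right_mono[OF True, of "x\<^sup>2"] by (simp add: power3_eq_cube power2_eq_square abs_mult_self_eq mult.assoc)
  have "\<bar>x - sin x\<bar> <= x\<^sup>2" using sin_minus_id_bound[of x] x3 zero_le_power2[of x] by linarith
  then have "\<bar>f1 * (x - sin x)\<bar> <= A * x\<^sup>2"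
   unfolding abs_mult using f1 A0 by (intro mult_mono) auto
  moreover have "f (y + x) - f y - f1 * sin x = (f (y + x) - f y - f1 * x) + f1 * (x - sin x)" by (simp add: algebra_simps)
  ultimately have "\<bar>f (y + x) - f y - f1 * sin x\<bar> <= B * x\<^sup>2 + A * x\<^sup>2" using B[of x] by linarith
  also have "... <= (3 * A + B) * x\<^sup>2" using A0 by (simp add: algebra_simps mult_right_mono)
  also have "x\<^sup>2 = min 1 (x\<^sup>2)" using True by (simp add: abs_square_le_1)
  finally show ?thesis .
 next
  case False
  have "\<bar>f1 * sin x\<bar> <= A * 1" unfolding abs_mult using f1 A0 by (intro mult_mono) auto
  then have "\<bar>f (y + x) - f y - f1 * sin x\<bar> <= 3 * A" using A[of "y + x"] A[of y] by linarith
  also have "... <= (3 * A + B) * min 1 (x\<^sup>2)"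
  proof -
   have "\<not> x\<^sup>2 <= 1" using False by (simp add: abs_square_le_1)
   then show ?thesis using B0 by simp
  qed
  finally show ?thesis .
 qed
 have i1: "integrable (mu h) (%x. f (y + x))" by (rule integrable_const_bound[of _ A]) (use A in auto)
 have i2: "integrable (mu h) (%x. sin x)" by (rule integrable_const_bound[of _ 1]) auto
 have "step_op (mu h) f y - f y = (LINT x|mu h. f (y + x) - f y - f1 * sin x) + f1 * (LINT x|mu h. sin x)"
  unfolding step_op_def using i1 i2 prob_space by simp
 moreover have "\<bar>LINT x|mu h. f (y + x) - f y - f1 * sin x\<bar> <= (3 * A + B) * (3 * step_const * h)"
 proof -
  have "\<bar>LINT x|mu h. f (y + x) - f y - f1 * sin x\<bar> <= (LINT x|mu h. \<bar>f (y + x) - f y - f1 * sin x\<bar>)"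
   by (rule integral_abs_bound)
  also have "... <= (LINT x|mu h. (3 * A + B) * min 1 (x\<^sup>2))"
  proof (rule integral_mono)
   show "integrable (mu h) (%x. (3 * A + B) * min 1 (x\<^sup>2))"
    by (intro integrable_mult_right integrable_const_bound[of _ 1]) auto
   show "integrable (mu h) (%x. \<bar>f (y + x) - f y - f1 * sin x\<bar>)" using i1 i2 by simp
  qed (rule pt)
  also have "... = (3 * A + B) * (LINT x|mu h. min 1 (x\<^sup>2))" by simp
  also have "... <= (3 * A + B) * (3 * step_const * h)"
   using trunc_second_moment[OF h] A0 B0 by (intro mult_left_mono) auto
  finally show ?thesis .
 qed
 moreover have "\<bar>f1 * (LINT x|mu h. sin x)\<bar> <= A * (step_const * h)"
  unfolding abs_mult using f1 expectation_sin_le[OF h] A0 by (intro mult_mono) auto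
 moreover have "(3 * A + B) * (3 * step_const * h) + A * (step_const * h) = h * step_const * (10 * A + 3 * B)"
  by (simp add: algebra_simps)
 ultimately show ?thesis by linarith
qed

lemma char_scaled:
 assumes h: "0 <= h"
 shows "char (distr (mu h) borel (%x. x / c)) u = exp (complex_of_real h * \<psi> (u / c))"
proof -
 interpret real_distribution "mu h" by (rule law[OF h])
 have "char (distr (mu h) borel (%x. x / c)) u = (CLINT x|mu h. iexp (u * (x / c)))"
  unfolding char_def by (subst integral_distr) auto
 also have "... = char (mu h) (u / c)" unfolding char_def by (intro Bochner_Integration.integral_cong) auto
 finally show ?thesis unfolding char_law[OF h] .
qed

text \<open>On the Brownian scale the Gaussian part of the exponent is invariant, while the drift is
  of order \<open>sqrt (th i)\<close>. So is the jump part, since finite variation lets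
  \<open>\<integral> iexp - 1\<close> grow only linearly in the frequency.\<close>

lemma scaled_law_weak_conv:
 assumes th: "th \<longlonglongrightarrow> 0" "!!i. 0 < th i" and n: "0 < n"
 shows "weak_conv_m (%i. distr (mu (th i / n)) borel (%x. x / sqrt (th i))) (distr gauss borel (%x. \<sigma> / sqrt n * x))"
proof (rule levy_continuity)
 have t0: "0 <= th i / n" for i using th(2)[of i] n by simp
 show "real_distribution (distr (mu (th i / n)) borel (%x. x / sqrt (th i)))" for i
 proof -
  interpret real_distribution "mu (th i / n)" by (rule law[OF t0])
  show ?thesis by (rule real_distribution_distr) simp
 qed
 show "real_distribution (distr gauss borel (%x. \<sigma> / sqrt n * x))" by (rule gauss.real_distribution_distr) simp
 fix u
 have "char (distr gauss borel (%x. \<sigma> / sqrt n * x)) u = (CLINT x|gauss. iexp (u * (\<sigma> / sqrt n * x)))"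
  unfolding char_def by (subst integral_distr) auto
 also have "... = char gauss (u * (\<sigma> / sqrt n))"
  unfolding char_def by (intro Bochner_Integration.integral_cong) (auto simp: mult.assoc)
 also have "... = exp (complex_of_real (- (\<sigma>\<^sup>2 * u\<^sup>2 / 2) / n))"
  using n unfolding char_std_normal_distribution by (simp add: exp_of_real[symmetric] power_mult_distrib power_divide mult.commute)
 finally have lim: "char (distr gauss borel (%x. \<sigma> / sqrt n * x)) u = exp (complex_of_real (- (\<sigma>\<^sup>2 * u\<^sup>2 / 2) / n))" .
 define J where "J i = complex_of_real (th i) * (CLINT z|\<nu>. iexp (u / sqrt (th i) * z) - 1)" for i
 have sq: "sqrt (th i) * sqrt (th i) = th i" for i using th(2)[of i] by simp
 have st: "(%i. sqrt (th i)) \<longlonglongrightarrow> 0" using tendsto_real_sqrt[OF th(1)] by simp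
 have J: "J \<longlonglongrightarrow> 0"
 proof (rule Lim_null_comparison)
  show "\<forall>\<^sub>F i in sequentially. norm (J i) <= (2 * th i + \<bar>u\<bar> * sqrt (th i)) * nu_mass"
  proof (intro always_eventually allI)
   fix i
   have "norm (J i) = th i * norm (CLINT z|\<nu>. iexp (u / sqrt (th i) * z) - 1)"
    unfolding J_def norm_mult using th(2)[of i] by simp
   also have "... <= th i * ((2 + \<bar>u / sqrt (th i)\<bar>) * nu_mass)"
    using th(2)[of i] by (intro mult_left_mono norm_nu_part) simp
   also have "... = (2 * th i + \<bar>u\<bar> * sqrt (th i)) * nu_mass"
   proof -
    have "th i / sqrt (th i) = sqrt (th i)" using th(2)[of i] by (simp add: real_div_sqrt)
    moreover have "th i * (2 + \<bar>u / sqrt (th i)\<bar>) = 2 * th i + \<bar>u\<bar> * (th i / sqrt (th i))"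
     using th(2)[of i] by (simp add: abs_divide algebra_simps)
    ultimately show ?thesis by (simp add: mult.assoc[symmetric])
   qed
   finally show "norm (J i) <= (2 * th i + \<bar>u\<bar> * sqrt (th i)) * nu_mass" .
  qed
  have "(%i. (2 * th i + \<bar>u\<bar> * sqrt (th i)) * nu_mass) \<longlonglongrightarrow> (2 * 0 + \<bar>u\<bar> * 0) * nu_mass"
   by (intro tendsto_intros th(1) st)
  then show "(%i. (2 * th i + \<bar>u\<bar> * sqrt (th i)) * nu_mass) \<longlonglongrightarrow> 0" by simp
 qed
 have eq: "complex_of_real (th i) * \<psi> (u / sqrt (th i)) = \<i> * complex_of_real (gam * u * sqrt (th i)) - complex_of_real (\<sigma>\<^sup>2 * u\<^sup>2 / 2) + J i" for i
 proof -
  have 1: "th i * (gam * (u / sqrt (th i))) = gam * u * sqrt (th i)"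
   using real_div_sqrt[of "th i"] th(2)[of i] by (simp add: field_simps)
  have 2: "th i * (\<sigma>\<^sup>2 * (u / sqrt (th i))\<^sup>2 / 2) = \<sigma>\<^sup>2 * u\<^sup>2 / 2"
   using th(2)[of i] by (simp add: power_divide)
  have "complex_of_real (th i) * \<psi> (u / sqrt (th i)) = \<i> * complex_of_real (th i * (gam * (u / sqrt (th i)))) - complex_of_real (th i * (\<sigma>\<^sup>2 * (u / sqrt (th i))\<^sup>2 / 2)) + J i"
   unfolding cf_exponent_def J_def by (simp add: algebra_simps)
  then show ?thesis unfolding 1 2 .
 qed
 have "(%i. \<i> * complex_of_real (gam * u * sqrt (th i)) - complex_of_real (\<sigma>\<^sup>2 * u\<^sup>2 / 2) + J i) \<longlonglongrightarrow> \<i> * complex_of_real (gam * u * 0) - complex_of_real (\<sigma>\<^sup>2 * u\<^sup>2 / 2) + 0"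
  by (intro tendsto_intros st J)
 then have "(%i. complex_of_real (th i) * \<psi> (u / sqrt (th i))) \<longlonglongrightarrow> - complex_of_real (\<sigma>\<^sup>2 * u\<^sup>2 / 2)"
  unfolding eq by simp
 then have "(%i. exp (complex_of_real (th i) * \<psi> (u / sqrt (th i)) / complex_of_real n)) \<longlonglongrightarrow> exp (- complex_of_real (\<sigma>\<^sup>2 * u\<^sup>2 / 2) / complex_of_real n)"
  using n by (intro tendsto_intros) auto
 moreover have "exp (complex_of_real (th i) * \<psi> (u / sqrt (th i)) / complex_of_real n) = char (distr (mu (th i / n)) borel (%x. x / sqrt (th i))) u" for i
  unfolding char_scaled[OF t0] by simp
 ultimately show "(%i. char (distr (mu (th i / n)) borel (%x. x / sqrt (th i))) u) \<longlonglongrightarrow> char (distr gauss borel (%x. \<sigma> / sqrt n * x)) u"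
  unfolding lim by simp
qed

end

section \<open>C1 smoothing of the put payoff from above and below\<close>

definition sqp :: "real \<Rightarrow> real" where "sqp t = (max 0 t)\<^sup>2"

lemma sqp_quadratic: "\<bar>sqp (t + x) - sqp t - 2 * max 0 t * x\<bar> <= x\<^sup>2"
proof (cases "0 <= t")
 case t: True
 show ?thesis
 proof (cases "0 <= t + x")
  case True
  have "sqp (t + x) - sqp t - 2 * max 0 t * x = x\<^sup>2"
   using t True by (simp add: sqp_def power2_eq_square algebra_simps)
  then show ?thesis by simp
 next
  case False
  have e: "sqp (t + x) - sqp t - 2 * max 0 t * x = - t\<^sup>2 - 2 * t * x"
   using t False by (simp add: sqp_def)
  have "t * t <= t * (- x)" using t False by (intro mult_left_mono) auto
  then have "t * t <= - (t * x)" by simp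
  then have "0 <= - (t * t) - 2 * (t * x)" using zero_le_square[of t] by linarith
  then have "0 <= - t\<^sup>2 - 2 * t * x" by (simp add: power2_eq_square)
  moreover have "- t\<^sup>2 - 2 * t * x <= x\<^sup>2"
   using zero_le_power2[of "t + x"] by (simp add: power2_eq_square algebra_simps)
  ultimately show ?thesis unfolding e by simp
 qed
next
 case t: False
 have "(max 0 (t + x))\<^sup>2 <= x\<^sup>2"
  using t by (cases "0 <= t + x") (auto simp: power_mono)
 then show ?thesis using t by (simp add: sqp_def)
qed

lemma DERIV_quadratic:
 fixes f :: "real \<Rightarrow> real"
 assumes "!!x. \<bar>f (t + x) - f t - D * x\<bar> <= B * x\<^sup>2"
 shows "(f has_real_derivative D) (at t)"
 unfolding DERIV_def
proof (rule LIM_zero_cancel, rule Lim_null_comparison)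
 show "\<forall>\<^sub>F x in at 0. norm ((f (t + x) - f t) / x - D) <= B * \<bar>x\<bar>"
  unfolding eventually_at_filter
 proof (intro always_eventually allI impI)
  fix x :: real assume x: "x \<noteq> 0"
  have "(f (t + x) - f t) / x - D = (f (t + x) - f t - D * x) / x" using x by (simp add: field_simps)
  then have "norm ((f (t + x) - f t) / x - D) = \<bar>f (t + x) - f t - D * x\<bar> / \<bar>x\<bar>" by (simp add: abs_divide)
  also have "... <= B * x\<^sup>2 / \<bar>x\<bar>" using assms by (intro divide_right_mono) auto
  also have "B * x\<^sup>2 / \<bar>x\<bar> = B * \<bar>x\<bar>"
   using x by (simp add: power2_eq_square abs_if)
  finally show "norm ((f (t + x) - f t) / x - D) <= B * \<bar>x\<bar>" .
 qed
 show "((%x. B * \<bar>x\<bar>) \<longlongrightarrow> 0) (at 0)"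
  using tendsto_mult_right_zero[OF tendsto_rabs_zero[OF tendsto_ident_at[of "0::real" UNIV]], of B] by simp
qed

lemma sqp_DERIV: "(sqp has_real_derivative 2 * max 0 t) (at t)"
 by (rule DERIV_quadratic[where B=1]) (use sqp_quadratic in simp)

lemma quadratic_bound_of_DERIV:
 fixes f f' :: "real \<Rightarrow> real"
 assumes D: "!!t. (f has_real_derivative f' t) (at t)" and L: "!!s t. \<bar>f' s - f' t\<bar> <= L * \<bar>s - t\<bar>"
 shows "\<bar>f (y + x) - f y - f' y * x\<bar> <= L * x\<^sup>2"
proof (cases "x = 0")
 case False
 have L0: "0 <= L" using L[of 0 1] abs_ge_zero[of "f' 0 - f' 1"] by simp
 obtain z where z: "\<bar>z - y\<bar> <= \<bar>x\<bar>" "f (y + x) - f y = x * f' z"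
 proof (cases "0 < x")
  case True
  then obtain z where "y < z" "z < y + x" "f (y + x) - f y = (y + x - y) * f' z"
   using MVT2[of y "y + x" f f'] D by auto
  then show ?thesis using that[of z] by auto
 next
  case F: False
  then have "y + x < y" using False by simp
  then obtain z where "y + x < z" "z < y" "f y - f (y + x) = (y - (y + x)) * f' z"
   using MVT2[of "y + x" y f f'] D by auto
  then show ?thesis using that[of z] by auto
 qed
 have "f (y + x) - f y - f' y * x = x * (f' z - f' y)" using z(2) by (simp add: algebra_simps)
 then have "\<bar>f (y + x) - f y - f' y * x\<bar> = \<bar>x\<bar> * \<bar>f' z - f' y\<bar>" by (simp add: abs_mult)
 also have "... <= \<bar>x\<bar> * (L * \<bar>x\<bar>)"
  using L[of z y] z(1) L0 by (intro mult_left_mono order_trans[OF L] mult_left_mono) auto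
 also have "... = L * x\<^sup>2" by (simp add: power2_eq_square abs_mult_self_eq algebra_simps)
 finally show ?thesis .
qed simp

lemma Lipschitz_of_DERIV:
 fixes f f' :: "real \<Rightarrow> real"
 assumes D: "!!t. (f has_real_derivative f' t) (at t)" and B: "!!t. \<bar>f' t\<bar> <= B"
 shows "\<bar>f x - f y\<bar> <= B * \<bar>x - y\<bar>"
 using field_differentiable_bound[of UNIV f f' B x y] D B by auto

text \<open>For \<open>c = 0\<close> (resp. \<open>c = 1\<close>) the function \<open>nps c eta\<close> is a C1 majorant (resp. minorant) of the
 negative part \<open>max 0 (- u)\<close>, equal to it for \<open>\<bar>u\<bar> \<ge> eta\<close>.\<close>

definition nps :: "real \<Rightarrow> real \<Rightarrow> real \<Rightarrow> real" where
 "nps c eta u = (sqp (eta - u) - sqp (- eta - u)) / (4 * eta) - c * (eta / 4) * sqp (1 - (u / eta)\<^sup>2)"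

definition nps' :: "real \<Rightarrow> real \<Rightarrow> real \<Rightarrow> real" where
 "nps' c eta u = (max 0 (- eta - u) - max 0 (eta - u)) / (2 * eta) + c * (u / eta) * max 0 (1 - (u / eta)\<^sup>2)"

lemma nps_DERIV:
 assumes "0 < eta"
 shows "(nps c eta has_real_derivative nps' c eta u) (at u)"
proof -
 have 1: "((%u. sqp (eta - u)) has_real_derivative (2 * max 0 (eta - u)) * (- 1)) (at u)"
  by (rule DERIV_chain2[OF sqp_DERIV]) (auto intro!: derivative_eq_intros)
 have 2: "((%u. sqp (- eta - u)) has_real_derivative (2 * max 0 (- eta - u)) * (- 1)) (at u)"
  by (rule DERIV_chain2[OF sqp_DERIV]) (auto intro!: derivative_eq_intros)
 have 3: "((%u. sqp (1 - (u / eta)\<^sup>2)) has_real_derivative (2 * max 0 (1 - (u / eta)\<^sup>2)) * (- 2 * (u / eta) / eta)) (at u)"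
 proof (rule DERIV_chain2[OF sqp_DERIV])
  have "((%u. u / eta) has_real_derivative 1 / eta) (at u)" by (rule DERIV_cdivide[OF DERIV_ident])
  from DERIV_diff[OF DERIV_const[of 1] DERIV_power[OF this, of 2]]
  show "((%u. 1 - (u / eta)\<^sup>2) has_real_derivative - 2 * (u / eta) / eta) (at u)" by simp
 qed
 have "(nps c eta has_real_derivative ((2 * max 0 (eta - u)) * (- 1) - (2 * max 0 (- eta - u)) * (- 1)) / (4 * eta)
   - c * (eta / 4) * ((2 * max 0 (1 - (u / eta)\<^sup>2)) * (- 2 * (u / eta) / eta))) (at u)"
  unfolding nps_def[abs_def] by (intro DERIV_diff DERIV_cdivide DERIV_cmult 1 2 3)
 moreover have "((2 * max 0 (eta - u)) * (- 1) - (2 * max 0 (- eta - u)) * (- 1)) / (4 * eta)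
   - c * (eta / 4) * ((2 * max 0 (1 - (u / eta)\<^sup>2)) * (- 2 * (u / eta) / eta)) = nps' c eta u"
  using assms unfolding nps'_def by (simp add: field_simps)
 ultimately show ?thesis by simp
qed

text \<open>After clamping to \<open>[-1, 1]\<close> the function is \<open>p - p ^ 3\<close>, with
  difference quotient \<open>1 - (p\<^sup>2 + p * q + q\<^sup>2)\<close>; the quadratic form lies
  between 0 and 3.\<close>

lemma cubic_clamp_Lipschitz:
 "\<bar>x * max 0 (1 - x\<^sup>2) - y * max 0 (1 - y\<^sup>2)\<bar> <= 2 * \<bar>x - y\<bar>" for x y :: real
proof -
 define p q where "p = max (-1) (min 1 x)" and "q = max (-1) (min 1 y)"
 have e: "x * max 0 (1 - x\<^sup>2) = p - p ^ 3" if p: "p = max (-1) (min 1 x)" for x p :: real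
 proof (cases "\<bar>x\<bar> <= 1")
  case True
  then have "p = x" "x\<^sup>2 <= 1" using p by (auto simp: abs_square_le_1)
  then show ?thesis by (simp add: power3_eq_cube power2_eq_square algebra_simps)
 next
  case False
  then have "\<not> x\<^sup>2 <= 1" by (simp add: abs_square_le_1)
  moreover have "p = 1 \<or> p = -1" using False p by (auto simp: abs_if min_def max_def split: if_splits)
  ultimately show ?thesis by auto
 qed
 have b: "\<bar>p\<bar> <= 1" "\<bar>q\<bar> <= 1" "\<bar>p - q\<bar> <= \<bar>x - y\<bar>" unfolding p_def q_def by auto
 have "(p - p ^ 3) - (q - q ^ 3) = (p - q) * (1 - (p\<^sup>2 + p * q + q\<^sup>2))"
  by (simp add: power3_eq_cube power2_eq_square algebra_simps)
 then have "\<bar>(p - p ^ 3) - (q - q ^ 3)\<bar> = \<bar>p - q\<bar> * \<bar>1 - (p\<^sup>2 + p * q + q\<^sup>2)\<bar>" by (simp add: abs_mult)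
 also have "... <= \<bar>x - y\<bar> * 2"
 proof (intro mult_mono b)
  have "p\<^sup>2 <= 1" "q\<^sup>2 <= 1" using b by (auto simp: abs_square_le_1)
  moreover have "\<bar>p * q\<bar> <= 1" using b unfolding abs_mult by (simp add: mult_le_one)
  moreover have "0 <= p\<^sup>2 + p * q + q\<^sup>2"
  proof -
   have "p\<^sup>2 + p * q + q\<^sup>2 = (p + q / 2)\<^sup>2 + 3 / 4 * q\<^sup>2" by (simp add: power2_eq_square algebra_simps)
   then show ?thesis by simp
  qed
  ultimately show "\<bar>1 - (p\<^sup>2 + p * q + q\<^sup>2)\<bar> <= 2" by linarith
 qed auto
 finally show ?thesis using e[OF p_def] e[OF q_def] by simp
qed

lemma nps'_Lipschitz:
 assumes eta: "0 < eta" and c: "0 <= c" "c <= 1"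
 shows "\<bar>nps' c eta u - nps' c eta v\<bar> <= 3 / eta * \<bar>u - v\<bar>"
proof -
 have m: "\<bar>max 0 p - max 0 q\<bar> <= \<bar>p - q\<bar>" for p q :: real by linarith
 have 1: "\<bar>(max 0 (- eta - u) - max 0 (eta - u)) - (max 0 (- eta - v) - max 0 (eta - v))\<bar> <= 2 * \<bar>u - v\<bar>"
 proof -
  have tri: "\<bar>(a - b) - (a' - b')\<bar> <= 2 * w" if "\<bar>a - a'\<bar> <= w" "\<bar>b - b'\<bar> <= w" for a b a' b' w :: real
   using that by linarith
  show ?thesis
   by (rule tri) (rule order_trans[OF m], simp add: abs_minus_commute)+
 qed
 have "\<bar>(max 0 (- eta - u) - max 0 (eta - u)) / (2 * eta) - (max 0 (- eta - v) - max 0 (eta - v)) / (2 * eta)\<bar>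
   = \<bar>(max 0 (- eta - u) - max 0 (eta - u)) - (max 0 (- eta - v) - max 0 (eta - v))\<bar> / (2 * eta)"
  using eta by (simp add: diff_divide_distrib[symmetric] abs_divide)
 also have "... <= 2 * \<bar>u - v\<bar> / (2 * eta)" using 1 eta by (intro divide_right_mono) auto
 finally have A: "\<bar>(max 0 (- eta - u) - max 0 (eta - u)) / (2 * eta) - (max 0 (- eta - v) - max 0 (eta - v)) / (2 * eta)\<bar> <= \<bar>u - v\<bar> / eta" by simp
 define P Q where "P = (u / eta) * max 0 (1 - (u / eta)\<^sup>2)" and "Q = (v / eta) * max 0 (1 - (v / eta)\<^sup>2)"
 have "\<bar>P - Q\<bar> <= 2 * \<bar>u / eta - v / eta\<bar>"
  unfolding P_def Q_def by (rule cubic_clamp_Lipschitz)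
 also have "... = 2 * (\<bar>u - v\<bar> / eta)" using eta by (simp add: diff_divide_distrib[symmetric] abs_divide)
 finally have "c * \<bar>P - Q\<bar> <= 1 * (2 * (\<bar>u - v\<bar> / eta))"
  using c by (intro mult_mono) auto
 moreover have "\<bar>c * P - c * Q\<bar> = c * \<bar>P - Q\<bar>"
  using c(1) by (simp add: abs_mult flip: right_diff_distrib)
 ultimately have B: "\<bar>c * P - c * Q\<bar> <= 2 * (\<bar>u - v\<bar> / eta)" by linarith
 define P' Q' where "P' = (max 0 (- eta - u) - max 0 (eta - u)) / (2 * eta)" and "Q' = (max 0 (- eta - v) - max 0 (eta - v)) / (2 * eta)"
 have "nps' c eta u = P' + c * P" "nps' c eta v = Q' + c * Q"
  unfolding nps'_def P_def Q_def P'_def Q'_def mult.assoc by (rule refl)+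
 moreover have "3 / eta * \<bar>u - v\<bar> = \<bar>u - v\<bar> / eta + 2 * (\<bar>u - v\<bar> / eta)" by simp
 moreover have "\<bar>P' - Q'\<bar> <= \<bar>u - v\<bar> / eta" using A unfolding P'_def Q'_def .
 ultimately show ?thesis using B by linarith
qed

lemma nps'_bound:
 assumes eta: "0 < eta" and c: "0 <= c" "c <= 1"
 shows "\<bar>nps' c eta u\<bar> <= 2"
proof -
 have 1: "\<bar>max 0 (- eta - u) - max 0 (eta - u)\<bar> <= 2 * eta" using eta by linarith
 then have A: "\<bar>(max 0 (- eta - u) - max 0 (eta - u)) / (2 * eta)\<bar> <= 1" using eta by (simp add: abs_divide)
 have B: "\<bar>(u / eta) * max 0 (1 - (u / eta)\<^sup>2)\<bar> <= 1"
 proof (cases "\<bar>u / eta\<bar> <= 1")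
  case True
  have "\<bar>max 0 (1 - (u / eta)\<^sup>2)\<bar> <= 1" by simp
  then show ?thesis unfolding abs_mult by (intro mult_le_one True) auto
 next
  case False
  then have "\<not> (u / eta)\<^sup>2 <= 1" by (subst abs_square_le_1)
  then show ?thesis by simp
 qed
 have "\<bar>c * ((u / eta) * max 0 (1 - (u / eta)\<^sup>2))\<bar> <= 1 * 1"
  unfolding abs_mult[of c] using B c by (intro mult_mono) auto
 with A show ?thesis unfolding nps'_def by (simp only: mult.assoc) linarith
qed

lemma nps_eq:
 assumes eta: "0 < eta" and u: "eta <= \<bar>u\<bar>"
 shows "nps c eta u = max 0 (- u)"
proof -
 have "1 <= \<bar>u / eta\<bar>" using u eta by (simp add: abs_divide)
 then have "1 <= (u / eta)\<^sup>2" by (metis one_le_power power2_abs)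
 then have b: "sqp (1 - (u / eta)\<^sup>2) = 0" by (simp add: sqp_def)
 show ?thesis
 proof (cases "0 <= u")
  case True
  then have "sqp (eta - u) = 0" "sqp (- eta - u) = 0" using u eta by (auto simp: sqp_def)
  then show ?thesis using b True by (simp add: nps_def)
 next
  case False
  then have "sqp (eta - u) = (eta - u)\<^sup>2" "sqp (- eta - u) = (- eta - u)\<^sup>2" using u eta by (auto simp: sqp_def)
  then have "sqp (eta - u) - sqp (- eta - u) = 4 * eta * (- u)" by (simp add: power2_eq_square algebra_simps)
  then have "nps c eta u = 4 * eta * (- u) / (4 * eta)" using b by (simp add: nps_def)
  also have "... = - u" using eta by simp
  finally show ?thesis using False by simp
 qed
qed

lemma nps_0_eq:
 assumes eta: "0 < eta" and u: "\<bar>u\<bar> <= eta"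
 shows "nps 0 eta u = (eta - u)\<^sup>2 / (4 * eta)"
 using assms by (auto simp: nps_def sqp_def)

lemma nps_0_minus:
 assumes eta: "0 < eta" and u: "\<bar>u\<bar> <= eta"
 shows "nps 0 eta u - max 0 (- u) = (eta - \<bar>u\<bar>)\<^sup>2 / (4 * eta)"
proof (cases "0 <= u")
 case True then show ?thesis using nps_0_eq[OF assms] by simp
next
 case False
 have "(eta - u)\<^sup>2 / (4 * eta) - (- u) = ((eta - u)\<^sup>2 - 4 * eta * (- u)) / (4 * eta)"
  using eta by (simp add: field_simps)
 also have "(eta - u)\<^sup>2 - 4 * eta * (- u) = (eta + u)\<^sup>2" by (simp add: power2_eq_square algebra_simps)
 finally show ?thesis using nps_0_eq[OF assms] False by simp
qed

text \<open>For \<open>c = 0\<close> the formula is the moving average of the negative part over a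
  window of half-width \<open>eta\<close>. By convexity it lies above, and the excess is largest at
  the kink, where it equals \<open>eta / 4\<close>.\<close>

lemma nps_upper:
 assumes eta: "0 < eta" shows "max 0 (- u) <= nps 0 eta u" "nps 0 eta u <= max 0 (- u) + eta / 4"
proof -
 have "0 <= nps 0 eta u - max 0 (- u) \<and> nps 0 eta u - max 0 (- u) <= eta / 4"
 proof (cases "\<bar>u\<bar> <= eta")
  case True
  have "(eta - \<bar>u\<bar>)\<^sup>2 <= eta\<^sup>2" using True by (intro power_mono) auto
  then have "(eta - \<bar>u\<bar>)\<^sup>2 / (4 * eta) <= eta\<^sup>2 / (4 * eta)" using eta by (intro divide_right_mono) auto
  also have "eta\<^sup>2 / (4 * eta) = eta / 4" by (simp add: power2_eq_square)
  finally show ?thesis unfolding nps_0_minus[OF eta True] using eta by simp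
 next
  case False then show ?thesis using nps_eq[OF eta, of u 0] eta by simp
 qed
 then show "max 0 (- u) <= nps 0 eta u" "nps 0 eta u <= max 0 (- u) + eta / 4" by auto
qed

text \<open>The bump subtracted for \<open>c = 1\<close> has height \<open>eta / 4\<close>, the
  largest excess of the average. With \<open>v = \<bar>u\<bar> / eta\<close> it dominates the excess
  everywhere, because
  \<open>(1 - v\<^sup>2)\<^sup>2 = (1 - v)\<^sup>2 * (1 + v)\<^sup>2\<close>.\<close>

lemma nps_lower:
 assumes eta: "0 < eta" shows "nps 1 eta u <= max 0 (- u)" "max 0 (- u) - eta / 4 <= nps 1 eta u"
proof -
 have rel: "nps 1 eta u = nps 0 eta u - eta / 4 * sqp (1 - (u / eta)\<^sup>2)" by (simp add: nps_def)
 have "sqp (1 - (u / eta)\<^sup>2) <= 1"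
 proof -
  have "(max 0 (1 - (u / eta)\<^sup>2))\<^sup>2 <= 1\<^sup>2" by (intro power_mono) auto
  then show ?thesis by (simp add: sqp_def)
 qed
 then have "eta / 4 * sqp (1 - (u / eta)\<^sup>2) <= eta / 4 * 1" using eta by (intro mult_left_mono) auto
 then show "max 0 (- u) - eta / 4 <= nps 1 eta u" using nps_upper(1)[OF eta, of u] unfolding rel by linarith
 show "nps 1 eta u <= max 0 (- u)"
 proof (cases "\<bar>u\<bar> <= eta")
  case True
  define v where "v = \<bar>u\<bar> / eta"
  have v: "0 <= v" "v <= 1" using True eta by (auto simp: v_def)
  have v2: "v\<^sup>2 <= 1" using v by (simp add: power_le_one)
  have "sqp (1 - (u / eta)\<^sup>2) = (1 - v\<^sup>2)\<^sup>2" using v2 by (simp add: sqp_def v_def power_divide)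
  also have "... = (1 - v)\<^sup>2 * (1 + v)\<^sup>2" by (simp add: power2_eq_square algebra_simps)
  finally have s: "sqp (1 - (u / eta)\<^sup>2) = (1 - v)\<^sup>2 * (1 + v)\<^sup>2" .
  have "(eta - \<bar>u\<bar>)\<^sup>2 / (4 * eta) = eta / 4 * (1 - v)\<^sup>2"
  proof -
   have "eta - \<bar>u\<bar> = eta * (1 - v)" using eta by (simp add: v_def field_simps)
   then show ?thesis using eta by (simp add: power_mult_distrib power2_eq_square)
  qed
  moreover have "eta / 4 * ((1 - v)\<^sup>2 * 1) <= eta / 4 * ((1 - v)\<^sup>2 * (1 + v)\<^sup>2)"
   using eta v by (intro mult_left_mono one_le_power) auto
  ultimately show ?thesis using nps_0_minus[OF eta True] rel s by simp
 next
  case False then show ?thesis using nps_eq[OF eta, of u 1] by simp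
 qed
qed

definition put_payoff :: "real \<Rightarrow> real \<Rightarrow> real" where
 "put_payoff K y = max 0 (K - exp y)"

text \<open>In log-price the put is \<open>K * (1 - exp (- max 0 (ln K - y)))\<close>, so smoothing
  the negative part in the exponent removes the only kink. Monotonicity of the outer function
  preserves majorant and minorant, and exactness off the window is inherited.\<close>

definition smooth_put :: "real \<Rightarrow> real \<Rightarrow> real \<Rightarrow> real \<Rightarrow> real" where
 "smooth_put K c eta y = K * (1 - exp (- nps c eta (y - ln K)))"

definition smooth_put' :: "real \<Rightarrow> real \<Rightarrow> real \<Rightarrow> real \<Rightarrow> real" where
 "smooth_put' K c eta y = K * (exp (- nps c eta (y - ln K)) * nps' c eta (y - ln K))"

lemma put_payoff_eq:
 assumes K: "0 < K" shows "put_payoff K y = K * (1 - exp (- max 0 (- (y - ln K))))"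
proof (cases "y <= ln K")
 case True
 then have "exp y <= K" using K by (metis exp_le_cancel_iff exp_ln)
 moreover have "K * exp (y - ln K) = exp y" using K by (simp add: exp_diff)
 ultimately show ?thesis using True by (simp add: put_payoff_def right_diff_distrib)
next
 case False
 then have "K <= exp y" using K by (metis exp_le_cancel_iff exp_ln linorder_le_cases)
 then show ?thesis using False by (simp add: put_payoff_def)
qed

context
 fixes K c eta :: real
 assumes K: "0 < K" and eta: "0 < eta" "eta <= 1" and c: "c = 0 \<or> c = 1"
begin

lemma nps_near: "\<bar>nps c eta u - max 0 (- u)\<bar> <= eta / 4"
proof -
 have "\<bar>nps 0 eta u - max 0 (- u)\<bar> <= eta / 4" "\<bar>nps 1 eta u - max 0 (- u)\<bar> <= eta / 4"
  using nps_upper[OF eta(1), of u] nps_lower[OF eta(1), of u] by linarith+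
 with c show ?thesis by (elim disjE) (simp_all only:)
qed

lemma nps_ge: "- 1 <= nps c eta u"
 using nps_near[of u] eta by linarith

lemma exp_nps_le: "exp (- nps c eta u) <= 3"
proof -
 have "exp (- nps c eta u) <= exp 1" using nps_ge[of u] by simp
 then show ?thesis using exp_le by linarith
qed

lemma smooth_put_eq: "eta <= \<bar>y - ln K\<bar> ==> smooth_put K c eta y = put_payoff K y"
 unfolding smooth_put_def put_payoff_eq[OF K] by (simp add: nps_eq[OF eta(1)])

lemma smooth_put_near: "\<bar>smooth_put K c eta y - put_payoff K y\<bar> <= K * eta"
proof -
 let ?u = "y - ln K"
 have "\<bar>exp (- nps c eta ?u) - exp (- max 0 (- ?u))\<bar> <= 3 * \<bar>- nps c eta ?u - (- max 0 (- ?u))\<bar>"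
 proof -
  have "norm (exp (- nps c eta ?u) - exp (- max 0 (- ?u))) <= 3 * norm (- nps c eta ?u - (- max 0 (- ?u)))"
  proof (rule field_differentiable_bound[where S="{..1::real}" and f'="exp"])
   show "norm (exp z) <= 3" if "z \<in> {..1}" for z :: real
   proof -
    have "exp z <= 3" by (rule order_trans[OF _ exp_le]) (use that in simp)
    then show ?thesis by simp
   qed
   show "(exp has_field_derivative exp z) (at z within {..1::real})" for z :: real
    by (auto intro!: derivative_eq_intros)
  qed (use nps_ge in auto)
  then show ?thesis by simp
 qed
 also have "... <= 3 * (eta / 4)" using nps_near[of ?u] by (simp add: abs_minus_commute)
 also have "... <= eta" using eta by simp
 finally have b: "\<bar>exp (- nps c eta ?u) - exp (- max 0 (- ?u))\<bar> <= eta" .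
 have "smooth_put K c eta y - put_payoff K y = - (K * (exp (- nps c eta ?u) - exp (- max 0 (- ?u))))"
  unfolding smooth_put_def put_payoff_eq[OF K] by (simp add: algebra_simps)
 then have "\<bar>smooth_put K c eta y - put_payoff K y\<bar> = K * \<bar>exp (- nps c eta ?u) - exp (- max 0 (- ?u))\<bar>"
  using K by (simp add: abs_mult)
 then show ?thesis using b K by simp
qed

lemma smooth_put_DERIV: "(smooth_put K c eta has_real_derivative smooth_put' K c eta y) (at y)"
proof -
 have 1: "((%y. nps c eta (y - ln K)) has_real_derivative nps' c eta (y - ln K) * 1) (at y)"
  by (rule DERIV_chain2[OF nps_DERIV[OF eta(1)]]) (auto intro!: derivative_eq_intros)
 have "(smooth_put K c eta has_real_derivative K * (0 - exp (- nps c eta (y - ln K)) * (- (nps' c eta (y - ln K) * 1)))) (at y)"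
  unfolding smooth_put_def[abs_def] by (intro DERIV_cmult DERIV_diff DERIV_const DERIV_fun_exp DERIV_minus 1)
 then show ?thesis by (simp add: smooth_put'_def)
qed

lemma c01: "0 <= c" "c <= 1" using c by auto

lemma smooth_put'_bound: "\<bar>smooth_put' K c eta y\<bar> <= 6 * K"
proof -
 have "exp (- nps c eta (y - ln K)) * \<bar>nps' c eta (y - ln K)\<bar> <= 3 * 2"
  using exp_nps_le nps'_bound[OF eta(1) c01] by (intro mult_mono) auto
 then show ?thesis using K unfolding smooth_put'_def by (simp add: abs_mult)
qed

lemma smooth_put_Lipschitz: "\<bar>smooth_put K c eta x - smooth_put K c eta y\<bar> <= 6 * K * \<bar>x - y\<bar>"
 by (rule Lipschitz_of_DERIV[OF smooth_put_DERIV smooth_put'_bound])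

lemma smooth_put_bound: "\<bar>smooth_put K c eta y\<bar> <= 6 * K"
proof -
 have "\<bar>1 - exp (- nps c eta (y - ln K))\<bar> <= 6" using exp_nps_le[of "y - ln K"] exp_gt_zero[of "- nps c eta (y - ln K)"] by linarith
 then show ?thesis using K unfolding smooth_put_def by (simp add: abs_mult)
qed

text \<open>The price of smoothing: curvature of order \<open>1 / eta\<close>. By the product rule
  the derivative has Lipschitz constant at most \<open>K * (6 * 2 + 3 * 3 / eta)\<close>, from the
  bounds 3 and 6 for the exponential and its slope, and 2 and \<open>3 / eta\<close> for
  \<open>nps'\<close>.\<close>

lemma smooth_put_quadratic:
 "\<bar>smooth_put K c eta (y + x) - smooth_put K c eta y - smooth_put' K c eta y * x\<bar> <= 21 * K / eta * x\<^sup>2"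
proof (rule quadratic_bound_of_DERIV[OF smooth_put_DERIV])
 fix s t
 let ?m = "%s. exp (- nps c eta (s - ln K))" and ?p = "%s. nps' c eta (s - ln K)"
 have Dm: "(?m has_real_derivative ?m y * (- (?p y * 1))) (at y)" for y
  by (intro DERIV_fun_exp DERIV_minus DERIV_chain2[OF nps_DERIV[OF eta(1)]]) (auto intro!: derivative_eq_intros)
 have "\<bar>?m y * (- (?p y * 1))\<bar> <= 6" for y
 proof -
  have "?m y * \<bar>?p y\<bar> <= 3 * 2"
   using exp_nps_le nps'_bound[OF eta(1) c01] by (intro mult_mono) auto
  then show ?thesis by (simp add: abs_mult)
 qed
 from Lipschitz_of_DERIV[OF Dm this] have m: "\<bar>?m s - ?m t\<bar> <= 6 * \<bar>s - t\<bar>" .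
 have p: "\<bar>?p s - ?p t\<bar> <= 3 / eta * \<bar>s - t\<bar>" using nps'_Lipschitz[OF eta(1) c01, of "s - ln K" "t - ln K"] by simp
 have "?m s * ?p s - ?m t * ?p t = (?m s - ?m t) * ?p s + ?m t * (?p s - ?p t)" by (simp add: algebra_simps)
 then have "\<bar>?m s * ?p s - ?m t * ?p t\<bar> <= \<bar>?m s - ?m t\<bar> * \<bar>?p s\<bar> + ?m t * \<bar>?p s - ?p t\<bar>"
  using abs_triangle_ineq[of "(?m s - ?m t) * ?p s" "?m t * (?p s - ?p t)"] by (simp add: abs_mult)
 also have "... <= 6 * \<bar>s - t\<bar> * 2 + 3 * (3 / eta * \<bar>s - t\<bar>)"
  using m p nps'_bound[OF eta(1) c01] exp_nps_le eta by (intro add_mono mult_mono) auto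
 also have "... <= 12 * (\<bar>s - t\<bar> / eta) + 9 * (\<bar>s - t\<bar> / eta)"
 proof -
  have "\<bar>s - t\<bar> * 1 <= \<bar>s - t\<bar> * (1 / eta)" using eta by (intro mult_left_mono) auto
  then show ?thesis by simp
 qed
 also have "... = 21 * (\<bar>s - t\<bar> / eta)" by simp
 finally have "K * \<bar>?m s * ?p s - ?m t * ?p t\<bar> <= K * (21 * (\<bar>s - t\<bar> / eta))" using K by (intro mult_left_mono) auto
 moreover have "\<bar>smooth_put' K c eta s - smooth_put' K c eta t\<bar> = K * \<bar>?m s * ?p s - ?m t * ?p t\<bar>"
  unfolding smooth_put'_def right_diff_distrib[symmetric] using K by (simp add: abs_mult)
 ultimately show "\<bar>smooth_put' K c eta s - smooth_put' K c eta t\<bar> <= 21 * K / eta * \<bar>s - t\<bar>"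
  by (simp add: algebra_simps)
qed

lemma smooth_put_isCont: "isCont (smooth_put K c eta) x"
 using smooth_put_DERIV DERIV_isCont by blast

lemma smooth_put_measurable[measurable]: "smooth_put K c eta \<in> borel_measurable borel"
 by (intro borel_measurable_continuous_onI continuous_at_imp_continuous_on) (auto simp: smooth_put_isCont)

end

lemma smooth_put_upper: "0 < K ==> 0 < eta ==> put_payoff K y <= smooth_put K 0 eta y"
 unfolding smooth_put_def put_payoff_eq using nps_upper(1)[of eta "y - ln K"] by simp

lemma smooth_put_lower: "0 < K ==> 0 < eta ==> smooth_put K 1 eta y <= put_payoff K y"
 unfolding smooth_put_def put_payoff_eq using nps_lower(1)[of eta "y - ln K"] by simp

section \<open>Generator of the log-price on the smoothed payoff\<close>

lemma exp_second_order: "\<exists>t. \<bar>t\<bar> <= \<bar>x\<bar> \<and> exp x - 1 - x = exp t / 2 * x\<^sup>2" for x :: real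
proof -
 obtain t where t: "\<bar>t\<bar> <= \<bar>x\<bar>" "exp x = (\<Sum>m<2. x ^ m / fact m) + exp t / fact 2 * x ^ 2"
  using Maclaurin_exp_le[of x 2] by blast
 have "(\<Sum>m<2. x ^ m / fact m) = 1 + x" by (simp add: eval_nat_numeral)
 with t show ?thesis by (intro exI[of _ t]) simp
qed

lemma exp_quadratic: "\<bar>exp x - 1 - x\<bar> <= 2 * x\<^sup>2" if "\<bar>x\<bar> <= 1" for x :: real
proof -
 obtain t where t: "\<bar>t\<bar> <= \<bar>x\<bar>" "exp x - 1 - x = exp t / 2 * x\<^sup>2" using exp_second_order by blast
 have "exp t <= 3" by (rule order_trans[OF _ exp_le]) (use t(1) that in simp)
 then have "exp t / 2 * x\<^sup>2 <= 2 * x\<^sup>2" by (intro mult_right_mono) auto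
 then show ?thesis unfolding t(2) by (simp add: abs_mult)
qed

lemma exp_quotient_tendsto: "((%x. (exp x - 1 - x) / x\<^sup>2) \<longlongrightarrow> (1 / 2 :: real)) (at 0)"
proof (rule tendsto_sandwich)
 have b: "exp (- \<bar>x\<bar>) / 2 <= (exp x - 1 - x) / x\<^sup>2 \<and> (exp x - 1 - x) / x\<^sup>2 <= exp \<bar>x\<bar> / 2" if "x \<noteq> 0" for x :: real
 proof -
  obtain t where t: "\<bar>t\<bar> <= \<bar>x\<bar>" "exp x - 1 - x = exp t / 2 * x\<^sup>2" using exp_second_order by blast
  have "(exp x - 1 - x) / x\<^sup>2 = exp t / 2" unfolding t(2) using that by simp
  moreover have "- \<bar>x\<bar> <= t" "t <= \<bar>x\<bar>" using t(1) by auto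
  ultimately show ?thesis by simp
 qed
 show "\<forall>\<^sub>F x in at 0. exp (- \<bar>x\<bar>) / 2 <= (exp x - 1 - x) / (x::real)\<^sup>2"
  using b by (auto simp: eventually_at_filter)
 show "\<forall>\<^sub>F x in at 0. (exp x - 1 - x) / (x::real)\<^sup>2 <= exp \<bar>x\<bar> / 2"
  using b by (auto simp: eventually_at_filter)
 have "((%x::real. exp (- \<bar>x\<bar>) / 2) \<longlongrightarrow> exp (- \<bar>0\<bar>) / 2) (at 0)" by (intro tendsto_intros) auto
 then show "((%x::real. exp (- \<bar>x\<bar>) / 2) \<longlongrightarrow> 1 / 2) (at 0)" by simp
 have "((%x::real. exp \<bar>x\<bar> / 2) \<longlongrightarrow> exp \<bar>0\<bar> / 2) (at 0)" by (intro tendsto_intros) auto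
 then show "((%x::real. exp \<bar>x\<bar> / 2) \<longlongrightarrow> 1 / 2) (at 0)" by simp
qed

text \<open>Pointwise convergence on a finite net of mesh \<open>e / (2 * C)\<close> controls the
  whole interval, since the Lipschitz constant does not depend on \<open>h\<close>.\<close>

lemma uniform_limit_equi_Lipschitz:
 fixes F :: "real \<Rightarrow> real \<Rightarrow> real"
 assumes lim: "!!y. y \<in> {a..b} ==> ((%h. F h y) \<longlongrightarrow> 0) (at_right 0)"
  and Lip: "!!h y y'. 0 < h ==> y \<in> {a..b} ==> y' \<in> {a..b} ==> \<bar>F h y - F h y'\<bar> <= C * \<bar>y - y'\<bar>"
  and C: "0 < C" and e: "0 < e"
 shows "\<forall>\<^sub>F h in at_right 0. \<forall>y\<in>{a..b}. \<bar>F h y\<bar> <= e"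
proof -
 have "{a..b} \<subseteq> (\<Union>t\<in>{a..b}. ball t (e / (2 * C)))" using e C by force
 then obtain T where T: "T \<subseteq> {a..b}" "finite T" "{a..b} \<subseteq> (\<Union>t\<in>T. ball t (e / (2 * C)))"
  using compactE_image[OF compact_Icc[of a b], of "{a..b}" "%t. ball t (e / (2 * C))"] by auto
 have "\<forall>\<^sub>F h in at_right 0. \<forall>t\<in>T. \<bar>F h t\<bar> < e / 2"
  using T(2)
 proof (rule eventually_ball_finite, intro ballI)
  fix t assume "t \<in> T"
  then have "((%h. F h t) \<longlongrightarrow> 0) (at_right 0)" using T(1) lim by blast
  from tendstoD[OF this, of "e / 2"] e show "\<forall>\<^sub>F h in at_right 0. \<bar>F h t\<bar> < e / 2"
   by (simp add: dist_real_def)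
 qed
 moreover have "\<forall>\<^sub>F h in at_right 0. (0::real) < h" by (auto simp: eventually_at_filter)
 ultimately show ?thesis
 proof eventually_elim
  case (elim h)
  show ?case
  proof
   fix y assume y: "y \<in> {a..b}"
   then obtain t where t: "t \<in> T" "\<bar>y - t\<bar> < e / (2 * C)" using T(3) by (auto simp: dist_real_def abs_minus_commute)
   have "C * \<bar>y - t\<bar> <= C * (e / (2 * C))" using t(2) C by (intro mult_left_mono) auto
   also have "... = e / 2" using C by simp
   finally have "\<bar>F h y - F h t\<bar> <= e / 2" using Lip[OF elim(2) y, of t] t(1) T(1) by force
   then show "\<bar>F h y\<bar> <= e" using elim(1)[rule_format, OF t(1)] by linarith
  qed
 qed
qed

text \<open>The condition \<open>drift\<close> says that the generator acts formally on
  \<open>exp\<close> as multiplication by \<open>r - \<delta>\<close>: it amounts to \<open>gam +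
  \<sigma>\<^sup>2 / 2 + \<integral> (exp z - 1) = r - \<delta>\<close>.\<close>

locale put_law = levy_law +
 fixes r \<delta> K :: real
 assumes r: "0 <= r" and \<delta>: "0 <= \<delta>" and K: "0 < K"
  and exp_int: "integrable \<nu> (%z. exp z - 1)"
  and drift: "gam = r - \<delta> - \<sigma>\<^sup>2 / 2 - (LINT z|\<nu>. exp z - 1)"
  and s_cont: "continuous_on (- {0}) s"
begin

definition phi0 :: "real \<Rightarrow> real" where
 "phi0 x = r * K - \<delta> * x - (LINT z|\<nu>. max 0 (x * exp z - K))"

lemma call_le: assumes "0 <= x" "x <= K" shows "max 0 (x * exp z - K) <= K * max 0 (exp z - 1)"
proof -
 have "x * exp z <= K * exp z" using assms by (intro mult_right_mono) auto
 then have "x * exp z - K <= K * (exp z - 1)" by (simp add: algebra_simps)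
 also have "... <= K * max 0 (exp z - 1)" using K by (intro mult_left_mono) auto
 finally show ?thesis using K by simp
qed

lemma call_integrable: assumes "0 <= x" "x <= K" shows "integrable \<nu> (%z. max 0 (x * exp z - K))"
proof (rule Bochner_Integration.integrable_bound[OF integrable_mult_right[OF exp_int, of K]])
 show "AE z in \<nu>. norm (max 0 (x * exp z - K)) <= norm (K * (exp z - 1))"
 proof (rule AE_I2)
  fix z
  have "K * max 0 (exp z - 1) <= K * \<bar>exp z - 1\<bar>" using K by (intro mult_left_mono) auto
  moreover have "norm (K * (exp z - 1)) = K * \<bar>exp z - 1\<bar>" using K by (simp add: abs_mult)
  moreover have "norm (max 0 (x * exp z - K)) = max 0 (x * exp z - K)" by simp
  ultimately show "norm (max 0 (x * exp z - K)) <= norm (K * (exp z - 1))"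
   using call_le[OF assms, of z] by linarith
 qed
qed simp

lemma payoff_eq_below: "y <= ln K ==> put_payoff K y = K - exp y"
 using K by (metis add.commute diff_ge_0_iff_ge exp_le_cancel_iff exp_ln max_def put_payoff_def)

lemma smooth_put_increment_integrable:
 assumes eta: "0 < eta" "eta <= 1" and c: "c = 0 \<or> c = 1"
 shows "integrable \<nu> (%z. smooth_put K c eta (y + z) - smooth_put K c eta y)"
proof (rule Bochner_Integration.integrable_bound[OF integrable_mult_right[OF nu_int, of "12 * K"]])
 show "AE z in \<nu>. norm (smooth_put K c eta (y + z) - smooth_put K c eta y) <= norm (12 * K * min 1 \<bar>z\<bar>)"
 proof (rule AE_I2)
  fix z
  have "\<bar>smooth_put K c eta (y + z) - smooth_put K c eta y\<bar> <= 6 * K * \<bar>z\<bar>"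
   using smooth_put_Lipschitz[OF K eta c, of "y + z" y] by simp
  moreover have "\<bar>smooth_put K c eta (y + z) - smooth_put K c eta y\<bar> <= 12 * K"
   using smooth_put_bound[OF K eta c, of "y + z"] smooth_put_bound[OF K eta c, of y] by linarith
  moreover have "6 * K * \<bar>z\<bar> <= 12 * K * \<bar>z\<bar>" using K by (intro mult_right_mono) auto
  moreover have "12 * K * min 1 \<bar>z\<bar> = 12 * K \<or> 12 * K * min 1 \<bar>z\<bar> = 12 * K * \<bar>z\<bar>" by (simp add: min_def)
  ultimately have "\<bar>smooth_put K c eta (y + z) - smooth_put K c eta y\<bar> <= 12 * K * min 1 \<bar>z\<bar>"
   by linarith
  then show "norm (smooth_put K c eta (y + z) - smooth_put K c eta y) <= norm (12 * K * min 1 \<bar>z\<bar>)" by simp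
 qed
 have [measurable]: "smooth_put K c eta \<in> borel_measurable borel" by (rule smooth_put_measurable[OF K eta c])
 show "(%z. smooth_put K c eta (y + z) - smooth_put K c eta y) \<in> borel_measurable \<nu>" by measurable
qed

text \<open>At distance \<open>2 * eta\<close> below the kink the smoothed payoff equals
  \<open>K - exp\<close> in a neighbourhood, so both derivatives at \<open>y\<close> are
  \<open>- exp y\<close> and \<open>drift\<close> collapses the local terms. Smoothing is visible
  only through jumps that land near the kink, which is the remaining integral.\<close>

lemma generator_smooth_put:
 assumes eta: "0 < eta" "eta <= 1" and c: "c = 0 \<or> c = 1" and y: "y <= ln K - 2 * eta"
 shows "((%h. (exp (- r * h) * step_op (mu h) (smooth_put K c eta) y - smooth_put K c eta y) / h)
   \<longlongrightarrow> - phi0 (exp y) + (LINT z|\<nu>. smooth_put K c eta (y + z) - put_payoff K (y + z))) (at_right 0)"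
proof -
 let ?g = "smooth_put K c eta"
 note gL = smooth_put_Lipschitz[OF K eta c]
 have gm[measurable]: "?g \<in> borel_measurable borel" by (rule smooth_put_measurable[OF K eta c])
 have g_eq: "?g x = K - exp x" if "x <= ln K - eta" for x
  using smooth_put_eq[OF K eta c, of x] payoff_eq_below[of x] that eta by simp
 have gy: "?g y = K - exp y" using y eta by (intro g_eq) simp
 have f2: "((%x. (?g (y + x) - ?g y - (- exp y) * x) / x\<^sup>2) \<longlongrightarrow> (- exp y) / 2) (at 0)"
 proof (rule Lim_transform_eventually)
  have "((%x. - exp y * ((exp x - 1 - x) / x\<^sup>2)) \<longlongrightarrow> - exp y * (1 / 2)) (at 0)"
   by (intro tendsto_intros exp_quotient_tendsto)
  then show "((%x. - exp y * ((exp x - 1 - x) / x\<^sup>2)) \<longlongrightarrow> - exp y / 2) (at 0)" by simp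
  have "\<forall>\<^sub>F x in at (0::real). \<bar>x\<bar> < eta"
   using eta by (auto simp: eventually_at dist_real_def intro!: exI[of _ eta])
  then show "\<forall>\<^sub>F x in at 0. - exp y * ((exp x - 1 - x) / x\<^sup>2) = (?g (y + x) - ?g y - (- exp y) * x) / x\<^sup>2"
  proof eventually_elim
   case (elim x)
   have "?g (y + x) = K - exp y * exp x" using elim y by (subst g_eq) (auto simp: exp_add)
   then show ?case unfolding gy by (simp add: algebra_simps)
  qed
 qed
 have lim1: "((%h. (step_op (mu h) ?g y - ?g y) / h) \<longlongrightarrow> gam * (- exp y) + \<sigma>\<^sup>2 / 2 * (- exp y) + (LINT z|\<nu>. ?g (y + z) - ?g y)) (at_right 0)"
  by (rule generator_limit[OF smooth_put_isCont[OF K eta c] smooth_put_bound[OF K eta c] f2])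
 have elim: "((%h. exp (- r * h)) \<longlongrightarrow> 1) (at_right 0)"
 proof -
  have "((%h. exp (- r * h)) \<longlongrightarrow> exp (- r * 0)) (at_right 0)" by (intro tendsto_intros)
  then show ?thesis by simp
 qed
 have rlim: "((%h. (exp (- r * h) - 1) / h) \<longlongrightarrow> - r) (at_right 0)"
 proof -
  have "((%h. exp (- r * h)) has_real_derivative exp (- r * 0) * (- r)) (at 0)"
   by (auto intro!: derivative_eq_intros)
  then have "((%h. (exp (- r * h) - 1) / h) \<longlongrightarrow> - r) (at 0)"
   unfolding has_field_derivative_iff by simp
  then show ?thesis by (rule filterlim_mono) (auto simp: at_le)
 qed
 have "((%h. exp (- r * h) * ((step_op (mu h) ?g y - ?g y) / h) + ?g y * ((exp (- r * h) - 1) / h))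
   \<longlongrightarrow> 1 * (gam * (- exp y) + \<sigma>\<^sup>2 / 2 * (- exp y) + (LINT z|\<nu>. ?g (y + z) - ?g y)) + ?g y * (- r)) (at_right 0)"
  by (intro tendsto_intros elim rlim lim1)
 moreover have "exp (- r * h) * ((step_op (mu h) ?g y - ?g y) / h) + ?g y * ((exp (- r * h) - 1) / h)
   = (exp (- r * h) * step_op (mu h) ?g y - ?g y) / h" for h
  by (simp add: add_divide_distrib[symmetric] algebra_simps)
 moreover have "1 * (gam * (- exp y) + \<sigma>\<^sup>2 / 2 * (- exp y) + (LINT z|\<nu>. ?g (y + z) - ?g y)) + ?g y * (- r)
   = - phi0 (exp y) + (LINT z|\<nu>. ?g (y + z) - put_payoff K (y + z))"
 proof -
  have "exp y <= exp (ln K)" using y eta by (subst exp_le_cancel_iff) simp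
  then have yK: "exp y <= K" using K by simp
  have ig: "integrable \<nu> (%z. ?g (y + z) - ?g y)" by (rule smooth_put_increment_integrable[OF eta c])
  have ic: "integrable \<nu> (%z. max 0 (exp y * exp z - K))" using yK by (intro call_integrable) auto
  have ie: "integrable \<nu> (%z. exp y * (exp z - 1))" using exp_int by (rule integrable_mult_right)
  \<comment> \<open>Put-call parity: the true payoff is \<open>K - exp (y + z)\<close> plus a call
    payoff, which produces the integral in \<open>phi0\<close>.\<close>
  have pt: "?g (y + z) - put_payoff K (y + z) = (?g (y + z) - ?g y) + exp y * (exp z - 1) - max 0 (exp y * exp z - K)" for z
   unfolding gy put_payoff_def exp_add by (simp add: algebra_simps max_def)
  have "(LINT z|\<nu>. ?g (y + z) - put_payoff K (y + z))
   = (LINT z|\<nu>. ?g (y + z) - ?g y) + (LINT z|\<nu>. exp y * (exp z - 1)) - (LINT z|\<nu>. max 0 (exp y * exp z - K))"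
   unfolding pt
   by (subst Bochner_Integration.integral_diff[OF Bochner_Integration.integrable_add[OF ig ie] ic],
     subst Bochner_Integration.integral_add[OF ig ie]) simp
  moreover have "(LINT z|\<nu>. exp y * (exp z - 1)) = exp y * (LINT z|\<nu>. exp z - 1)" by simp
  ultimately show ?thesis unfolding phi0_def gy drift by (simp add: algebra_simps)
 qed
 ultimately show ?thesis by (simp only:)
qed

text \<open>Height \<open>K * eta\<close> times window length \<open>2 * eta\<close> times a bound
  on the jump density. The second power of \<open>eta\<close> is what makes the smoothing
  affordable.\<close>

lemma smoothing_error:
 assumes eta: "0 < eta" "eta <= 1" and c: "c = 0 \<or> c = 1"
  and S: "!!z. \<bar>z - (ln K - y)\<bar> <= eta ==> s z <= S"
 shows "\<bar>LINT z|\<nu>. smooth_put K c eta (y + z) - put_payoff K (y + z)\<bar> <= 2 * K * S * eta\<^sup>2"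
proof -
 have gm[measurable]: "smooth_put K c eta \<in> borel_measurable borel" by (rule smooth_put_measurable[OF K eta c])
 have pm[measurable]: "put_payoff K \<in> borel_measurable borel" unfolding put_payoff_def[abs_def] by measurable
 let ?I = "{ln K - y - eta..ln K - y + eta}"
 have "\<bar>LINT z|\<nu>. smooth_put K c eta (y + z) - put_payoff K (y + z)\<bar> <= (LINT z|\<nu>. \<bar>smooth_put K c eta (y + z) - put_payoff K (y + z)\<bar>)"
  by (rule integral_abs_bound)
 also have "... = (LINT z|lborel. s z * \<bar>smooth_put K c eta (y + z) - put_payoff K (y + z)\<bar>)"
  unfolding nu_eq by (subst integral_density) (auto simp: s_nonneg)
 also have "... <= (LINT z|lborel. S * (K * eta) * indicator ?I z)"
 proof (rule integral_mono')
  show "integrable lborel (%z. S * (K * eta) * indicator ?I z)"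
   by (intro integrable_mult_right integrable_real_indicator) (auto simp: emeasure_lborel_Icc_eq)
  have S0: "0 <= S" using S[of "ln K - y"] s_nonneg[of "ln K - y"] eta by simp
  show "s z * \<bar>smooth_put K c eta (y + z) - put_payoff K (y + z)\<bar> <= S * (K * eta) * indicator ?I z" for z
  proof (cases "z \<in> ?I")
   case True
   then have "\<bar>z - (ln K - y)\<bar> <= eta" by auto
   then show ?thesis using True S smooth_put_near[OF K eta c, of "y + z"] s_nonneg S0 K eta
    by (auto intro!: mult_mono)
  next
   case False
   then have "eta <= \<bar>y + z - ln K\<bar>" by auto
   then show ?thesis using smooth_put_eq[OF K eta c, of "y + z"] False by simp
  qed
  show "0 <= S * (K * eta) * indicator ?I z" for z using S0 K eta by simp
 qed
 also have "... = 2 * K * S * eta\<^sup>2" using eta by (simp add: power2_eq_square)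
 finally show ?thesis .
qed

end

section \<open>Truncated rewards and comparison of grids\<close>

definition truncr :: "real \<Rightarrow> real \<Rightarrow> real" where
 "truncr R x = max (- R) (min R x)"

lemma truncr_measurable[measurable]: "truncr R \<in> borel_measurable borel"
 unfolding truncr_def[abs_def] by measurable

lemma truncr_bound: "0 <= R ==> \<bar>truncr R x\<bar> <= R"
 by (auto simp: truncr_def)

lemma truncr_Lipschitz: "\<bar>truncr R x - truncr R y\<bar> <= \<bar>x - y\<bar>"
proof -
 have "\<bar>max a u - max a v\<bar> <= \<bar>u - v\<bar>" for a u v :: real by linarith
 moreover have "\<bar>min a u - min a v\<bar> <= \<bar>u - v\<bar>" for a u v :: real by linarith
 ultimately show ?thesis unfolding truncr_def by (blast intro: order_trans)
qed

lemma truncr_error: assumes R: "0 < R" shows "\<bar>x - truncr R x\<bar> <= x\<^sup>2 / R"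
proof (cases "\<bar>x\<bar> <= R")
 case True
 then have "truncr R x = x" by (auto simp: truncr_def)
 then show ?thesis using R by simp
next
 case False
 then have "\<bar>x - truncr R x\<bar> <= \<bar>x\<bar>" using R by (auto simp: truncr_def abs_if min_def max_def)
 also have "... <= \<bar>x\<bar> * (\<bar>x\<bar> / R)" using False R mult_left_mono[of 1 "\<bar>x\<bar> / R" "\<bar>x\<bar>"] by simp
 also have "... = x\<^sup>2 / R" by (simp add: power2_eq_square)
 finally show ?thesis .
qed

lemma truncr_scale: "0 < c ==> truncr (R * c) x = c * truncr R (x / c)"
 by (simp add: truncr_def max_mult_distrib_left min_mult_distrib_left mult.commute)

text \<open>With \<open>l = sqrt H\<close> this turns a truncated second moment of order
  \<open>H\<close> into a truncated first moment of order \<open>sqrt H\<close>.\<close>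

lemma min_abs_le:
 fixes x l :: real
 assumes l: "0 < l"
 shows "min 1 \<bar>x\<bar> <= l + min 1 (x\<^sup>2) / l"
proof -
 define w where "w = min 1 \<bar>x\<bar>"
 have w2: "min 1 (x\<^sup>2) = w\<^sup>2"
 proof (cases "\<bar>x\<bar> <= 1")
  case True
  then have "x\<^sup>2 <= 1" "w = \<bar>x\<bar>" by (auto simp: abs_square_le_1 w_def)
  then show ?thesis by simp
 next
  case False
  then have "\<not> x\<^sup>2 <= 1" "w = 1" by (auto simp: abs_square_le_1 w_def)
  then show ?thesis by simp
 qed
 have "0 <= (w - l)\<^sup>2 + w * l" unfolding w_def using l by simp
 also have "(w - l)\<^sup>2 + w * l = w\<^sup>2 + l * l - w * l" by (simp add: power2_eq_square algebra_simps)
 finally have "w * l <= l * l + w\<^sup>2" by simp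
 then have "w <= (l * l + w\<^sup>2) / l" using l by (simp add: pos_le_divide_eq)
 also have "... = l + w\<^sup>2 / l" using l by (simp add: add_divide_distrib)
 finally have "w <= l + w\<^sup>2 / l" .
 then show ?thesis unfolding w2 unfolding w_def .
qed

lemma truncr_diff_le: assumes "0 <= R" "2 * R <= 1" shows "\<bar>truncr R x - truncr R y\<bar> <= min 1 \<bar>x - y\<bar>"
 using truncr_Lipschitz[of R x y] truncr_bound[OF assms(1), of x] truncr_bound[OF assms(1), of y] assms(2) by (intro min.boundedI) linarith+

text \<open>\<open>(k + m - 1) div m\<close> is the quotient rounded up; rounding up keeps a
  stopping rule adapted to the coarser grid.\<close>

lemma ceil_div_less: assumes "0 < (m::nat)" shows "j < (k + m - 1) div m \<longleftrightarrow> j * m < k"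
proof -
 have "j < (k + m - 1) div m \<longleftrightarrow> Suc j <= (k + m - 1) div m" by auto
 also have "... \<longleftrightarrow> Suc j * m <= k + m - 1" using assms by (simp add: less_eq_div_iff_mult_less_eq)
 also have "... \<longleftrightarrow> j * m < k" using assms by auto
 finally show ?thesis .
qed

text \<open>A common interface for the log-price and for Brownian motion, so that the comparison of
  grids is done once for both.\<close>

locale grid_process = prob_space M for M :: "'a measure" +
 fixes F :: "real \<Rightarrow> 'a measure" and Y :: "real \<Rightarrow> 'a \<Rightarrow> real" and mu :: "real \<Rightarrow> real measure"
 assumes F_sub: "!!t. subalgebra M (F t)" and F_mono: "!!s t. s <= t ==> sets (F s) \<subseteq> sets (F t)"
  and Y_adapted: "!!t. 0 <= t ==> Y t \<in> borel_measurable (F t)"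
  and Y_0: "AE om in M. Y 0 om = 0"
  and Y_indep: "!!s t. 0 <= s ==> s <= t ==> indep_set (sets (F s)) (rv_events M (%om. Y t om - Y s om))"
  and Y_incr: "!!s t. 0 <= s ==> s <= t ==> distr M borel (%om. Y t om - Y s om) = mu (t - s)"
  and Y_law: "!!t. 0 <= t ==> distr M borel (Y t) = mu t"
begin

lemma Y_meas: "0 <= t ==> Y t \<in> borel_measurable M"
 using measurable_from_subalg[OF F_sub Y_adapted] .

lemma walk: assumes h: "0 <= h" shows "random_walk M (%k. F (real k * h)) (%k. Y (real k * h)) (mu h)"
proof
 show "subalgebra M (F (real k * h))" for k by (rule F_sub)
 show "sets (F (real i * h)) \<subseteq> sets (F (real j * h))" if "i <= j" for i j
  using that h by (intro F_mono mult_right_mono) auto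
 show "Y (real k * h) \<in> borel_measurable (F (real k * h))" for k using h by (intro Y_adapted) simp
 have le: "0 <= real k * h" "real k * h <= real (Suc k) * h" for k using h by (auto intro: mult_right_mono)
 show "indep_set (sets (F (real k * h))) (rv_events M (%om. Y (real (Suc k) * h) om - Y (real k * h) om))" for k
  by (rule Y_indep[OF le])
 have "real (Suc k) * h - real k * h = h" for k by (simp add: algebra_simps)
 then show "distr M borel (%om. Y (real (Suc k) * h) om - Y (real k * h) om) = mu h" for k
  using Y_incr[OF le[of k]] by simp
qed

abbreviation "gstop h \<equiv> random_walk.grid_stopping M (%k. F (real k * h))"

lemma gstop_def: "0 <= h ==> gstop h n kp \<longleftrightarrow> (\<forall>k. {om \<in> space M. kp om <= k} \<in> sets (F (real k * h))) \<and> (\<forall>om\<in>space M. kp om <= n)"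
 by (rule random_walk.grid_stopping_def[OF walk])

definition rew :: "real \<Rightarrow> (real \<Rightarrow> real) \<Rightarrow> nat \<Rightarrow> ('a \<Rightarrow> nat) \<Rightarrow> real" where
 "rew h c n kp = (\<Sum>k<n. expectation (%om. indicator {om\<in>space M. k < kp om} om * c (Y (real k * h) om)))"

lemma Y_0_expectation:
 fixes f :: "real \<Rightarrow> real"
 shows "f \<in> borel_measurable borel ==> expectation (%om. f (Y 0 om)) = f 0"
proof -
 assume [measurable]: "f \<in> borel_measurable borel"
 have [measurable]: "Y 0 \<in> borel_measurable M" by (rule Y_meas) simp
 have "expectation (%om. f (Y 0 om)) = expectation (%om. f 0)"
  using Y_0 by (intro integral_cong_AE) (auto elim!: eventually_mono)
 then show ?thesis using prob_space by simp
qed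

text \<open>Rounding has to go upwards: the rounded index is at most \<open>k\<close> exactly if
  \<open>tau\<close> is at most \<open>k * h\<close>, an event known at that time.\<close>

lemma grid_round_up:
 assumes tau: "stopping_time F tau" "!!om. om \<in> space M ==> 0 <= tau om \<and> tau om <= real n * h" and h: "0 < h"
 shows "gstop h n (%om. nat \<lceil>tau om / h\<rceil>)"
 unfolding gstop_def[OF less_imp_le[OF h]]
proof (intro conjI allI ballI)
 have sp: "space (F t) = space M" for t using F_sub[of t] by (simp add: subalgebra_def)
 fix k
 have "nat \<lceil>tau om / h\<rceil> <= k \<longleftrightarrow> tau om <= real k * h" for om
  using h by (simp add: nat_le_iff ceiling_le_iff pos_divide_le_eq)
 then show "{om \<in> space M. nat \<lceil>tau om / h\<rceil> <= k} \<in> sets (F (real k * h))"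
  using stopping_timeD[OF tau(1), of "real k * h"] unfolding pred_def sp by simp
next
 fix om assume "om \<in> space M"
 then show "nat \<lceil>tau om / h\<rceil> <= n" using tau(2) h by (simp add: nat_le_iff ceiling_le_iff pos_divide_le_eq)
qed

lemma grid_stopping_time:
 assumes h: "0 < h" and kp: "gstop h n kp"
 shows "stopping_time F (%om. real (kp om) * h)"
 unfolding stopping_time_def
proof
 have g: "!!k. {om \<in> space M. kp om <= k} \<in> sets (F (real k * h))"
  using kp h unfolding gstop_def[OF less_imp_le[OF h]] by auto
 have sp: "space (F t) = space M" for t using F_sub[of t] by (simp add: subalgebra_def)
 fix t
 show "Measurable.pred (F t) (%om. real (kp om) * h <= t)"
 proof (cases "0 <= t")
  case True
  define k where "k = nat \<lfloor>t / h\<rfloor>"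
  have kt: "real k * h <= t" using True h by (simp add: k_def field_simps) (metis floor_divide_lower mult.commute h)
  have iff: "real j * h <= t \<longleftrightarrow> j <= k" for j :: nat
   using h by (simp add: k_def pos_le_divide_eq[symmetric] le_nat_iff True le_floor_iff)
  have "{om \<in> space M. kp om <= k} \<in> sets (F t)" using g[of k] F_mono[OF kt] by auto
  then show ?thesis unfolding pred_def sp iff .
 next
  case False
  then have "\<not> real (kp om) * h <= t" for om using h by (smt (verit) mult_nonneg_nonneg of_nat_0_le_iff)
  then show ?thesis by simp
 qed
qed

text \<open>The fine rule is rounded up to the next multiple of \<open>m\<close>. Within a block
  where both rules continue, the reward differs only by the fluctuation of the truncated process, of
  mean at most \<open>\<beta> * E0\<close>. Where the fine rule stops inside a block, at most one
  block of reward is at stake, which gives the separate term of order \<open>H\<close>.\<close>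

lemma coarsen:
 fixes \<alpha> :: real
 assumes h: "0 < h" and m: "0 < m" and H: "H = real m * h" and kp: "gstop h (N * m) kp"
  and \<beta>: "0 <= \<beta>" and rho: "0 <= rho"
  and inc: "!!t u. 0 <= t ==> 0 <= u ==> u <= H ==> expectation (%om. \<bar>truncr rho (Y (t + u) om) - truncr rho (Y t om)\<bar>) <= E0"
 defines "kp' \<equiv> %om. (kp om + m - 1) div m" and "c \<equiv> %x. \<beta> * (\<alpha> + truncr rho x)"
 shows "gstop H N kp'"
  and "\<bar>rew h (%x. h * c x) (N * m) kp - rew H (%x. H * c x) N kp'\<bar>
    <= real N * H * (\<beta> * E0) + H * (\<beta> * (\<bar>\<alpha>\<bar> + rho))"
proof -
 have h0: "0 <= h" "0 < H" "0 <= H" using h m by (auto simp: H)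
 interpret W: random_walk M "%k. F (real k * h)" "%k. Y (real k * h)" "mu h" by (rule walk[OF h0(1)])
 have g: "!!k. {om \<in> space M. kp om <= k} \<in> sets (F (real k * h))" "!!om. om \<in> space M ==> kp om <= N * m"
  using kp unfolding gstop_def[OF h0(1)] by auto
 have kl: "j < kp' om \<longleftrightarrow> j * m < kp om" for j om unfolding kp'_def by (rule ceil_div_less[OF m])
 have jH: "real (j * m) * h = real j * H" for j by (simp add: H)
 show "gstop H N kp'"
  unfolding gstop_def[OF h0(3)]
 proof (intro conjI allI ballI)
  fix k
  have "kp' om <= k \<longleftrightarrow> kp om <= k * m" for om using kl[of k om] by (simp add: not_less[symmetric])
  then show "{om \<in> space M. kp' om <= k} \<in> sets (F (real k * H))" using g(1)[of "k * m"] unfolding jH by simp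
 next
  fix om assume "om \<in> space M"
  then show "kp' om <= N" using g(2) kl[of N om] by (simp add: not_less[symmetric])
 qed
 have [measurable]: "{om\<in>space M. k < kp om} \<in> sets M" for k
  using W.grid_stopping_gt[OF kp] W.sets_G by blast
 have Ym[measurable]: "(%om. Y (real k * h) om) \<in> borel_measurable M" for k using h by (intro Y_meas) simp
 have cm[measurable]: "c \<in> borel_measurable borel" unfolding c_def by measurable
 define B where "B = \<beta> * (\<bar>\<alpha>\<bar> + rho)"
 have cb: "\<bar>c x\<bar> <= B" for x
  unfolding c_def B_def abs_mult abs_of_nonneg[OF \<beta>] using truncr_bound[OF rho, of x] \<beta> by (intro mult_left_mono) auto
 have B0: "0 <= B" using cb[of 0] by linarith
 let ?I = "%k. indicator {om\<in>space M. k < kp om} :: 'a \<Rightarrow> real"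
 \<comment> \<open>The event that the fine rule stops strictly inside block \<open>j\<close>. These
   events are disjoint, so their probabilities add up to at most 1 and the cost \<open>H * B\<close>
   is paid once, not once per block.\<close>
 let ?J = "%j. indicator {om\<in>space M. j * m < kp om \<and> kp om < Suc j * m} :: 'a \<Rightarrow> real"
 have ib: "\<bar>indicator S x * z\<bar> <= D" if "\<bar>z\<bar> <= D" for z D :: real and x :: 'a and S
  using that by (auto simp: indicator_def)
 have int: "integrable M (%om. ?I k om * c (Y (real l * h) om))" for k l
  by (rule integrable_const_bound[of _ B]) (unfold real_norm_def, intro AE_I2 ib cb, simp)
 have km: "kp \<in> measurable M (count_space UNIV)" by (rule W.grid_stopping_measurable[OF kp])
 have Jm[measurable]: "{om\<in>space M. j * m < kp om \<and> kp om < Suc j * m} \<in> sets M" for j using km by measurable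
 have Ji: "integrable M (?J j)" for j by (rule integrable_const_bound[of _ 1], simp, rule borel_measurable_indicator[OF Jm])
 have ci: "integrable M (%om. \<bar>c (Y (real k * h) om) - c (Y (real l * h) om)\<bar>)" for k l
 proof (rule integrable_const_bound[of _ "B + B"])
  have "norm \<bar>c x - c y\<bar> <= B + B" for x y using cb[of x] cb[of y] by simp
  then show "AE om in M. norm \<bar>c (Y (real k * h) om) - c (Y (real l * h) om)\<bar> <= B + B" by (intro AE_I2)
 qed simp
 define D where "D j i = expectation (%om. ?I (j * m + i) om * c (Y (real (j * m + i) * h) om)) - expectation (%om. ?I (j * m) om * c (Y (real (j * m) * h) om))" for j i
 define E where "E = \<beta> * E0"
 have Db: "\<bar>D j i\<bar> <= E + B * expectation (?J j)" if i: "i < m" for j i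
 proof -
  have "\<bar>D j i\<bar> = \<bar>expectation (%om. ?I (j * m + i) om * c (Y (real (j * m + i) * h) om) - ?I (j * m) om * c (Y (real (j * m) * h) om))\<bar>"
   unfolding D_def by (simp only: Bochner_Integration.integral_diff[OF int int])
  also have "... <= expectation (%om. \<bar>?I (j * m + i) om * c (Y (real (j * m + i) * h) om) - ?I (j * m) om * c (Y (real (j * m) * h) om)\<bar>)"
   by (rule integral_abs_bound)
  also have "... <= expectation (%om. \<bar>c (Y (real (j * m + i) * h) om) - c (Y (real (j * m) * h) om)\<bar> + B * ?J j om)"
  proof (rule integral_mono)
   show "integrable M (%om. \<bar>?I (j * m + i) om * c (Y (real (j * m + i) * h) om) - ?I (j * m) om * c (Y (real (j * m) * h) om)\<bar>)"
    by (intro integrable_abs Bochner_Integration.integrable_diff int)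
   show "integrable M (%om. \<bar>c (Y (real (j * m + i) * h) om) - c (Y (real (j * m) * h) om)\<bar> + B * ?J j om)"
    by (intro Bochner_Integration.integrable_add integrable_mult_right ci Ji)
   fix om assume w: "om \<in> space M"
   define p q where "p = c (Y (real (j * m + i) * h) om)" and "q = c (Y (real (j * m) * h) om)"
   have q: "\<bar>q\<bar> <= B" unfolding q_def by (rule cb)
   consider "j * m + i < kp om" | "j * m < kp om" "kp om <= j * m + i" | "kp om <= j * m" by linarith
   then have "\<bar>?I (j * m + i) om * p - ?I (j * m) om * q\<bar> <= \<bar>p - q\<bar> + B * ?J j om"
   proof cases
    case 1
    then have "?I (j * m + i) om = 1" "?I (j * m) om = 1" using w by (auto simp: indicator_def)
    moreover have "0 <= B * ?J j om" using B0 by simp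
    ultimately show ?thesis by simp
   next
    case 2
    then have "?I (j * m + i) om = 0" "?I (j * m) om = 1" "?J j om = 1" using w i by (auto simp: indicator_def)
    then show ?thesis using q by simp
   next
    case 3
    then have "?I (j * m + i) om = 0" "?I (j * m) om = 0" using w by (auto simp: indicator_def)
    moreover have "0 <= B * ?J j om" using B0 by simp
    ultimately show ?thesis by simp
   qed
   then show "\<bar>?I (j * m + i) om * c (Y (real (j * m + i) * h) om) - ?I (j * m) om * c (Y (real (j * m) * h) om)\<bar>
     <= \<bar>c (Y (real (j * m + i) * h) om) - c (Y (real (j * m) * h) om)\<bar> + B * ?J j om" unfolding p_def q_def .
  qed
  also have "... = expectation (%om. \<bar>c (Y (real (j * m + i) * h) om) - c (Y (real (j * m) * h) om)\<bar>) + expectation (%om. B * ?J j om)"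
   by (rule Bochner_Integration.integral_add[OF ci integrable_mult_right[OF Ji]])
  also have "expectation (%om. B * ?J j om) = B * expectation (?J j)" by (rule integral_mult_right_zero)
  also have "expectation (%om. \<bar>c (Y (real (j * m + i) * h) om) - c (Y (real (j * m) * h) om)\<bar>) <= E"
  proof -
   have cd: "\<bar>c x - c y\<bar> = \<beta> * \<bar>truncr rho x - truncr rho y\<bar>" for x y
   proof -
    have "c x - c y = \<beta> * (truncr rho x - truncr rho y)" unfolding c_def by (simp add: algebra_simps)
    then show ?thesis using \<beta> by (simp add: abs_mult)
   qed
   have t: "real (j * m + i) * h = real (j * m) * h + real i * h" by (simp add: algebra_simps)
   have "real i * h <= H" unfolding H using i h by (intro mult_right_mono) auto
   then have "expectation (%om. \<bar>truncr rho (Y (real (j * m) * h + real i * h) om) - truncr rho (Y (real (j * m) * h) om)\<bar>) <= E0"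
    using h by (intro inc) auto
   then show ?thesis unfolding cd t E_def integral_mult_right_zero using \<beta> by (intro mult_left_mono)
  qed
  finally show ?thesis by simp
 qed
 have Jsum: "(\<Sum>j<N. expectation (?J j)) <= 1"
 proof -
  have "(\<Sum>j<N. expectation (?J j)) = expectation (%om. \<Sum>j<N. ?J j om)"
   by (rule Bochner_Integration.integral_sum[symmetric]) (rule Ji)
  also have "... <= expectation (%om. 1)"
  proof (rule integral_mono')
   fix om
   have "?J j om <= (if j = kp om div m then 1 else 0)" for j
   proof -
    have "kp om div m = j" if "j * m < kp om" "kp om < Suc j * m"
     using that by (intro div_nat_eqI) (auto simp: mult.commute)
    then show ?thesis by (auto simp: indicator_def)
   qed
   then have "(\<Sum>j<N. ?J j om) <= (\<Sum>j<N. if j = kp om div m then 1 else 0)" by (intro sum_mono)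
   also have "... <= 1" by simp
   finally show "(\<Sum>j<N. ?J j om) <= 1" .
  qed auto
  finally show ?thesis using prob_space by simp
 qed
 have r1: "rew h (%x. h * c x) (N * m) kp = (\<Sum>j<N. \<Sum>i<m. h * expectation (%om. ?I (j * m + i) om * c (Y (real (j * m + i) * h) om)))"
 proof -
  have "rew h (%x. h * c x) (N * m) kp = (\<Sum>k<N * m. h * expectation (%om. ?I k om * c (Y (real k * h) om)))"
   unfolding rew_def by (intro sum.cong refl) (simp add: mult.left_commute[of _ h])
  also have "... = (\<Sum>j<N. \<Sum>k\<in>{j * m..<j * m + m}. h * expectation (%om. ?I k om * c (Y (real k * h) om)))"
   by (rule sum.nat_group[symmetric])
  also have "... = (\<Sum>j<N. \<Sum>i<m. h * expectation (%om. ?I (j * m + i) om * c (Y (real (j * m + i) * h) om)))"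
  proof (rule sum.cong[OF refl])
   fix j
   show "(\<Sum>k\<in>{j * m..<j * m + m}. h * expectation (%om. ?I k om * c (Y (real k * h) om))) = (\<Sum>i<m. h * expectation (%om. ?I (j * m + i) om * c (Y (real (j * m + i) * h) om)))"
    using sum.shift_bounds_nat_ivl[of "%k. h * expectation (%om. ?I k om * c (Y (real k * h) om))" 0 "j * m" m]
    by (simp add: atLeast0LessThan add.commute)
  qed
  finally show ?thesis .
 qed
 have r2: "rew H (%x. H * c x) N kp' = (\<Sum>j<N. \<Sum>i<m. h * expectation (%om. ?I (j * m) om * c (Y (real (j * m) * h) om)))"
  unfolding rew_def kl jH by (intro sum.cong refl) (simp add: H mult.left_commute[of _ "real m * h"])
 have "rew h (%x. h * c x) (N * m) kp - rew H (%x. H * c x) N kp' = (\<Sum>j<N. \<Sum>i<m. h * D j i)"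
  unfolding r1 r2 D_def right_diff_distrib sum_subtractf ..
 then have "\<bar>rew h (%x. h * c x) (N * m) kp - rew H (%x. H * c x) N kp'\<bar> <= (\<Sum>j<N. \<Sum>i<m. \<bar>h * D j i\<bar>)"
  by (simp only:) (intro order_trans[OF sum_abs] sum_mono sum_abs)
 also have "... <= (\<Sum>j<N. \<Sum>i<m. h * (E + B * expectation (?J j)))"
  using Db h by (intro sum_mono) (auto simp: abs_mult)
 also have "... = (\<Sum>j<N. H * E + H * B * expectation (?J j))"
  unfolding H by (intro sum.cong refl) (simp add: algebra_simps)
 also have "... = real N * (H * E) + H * B * (\<Sum>j<N. expectation (?J j))"
  by (simp add: sum.distrib sum_distrib_left)
 also have "... <= real N * (H * E) + H * B * 1"
  using Jsum h0 B0 by (intro add_left_mono mult_left_mono) auto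
 finally show "\<bar>rew h (%x. h * c x) (N * m) kp - rew H (%x. H * c x) N kp'\<bar>
    <= real N * H * (\<beta> * E0) + H * (\<beta> * (\<bar>\<alpha>\<bar> + rho))"
  unfolding E_def B_def by (simp add: mult.assoc)
qed

text \<open>The converse transfer for lower bounds: a coarse rule is also a rule on the fine grid,
  and coarsening it returns the original, so \<open>coarsen\<close> applies to it in both
  directions.\<close>

lemma refine_stopping:
 assumes h: "0 < h" and m: "0 < m" and H: "H = real m * h" and kp: "gstop H N kp"
 shows "gstop h (N * m) (%om. kp om * m)" "(kp om * m + m - 1) div m = kp om"
proof -
 have h0: "0 <= h" "0 <= H" using h by (auto simp: H)
 have g: "!!k. {om \<in> space M. kp om <= k} \<in> sets (F (real k * H))" "!!om. om \<in> space M ==> kp om <= N"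
  using kp unfolding gstop_def[OF h0(2)] by auto
 show "gstop h (N * m) (%om. kp om * m)"
  unfolding gstop_def[OF h0(1)]
 proof (intro conjI allI ballI)
  fix k
  have "kp om * m <= k \<longleftrightarrow> kp om <= k div m" for om using m by (simp add: less_eq_div_iff_mult_less_eq)
  moreover have "real (k div m) * H <= real k * h"
  proof -
   have "real (k div m * m) <= real k" by (simp only: of_nat_le_iff div_times_less_eq_dividend)
   then have "real (k div m * m) * h <= real k * h" using h by (intro mult_right_mono) auto
   then show ?thesis by (simp add: H)
  qed
  then have "sets (F (real (k div m) * H)) \<subseteq> sets (F (real k * h))" by (rule F_mono)
  ultimately show "{om \<in> space M. kp om * m <= k} \<in> sets (F (real k * h))" using g(1)[of "k div m"] by auto
 qed (use g(2) in simp)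
 show "(kp om * m + m - 1) div m = kp om" using m by (intro div_nat_eqI) (auto simp: algebra_simps)
qed
lemma rew_le_stop_value:
 assumes H: "0 < H" and kp: "gstop H N kp" and c[measurable]: "c \<in> borel_measurable borel" and b: "!!x. \<bar>c x\<bar> <= B"
 shows "rew H c N kp <= stop_value (mu H) c N 0"
proof -
 interpret W: random_walk M "%k. F (real k * H)" "%k. Y (real k * H)" "mu H" by (rule walk) (use H in simp)
 have "rew H c N kp = W.reward c N kp" unfolding rew_def W.reward_def ..
 also have "... <= expectation (%om. stop_value (mu H) c N (Y (real 0 * H) om))" by (rule W.reward_le_stop_value[OF kp c b])
 also have "... = stop_value (mu H) c N 0" using Y_0_expectation[of "stop_value (mu H) c N"] by simp
 finally show ?thesis .
qed

lemma rew_attains_stop_value: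
 assumes H: "0 < H" and c[measurable]: "c \<in> borel_measurable borel" and b: "!!x. \<bar>c x\<bar> <= B"
 obtains kp where "gstop H N kp" "rew H c N kp = stop_value (mu H) c N 0"
proof -
 interpret W: random_walk M "%k. F (real k * H)" "%k. Y (real k * H)" "mu H" by (rule walk) (use H in simp)
 obtain kp where kp: "W.grid_stopping N kp" "W.reward c N kp = expectation (%om. stop_value (mu H) c N (Y (real 0 * H) om))"
  using W.stop_value_attained[OF c b] by blast
 have "rew H c N kp = W.reward c N kp" unfolding rew_def W.reward_def ..
 also have "... = stop_value (mu H) c N 0" unfolding kp(2) using Y_0_expectation[of "stop_value (mu H) c N"] by simp
 finally show ?thesis using that kp(1) by blast
qed

end

section \<open>Uniform drift estimates and the root of \<open>phi0\<close>\<close>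

lemma exp_diff_le: "\<bar>exp y - exp y'\<bar> <= B * \<bar>y - y'\<bar>" if "exp y <= B" "exp y' <= B" for y y' B :: real
proof -
 have B: "0 < B" using that(1) exp_gt_zero[of y] by linarith
 have "norm (exp y - exp y') <= B * norm (y - y')"
 proof (rule field_differentiable_bound[where S="{..ln B}" and f'="exp"])
  show "(exp has_field_derivative exp z) (at z within {..ln B})" for z :: real by (auto intro!: derivative_eq_intros)
  show "norm (exp z) <= B" if "z \<in> {..ln B}" for z :: real
   using that B by (metis abs_exp_cancel atMost_iff exp_le_cancel_iff exp_ln real_norm_def)
  show "y \<in> {..ln B}" "y' \<in> {..ln B}" using that B by (auto simp: ln_ge_iff)
 qed simp
 then show ?thesis by simp
qed

context put_law
begin

lemma density_bounded:
 assumes "0 < a" shows "\<exists>S\<ge>0. \<forall>z\<in>{a..b}. s z <= S"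
proof -
 have "compact (s ` {a..b})"
  using assms by (intro compact_continuous_image continuous_on_subset[OF s_cont]) auto
 then obtain S where S: "!!z. z \<in> {a..b} ==> \<bar>s z\<bar> <= S"
  by (metis bounded_iff compact_imp_bounded image_eqI real_norm_def)
 have "s z <= max 0 S" if "z \<in> {a..b}" for z using S[OF that] by linarith
 then show ?thesis by (intro exI[of _ "max 0 S"]) auto
qed

definition disc_drift :: "real \<Rightarrow> real \<Rightarrow> real \<Rightarrow> real \<Rightarrow> real" where
 "disc_drift c eta h y = (exp (- r * h) * step_op (mu h) (smooth_put K c eta) y - smooth_put K c eta y) / h"

lemma exp_minus_one_le: "0 <= h ==> 0 <= 1 - exp (- r * h) \<and> 1 - exp (- r * h) <= r * h"
 using r exp_ge_add_one_self[of "- r * h"] by auto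

lemma smooth_put_small: "eta <= 1 ==> 0 < eta ==> c = 0 \<or> c = 1 ==> y <= ln K - eta ==> smooth_put K c eta y = K - exp y"
 using smooth_put_eq[OF K, of eta c y] payoff_eq_below[of y] by auto

text \<open>A crude bound at all points and all mesh sizes; the factor 123 is
  \<open>10 * 6 + 3 * 21\<close> after replacing \<open>K\<close> by \<open>K / eta\<close>. It
  controls the drift where the process has left the neighbourhood of the critical level, which is
  rare enough to pay for \<open>1 / eta\<close>.\<close>

lemma disc_drift_bound:
 assumes h: "0 < h" and eta: "0 < eta" "eta <= 1" and c: "c = 0 \<or> c = 1"
 shows "\<bar>disc_drift c eta h y\<bar> <= (step_const * 123 + 6 * r) * K / eta"
proof -
 let ?g = "smooth_put K c eta"
 have gm: "?g \<in> borel_measurable borel" by (rule smooth_put_measurable[OF K eta c])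
 have 1: "\<bar>step_op (mu h) ?g y - ?g y\<bar> <= h * step_const * (10 * (6 * K) + 3 * (21 * K / eta))"
  using h by (intro step_bound[where ?f1.0="smooth_put' K c eta y"] gm smooth_put_bound[OF K eta c] smooth_put'_bound[OF K eta c] smooth_put_quadratic[OF K eta c]) auto
 have "10 * (6 * K) + 3 * (21 * K / eta) <= 123 * (K / eta)"
 proof -
  have "K * 1 <= K * (1 / eta)" using eta K by (intro mult_left_mono) auto
  then show ?thesis by simp
 qed
 then have "h * step_const * (10 * (6 * K) + 3 * (21 * K / eta)) <= h * step_const * (123 * (K / eta))"
  using h step_const_nonneg by (intro mult_left_mono) auto
 with 1 have 2: "\<bar>step_op (mu h) ?g y - ?g y\<bar> <= h * step_const * (123 * (K / eta))" by linarith
 have eq: "exp (- r * h) * step_op (mu h) ?g y - ?g y = exp (- r * h) * (step_op (mu h) ?g y - ?g y) - (1 - exp (- r * h)) * ?g y"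
  by (simp add: algebra_simps)
 have "\<bar>exp (- r * h) * (step_op (mu h) ?g y - ?g y)\<bar> <= 1 * (h * step_const * (123 * (K / eta)))"
  unfolding abs_mult using 2 h r by (intro mult_mono) auto
 moreover have "\<bar>(1 - exp (- r * h)) * ?g y\<bar> <= (r * h) * (6 * K)"
  unfolding abs_mult using exp_minus_one_le[of h] h r smooth_put_bound[OF K eta c, of y] by (intro mult_mono) auto
 moreover have "(r * h) * (6 * K) <= (r * h) * (6 * (K / eta))"
 proof -
  have "K * 1 <= K * (1 / eta)" using eta K by (intro mult_left_mono) auto
  then show ?thesis using r h by (intro mult_left_mono) auto
 qed
 ultimately have "\<bar>exp (- r * h) * step_op (mu h) ?g y - ?g y\<bar> <= h * step_const * (123 * (K / eta)) + (r * h) * (6 * (K / eta))"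
  unfolding eq by linarith
 also have "... = h * ((step_const * 123 + 6 * r) * K / eta)" by (simp add: algebra_simps add_divide_distrib)
 finally show ?thesis using h unfolding disc_drift_def by (simp add: abs_divide pos_divide_le_eq mult.commute)
qed

text \<open>\<open>step_bound\<close> is applied to the difference of two translates of the payoff.
  Near 0 both translates are exact exponentials, so the constant depends on the distance
  \<open>eps\<close> to the kink and neither on \<open>eta\<close> nor on \<open>h\<close>.\<close>

lemma disc_drift_Lipschitz:
 assumes h: "0 < h" and eps: "0 < eps" "eps <= 1" and eta: "0 < eta" "eta <= 1" and c: "c = 0 \<or> c = 1"
  and y: "y <= ln K - eps - eta" "y' <= ln K - eps - eta"
 shows "\<bar>disc_drift c eta h y - disc_drift c eta h y'\<bar> <= (step_const * (60 * K + 39 * K / eps\<^sup>2) + 6 * r * K) * \<bar>y - y'\<bar>"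
proof -
 let ?g = "smooth_put K c eta"
 have gm[measurable]: "?g \<in> borel_measurable borel" by (rule smooth_put_measurable[OF K eta c])
 have h0: "0 <= h" using h by simp
 interpret real_distribution "mu h" by (rule law[OF h0])
 define d where "d = \<bar>y - y'\<bar>"
 define f where "f x = ?g (y + x) - ?g (y' + x)" for x
 define f1 where "f1 = - (exp y - exp y')"
 have fm[measurable]: "f \<in> borel_measurable borel" unfolding f_def by measurable
 have fA: "\<bar>f x\<bar> <= 6 * K * d" for x
  using smooth_put_Lipschitz[OF K eta c, of "y + x" "y' + x"] by (simp add: f_def d_def)
 have "exp y <= exp (ln K)" "exp y' <= exp (ln K)" using y eps eta by (auto simp only: exp_le_cancel_iff)
 then have ee: "\<bar>f1\<bar> <= K * d" using exp_diff_le[of y K y'] K unfolding f1_def d_def by simp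
 have d0: "0 <= d" by (simp add: d_def)
 have q: "\<bar>f (0 + x) - f 0 - f1 * x\<bar> <= (13 * K / eps\<^sup>2 * d) * x\<^sup>2" for x
 proof (cases "\<bar>x\<bar> <= eps")
  case True
  have "?g (y + x) = K - exp (y + x)" "?g (y' + x) = K - exp (y' + x)" "?g y = K - exp y" "?g y' = K - exp y'"
   using True y eps by (auto intro!: smooth_put_small eta c)
  then have "f (0 + x) - f 0 - f1 * x = f1 * (exp x - 1 - x)"
   by (simp add: f_def f1_def exp_add algebra_simps)
  then have "\<bar>f (0 + x) - f 0 - f1 * x\<bar> = \<bar>f1\<bar> * \<bar>exp x - 1 - x\<bar>" by (simp add: abs_mult)
  also have "... <= (K * d) * (2 * x\<^sup>2)"
   using ee True eps exp_quadratic[of x] K d0 by (intro mult_mono) auto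
  also have "... <= (13 * K / eps\<^sup>2 * d) * x\<^sup>2"
  proof -
   have "eps\<^sup>2 <= 1" using eps by (simp add: power_le_one)
   then have "2 <= 13 / eps\<^sup>2" using eps by (simp add: field_simps)
   then have "(K * d * x\<^sup>2) * 2 <= (K * d * x\<^sup>2) * (13 / eps\<^sup>2)" using K d0 by (intro mult_left_mono) auto
   then show ?thesis by (simp add: algebra_simps)
  qed
  finally show ?thesis .
 next
  case False
  \<comment> \<open>Farther than \<open>eps\<close> only Lipschitz bounds are left. Both 1 and
    \<open>\<bar>x\<bar>\<close> are then at most \<open>x\<^sup>2 / eps\<^sup>2\<close>, and the
    terms \<open>6 + 6 + 1\<close> make up the 13.\<close>
  have xe: "1 <= \<bar>x\<bar> / eps" using False eps by simp
  have x2: "1 <= x\<^sup>2 / eps\<^sup>2" using power_mono[OF xe, of 2] by (simp add: power_divide)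
  have "\<bar>x\<bar> <= \<bar>x\<bar> * (\<bar>x\<bar> / eps)" using mult_left_mono[OF xe, of "\<bar>x\<bar>"] by simp
  also have "... <= x\<^sup>2 / eps\<^sup>2"
  proof -
   have "1 / eps * 1 <= 1 / eps * (1 / eps)" using eps by (intro mult_left_mono) auto
   then have "1 / eps <= 1 / eps\<^sup>2" by (simp add: power2_eq_square)
   then have "x\<^sup>2 * (1 / eps) <= x\<^sup>2 * (1 / eps\<^sup>2)" by (intro mult_left_mono) auto
   then show ?thesis by (simp add: power2_eq_square abs_mult_self_eq)
  qed
  finally have x1: "\<bar>x\<bar> <= x\<^sup>2 / eps\<^sup>2" .
  have "\<bar>f (0 + x) - f 0 - f1 * x\<bar> <= \<bar>f x\<bar> + \<bar>f 0\<bar> + \<bar>f1\<bar> * \<bar>x\<bar>"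
   unfolding add_0 abs_mult[symmetric] by linarith
  also have "... <= 6 * K * d + 6 * K * d + K * d * \<bar>x\<bar>"
   using fA ee by (intro add_mono mult_right_mono) auto
  also have "... = (K * d) * (12 * 1 + \<bar>x\<bar>)" by (simp add: algebra_simps)
  also have "... <= (K * d) * (12 * (x\<^sup>2 / eps\<^sup>2) + x\<^sup>2 / eps\<^sup>2)"
   using x1 x2 K d0 by (intro mult_left_mono add_mono) auto
  also have "... = (13 * K / eps\<^sup>2 * d) * x\<^sup>2" by (simp add: algebra_simps)
  finally show ?thesis .
 qed
 have "\<bar>f1\<bar> <= 6 * K * d" using ee mult_nonneg_nonneg[of K d] K d0 by linarith
 from step_bound[OF h0 fm fA this q]
 have b: "\<bar>step_op (mu h) f 0 - f 0\<bar> <= h * step_const * (10 * (6 * K * d) + 3 * (13 * K / eps\<^sup>2 * d))" .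
 have so: "step_op (mu h) f 0 = step_op (mu h) ?g y - step_op (mu h) ?g y'"
  unfolding step_op_def f_def
  using step_op_integrable[OF gm smooth_put_bound[OF K eta c], of y] step_op_integrable[OF gm smooth_put_bound[OF K eta c], of y'] by simp
 have "disc_drift c eta h y - disc_drift c eta h y' = (exp (- r * h) * (step_op (mu h) f 0 - f 0) - (1 - exp (- r * h)) * f 0) / h"
  unfolding disc_drift_def so diff_divide_distrib[symmetric] by (simp add: f_def algebra_simps)
 then have "\<bar>disc_drift c eta h y - disc_drift c eta h y'\<bar> = \<bar>exp (- r * h) * (step_op (mu h) f 0 - f 0) - (1 - exp (- r * h)) * f 0\<bar> / h"
  using h by (simp add: abs_divide)
 also have "... <= (h * step_const * (10 * (6 * K * d) + 3 * (13 * K / eps\<^sup>2 * d)) + (r * h) * (6 * K * d)) / h"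
 proof (intro divide_right_mono)
  have "\<bar>exp (- r * h) * (step_op (mu h) f 0 - f 0)\<bar> <= 1 * (h * step_const * (10 * (6 * K * d) + 3 * (13 * K / eps\<^sup>2 * d)))"
   unfolding abs_mult using b h r by (intro mult_mono) auto
  moreover have "\<bar>(1 - exp (- r * h)) * f 0\<bar> <= (r * h) * (6 * K * d)"
   unfolding abs_mult using exp_minus_one_le[of h] h r fA[of 0] by (intro mult_mono) auto
  ultimately show "\<bar>exp (- r * h) * (step_op (mu h) f 0 - f 0) - (1 - exp (- r * h)) * f 0\<bar>
    <= h * step_const * (10 * (6 * K * d) + 3 * (13 * K / eps\<^sup>2 * d)) + (r * h) * (6 * K * d)" by linarith
 qed (use h in simp)
 also have "... = (step_const * (60 * K + 39 * K / eps\<^sup>2) + 6 * r * K) * d"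
 proof -
  define q where "q = K / eps\<^sup>2"
  have q: "13 * K / eps\<^sup>2 = 13 * q" "39 * K / eps\<^sup>2 = 39 * q" by (simp_all add: q_def)
  have e: "h * step_const * (10 * (6 * K * d) + 3 * (13 * q * d)) + (r * h) * (6 * K * d) = h * ((step_const * (60 * K + 39 * q) + 6 * r * K) * d)"
   by (simp add: algebra_simps)
  show ?thesis unfolding q e using h by simp
 qed
 finally show ?thesis unfolding d_def .
qed

text \<open>The pointwise limits of \<open>generator_smooth_put\<close> become uniform by the
  Lipschitz bound common to all \<open>h\<close>, which the limit inherits. The distance of the
  limit to \<open>- phi0\<close> is the smoothing error, quadratic in \<open>eta\<close>.\<close>

lemma disc_drift_uniform:
 assumes eps: "0 < eps" "eps <= 1" "y1 + 4 * eps <= ln K" and eta: "0 < eta" "eta <= eps" and c: "c = 0 \<or> c = 1" and e: "0 < e"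
  and S: "!!z. z \<in> {ln K - y1 - 2 * eps..ln K - y1 + 2 * eps} ==> s z <= S"
 shows "\<forall>\<^sub>F h in at_right 0. \<forall>y\<in>{y1 - eps..y1 + eps}. \<bar>disc_drift c eta h y + phi0 (exp y)\<bar> <= 2 * K * S * eta\<^sup>2 + e"
proof -
 have eta1: "eta <= 1" using eta eps by simp
 define Er where "Er y = (LINT z|\<nu>. smooth_put K c eta (y + z) - put_payoff K (y + z))" for y
 define Lm where "Lm y = - phi0 (exp y) + Er y" for y
 define C where "C = step_const * (60 * K + 39 * K / eps\<^sup>2) + 6 * r * K + 1"
 have C0: "0 < C" unfolding C_def using step_const_nonneg K r by (intro add_nonneg_pos add_nonneg_nonneg mult_nonneg_nonneg) auto
 have lim: "((%h. disc_drift c eta h y) \<longlongrightarrow> Lm y) (at_right 0)" if "y \<in> {y1 - eps..y1 + eps}" for y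
  unfolding disc_drift_def Lm_def Er_def using that eps eta
  by (intro generator_smooth_put eta eta1 c) auto
 have Lip: "\<bar>disc_drift c eta h y - disc_drift c eta h y'\<bar> <= C * \<bar>y - y'\<bar>"
  if "0 < h" "y \<in> {y1 - eps..y1 + eps}" "y' \<in> {y1 - eps..y1 + eps}" for h y y'
 proof -
  have "\<bar>disc_drift c eta h y - disc_drift c eta h y'\<bar> <= (C - 1) * \<bar>y - y'\<bar>"
   using disc_drift_Lipschitz[OF that(1) eps(1,2) eta(1) eta1 c, of y y'] that(2,3) eps eta unfolding C_def by simp
  also have "... <= C * \<bar>y - y'\<bar>" by (intro mult_right_mono) auto
  finally show ?thesis .
 qed
 have LLip: "\<bar>Lm y - Lm y'\<bar> <= C * \<bar>y - y'\<bar>" if "y \<in> {y1 - eps..y1 + eps}" "y' \<in> {y1 - eps..y1 + eps}" for y y'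
 proof (rule tendsto_upperbound)
  show "((%h. \<bar>disc_drift c eta h y - disc_drift c eta h y'\<bar>) \<longlongrightarrow> \<bar>Lm y - Lm y'\<bar>) (at_right 0)"
   by (intro tendsto_intros lim that)
  show "\<forall>\<^sub>F h in at_right 0. \<bar>disc_drift c eta h y - disc_drift c eta h y'\<bar> <= C * \<bar>y - y'\<bar>"
   using Lip that by (auto simp: eventually_at_filter)
 qed simp
 have "\<forall>\<^sub>F h in at_right 0. \<forall>y\<in>{y1 - eps..y1 + eps}. \<bar>disc_drift c eta h y - Lm y\<bar> <= e"
 proof (rule uniform_limit_equi_Lipschitz[where C="2 * C"])
  show "((%h. disc_drift c eta h y - Lm y) \<longlongrightarrow> 0) (at_right 0)" if "y \<in> {y1 - eps..y1 + eps}" for y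
   using lim[OF that] by (rule LIM_zero)
  show "\<bar>disc_drift c eta h y - Lm y - (disc_drift c eta h y' - Lm y')\<bar> <= 2 * C * \<bar>y - y'\<bar>"
   if "0 < h" "y \<in> {y1 - eps..y1 + eps}" "y' \<in> {y1 - eps..y1 + eps}" for h y y'
   using Lip[OF that] LLip[OF that(2,3)] by linarith
 qed (use C0 e in auto)
 then show ?thesis
 proof eventually_elim
  case (elim h)
  show ?case
  proof
   fix y assume y: "y \<in> {y1 - eps..y1 + eps}"
   have "\<bar>Er y\<bar> <= 2 * K * S * eta\<^sup>2"
    unfolding Er_def using y eta by (intro smoothing_error eta eta1 c S) (auto simp: abs_le_iff)
   then show "\<bar>disc_drift c eta h y + phi0 (exp y)\<bar> <= 2 * K * S * eta\<^sup>2 + e"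
    using elim[rule_format, OF y] unfolding Lm_def by linarith
  qed
 qed
qed

lemma phi0_0: "phi0 0 = r * K"
 using K by (simp add: phi0_def)

text \<open>Only chords from 0 occur, where \<open>phi0\<close> equals \<open>r * K\<close>. The
  inequality holds because the strike does not shrink with the price, so scaling the price by
  \<open>t\<close> at least scales the call payoff down by \<open>t\<close>.\<close>

lemma phi0_concave:
 assumes "0 <= t" "t <= 1" "0 <= x" "x <= K"
 shows "t * phi0 x + (1 - t) * (r * K) <= phi0 (t * x)"
proof -
 have tx: "0 <= t * x" "t * x <= K" using assms mult_left_le_one_le[of x t] by auto
 have "(LINT z|\<nu>. max 0 (t * x * exp z - K)) <= (LINT z|\<nu>. t * max 0 (x * exp z - K))"
 proof (rule integral_mono)
  fix z
  have "t * x * exp z - K <= t * (x * exp z - K)"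
   using assms K mult_right_mono[of t 1 K] by (simp add: algebra_simps)
  also have "... <= t * max 0 (x * exp z - K)" using assms by (intro mult_left_mono) auto
  finally show "max 0 (t * x * exp z - K) <= t * max 0 (x * exp z - K)" using assms by simp
 qed (use call_integrable tx assms in auto)
 then show ?thesis unfolding phi0_def by (simp add: algebra_simps)
qed

lemma phi0_continuous: "continuous_on {0..K} phi0"
 unfolding continuous_on_sequentially
proof (intro ballI allI impI)
 fix u :: "nat \<Rightarrow> real" and a assume a: "a \<in> {0..K}" and u: "(\<forall>n. u n \<in> {0..K}) \<and> u \<longlonglongrightarrow> a"
 have "(%n. LINT z|\<nu>. max 0 (u n * exp z - K)) \<longlonglongrightarrow> (LINT z|\<nu>. max 0 (a * exp z - K))"
 proof (rule integral_dominated_convergence[where w="%z. K * max 0 (exp z - 1)"])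
  have "integrable \<nu> (%z. max 0 (exp z - 1))"
   by (rule Bochner_Integration.integrable_bound[OF exp_int]) auto
  then show "integrable \<nu> (%z. K * max 0 (exp z - 1))" by (rule integrable_mult_right)
  show "AE z in \<nu>. (%n. max 0 (u n * exp z - K)) \<longlonglongrightarrow> max 0 (a * exp z - K)"
   using u by (intro AE_I2 tendsto_intros) auto
  show "AE z in \<nu>. norm (max 0 (u n * exp z - K)) <= K * max 0 (exp z - 1)" for n
   using u call_le[of "u n"] by (intro AE_I2) auto
 qed auto
 then show "(phi0 \<circ> u) \<longlonglongrightarrow> phi0 a"
  unfolding phi0_def comp_def using u by (intro tendsto_intros) auto
qed

text \<open>At the strike the call integral runs over upward jumps only, so the sign of
  \<open>phi0 K\<close> is the sign of the quantity \<open>d\<close> of the theorem.\<close>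

lemma phi0_K: "phi0 K = K * (r - \<delta> - (LINT z:{0<..}|\<nu>. exp z - 1))"
proof -
 have "max 0 (K * exp z - K) = K * (indicator {0<..} z * (exp z - 1))" for z
 proof (cases "0 < z")
  case True
  then have "0 <= K * exp z - K" using K by simp
  then show ?thesis using True by (simp add: algebra_simps)
 next
  case False
  then have "K * exp z <= K" using K by simp
  then show ?thesis using False by simp
 qed
 then have "(LINT z|\<nu>. max 0 (K * exp z - K)) = K * (LINT z:{0<..}|\<nu>. exp z - 1)"
  unfolding set_lebesgue_integral_def by simp
 then show ?thesis by (simp add: phi0_def algebra_simps)
qed

text \<open>A root exists by the intermediate value theorem. Comparison with the chord from the
  strictly positive value at 0 then forces strict signs on both sides, hence uniqueness.\<close>

lemma phi0_root:
 assumes r_pos: "0 < r" and d_neg: "r - \<delta> - (LINT z:{0<..}|\<nu>. exp z - 1) < 0"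
 obtains x0 where "0 < x0" "x0 < K" "phi0 x0 = 0" "!!x. 0 <= x ==> x < x0 ==> 0 < phi0 x" "!!x. x0 < x ==> x <= K ==> phi0 x < 0"
proof -
 have pK: "phi0 K < 0" unfolding phi0_K using K d_neg by (simp add: mult_pos_neg)
 have p0: "0 < phi0 0" unfolding phi0_0 using r_pos K by simp
 obtain x0 where x0: "0 <= x0" "x0 <= K" "phi0 x0 = 0"
  using IVT2'[of phi0 K 0 0] pK p0 K phi0_continuous by auto
 have x0': "0 < x0" "x0 < K" using x0 pK p0 by (auto simp: less_le)
 show ?thesis
 proof (rule that[OF x0' x0(3)])
  fix x assume x: "0 <= x" "x < x0"
  have "(x / x0) * phi0 x0 + (1 - x / x0) * (r * K) <= phi0 ((x / x0) * x0)"
   using x x0 x0' by (intro phi0_concave) auto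
  moreover have "0 < (1 - x / x0) * (r * K)" using x x0' r_pos K by (intro mult_pos_pos) auto
  ultimately show "0 < phi0 x" using x0 x0' by simp
 next
  fix x assume x: "x0 < x" "x <= K"
  have xp: "0 < x" using x x0' by simp
  have "(x0 / x) * phi0 x + (1 - x0 / x) * (r * K) <= phi0 ((x0 / x) * x)"
   using x x0 x0' xp by (intro phi0_concave) auto
  moreover have "0 < (1 - x0 / x) * (r * K)" using x xp r_pos K by (intro mult_pos_pos) auto
  ultimately have "(x0 / x) * phi0 x < 0" using x0 xp by simp
  then show "phi0 x < 0" using x0' xp by (simp add: mult_less_0_iff divide_less_0_iff not_less zero_less_mult_iff)
 qed
qed

end

context put_law
begin

definition dbar :: "real \<Rightarrow> real" where
 "dbar y1 = \<delta> + (LINT z:{ln K - y1<..}|\<nu>. exp z)"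

lemma exp_tail_integrable:
 assumes c: "0 < c" shows "integrable \<nu> (%z. indicator {c<..} z * exp z)"
proof (rule Bochner_Integration.integrable_bound[OF integrable_mult_right[OF exp_int, of "1 / (1 - exp (- c))"]])
 have p: "0 < 1 - exp (- c)" using c by simp
 show "AE z in \<nu>. norm (indicator {c<..} z * exp z) <= norm (1 / (1 - exp (- c)) * (exp z - 1))"
 proof (rule AE_I2)
  fix z
  show "norm (indicator {c<..} z * exp z) <= norm (1 / (1 - exp (- c)) * (exp z - 1))"
  proof (cases "c < z")
   case True
   have "exp z * exp (- z) <= exp z * exp (- c)" using True by (intro mult_left_mono) auto
   then have "exp z * (1 - exp (- c)) <= exp z - 1" by (simp add: algebra_simps exp_minus)
   then have "exp z <= (exp z - 1) / (1 - exp (- c))" using p by (simp add: pos_le_divide_eq)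
   also have "... <= \<bar>(exp z - 1) / (1 - exp (- c))\<bar>" by (rule abs_ge_self)
   finally show ?thesis using True by simp
  qed simp
 qed
qed simp

lemma dbar_nonneg: "0 <= dbar y1"
 unfolding dbar_def set_lebesgue_integral_def using \<delta> by (intro add_nonneg_nonneg Bochner_Integration.integral_nonneg) auto

text \<open>The call payoff is linear in the price unless the two log-prices lie on different sides
  of the kink, which confines the error to jumps within \<open>\<bar>y - y1\<bar>\<close> of
  \<open>ln K - y1\<close>.\<close>

lemma call_first_order:
 fixes y y1 z :: real
 shows "\<bar>max 0 (exp (y + z) - K) - max 0 (exp (y1 + z) - K) - indicator {ln K - y1<..} z * (exp z * (exp y - exp y1))\<bar>
   <= indicator {ln K - y1 - \<bar>y - y1\<bar>..ln K - y1 + \<bar>y - y1\<bar>} z * (exp z * \<bar>exp y - exp y1\<bar>)"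
proof -
 have K': "K <= exp x \<longleftrightarrow> ln K <= x" for x using K by (metis exp_le_cancel_iff exp_ln)
 have ex: "exp z * (exp y - exp y1) = exp (y + z) - exp (y1 + z)" by (simp add: exp_add algebra_simps)
 have exa: "exp z * \<bar>exp y - exp y1\<bar> = \<bar>exp (y + z) - exp (y1 + z)\<bar>"
  unfolding ex[symmetric] by (simp add: abs_mult)
 show ?thesis unfolding ex exa
 proof (cases "ln K - y1 < z")
  case t: True
  then have a: "K <= exp (y1 + z)" by (subst K') simp
  show "\<bar>max 0 (exp (y + z) - K) - max 0 (exp (y1 + z) - K) - indicator {ln K - y1<..} z * (exp (y + z) - exp (y1 + z))\<bar>
   <= indicator {ln K - y1 - \<bar>y - y1\<bar>..ln K - y1 + \<bar>y - y1\<bar>} z * \<bar>exp (y + z) - exp (y1 + z)\<bar>"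
  proof (cases "ln K <= y + z")
   case True
   then have "K <= exp (y + z)" by (subst K')
   then show ?thesis using t a by simp
  next
   case False
   then have b: "\<not> K <= exp (y + z)" by (subst K')
   have "z \<in> {ln K - y1 - \<bar>y - y1\<bar>..ln K - y1 + \<bar>y - y1\<bar>}" using t False by auto
   then show ?thesis using t a b by simp
  qed
 next
  case t: False
  show "\<bar>max 0 (exp (y + z) - K) - max 0 (exp (y1 + z) - K) - indicator {ln K - y1<..} z * (exp (y + z) - exp (y1 + z))\<bar>
   <= indicator {ln K - y1 - \<bar>y - y1\<bar>..ln K - y1 + \<bar>y - y1\<bar>} z * \<bar>exp (y + z) - exp (y1 + z)\<bar>"
  proof -
   have "exp (y1 + z) <= exp (ln K)" using t by (subst exp_le_cancel_iff) simp
   then have a: "exp (y1 + z) <= K" using K by simp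
   show ?thesis
   proof (cases "ln K <= y + z")
    case True
    then have b: "K <= exp (y + z)" by (subst K')
    have "z \<in> {ln K - y1 - \<bar>y - y1\<bar>..ln K - y1 + \<bar>y - y1\<bar>}" using t True by auto
    then show ?thesis using t a b by simp
   next
    case False
    then have "\<not> K <= exp (y + z)" by (subst K')
    then show ?thesis using t a by simp
   qed
  qed
 qed
qed

text \<open>Linearity fails only for jumps in an interval of length \<open>2 * d\<close>, where the
  error is of order \<open>d\<close>. A bounded jump density makes this quadratic, so the left and
  right slopes of \<open>phi0\<close> at the critical level coincide.\<close>

lemma phi0_expansion:
 assumes eps: "0 < eps" "eps <= 1" "y1 + 4 * eps <= ln K" and S: "!!z. z \<in> {ln K - y1 - 2 * eps..ln K - y1 + 2 * eps} ==> s z <= S"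
 shows "\<exists>C\<ge>0. \<forall>y\<in>{y1 - eps..y1 + eps}. \<bar>phi0 (exp y1) - phi0 (exp y) - exp y1 * dbar y1 * (y - y1)\<bar> <= C * (y - y1)\<^sup>2"
proof -
 define c0 where "c0 = ln K - y1"
 have c0: "0 < c0" using eps by (simp add: c0_def)
 have S0: "0 <= S" using S[of "ln K - y1"] s_nonneg[of "ln K - y1"] eps by simp
 define C where "C = 2 * exp y1 * dbar y1 + 2 * S * exp (c0 + 1) * K"
 show ?thesis
 proof (intro exI[of _ C] conjI ballI)
  show "0 <= C" unfolding C_def using dbar_nonneg S0 K by simp
  fix y assume y: "y \<in> {y1 - eps..y1 + eps}"
  define d where "d = \<bar>y - y1\<bar>"
  have d: "0 <= d" "d <= eps" using y by (auto simp: d_def)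
  have "exp y <= exp (ln K)" "exp y1 <= exp (ln K)" using y eps by (auto simp only: exp_le_cancel_iff atLeastAtMost_iff)
  then have yK: "exp y <= K" "exp y1 <= K" using K by auto
  have ed: "\<bar>exp y - exp y1\<bar> <= K * d" unfolding d_def by (rule exp_diff_le[OF yK])
  let ?I = "{ln K - y1 - d..ln K - y1 + d}"
  have i1: "integrable \<nu> (%z. max 0 (exp (y + z) - K))" "integrable \<nu> (%z. max 0 (exp (y1 + z) - K))"
   unfolding exp_add using yK by (auto intro!: call_integrable)
  have i2: "integrable \<nu> (%z. indicator {ln K - y1<..} z * (exp z * (exp y - exp y1)))"
   using integrable_mult_left[OF exp_tail_integrable[OF c0], of "exp y - exp y1"] by (simp add: c0_def mult.assoc)
  have t: "(LINT z|\<nu>. indicator {ln K - y1<..} z * (exp z * (exp y - exp y1))) = (dbar y1 - \<delta>) * (exp y - exp y1)"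
   unfolding dbar_def set_lebesgue_integral_def by (simp add: mult.assoc[symmetric])
  define R where "R = (LINT z|\<nu>. max 0 (exp (y + z) - K) - max 0 (exp (y1 + z) - K) - indicator {ln K - y1<..} z * (exp z * (exp y - exp y1)))"
  have R: "R = (LINT z|\<nu>. max 0 (exp (y + z) - K)) - (LINT z|\<nu>. max 0 (exp (y1 + z) - K)) - (dbar y1 - \<delta>) * (exp y - exp y1)"
   unfolding R_def t[symmetric]
   by (subst Bochner_Integration.integral_diff[OF Bochner_Integration.integrable_diff[OF i1] i2],
     subst Bochner_Integration.integral_diff[OF i1]) simp
  have "\<bar>R\<bar> <= (LINT z|\<nu>. \<bar>max 0 (exp (y + z) - K) - max 0 (exp (y1 + z) - K) - indicator {ln K - y1<..} z * (exp z * (exp y - exp y1))\<bar>)"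
   unfolding R_def by (rule integral_abs_bound)
  also have "... = (LINT z|lborel. s z * \<bar>max 0 (exp (y + z) - K) - max 0 (exp (y1 + z) - K) - indicator {ln K - y1<..} z * (exp z * (exp y - exp y1))\<bar>)"
   unfolding nu_eq by (subst integral_density) (auto simp: s_nonneg)
  also have "... <= (LINT z|lborel. S * exp (c0 + 1) * (K * d) * indicator ?I z)"
  proof (rule integral_mono')
   show "integrable lborel (%z. S * exp (c0 + 1) * (K * d) * indicator ?I z)"
    by (intro integrable_mult_right integrable_real_indicator) (auto simp: emeasure_lborel_Icc_eq)
   fix z
   show "0 <= S * exp (c0 + 1) * (K * d) * indicator ?I z" using S0 K d by simp
   have "s z * \<bar>max 0 (exp (y + z) - K) - max 0 (exp (y1 + z) - K) - indicator {ln K - y1<..} z * (exp z * (exp y - exp y1))\<bar>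
    <= s z * (indicator ?I z * (exp z * \<bar>exp y - exp y1\<bar>))"
    unfolding d_def by (intro mult_left_mono call_first_order s_nonneg)
   also have "... <= S * exp (c0 + 1) * (K * d) * indicator ?I z"
   proof (cases "z \<in> ?I")
    case True
    then have "s z <= S" using d by (intro S) auto
    moreover have "exp z <= exp (c0 + 1)" using True d eps by (simp add: c0_def)
    ultimately have "s z * (exp z * \<bar>exp y - exp y1\<bar>) <= S * (exp (c0 + 1) * (K * d))"
     using ed s_nonneg S0 by (intro mult_mono) auto
    then show ?thesis using True by (simp add: mult.assoc)
   qed simp
   finally show "s z * \<bar>max 0 (exp (y + z) - K) - max 0 (exp (y1 + z) - K) - indicator {ln K - y1<..} z * (exp z * (exp y - exp y1))\<bar>
     <= S * exp (c0 + 1) * (K * d) * indicator ?I z" .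
  qed
  also have "... = 2 * S * exp (c0 + 1) * K * d\<^sup>2" using d by (simp add: power2_eq_square)
  finally have Rb: "\<bar>R\<bar> <= 2 * S * exp (c0 + 1) * K * d\<^sup>2" .
  define Q where "Q = exp (y - y1) - 1 - (y - y1)"
  have Qb: "\<bar>Q\<bar> <= 2 * d\<^sup>2" unfolding Q_def d_def power2_abs using y eps by (intro exp_quadratic) auto
  have E: "exp y - exp y1 = exp y1 * ((y - y1) + Q)"
   unfolding Q_def by (simp add: algebra_simps exp_diff exp_minus)
  have "phi0 (exp y1) - phi0 (exp y) = R + dbar y1 * (exp y - exp y1)"
   unfolding phi0_def R exp_add by (simp add: algebra_simps)
  then have "phi0 (exp y1) - phi0 (exp y) - exp y1 * dbar y1 * (y - y1) = R + exp y1 * dbar y1 * Q"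
   unfolding E by (simp add: algebra_simps)
  moreover have "\<bar>exp y1 * dbar y1 * Q\<bar> <= exp y1 * dbar y1 * (2 * d\<^sup>2)"
   unfolding abs_mult[of "exp y1 * dbar y1"] using dbar_nonneg Qb by (intro mult_mono) auto
  ultimately have "\<bar>phi0 (exp y1) - phi0 (exp y) - exp y1 * dbar y1 * (y - y1)\<bar> <= 2 * S * exp (c0 + 1) * K * d\<^sup>2 + exp y1 * dbar y1 * (2 * d\<^sup>2)"
   using Rb by linarith
  also have "... = C * (y - y1)\<^sup>2" unfolding C_def d_def power2_abs by (simp add: algebra_simps)
  finally show "\<bar>phi0 (exp y1) - phi0 (exp y) - exp y1 * dbar y1 * (y - y1)\<bar> <= C * (y - y1)\<^sup>2" .
 qed
qed

end

section \<open>The put value as a limit of grid problems\<close>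

locale put_process = put_law gam \<sigma> s \<nu> mu r \<delta> K + grid_process M F Y mu
 for gam \<sigma> s \<nu> mu r \<delta> K and M :: "'a measure" and F Y +
 assumes Y_right_cont: "AE om in M. \<forall>t\<ge>0. ((%u. Y u om) \<longlongrightarrow> Y t om) (at_right t)"
begin

definition put_value :: "real \<Rightarrow> real \<Rightarrow> real" where
 "put_value th y = (SUP tau \<in> {tau. stopping_time F tau \<and> (\<forall>om\<in>space M. 0 <= tau om \<and> tau om <= th)}.
   expectation (%om. exp (- r * tau om) * put_payoff K (y + Y (tau om) om)))"

lemma payoff_bounds: "0 <= put_payoff K y" "put_payoff K y <= K"
 using K by (auto simp: put_payoff_def)

lemma disc_payoff_bounds: "0 <= t ==> 0 <= exp (- r * t) * put_payoff K y \<and> exp (- r * t) * put_payoff K y <= K"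
proof -
 assume t: "0 <= t"
 have "exp (- r * t) * put_payoff K y <= 1 * K"
  using payoff_bounds t r by (intro mult_mono) auto
 then show ?thesis using payoff_bounds by simp
qed

lemma put_payoff_measurable[measurable]: "put_payoff K \<in> borel_measurable borel"
 unfolding put_payoff_def[abs_def] by measurable

lemma put_value_upper_bound:
 assumes "!!om. om \<in> space M ==> 0 <= tau om"
 shows "expectation (%om. exp (- r * tau om) * put_payoff K (y + Y (tau om) om)) <= K"
proof -
 have "expectation (%om. exp (- r * tau om) * put_payoff K (y + Y (tau om) om)) <= expectation (%om. K)"
  using K disc_payoff_bounds assms by (intro integral_mono_AE') auto
 then show ?thesis using prob_space by simp
qed

lemma put_value_ge:
 assumes "stopping_time F tau" "!!om. om \<in> space M ==> 0 <= tau om \<and> tau om <= th"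
 shows "expectation (%om. exp (- r * tau om) * put_payoff K (y + Y (tau om) om)) <= put_value th y"
 unfolding put_value_def
proof (rule cSUP_upper)
 show "bdd_above ((%tau. expectation (%om. exp (- r * tau om) * put_payoff K (y + Y (tau om) om))) ` {tau. stopping_time F tau \<and> (\<forall>om\<in>space M. 0 <= tau om \<and> tau om <= th)})"
  by (rule bdd_aboveI2[where M=K], rule put_value_upper_bound) auto
qed (use assms in auto)

lemma put_value_ge_grid:
 assumes h: "0 < h" and kp: "gstop h n kp" and n: "real n * h <= th"
 shows "expectation (%om. exp (- r * (real (kp om) * h)) * put_payoff K (y + Y (real (kp om) * h) om)) <= put_value th y"
proof (rule put_value_ge[OF grid_stopping_time[OF h kp]])
 fix om assume "om \<in> space M"
 then have "kp om <= n" using kp unfolding gstop_def[OF less_imp_le[OF h]] by auto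
 then have "real (kp om) * h <= real n * h" using h by (intro mult_right_mono) auto
 moreover have "0 <= real (kp om) * h" using h by simp
 ultimately show "0 <= real (kp om) * h \<and> real (kp om) * h <= th" using n by linarith
qed

text \<open>A stopping time is approached from above by its roundings, so right continuity of paths
  and dominated convergence suffice. Bounds along one sequence of refining grids therefore bound the
  supremum over all stopping times.\<close>

lemma put_value_le:
 assumes th: "0 < th" and n: "!!i. 0 < n i" "filterlim n at_top sequentially"
  and b: "B \<longlonglongrightarrow> b"
  and bound: "\<forall>\<^sub>F i in sequentially. \<forall>kp. gstop (th / real (n i)) (n i) kp \<longrightarrow>
    expectation (%om. exp (- r * (real (kp om) * (th / real (n i)))) * put_payoff K (y + Y (real (kp om) * (th / real (n i))) om)) <= B i"
 shows "put_value th y <= b"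
 unfolding put_value_def
proof (rule cSUP_least)
 show "{tau. stopping_time F tau \<and> (\<forall>om\<in>space M. 0 <= tau om \<and> tau om <= th)} \<noteq> {}"
  using stopping_time_const[of F 0] th by (intro ex_in_conv[THEN iffD1] exI[of _ "%_. 0"]) auto
 fix tau assume "tau \<in> {tau. stopping_time F tau \<and> (\<forall>om\<in>space M. 0 <= tau om \<and> tau om <= th)}"
 then have tau: "stopping_time F tau" "!!om. om \<in> space M ==> 0 <= tau om \<and> tau om <= th" by auto
 define h where "h i = th / real (n i)" for i
 have h: "0 < h i" for i using th n(1) by (simp add: h_def)
 have nh: "real (n i) * h i = th" for i using n(1)[of i] by (simp add: h_def)
 have h0: "h \<longlonglongrightarrow> 0"
 proof -
  have "filterlim (%i. real (n i)) at_top sequentially" using n(2) filterlim_compose[OF filterlim_real_sequentially] by blast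
  then show ?thesis unfolding h_def by (intro tendsto_divide_0[OF tendsto_const] filterlim_at_top_imp_at_infinity)
 qed
 define kp where "kp i om = nat \<lceil>tau om / h i\<rceil>" for i om
 have gs: "gstop (h i) (n i) (kp i)" for i
  unfolding kp_def by (rule grid_round_up[OF tau(1) _ h]) (use tau(2) nh in auto)
 have up: "tau om <= real (kp i om) * h i" "real (kp i om) * h i <= tau om + h i" if "om \<in> space M" for i om
 proof -
  have t0: "0 <= tau om / h i" using tau(2)[OF that] h[of i] by simp
  then have k: "real (kp i om) = of_int \<lceil>tau om / h i\<rceil>" by (simp add: kp_def)
  have "tau om / h i <= real (kp i om)" "real (kp i om) <= tau om / h i + 1" unfolding k by linarith+
  then show "tau om <= real (kp i om) * h i" "real (kp i om) * h i <= tau om + h i"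
   using h[of i] by (auto simp: field_simps)
 qed
 define G where "G i om = exp (- r * (real (kp i om) * h i)) * put_payoff K (y + Y (real (kp i om) * h i) om)" for i om
 define Gt where "Gt om = exp (- r * tau om) * put_payoff K (y + Y (tau om) om)" for om
 have Bi: "\<forall>\<^sub>F i in sequentially. expectation (G i) <= B i"
  using bound by eventually_elim (use gs in \<open>auto simp: G_def[abs_def] h_def\<close>)
 have G0: "0 <= expectation (G i)" for i
  unfolding G_def using payoff_bounds by (intro Bochner_Integration.integral_nonneg) auto
 show "expectation (%om. exp (- r * tau om) * put_payoff K (y + Y (tau om) om)) <= b"
 proof (cases "Gt \<in> borel_measurable M")
  case False
  \<comment> \<open>A stopped payoff that fails to be measurable has integral 0 by convention, and
    \<open>b\<close> is nonnegative as a limit of bounds on nonnegative expectations.\<close>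
  then have "expectation Gt = 0" by (intro not_integrable_integral_eq) auto
  moreover have "0 <= b"
   by (rule tendsto_lowerbound[OF b]) (use Bi G0 in \<open>auto elim!: eventually_mono intro: order_trans\<close>)
  ultimately show ?thesis by (simp add: Gt_def[abs_def])
 next
  case True
  have Gm: "G i \<in> borel_measurable M" for i
  proof -
   interpret W: random_walk M "%k. F (real k * h i)" "%k. Y (real k * h i)" "mu (h i)" by (rule walk) (use h[of i] in simp)
   have [measurable]: "kp i \<in> measurable M (count_space UNIV)" by (rule W.grid_stopping_measurable[OF gs])
   have [measurable]: "(%om. Y (real k * h i) om) \<in> borel_measurable M" for k using h[of i] by (intro Y_meas) simp
   have "(%om. (%k om. exp (- r * (real k * h i)) * put_payoff K (y + Y (real k * h i) om)) (kp i om) om) \<in> borel_measurable M"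
    by (rule measurable_compose_countable[where g="kp i"]) measurable
   then show ?thesis by (simp add: G_def[abs_def])
  qed
  have "(%i. expectation (G i)) \<longlonglongrightarrow> expectation Gt"
  proof (rule integral_dominated_convergence[where w="%_. K"])
   show "AE om in M. norm (G i om) <= K" for i
    using disc_payoff_bounds h[of i] by (intro AE_I2) (auto simp: G_def)
   show "AE om in M. (%i. G i om) \<longlonglongrightarrow> Gt om"
    using Y_right_cont AE_space
   proof eventually_elim
    case (elim om)
    have tt: "(%i. real (kp i om) * h i) \<longlonglongrightarrow> tau om"
    proof (rule tendsto_sandwich[of "%_. tau om" _ _ "%i. tau om + h i"])
     show "(%i. tau om + h i) \<longlonglongrightarrow> tau om" using tendsto_add[OF tendsto_const h0, of "tau om"] by simp
    qed (use up[OF elim(2)] in auto)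
    have "(%i. Y (real (kp i om) * h i) om) \<longlonglongrightarrow> Y (tau om) om"
    proof -
     have r: "((%u. Y u om) \<longlongrightarrow> Y (tau om) om) (at_right (tau om))" using elim(1) tau(2)[OF elim(2)] by blast
     then have "((%u. Y u om) \<longlongrightarrow> Y (tau om) om) (at (tau om) within {tau om..})"
      by (simp add: at_within_Ici_at_right)
     then have "continuous (at (tau om) within {tau om..}) (%u. Y u om)" by (simp add: continuous_within)
     from continuous_within_tendsto_compose'[OF this _ tt] show ?thesis using up[OF elim(2)] by auto
    qed
    then show ?case unfolding G_def Gt_def put_payoff_def using tt by (intro tendsto_intros)
   qed
  qed (use True Gm in auto)
  then have "expectation Gt <= b"
   by (rule tendsto_le[OF sequentially_bot b _ Bi])
  then show ?thesis by (simp add: Gt_def[abs_def])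
 qed
qed

end

section \<open>Prices strictly above and strictly below the critical level\<close>

lemma gw_DERIV: "(gw has_real_derivative x * exp (- x\<^sup>2 / 2)) (at x)"
proof -
 have "(gw has_real_derivative 0 - exp (- x\<^sup>2 / 2) * (- (2 * x) / 2)) (at x)"
  unfolding gw_def[abs_def]
  by (intro DERIV_diff DERIV_const DERIV_fun_exp DERIV_cdivide DERIV_minus) (auto intro!: derivative_eq_intros)
 then show ?thesis by (simp add: mult.commute)
qed

lemma gw_quadratic: "\<bar>gw (y + x) - gw y - (y * exp (- y\<^sup>2 / 2)) * x\<bar> <= 3 * x\<^sup>2"
proof (rule quadratic_bound_of_DERIV[OF gw_DERIV])
 fix s t :: real
 show "\<bar>s * exp (- s\<^sup>2 / 2) - t * exp (- t\<^sup>2 / 2)\<bar> <= 3 * \<bar>s - t\<bar>"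
 proof (rule Lipschitz_of_DERIV)
  fix t :: real
  have "((%t. - t\<^sup>2 / 2) has_real_derivative - t) (at t)" by (auto intro!: derivative_eq_intros)
  then have "((%t. exp (- t\<^sup>2 / 2)) has_real_derivative exp (- t\<^sup>2 / 2) * (- t)) (at t)" by (rule DERIV_fun_exp)
  from DERIV_mult[OF DERIV_ident this]
  show "((%t. t * exp (- t\<^sup>2 / 2)) has_real_derivative (1 - t\<^sup>2) * exp (- t\<^sup>2 / 2)) (at t)"
   by (simp add: algebra_simps power2_eq_square)
  have "t\<^sup>2 / 2 <= exp (t\<^sup>2 / 2)" using exp_ge_add_one_self[of "t\<^sup>2 / 2"] by linarith
  then have "t\<^sup>2 * exp (- t\<^sup>2 / 2) <= 2 * (exp (t\<^sup>2 / 2) * exp (- t\<^sup>2 / 2))"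
   using mult_right_mono[of "t\<^sup>2 / 2" "exp (t\<^sup>2 / 2)" "2 * exp (- t\<^sup>2 / 2)"] by simp
  then have 1: "t\<^sup>2 * exp (- t\<^sup>2 / 2) <= 2" by (simp flip: exp_add)
  have 2: "exp (- t\<^sup>2 / 2) <= 1" "0 <= exp (- t\<^sup>2 / 2)" "0 <= t\<^sup>2 * exp (- t\<^sup>2 / 2)" by auto
  show "\<bar>(1 - t\<^sup>2) * exp (- t\<^sup>2 / 2)\<bar> <= 3" unfolding left_diff_distrib using 1 2 by linarith
 qed
qed

lemma gw'_bound: "\<bar>y * exp (- y\<^sup>2 / 2)\<bar> <= 1" for y :: real
proof -
 have "0 <= (\<bar>y\<bar> - 1)\<^sup>2" by simp
 then have "\<bar>y\<bar> <= 1 + y\<^sup>2 / 2" unfolding power2_diff by simp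
 also have "... <= exp (y\<^sup>2 / 2)" by (rule exp_ge_add_one_self)
 finally have "\<bar>y\<bar> * exp (- y\<^sup>2 / 2) <= exp (y\<^sup>2 / 2) * exp (- y\<^sup>2 / 2)" by (intro mult_right_mono) auto
 also have "... = 1" by (simp flip: exp_add)
 finally show ?thesis by (simp add: abs_mult)
qed

text \<open>\<open>gw\<close> will penalise leaving the starting point; this bounds the mean growth
  of the penalty per step. The constant is \<open>10 * 1 + 3 * 3\<close>.\<close>

lemma (in levy_law) gw_step: assumes h: "0 <= h" shows "step_op (mu h) gw y - gw y <= 19 * step_const * h"
proof -
 have "\<bar>step_op (mu h) gw y - gw y\<bar> <= h * step_const * (10 * 1 + 3 * 3)"
  by (rule step_bound[OF h _ _ gw'_bound gw_quadratic]) (use gw_nonneg gw_le_1 in auto)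
 then show ?thesis by (simp add: algebra_simps)
qed

context put_process
begin

lemma step_op_shift: "step_op (mu h) (%x. f (y + x)) x = step_op (mu h) f (y + x)"
 by (simp add: step_op_def add.assoc)

lemma disc_drift_mult: "0 < h ==> exp (- r * h) * step_op (mu h) (smooth_put K c eta) y - smooth_put K c eta y = h * disc_drift c eta h y"
 by (simp add: disc_drift_def)

lemma grid_dynkin:
 assumes h: "0 < h" and kp: "gstop h n kp" and eta: "0 < eta" "eta <= 1" and c: "c = 0 \<or> c = 1"
 shows "expectation (%om. exp (- r * (real (kp om) * h)) * smooth_put K c eta (y + Y (real (kp om) * h) om))
  = smooth_put K c eta y + (\<Sum>k<n. expectation (%om. indicator {om\<in>space M. k < kp om} om * (exp (- r * (real k * h)) * (h * disc_drift c eta h (y + Y (real k * h) om)))))"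
proof -
 have h0: "0 <= h" using h by simp
 interpret W: random_walk M "%k. F (real k * h)" "%k. Y (real k * h)" "mu h" by (rule walk[OF h0])
 note gm[measurable] = smooth_put_measurable[OF K eta c]
 define f where "f k x = exp (- r * (real k * h)) * smooth_put K c eta (y + x)" for k :: nat and x
 have fb: "\<bar>f k x\<bar> <= 6 * K" for k x
 proof -
  have "exp (- r * (real k * h)) * \<bar>smooth_put K c eta (y + x)\<bar> <= 1 * (6 * K)"
   using smooth_put_bound[OF K eta c] r h by (intro mult_mono) auto
  then show ?thesis by (simp add: f_def abs_mult)
 qed
 have st: "step_op (mu h) (f (Suc k)) x - f k x = exp (- r * (real k * h)) * (h * disc_drift c eta h (y + x))" for k x
 proof -
  have "exp (- r * (real (Suc k) * h)) = exp (- r * (real k * h)) * exp (- r * h)"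
   by (simp add: exp_add[symmetric] algebra_simps)
  then have "step_op (mu h) (f (Suc k)) x = exp (- r * (real k * h)) * (exp (- r * h) * step_op (mu h) (smooth_put K c eta) (y + x))"
   unfolding f_def step_op_def by (simp add: add.assoc)
  then show ?thesis unfolding f_def disc_drift_mult[OF h, symmetric] by (simp add: algebra_simps)
 qed
 have "expectation (%om. f (kp om) (Y (real (kp om) * h) om)) = expectation (%om. f 0 (Y (real 0 * h) om))
   + (\<Sum>k<n. expectation (%om. indicator {om\<in>space M. k < kp om} om * (step_op (mu h) (f (Suc k)) (Y (real k * h) om) - f k (Y (real k * h) om))))"
  by (rule W.stopped_expectation[OF kp _ fb]) (simp add: f_def[abs_def])
 moreover have "expectation (%om. f 0 (Y (real 0 * h) om)) = smooth_put K c eta y"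
  using Y_0_expectation[of "f 0"] by (simp add: f_def[abs_def])
 ultimately show ?thesis unfolding st by (simp only: f_def)
qed

text \<open>The deterministic rule of waiting until maturity is good enough: at this price the
  smoothed minorant has strictly positive drift over the single step \<open>th\<close>, and it
  coincides with the intrinsic value at the start.\<close>

lemma put_value_gt:
 assumes y: "y < ln K" and neg: "phi0 (exp y) < 0"
 shows "\<forall>\<^sub>F th in at_right 0. K - exp y < put_value th y"
proof -
 define eps where "eps = min 1 ((ln K - y) / 4)"
 have "eps <= (ln K - y) / 4" unfolding eps_def by (rule min.cobounded2)
 then have "y + 4 * eps <= ln K" by (simp add: field_simps)
 moreover have "0 < eps" "eps <= 1" using y by (simp_all add: eps_def)
 ultimately have eps: "0 < eps" "eps <= 1" "y + 4 * eps <= ln K" by auto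
 obtain S where S: "0 <= S" "!!z. z \<in> {ln K - y - 2 * eps..ln K - y + 2 * eps} ==> s z <= S"
  using density_bounded[of "ln K - y - 2 * eps" "ln K - y + 2 * eps"] eps by auto
 define q where "q = - phi0 (exp y)"
 have q: "0 < q" using neg by (simp add: q_def)
 \<comment> \<open>The drift is close to \<open>q\<close>; a quarter of \<open>q\<close> is reserved
   for the smoothing error and another quarter for the mesh error, so half of it survives.\<close>
 obtain eta where eta: "0 < eta" "eta <= eps" "2 * K * S * eta\<^sup>2 <= q / 4"
 proof -
  define eta where "eta = min eps (q / (8 * K * (S + 1)))"
  have p: "0 < 8 * K * (S + 1)" using K S by simp
  have e: "0 < eta" "eta <= eps" using eps q p by (auto simp: eta_def)
  have "eta\<^sup>2 <= eta * 1" using e eps unfolding power2_eq_square by (intro mult_left_mono) auto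
  moreover have "eta <= q / (8 * K * (S + 1))" by (simp add: eta_def)
  ultimately have "eta\<^sup>2 <= q / (8 * K * (S + 1))" by simp
  then have "eta\<^sup>2 * (8 * K * (S + 1)) <= q" using p by (simp add: pos_le_divide_eq)
  moreover have "0 <= eta\<^sup>2 * K" using K by simp
  ultimately have "2 * K * S * eta\<^sup>2 <= q / 4" by (simp add: algebra_simps)
  then show ?thesis using that e by blast
 qed
 have eta1: "eta <= 1" using eta eps by simp
 have "\<forall>\<^sub>F h in at_right 0. \<forall>y'\<in>{y - eps..y + eps}. \<bar>disc_drift 1 eta h y' + phi0 (exp y')\<bar> <= 2 * K * S * eta\<^sup>2 + q / 4"
  by (rule disc_drift_uniform[OF eps eta(1,2) _ _ S(2)]) (use q in auto)
 moreover have "\<forall>\<^sub>F h in at_right 0. (0::real) < h" by (auto simp: eventually_at_filter)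
 ultimately show ?thesis
 proof eventually_elim
  case (elim th)
  have "y \<in> {y - eps..y + eps}" using eps by simp
  from elim(1)[rule_format, OF this] have D: "0 < disc_drift 1 eta th y"
   using eta(3) q unfolding q_def by linarith
  have gs: "gstop th 1 (%_. 1)"
   unfolding gstop_def[OF less_imp_le[OF elim(2)]]
  proof (intro conjI allI ballI)
   fix k :: nat
   have sp: "space (F t) = space M" for t using F_sub[of t] by (simp add: subalgebra_def)
   show "{om \<in> space M. 1 <= k} \<in> sets (F (real k * th))"
    using sets.top[of "F (real k * th)"] by (cases "1 <= k") (simp_all add: sp)
  qed simp
  have [measurable]: "Y th \<in> borel_measurable M" using elim(2) by (intro Y_meas) simp
  note gm[measurable] = smooth_put_measurable[OF K eta(1) eta1, of 1, simplified]
  have "K - exp y = smooth_put K 1 eta y" using eps eta by (intro smooth_put_small[symmetric] eta1) auto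
  also have "... < smooth_put K 1 eta y + th * disc_drift 1 eta th y" using D elim(2) by simp
  also have "... = exp (- r * th) * step_op (mu th) (smooth_put K 1 eta) y" unfolding disc_drift_mult[OF elim(2), symmetric] by simp
  also have "... = expectation (%om. exp (- r * th) * smooth_put K 1 eta (y + Y th om))"
   unfolding step_op_def Y_law[symmetric, OF less_imp_le[OF elim(2)]] by (subst integral_distr) auto
  also have "... <= expectation (%om. exp (- r * th) * put_payoff K (y + Y th om))"
  proof (rule integral_mono)
   show "integrable M (%om. exp (- r * th) * smooth_put K 1 eta (y + Y th om))"
    by (intro integrable_mult_right integrable_const_bound[of _ "6 * K"]) (simp_all add: smooth_put_bound[OF K eta(1) eta1])
   show "integrable M (%om. exp (- r * th) * put_payoff K (y + Y th om))"
    by (intro integrable_mult_right integrable_const_bound[of _ K]) (simp_all add: payoff_bounds)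
  qed (intro mult_left_mono smooth_put_lower K eta, simp)
  also have "... <= put_value th y"
   using put_value_ge_grid[OF elim(2) gs, of th y] by simp
  finally show ?case .
 qed
qed

text \<open>The discounted majorant alone is a supermartingale only near \<open>y1\<close>. Adding a
  penalty \<open>\<Lambda> * (th - t) * gw\<close> repairs this: as time passes it releases
  \<open>\<Lambda> * gw\<close> per unit time, enough to absorb the uncontrolled drift at a
  distance. Near \<open>y1\<close> the negative drift absorbs the growth of the penalty once
  \<open>th\<close> is small.\<close>

lemma put_value_le_intrinsic:
 assumes eps: "0 < eps" "eps <= 1" "y1 + 4 * eps <= ln K" and q: "0 < q" "!!y. y \<in> {y1 - eps..y1 + eps} ==> q <= phi0 (exp y)"
 shows "\<forall>\<^sub>F th in at_right 0. put_value th y1 <= K - exp y1"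
proof -
 obtain S where S: "0 <= S" "!!z. z \<in> {ln K - y1 - 2 * eps..ln K - y1 + 2 * eps} ==> s z <= S"
  using density_bounded[of "ln K - y1 - 2 * eps" "ln K - y1 + 2 * eps"] eps by auto
 obtain eta where eta: "0 < eta" "eta <= eps" "2 * K * S * eta\<^sup>2 <= q / 4"
 proof -
  define eta where "eta = min eps (q / (8 * K * (S + 1)))"
  have p: "0 < 8 * K * (S + 1)" using K S by simp
  have e: "0 < eta" "eta <= eps" using eps q p by (auto simp: eta_def)
  have "eta\<^sup>2 <= eta * 1" using e eps unfolding power2_eq_square by (intro mult_left_mono) auto
  moreover have "eta <= q / (8 * K * (S + 1))" by (simp add: eta_def)
  ultimately have "eta\<^sup>2 <= q / (8 * K * (S + 1))" by simp
  then have "eta\<^sup>2 * (8 * K * (S + 1)) <= q" using p by (simp add: pos_le_divide_eq)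
  moreover have "0 <= eta\<^sup>2 * K" using K by simp
  ultimately have "2 * K * S * eta\<^sup>2 <= q / 4" by (simp add: algebra_simps)
  then show ?thesis using that e by blast
 qed
 have eta1: "eta <= 1" using eta eps by simp
 let ?g = "smooth_put K 0 eta"
 note gm[measurable] = smooth_put_measurable[OF K eta(1) eta1, of 0, simplified]
 define C1 where "C1 = (step_const * 123 + 6 * r) * K / eta"
 have C1: "0 <= C1" unfolding C1_def using step_const_nonneg r K eta by (intro divide_nonneg_pos mult_nonneg_nonneg add_nonneg_nonneg) auto
 have ge: "0 < gw eps" using eps by (intro gw_pos) simp
 \<comment> \<open>At distance \<open>eps\<close> the penalty releases at least
   \<open>\<Lambda> * gw eps = 2 * C1\<close>: one half pays for the drift bound \<open>C1\<close>,
   the other half for the growth of the penalty.\<close>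
 define \<Lambda> where "\<Lambda> = 2 * C1 / gw eps"
 have \<Lambda>: "0 <= \<Lambda>" "C1 = \<Lambda> * gw eps / 2" unfolding \<Lambda>_def using C1 ge by auto
 define A where "A = 19 * step_const"
 have A: "0 <= A" unfolding A_def using step_const_nonneg by simp
 have t: "((%th. A * th) \<longlongrightarrow> A * 0) (at_right 0)" "((%th. exp (- r * th)) \<longlongrightarrow> exp (- r * 0)) (at_right 0)" "((%th. \<Lambda> * (A * th)) \<longlongrightarrow> \<Lambda> * (A * 0)) (at_right 0)"
  by (intro tendsto_intros)+
 have "\<forall>\<^sub>F th in at_right 0. A * th < gw eps / 2" by (rule order_tendstoD(2)[OF t(1)]) (use ge in simp)
 moreover have "\<forall>\<^sub>F th in at_right 0. exp (- r * th) > 1 / 2" by (rule order_tendstoD(1)[OF t(2)]) simp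
 moreover have "\<forall>\<^sub>F th in at_right 0. \<Lambda> * (A * th) < q / 4" by (rule order_tendstoD(2)[OF t(3)]) (use q in simp)
 moreover have "\<forall>\<^sub>F h in at_right 0. (0::real) < h" by (auto simp: eventually_at_filter)
 ultimately show ?thesis
 proof eventually_elim
  case (elim th)
  have "\<forall>\<^sub>F h in at_right 0. \<forall>y'\<in>{y1 - eps..y1 + eps}. \<bar>disc_drift 0 eta h y' + phi0 (exp y')\<bar> <= 2 * K * S * eta\<^sup>2 + q / 4"
   by (rule disc_drift_uniform[OF eps eta(1,2) _ _ S(2)]) (use q in auto)
  moreover have "filterlim (%i. th / real (Suc i)) (at_right 0) sequentially"
  proof (rule tendsto_imp_filterlim_at_right)
   show "(%i. th / real (Suc i)) \<longlonglongrightarrow> 0"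
    using LIMSEQ_Suc[OF lim_const_over_n[of th]] by simp
  qed (use elim(4) in auto)
  ultimately have ev: "\<forall>\<^sub>F i in sequentially. \<forall>y'\<in>{y1 - eps..y1 + eps}. \<bar>disc_drift 0 eta (th / real (Suc i)) y' + phi0 (exp y')\<bar> <= 2 * K * S * eta\<^sup>2 + q / 4"
   by (rule eventually_compose_filterlim)
  show ?case
  proof (rule put_value_le[OF elim(4), where n=Suc and B="%_. K - exp y1"])
   show "filterlim Suc at_top sequentially" by (rule filterlim_Suc)
   show "\<forall>\<^sub>F i in sequentially. \<forall>kp. gstop (th / real (Suc i)) (Suc i) kp \<longrightarrow>
    expectation (%om. exp (- r * (real (kp om) * (th / real (Suc i)))) * put_payoff K (y1 + Y (real (kp om) * (th / real (Suc i))) om)) <= K - exp y1"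
    using ev
   proof eventually_elim
    case (elim i)
    define h where "h = th / real (Suc i)"
    define n where "n = Suc i"
    have h: "0 < h" using \<open>0 < th\<close> by (simp add: h_def)
    have nh: "real n * h = th" by (simp add: h_def n_def)
    have D: "disc_drift 0 eta h y <= - q / 2" if "y \<in> {y1 - eps..y1 + eps}" for y
     using elim[rule_format, OF that] q(2)[OF that] eta(3) unfolding h_def by linarith
    have "expectation (%om. exp (- r * (real (kp om) * h)) * put_payoff K (y1 + Y (real (kp om) * h) om)) <= K - exp y1"
     if kp: "gstop h n kp" for kp
    proof -
     interpret W: random_walk M "%k. F (real k * h)" "%k. Y (real k * h)" "mu h" by (rule walk) (use h in simp)
     have [measurable]: "{om\<in>space M. k < kp om} \<in> sets M" for k
      using W.grid_stopping_gt[OF kp] W.sets_G by blast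
     \<comment> \<open>As \<open>gw 0 = 0\<close>, the penalty costs nothing at the start, so the
       initial value of the supermartingale is exactly the intrinsic value.\<close>
     define f where "f k x = exp (- r * (real k * h)) * ?g (y1 + x) + \<Lambda> * max 0 (th - real k * h) * gw x" for k :: nat and x
     have fm[measurable]: "f k \<in> borel_measurable borel" for k unfolding f_def[abs_def] by measurable
     have fb: "\<bar>f k x\<bar> <= 6 * K + \<Lambda> * th" for k x
     proof -
      have "\<bar>exp (- r * (real k * h)) * ?g (y1 + x)\<bar> <= 1 * (6 * K)"
       unfolding abs_mult using smooth_put_bound[OF K eta(1) eta1] r h by (intro mult_mono) auto
      moreover have "\<bar>\<Lambda> * max 0 (th - real k * h) * gw x\<bar> <= \<Lambda> * th * 1"
       unfolding abs_mult using \<Lambda> gw_nonneg gw_le_1 h \<open>0 < th\<close> by (intro mult_mono) auto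
      ultimately show ?thesis unfolding f_def by linarith
     qed
     have neg: "step_op (mu h) (f (Suc k)) x - f k x <= 0" if k: "k < n" for k x
     proof -
      have "real (Suc k) * h <= real n * h" using k h by (intro mult_right_mono) auto
      then have kh: "real (Suc k) * h <= th" "real k * h <= th" using nh h by (auto simp: algebra_simps)
      have ee: "exp (- r * (real (Suc k) * h)) = exp (- r * (real k * h)) * exp (- r * h)"
       by (simp add: exp_add[symmetric] algebra_simps)
      have i1: "integrable (mu h) (%z. ?g (y1 + x + z))"
       by (rule W.law.step_op_integrable[OF gm, of "6 * K"]) (use smooth_put_bound[OF K eta(1) eta1] in auto)
      have i2: "integrable (mu h) (%z. gw (x + z))"
       by (rule W.law.step_op_integrable[of _ 1]) (use gw_nonneg gw_le_1 in auto)
      have "step_op (mu h) (f (Suc k)) x = exp (- r * (real (Suc k) * h)) * step_op (mu h) ?g (y1 + x) + \<Lambda> * (th - real (Suc k) * h) * step_op (mu h) gw x"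
       unfolding f_def step_op_def using i1 i2 kh by (simp add: add.assoc)
      also have "... - f k x = exp (- r * (real k * h)) * (exp (- r * h) * step_op (mu h) ?g (y1 + x) - ?g (y1 + x))
        + \<Lambda> * (th - real (Suc k) * h) * (step_op (mu h) gw x - gw x) - h * (\<Lambda> * gw x)"
       unfolding f_def ee using kh by (simp add: algebra_simps)
      also have "... = exp (- r * (real k * h)) * (h * disc_drift 0 eta h (y1 + x))
        + \<Lambda> * (th - real (Suc k) * h) * (step_op (mu h) gw x - gw x) - h * (\<Lambda> * gw x)"
       unfolding disc_drift_mult[OF h] ..
      also have "\<Lambda> * (th - real (Suc k) * h) * (step_op (mu h) gw x - gw x) <= h * (\<Lambda> * (A * th))"
      proof -
       have "(th - real (Suc k) * h) * (step_op (mu h) gw x - gw x) <= (th - real (Suc k) * h) * (A * h)"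
        using gw_step[of h x] h kh unfolding A_def by (intro mult_left_mono) auto
       also have "... <= th * (A * h)" using h A by (intro mult_right_mono) auto
       finally have "\<Lambda> * ((th - real (Suc k) * h) * (step_op (mu h) gw x - gw x)) <= \<Lambda> * (th * (A * h))"
        using \<Lambda> by (intro mult_left_mono) auto
       then show ?thesis by (simp add: algebra_simps)
      qed
      finally have main: "step_op (mu h) (f (Suc k)) x - f k x <= exp (- r * (real k * h)) * (h * disc_drift 0 eta h (y1 + x)) + h * (\<Lambda> * (A * th)) - h * (\<Lambda> * gw x)"
       by simp
      show ?thesis
      proof (cases "\<bar>x\<bar> <= eps")
       case True
       have "y1 + x \<in> {y1 - eps..y1 + eps}" using True by auto
       from D[OF this] have "h * disc_drift 0 eta h (y1 + x) <= h * (- q / 2)" using h by (intro mult_left_mono) auto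
       then have "exp (- r * (real k * h)) * (h * disc_drift 0 eta h (y1 + x)) <= exp (- r * (real k * h)) * (h * (- q / 2))" by (rule mult_left_mono) simp
       also have "... <= (1 / 2) * (h * (- q / 2))"
       proof (rule mult_right_mono_neg)
        have "exp (- r * th) <= exp (- r * (real k * h))" using kh r by (simp add: mult_left_mono)
        then show "1 / 2 <= exp (- r * (real k * h))" using \<open>exp (- r * th) > 1 / 2\<close> by linarith
       qed (use h q in simp)
       finally have "exp (- r * (real k * h)) * (h * disc_drift 0 eta h (y1 + x)) <= h * (- q / 4)" by simp
       moreover have "h * (\<Lambda> * (A * th)) <= h * (q / 4)" using h \<open>\<Lambda> * (A * th) < q / 4\<close> by (intro mult_left_mono) auto
       moreover have "0 <= h * (\<Lambda> * gw x)" using h \<Lambda> gw_nonneg by simp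
       ultimately show ?thesis using main by simp
      next
       case False
       have "exp (- r * (real k * h)) * (h * disc_drift 0 eta h (y1 + x)) <= exp (- r * (real k * h)) * (h * C1)"
        using disc_drift_bound[OF h eta(1) eta1, of 0 "y1 + x"] h unfolding C1_def by (intro mult_left_mono) auto
       also have "... <= 1 * (h * C1)" using h C1 r by (intro mult_right_mono) auto
       finally have 1: "exp (- r * (real k * h)) * (h * disc_drift 0 eta h (y1 + x)) <= h * (\<Lambda> * (gw eps / 2))"
        using \<Lambda>(2) by simp
       have 2: "h * (\<Lambda> * (A * th)) <= h * (\<Lambda> * (gw eps / 2))" using h \<Lambda> \<open>A * th < gw eps / 2\<close> by (intro mult_left_mono) auto
       have "gw eps <= gw x" using False eps by (intro gw_mono) auto
       then have 3: "h * (\<Lambda> * gw eps) <= h * (\<Lambda> * gw x)" using h \<Lambda> by (intro mult_left_mono) auto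
       show ?thesis using main 1 2 3 by (simp add: algebra_simps)
      qed
     qed
     have "expectation (%om. exp (- r * (real (kp om) * h)) * put_payoff K (y1 + Y (real (kp om) * h) om))
       <= expectation (%om. f (kp om) (Y (real (kp om) * h) om))"
     proof (rule integral_mono')
      have [measurable]: "kp \<in> measurable M (count_space UNIV)" by (rule W.grid_stopping_measurable[OF kp])
      have "(%om. (%k om. f k (Y (real k * h) om)) (kp om) om) \<in> borel_measurable M"
       by (rule measurable_compose_countable[where g=kp]) measurable
      then show "integrable M (%om. f (kp om) (Y (real (kp om) * h) om))"
       by (intro integrable_const_bound[of _ "6 * K + \<Lambda> * th"]) (use fb in auto)
      have le: "exp (- r * (real (kp om) * h)) * put_payoff K (y1 + Y (real (kp om) * h) om) <= f (kp om) (Y (real (kp om) * h) om)" for om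
      proof -
       have "exp (- r * (real (kp om) * h)) * put_payoff K (y1 + Y (real (kp om) * h) om) <= exp (- r * (real (kp om) * h)) * ?g (y1 + Y (real (kp om) * h) om)"
        by (intro mult_left_mono smooth_put_upper K eta) simp
       moreover have "0 <= \<Lambda> * max 0 (th - real (kp om) * h) * gw (Y (real (kp om) * h) om)" using \<Lambda> gw_nonneg by simp
       ultimately show ?thesis unfolding f_def by linarith
      qed
      show "exp (- r * (real (kp om) * h)) * put_payoff K (y1 + Y (real (kp om) * h) om) <= f (kp om) (Y (real (kp om) * h) om)" for om by (rule le)
      show "0 <= f (kp om) (Y (real (kp om) * h) om)" for om
       by (rule order_trans[OF _ le]) (use payoff_bounds in auto)
     qed
     also have "... = expectation (%om. f 0 (Y (real 0 * h) om))
       + (\<Sum>k<n. expectation (%om. indicator {om\<in>space M. k < kp om} om * (step_op (mu h) (f (Suc k)) (Y (real k * h) om) - f k (Y (real k * h) om))))"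
      by (rule W.stopped_expectation[OF kp _ fb]) simp
     also have "(\<Sum>k<n. expectation (%om. indicator {om\<in>space M. k < kp om} om * (step_op (mu h) (f (Suc k)) (Y (real k * h) om) - f k (Y (real k * h) om)))) <= 0"
     proof (rule sum_nonpos)
      fix k assume "k \<in> {..<n}"
      then have k: "k < n" by simp
      have "expectation (%om. indicator {om\<in>space M. k < kp om} om * (step_op (mu h) (f (Suc k)) (Y (real k * h) om) - f k (Y (real k * h) om))) <= expectation (%om. 0)"
       by (rule integral_mono') (use neg[OF k] in \<open>auto intro!: mult_nonneg_nonpos\<close>)
      then show "expectation (%om. indicator {om\<in>space M. k < kp om} om * (step_op (mu h) (f (Suc k)) (Y (real k * h) om) - f k (Y (real k * h) om))) <= 0" by simp
     qed
     also have "expectation (%om. f 0 (Y (real 0 * h) om)) = f 0 0" using Y_0_expectation[OF fm[of 0]] by simp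
     also have "f 0 0 = K - exp y1" using eps eta by (simp add: f_def smooth_put_small[OF eta1 eta(1)])
     finally show ?thesis by simp
    qed
    then show ?case unfolding h_def n_def by blast
   qed
  qed auto
 qed
qed

end

section \<open>The early exercise gain near the critical level\<close>

context put_process
begin

lemma trunc_moment_Y:
 assumes t: "0 <= t" shows "expectation (%om. min 1 ((Y t om)\<^sup>2)) <= 3 * step_const * t"
proof -
 have [measurable]: "Y t \<in> borel_measurable M" by (rule Y_meas[OF t])
 have "expectation (%om. min 1 ((Y t om)\<^sup>2)) = (LINT x|mu t. min 1 (x\<^sup>2))"
  unfolding Y_law[OF t, symmetric] by (subst integral_distr) auto
 then show ?thesis using trunc_second_moment[OF t] by simp
qed

text \<open>Every error is put in the form of a constant plus a multiple of
  \<open>min 1 (x\<^sup>2)\<close>, because the mean of the latter along the process is of the order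
  of the horizon. Near \<open>y1\<close> the errors come from discounting, the uniform limit, the
  expansion of \<open>phi0\<close> and truncation; elsewhere both terms are bounded crudely.\<close>

lemma drift_pointwise:
 assumes U: "!!y. y \<in> {y1 - eps..y1 + eps} ==> \<bar>D y + phi0 (exp y)\<bar> <= E"
  and X: "!!y. y \<in> {y1 - eps..y1 + eps} ==> \<bar>phi0 (exp y) + \<beta> * (y - y1)\<bar> <= C0 * (y - y1)\<^sup>2"
  and B: "!!y. \<bar>D y\<bar> <= C2" and eps: "0 < eps" "eps <= 1" and \<alpha>: "\<bar>\<alpha>\<bar> <= eps / 2" and rho: "0 < rho" "rho <= 1"
  and \<beta>: "0 <= \<beta>" and C0: "0 <= C0" and E: "0 <= E" "E <= E1" and t: "0 <= t" "t <= th"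
 shows "\<bar>exp (- r * t) * D (y1 + \<alpha> + x) - \<beta> * (\<alpha> + truncr rho x)\<bar>
   <= r * th * (E1 + \<beta> + C0) + E + 2 * C0 * \<alpha>\<^sup>2 + (2 * C0 + \<beta> / rho + (C2 + 2 * \<beta>) * (4 / eps\<^sup>2)) * min 1 (x\<^sup>2)"
proof -
 have C2: "0 <= C2" using B[of 0] by linarith
 define P where "P = r * th * (E1 + \<beta> + C0) + E + 2 * C0 * \<alpha>\<^sup>2"
 define Q1 where "Q1 = 2 * C0 + \<beta> / rho"
 define Q2 where "Q2 = (C2 + 2 * \<beta>) * (4 / eps\<^sup>2)"
 have P0: "0 <= P" unfolding P_def using r t \<beta> C0 E by (intro add_nonneg_nonneg mult_nonneg_nonneg) auto
 have Q: "0 <= Q1" "0 <= Q2" unfolding Q1_def Q2_def using \<beta> C0 C2 rho by (auto intro!: add_nonneg_nonneg mult_nonneg_nonneg)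
 have m0: "0 <= min 1 (x\<^sup>2)" by simp
 have "\<bar>exp (- r * t) * D (y1 + \<alpha> + x) - \<beta> * (\<alpha> + truncr rho x)\<bar> <= P + (Q1 + Q2) * min 1 (x\<^sup>2)"
 proof (cases "\<bar>x\<bar> <= eps / 2")
  case True
  define v where "v = \<alpha> + x"
  define d where "d = D (y1 + \<alpha> + x)"
  define f where "f = phi0 (exp (y1 + \<alpha> + x))"
  have v: "\<bar>v\<bar> <= eps" using True \<alpha> unfolding v_def by simp
  have I: "y1 + \<alpha> + x \<in> {y1 - eps..y1 + eps}" using v unfolding v_def by (auto simp: abs_le_iff)
  have 1: "\<bar>d + f\<bar> <= E" using U[OF I] unfolding d_def f_def .
  have "y1 + \<alpha> + x - y1 = v" by (simp add: v_def)
  then have 2: "\<bar>f + \<beta> * v\<bar> <= C0 * v\<^sup>2" using X[OF I] unfolding f_def by simp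
  have v1: "\<bar>v\<bar> <= 1" "v\<^sup>2 <= 1" using v eps by (auto simp: abs_square_le_1)
  have 3: "\<bar>\<beta> * v\<bar> <= \<beta>" unfolding abs_mult using v1 \<beta> mult_left_mono[of "\<bar>v\<bar>" 1 \<beta>] by simp
  have 4: "C0 * v\<^sup>2 <= C0" using v1 C0 mult_left_mono[of "v\<^sup>2" 1 C0] by simp
  have 5: "\<bar>d\<bar> <= E1 + \<beta> + C0" using 1 2 3 4 E by linarith
  have "exp (- r * t) * d - d = - ((1 - exp (- r * t)) * d)" by (simp add: algebra_simps)
  then have "\<bar>exp (- r * t) * d - d\<bar> = \<bar>1 - exp (- r * t)\<bar> * \<bar>d\<bar>" by (simp only: abs_minus_cancel abs_mult)
  also have "\<bar>1 - exp (- r * t)\<bar> = 1 - exp (- r * t)" using exp_minus_one_le[OF t(1)] by (intro abs_of_nonneg) blast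
  finally have "\<bar>exp (- r * t) * d - d\<bar> = (1 - exp (- r * t)) * \<bar>d\<bar>" .
  also have "... <= (r * th) * (E1 + \<beta> + C0)"
  proof (rule mult_mono)
   show "1 - exp (- r * t) <= r * th" using exp_minus_one_le[OF t(1)] mult_left_mono[OF t(2) r] by linarith
  qed (use 5 r t in auto)
  finally have 6: "\<bar>exp (- r * t) * d - d\<bar> <= r * th * (E1 + \<beta> + C0)" .
  have "0 <= (\<alpha> - x)\<^sup>2" by simp
  then have "v\<^sup>2 <= 2 * \<alpha>\<^sup>2 + 2 * x\<^sup>2" unfolding v_def power2_sum power2_diff by simp
  then have 7: "C0 * v\<^sup>2 <= C0 * (2 * \<alpha>\<^sup>2 + 2 * x\<^sup>2)" using C0 by (rule mult_left_mono)
  have 8: "\<bar>\<beta> * v - \<beta> * (\<alpha> + truncr rho x)\<bar> <= \<beta> * (x\<^sup>2 / rho)"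
  proof -
   have eq: "\<beta> * v - \<beta> * (\<alpha> + truncr rho x) = \<beta> * (x - truncr rho x)" by (simp add: v_def algebra_simps)
   show ?thesis unfolding eq abs_mult abs_of_nonneg[OF \<beta>] by (intro mult_left_mono truncr_error rho \<beta>)
  qed
  have m: "min 1 (x\<^sup>2) = x\<^sup>2"
  proof -
   have "\<bar>x\<bar> <= 1" using True eps by simp
   then show ?thesis by (simp add: abs_square_le_1)
  qed
  have "\<bar>exp (- r * t) * d - \<beta> * (\<alpha> + truncr rho x)\<bar> <= r * th * (E1 + \<beta> + C0) + E + C0 * (2 * \<alpha>\<^sup>2 + 2 * x\<^sup>2) + \<beta> * (x\<^sup>2 / rho)"
   using 1 2 6 7 8 by linarith
  also have "... = P + Q1 * min 1 (x\<^sup>2)" unfolding m P_def Q1_def by (simp add: algebra_simps)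
  also have "... <= P + (Q1 + Q2) * min 1 (x\<^sup>2)" using Q m0 by (intro add_left_mono mult_right_mono) auto
  finally show ?thesis unfolding d_def .
 next
  case False
  \<comment> \<open>Chebyshev's inequality before taking means: away from 0 the factor
    \<open>4 / eps\<^sup>2 * min 1 (x\<^sup>2)\<close> is at least 1 and may multiply any
    constant.\<close>
  have "(eps / 2)\<^sup>2 <= \<bar>x\<bar>\<^sup>2" using False eps by (intro power_mono) auto
  moreover have "(eps / 2)\<^sup>2 <= 1" using eps by (simp add: power_le_one)
  ultimately have "eps\<^sup>2 / 4 <= min 1 (x\<^sup>2)" by (simp add: power_divide)
  then have "4 / eps\<^sup>2 * (eps\<^sup>2 / 4) <= 4 / eps\<^sup>2 * min 1 (x\<^sup>2)" by (intro mult_left_mono) auto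
  then have g: "1 <= 4 / eps\<^sup>2 * min 1 (x\<^sup>2)" using eps by simp
  have "\<bar>exp (- r * t) * D (y1 + \<alpha> + x)\<bar> <= 1 * C2"
   unfolding abs_mult using B r t by (intro mult_mono) auto
  moreover have "\<bar>\<beta> * (\<alpha> + truncr rho x)\<bar> <= \<beta> * 2"
   unfolding abs_mult using \<beta> \<alpha> eps truncr_bound[of rho x] rho by (intro mult_mono) auto
  ultimately have "\<bar>exp (- r * t) * D (y1 + \<alpha> + x) - \<beta> * (\<alpha> + truncr rho x)\<bar> <= 1 * C2 + \<beta> * 2"
   by (rule order_trans[OF abs_triangle_ineq4 add_mono])
  also have "... = (C2 + 2 * \<beta>) * 1" by simp
  finally have "\<bar>exp (- r * t) * D (y1 + \<alpha> + x) - \<beta> * (\<alpha> + truncr rho x)\<bar> <= (C2 + 2 * \<beta>) * 1" .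
  also have "... <= (C2 + 2 * \<beta>) * (4 / eps\<^sup>2 * min 1 (x\<^sup>2))" using g C2 \<beta> by (intro mult_left_mono) auto
  also have "... = Q2 * min 1 (x\<^sup>2)" unfolding Q2_def by simp
  also have "... <= P + (Q1 + Q2) * min 1 (x\<^sup>2)"
   using P0 mult_nonneg_nonneg[OF Q(1) m0] by (simp add: distrib_right)
  finally show ?thesis .
 qed
 then show ?thesis unfolding P_def Q1_def Q2_def by simp
qed

text \<open>Each step of length \<open>h\<close> contributes \<open>h\<close> times the pointwise
  bound with \<open>min 1 (x\<^sup>2)\<close> replaced by its mean, and the steps add up to the
  horizon. The bound does not depend on the stopping rule.\<close>

lemma grid_error:
 assumes h: "0 < h" and kp: "gstop h n kp" and nh: "real n * h = th" and eta: "0 < eta" "eta <= 1" and c: "c = 0 \<or> c = 1"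
  and pt: "!!t x. 0 <= t ==> t <= th ==> \<bar>exp (- r * t) * disc_drift c eta h (y + x) - \<phi> x\<bar> <= P + Q * min 1 (x\<^sup>2)"
  and PQ: "0 <= P" "0 <= Q" and \<phi>[measurable]: "\<phi> \<in> borel_measurable borel" and \<phi>b: "!!x. \<bar>\<phi> x\<bar> <= B"
 shows "\<bar>expectation (%om. exp (- r * (real (kp om) * h)) * smooth_put K c eta (y + Y (real (kp om) * h) om))
   - smooth_put K c eta y - rew h (%x. h * \<phi> x) n kp\<bar> <= th * (P + Q * (3 * step_const * th))"
proof -
 have h0: "0 <= h" using h by simp
 interpret W: random_walk M "%k. F (real k * h)" "%k. Y (real k * h)" "mu h" by (rule walk[OF h0])
 have [measurable]: "{om\<in>space M. k < kp om} \<in> sets M" for k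
  using W.grid_stopping_gt[OF kp] W.sets_G by blast
 note gm[measurable] = smooth_put_measurable[OF K eta c]
 have dm[measurable]: "disc_drift c eta h \<in> borel_measurable borel"
  unfolding disc_drift_def[abs_def] by measurable
 have Ym[measurable]: "(%om. Y (real k * h) om) \<in> borel_measurable M" for k using h by (intro Y_meas) simp
 let ?I = "%k. indicator {om\<in>space M. k < kp om} :: 'a \<Rightarrow> real"
 let ?a = "%k om. ?I k om * (exp (- r * (real k * h)) * (h * disc_drift c eta h (y + Y (real k * h) om)))"
 let ?b = "%k om. ?I k om * (h * \<phi> (Y (real k * h) om))"
 define C where "C = (step_const * 123 + 6 * r) * K / eta"
 have ib: "\<bar>indicator S x * z\<bar> <= D" if "\<bar>z\<bar> <= D" for z D :: real and x :: 'a and S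
  using that by (auto simp: indicator_def)
 have ia: "integrable M (?a k)" for k
 proof (rule integrable_const_bound[of _ "1 * (h * C)"])
  have "\<bar>exp (- r * (real k * h)) * (h * disc_drift c eta h x)\<bar> <= 1 * (h * C)" for x
   unfolding abs_mult[of "exp (- r * (real k * h))"] abs_mult[of h] C_def
   using disc_drift_bound[OF h eta c] h r by (intro mult_mono) auto
  then show "AE om in M. norm (?a k om) <= 1 * (h * C)" unfolding real_norm_def by (intro AE_I2 ib)
 qed simp
 have ibb: "integrable M (?b k)" for k
 proof (rule integrable_const_bound[of _ "h * B"])
  have "\<bar>h * \<phi> x\<bar> <= h * B" for x using \<phi>b[of x] h by (simp add: abs_mult)
  then show "AE om in M. norm (?b k om) <= h * B" unfolding real_norm_def by (intro AE_I2 ib)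
 qed simp
 have im: "integrable M (%om. min 1 ((Y (real k * h) om)\<^sup>2))" for k
  by (rule integrable_const_bound[of _ 1]) auto
 have each: "\<bar>expectation (?a k) - expectation (?b k)\<bar> <= h * (P + Q * (3 * step_const * th))" if "k < n" for k
 proof -
  have "real k * h <= real n * h" using that h by (intro mult_right_mono) auto
  then have kh: "0 <= real k * h" "real k * h <= th" using nh h by auto
  have "\<bar>expectation (?a k) - expectation (?b k)\<bar> = \<bar>expectation (%om. ?a k om - ?b k om)\<bar>"
   by (simp only: Bochner_Integration.integral_diff[OF ia ibb])
  also have "... <= expectation (%om. \<bar>?a k om - ?b k om\<bar>)" by (rule integral_abs_bound)
  also have "... <= expectation (%om. h * P + h * Q * min 1 ((Y (real k * h) om)\<^sup>2))"
  proof (rule integral_mono)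
   show "integrable M (%om. \<bar>?a k om - ?b k om\<bar>)" by (intro integrable_abs Bochner_Integration.integrable_diff ia ibb)
   show "integrable M (%om. h * P + h * Q * min 1 ((Y (real k * h) om)\<^sup>2))"
    by (intro Bochner_Integration.integrable_add integrable_mult_right im integrable_const)
   fix om
   define x where "x = Y (real k * h) om"
   have eq: "?a k om - ?b k om = ?I k om * (h * (exp (- r * (real k * h)) * disc_drift c eta h (y + x) - \<phi> x))"
    unfolding x_def by (simp add: algebra_simps)
   have "\<bar>h * (exp (- r * (real k * h)) * disc_drift c eta h (y + x) - \<phi> x)\<bar> <= h * (P + Q * min 1 (x\<^sup>2))"
    unfolding abs_mult[of h] using pt[OF kh, of x] h by (intro mult_mono) auto
   also have "... = h * P + h * Q * min 1 ((Y (real k * h) om)\<^sup>2)" unfolding x_def by (simp only: distrib_left mult.assoc)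
   finally show "\<bar>?a k om - ?b k om\<bar> <= h * P + h * Q * min 1 ((Y (real k * h) om)\<^sup>2)"
    unfolding eq by (rule ib)
  qed
  also have "... = h * P + h * Q * expectation (%om. min 1 ((Y (real k * h) om)\<^sup>2))"
  proof -
   have "expectation (%om. h * P + h * Q * min 1 ((Y (real k * h) om)\<^sup>2)) = expectation (%om. h * P) + expectation (%om. h * Q * min 1 ((Y (real k * h) om)\<^sup>2))"
    by (rule Bochner_Integration.integral_add) (auto intro!: integrable_mult_right im)
   then show ?thesis using prob_space by simp
  qed
  also have "... <= h * P + h * Q * (3 * step_const * th)"
  proof (intro add_left_mono mult_left_mono)
   have "3 * step_const * (real k * h) <= 3 * step_const * th" using kh step_const_nonneg by (intro mult_left_mono) auto
   then show "expectation (%om. min 1 ((Y (real k * h) om)\<^sup>2)) <= 3 * step_const * th"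
    using trunc_moment_Y[OF kh(1)] by linarith
  qed (use h PQ in simp)
  finally show ?thesis by (simp add: algebra_simps)
 qed
 have eq: "expectation (%om. exp (- r * (real (kp om) * h)) * smooth_put K c eta (y + Y (real (kp om) * h) om))
   - smooth_put K c eta y - rew h (%x. h * \<phi> x) n kp = (\<Sum>k<n. expectation (?a k) - expectation (?b k))"
  unfolding grid_dynkin[OF h kp eta c] rew_def sum_subtractf add_diff_cancel_left' by (rule refl)
 have "\<bar>\<Sum>k<n. expectation (?a k) - expectation (?b k)\<bar> <= (\<Sum>k<n. \<bar>expectation (?a k) - expectation (?b k)\<bar>)" by (rule sum_abs)
 also have "... <= (\<Sum>k<n. h * (P + Q * (3 * step_const * th)))" by (intro sum_mono each) simp
 also have "... = th * (P + Q * (3 * step_const * th))" using nh by (simp add: mult.assoc[symmetric])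
 finally show ?thesis unfolding eq .
qed

end

context put_process
begin

text \<open>The order of quantifiers carries the argument: \<open>A\<close> is independent of
  \<open>p\<close>, \<open>R\<close>, the smoothing side \<open>c\<close> and the stopping rule,
  while the admissible mesh may depend on \<open>p\<close>, \<open>R\<close> and \<open>c\<close>.
  The level \<open>R\<close> enters the error only as \<open>1 / R\<close>.\<close>

lemma main_grid:
 assumes y1: "y1 < ln K" and root: "phi0 (exp y1) = 0"
 shows "\<exists>A>0. \<forall>\<^sub>F p in at_right 0. \<forall>R c. 1 <= R \<longrightarrow> R * p ^ 4 <= 1 \<longrightarrow> c = 0 \<or> c = 1 \<longrightarrow>
   (\<forall>\<^sub>F h in at_right 0. \<forall>n kp. real n * h = p ^ 8 \<longrightarrow> gstop h n kp \<longrightarrow>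
    \<bar>expectation (%om. exp (- r * (real (kp om) * h)) * smooth_put K c (p ^ 3) (y1 + a * p ^ 4 + Y (real (kp om) * h) om))
     - (K - exp (y1 + a * p ^ 4)) - rew h (%x. h * (exp y1 * dbar y1 * (a * p ^ 4 + truncr (R * p ^ 4) x))) n kp\<bar>
    <= A * p ^ 12 * (1 / R + p))"
proof -
 define \<beta> where "\<beta> = exp y1 * dbar y1"
 have \<beta>: "0 <= \<beta>" unfolding \<beta>_def using dbar_nonneg by simp
 define eps where "eps = min 1 ((ln K - y1) / 4)"
 have "eps <= (ln K - y1) / 4" unfolding eps_def by (rule min.cobounded2)
 then have "y1 + 4 * eps <= ln K" by (simp add: field_simps)
 moreover have "0 < eps" "eps <= 1" using y1 by (simp_all add: eps_def)
 ultimately have eps: "0 < eps" "eps <= 1" "y1 + 4 * eps <= ln K" by auto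
 obtain S where S: "0 <= S" "!!z. z \<in> {ln K - y1 - 2 * eps..ln K - y1 + 2 * eps} ==> s z <= S"
  using density_bounded[of "ln K - y1 - 2 * eps" "ln K - y1 + 2 * eps"] eps by auto
 obtain C0 where C0: "0 <= C0" "!!y. y \<in> {y1 - eps..y1 + eps} ==> \<bar>phi0 (exp y) + \<beta> * (y - y1)\<bar> <= C0 * (y - y1)\<^sup>2"
 proof -
  obtain C where C: "0 <= C" "\<forall>y\<in>{y1 - eps..y1 + eps}. \<bar>phi0 (exp y1) - phi0 (exp y) - exp y1 * dbar y1 * (y - y1)\<bar> <= C * (y - y1)\<^sup>2"
   using phi0_expansion[OF eps S(2)] by auto
  have "\<bar>phi0 (exp y) + \<beta> * (y - y1)\<bar> <= C * (y - y1)\<^sup>2" if "y \<in> {y1 - eps..y1 + eps}" for y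
  proof -
   have "phi0 (exp y) + \<beta> * (y - y1) = - (phi0 (exp y1) - phi0 (exp y) - exp y1 * dbar y1 * (y - y1))"
    unfolding root \<beta>_def by simp
   then show ?thesis using C(2)[rule_format, OF that] by (simp only: abs_minus_cancel)
  qed
  with C(1) show ?thesis using that by blast
 qed
 define sc where "sc = step_const"
 have sc: "0 <= sc" unfolding sc_def by (rule step_const_nonneg)
 define E1 where "E1 = 2 * K * S + 1"
 define C1 where "C1 = (step_const * 123 + 6 * r) * K"
 have C1: "0 <= C1" unfolding C1_def using step_const_nonneg r K by (intro mult_nonneg_nonneg add_nonneg_nonneg) auto
 have E1: "0 <= E1" unfolding E1_def using K S by simp
 define a1 where "a1 = r * (E1 + \<beta> + C0) + 1 + 2 * C0 * a\<^sup>2"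
 define a2 where "a2 = 2 * K * S"
 define a3 where "a3 = 3 * sc * (2 * C0 + 8 * \<beta> / eps\<^sup>2)"
 define a4 where "a4 = 12 * sc * C1 / eps\<^sup>2"
 define a5 where "a5 = 3 * sc * \<beta>"
 have a0: "0 <= a1" "0 <= a2" "0 <= a3" "0 <= a4" "0 <= a5"
  unfolding a1_def a2_def a3_def a4_def a5_def using r E1 \<beta> C0 K S sc C1 by auto
 define A where "A = a1 + a2 + a3 + a4 + a5 + 1"
 have A: "0 < A" unfolding A_def using a0 by simp
 define p0 where "p0 = min eps (eps / (2 * (\<bar>a\<bar> + 1)))"
 have p0: "0 < p0" unfolding p0_def using eps by simp
 have "\<forall>\<^sub>F p in at_right 0. 0 < p \<and> p < p0"
  using p0 by (auto simp: eventually_at_right_field)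
 then have "\<forall>\<^sub>F p in at_right 0. \<forall>R c. 1 <= R \<longrightarrow> R * p ^ 4 <= 1 \<longrightarrow> c = 0 \<or> c = 1 \<longrightarrow>
   (\<forall>\<^sub>F h in at_right 0. \<forall>n kp. real n * h = p ^ 8 \<longrightarrow> gstop h n kp \<longrightarrow>
    \<bar>expectation (%om. exp (- r * (real (kp om) * h)) * smooth_put K c (p ^ 3) (y1 + a * p ^ 4 + Y (real (kp om) * h) om))
     - (K - exp (y1 + a * p ^ 4)) - rew h (%x. h * (\<beta> * (a * p ^ 4 + truncr (R * p ^ 4) x))) n kp\<bar>
    <= A * p ^ 12 * (1 / R + p))"
 proof eventually_elim
  case (elim p)
  then have p: "0 < p" "p <= eps" "p <= eps / (2 * (\<bar>a\<bar> + 1))" "p <= 1" using eps unfolding p0_def by auto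
  have pl: "p ^ k <= p" if "1 <= k" for k using power_decreasing[OF that, of p] p by simp
  have eta: "0 < p ^ 3" "p ^ 3 <= eps" "p ^ 3 <= 1" using p pl[of 3] eps by auto
  define \<alpha> where "\<alpha> = a * p ^ 4"
  have \<alpha>: "\<bar>\<alpha>\<bar> <= eps / 2"
  proof -
   have "\<bar>\<alpha>\<bar> = \<bar>a\<bar> * p ^ 4" using p by (simp add: \<alpha>_def abs_mult)
   also have "... <= (\<bar>a\<bar> + 1) * (eps / (2 * (\<bar>a\<bar> + 1)))" using p pl[of 4] by (intro mult_mono) auto
   also have "... = eps / 2" by (simp add: field_simps)
   finally show ?thesis .
  qed
  show ?case
  proof (intro allI impI)
   fix R c :: real assume R: "1 <= R" "R * p ^ 4 <= 1" and c: "c = 0 \<or> c = 1"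
   define rho where "rho = R * p ^ 4"
   have rho: "0 < rho" "rho <= 1" using R p by (auto simp: rho_def)
   \<comment> \<open>The free tolerance of \<open>disc_drift_uniform\<close> is set to
     \<open>p ^ 8\<close>; multiplied by the horizon it contributes only
     \<open>p ^ 16\<close>.\<close>
   define E where "E = 2 * K * S * (p ^ 3)\<^sup>2 + p ^ 8"
   have E: "0 <= E" "E <= E1"
   proof -
    show "0 <= E" unfolding E_def using K S p by simp
    have "2 * K * S * (p ^ 3)\<^sup>2 <= 2 * K * S * 1" using K S p by (intro mult_left_mono power_le_one) auto
    then show "E <= E1" unfolding E_def E1_def using pl[of 8] p by simp
   qed
   have "\<forall>\<^sub>F h in at_right 0. \<forall>y\<in>{y1 - eps..y1 + eps}. \<bar>disc_drift c (p ^ 3) h y + phi0 (exp y)\<bar> <= 2 * K * S * (p ^ 3)\<^sup>2 + p ^ 8"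
    by (rule disc_drift_uniform[OF eps eta(1,2) c _ S(2)]) (use p in auto)
   moreover have "\<forall>\<^sub>F h in at_right 0. (0::real) < h" by (auto simp: eventually_at_filter)
   ultimately show "\<forall>\<^sub>F h in at_right 0. \<forall>n kp. real n * h = p ^ 8 \<longrightarrow> gstop h n kp \<longrightarrow>
    \<bar>expectation (%om. exp (- r * (real (kp om) * h)) * smooth_put K c (p ^ 3) (y1 + a * p ^ 4 + Y (real (kp om) * h) om))
     - (K - exp (y1 + a * p ^ 4)) - rew h (%x. h * (\<beta> * (a * p ^ 4 + truncr (R * p ^ 4) x))) n kp\<bar>
    <= A * p ^ 12 * (1 / R + p)"
   proof eventually_elim
    case (elim h)
    have U: "\<bar>disc_drift c (p ^ 3) h y + phi0 (exp y)\<bar> <= E" if "y \<in> {y1 - eps..y1 + eps}" for y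
     using elim(1) that unfolding E_def by blast
    define C2 where "C2 = C1 / p ^ 3"
    have C2: "\<bar>disc_drift c (p ^ 3) h y\<bar> <= C2" for y
     unfolding C2_def C1_def by (rule disc_drift_bound[OF elim(2) eta(1,3) c])
    define P where "P = r * p ^ 8 * (E1 + \<beta> + C0) + E + 2 * C0 * \<alpha>\<^sup>2"
    define Q where "Q = 2 * C0 + \<beta> / rho + (C2 + 2 * \<beta>) * (4 / eps\<^sup>2)"
    have PQ: "0 <= P" "0 <= Q" unfolding P_def Q_def C2_def using r p E1 \<beta> C0 E rho C1 by auto
    have pt: "\<bar>exp (- r * t) * disc_drift c (p ^ 3) h (y1 + \<alpha> + x) - \<beta> * (\<alpha> + truncr rho x)\<bar> <= P + Q * min 1 (x\<^sup>2)"
     if "0 <= t" "t <= p ^ 8" for t x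
     unfolding P_def Q_def
     by (rule drift_pointwise[OF U C0(2) C2 eps(1,2) \<alpha> rho \<beta> C0(1) E that])
    have bd: "\<bar>\<beta> * (\<alpha> + truncr rho x)\<bar> <= \<beta> * (\<bar>\<alpha>\<bar> + rho)" for x
     unfolding abs_mult abs_of_nonneg[OF \<beta>] using truncr_bound[of rho x] rho \<beta> by (intro mult_left_mono) auto
    have sp: "smooth_put K c (p ^ 3) (y1 + \<alpha>) = K - exp (y1 + \<alpha>)"
     using \<alpha> eta eps by (intro smooth_put_small c) auto
    \<comment> \<open>The critical contributions are \<open>p ^ 14\<close> from the smoothing error,
      \<open>p ^ 13\<close> from the drift of order \<open>1 / p ^ 3\<close> at a distance, and
      \<open>p ^ 12 / R\<close> from truncation; only the last is of the order of the gain itself.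
      All others are at most \<open>p ^ 13\<close>.\<close>
    have num: "p ^ 8 * (P + Q * (3 * step_const * p ^ 8)) <= A * p ^ 12 * (1 / R + p)"
    proof -
     have q1: "p ^ 16 <= p ^ 13" "p ^ 14 <= p ^ 13" using p by (auto intro!: power_decreasing)
     have e1: "p ^ 8 * P = a1 * p ^ 16 + a2 * p ^ 14"
      unfolding P_def E_def a1_def a2_def \<alpha>_def by (simp add: algebra_simps power_mult_distrib flip: power_mult power_add)
     have "p ^ 16 * (\<beta> / rho) = \<beta> * (p ^ 12 / R)"
     proof -
      have "p ^ 16 = p ^ 12 * p ^ 4" by (simp flip: power_add)
      then show ?thesis using p R unfolding rho_def by (simp add: field_simps)
     qed
     moreover have "p ^ 16 * C2 = C1 * p ^ 13"
     proof -
      have e: "p ^ 16 = p ^ 13 * p ^ 3" by (simp flip: power_add)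
      have f: "p ^ 3 * (C1 / p ^ 3) = C1" using p by simp
      show ?thesis unfolding C2_def e mult.assoc f by (rule mult.commute)
     qed
     moreover have "p ^ 8 * (Q * (3 * step_const * p ^ 8)) = 3 * sc * (2 * C0 * p ^ 16 + p ^ 16 * (\<beta> / rho) + (p ^ 16 * C2 + 2 * \<beta> * p ^ 16) * (4 / eps\<^sup>2))"
     proof -
      have "p ^ 8 * (Q * (3 * step_const * p ^ 8)) = 3 * sc * (Q * p ^ 16)" unfolding sc_def by (simp add: algebra_simps flip: power_add)
      then show ?thesis unfolding Q_def by (simp only: distrib_right distrib_left mult.assoc mult.commute mult.left_commute)
     qed
     ultimately have "p ^ 8 * (Q * (3 * step_const * p ^ 8)) = 3 * sc * (2 * C0 * p ^ 16 + \<beta> * (p ^ 12 / R) + (C1 * p ^ 13 + 2 * \<beta> * p ^ 16) * (4 / eps\<^sup>2))"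
      by (simp only:)
     also have "... = a3 * p ^ 16 + a5 * (p ^ 12 / R) + a4 * p ^ 13"
      unfolding a3_def a4_def a5_def by (simp add: algebra_simps add_divide_distrib)
     finally have e2: "p ^ 8 * (Q * (3 * step_const * p ^ 8)) = a3 * p ^ 16 + a5 * (p ^ 12 / R) + a4 * p ^ 13" .
     have "p ^ 8 * (P + Q * (3 * step_const * p ^ 8)) = a1 * p ^ 16 + a2 * p ^ 14 + (a3 * p ^ 16 + a5 * (p ^ 12 / R) + a4 * p ^ 13)"
      unfolding distrib_left e1 e2 ..
     also have "... <= a1 * p ^ 13 + a2 * p ^ 13 + (a3 * p ^ 13 + a5 * (p ^ 12 / R) + a4 * p ^ 13)"
      using q1 a0 by (intro add_mono mult_left_mono order_refl) auto
     also have "... = (a1 + a2 + a3 + a4) * p ^ 13 + a5 * (p ^ 12 / R)" by (simp add: algebra_simps)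
     also have "... <= A * p ^ 13 + A * (p ^ 12 / R)"
     proof -
      have "a1 + a2 + a3 + a4 <= A" "a5 <= A" unfolding A_def using a0 by auto
      then show ?thesis using p R by (intro add_mono[OF mult_right_mono mult_right_mono]) auto
     qed
     also have "... = A * p ^ 12 * (1 / R + p)" by (simp add: algebra_simps flip: power_Suc)
     finally show ?thesis .
    qed
    have "\<bar>expectation (%om. exp (- r * (real (kp om) * h)) * smooth_put K c (p ^ 3) (y1 + \<alpha> + Y (real (kp om) * h) om))
     - smooth_put K c (p ^ 3) (y1 + \<alpha>) - rew h (%x. h * (\<beta> * (\<alpha> + truncr rho x))) n kp\<bar> <= p ^ 8 * (P + Q * (3 * step_const * p ^ 8))"
     if "real n * h = p ^ 8" "gstop h n kp" for n kp
     by (rule grid_error[OF elim(2) that(2,1) eta(1,3) c pt PQ _ bd]) measurable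
    then show ?case using num unfolding sp unfolding \<alpha>_def rho_def by (meson order_trans)
   qed
  qed
 qed
 with A show ?thesis unfolding \<beta>_def by blast
qed

end

context put_process
begin

text \<open>Increments of the log-price need not be integrable, but for \<open>2 * rho <= 1\<close>
  truncated ones are at most \<open>min 1\<close> of their size. \<open>min_abs_le\<close> with
  \<open>l = sqrt H\<close> then balances the two terms.\<close>

lemma truncr_increment:
 assumes t: "0 <= t" "0 <= u" "u <= H" and H: "0 < H" and rho: "0 <= rho" "2 * rho <= 1"
 shows "expectation (%om. \<bar>truncr rho (Y (t + u) om) - truncr rho (Y t om)\<bar>) <= sqrt H * (1 + 3 * step_const)"
proof -
 have [measurable]: "Y t \<in> borel_measurable M" "Y (t + u) \<in> borel_measurable M" using t by (auto intro!: Y_meas)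
 interpret L: real_distribution "mu u" by (rule law[OF t(2)])
 have sH: "0 < sqrt H" using H by simp
 have eq: "t + u - t = u" by simp
 have "expectation (%om. \<bar>truncr rho (Y (t + u) om) - truncr rho (Y t om)\<bar>) <= expectation (%om. min 1 \<bar>Y (t + u) om - Y t om\<bar>)"
 proof (rule integral_mono')
  show "integrable M (%om. min 1 \<bar>Y (t + u) om - Y t om\<bar>)" by (rule integrable_const_bound[of _ 1]) auto
 qed (rule truncr_diff_le[OF rho], simp)
 also have "... = (LINT x|distr M borel (%om. Y (t + u) om - Y t om). min 1 \<bar>x\<bar>)"
  by (subst integral_distr) auto
 also have "... = (LINT x|mu u. min 1 \<bar>x\<bar>)" using Y_incr[of t "t + u"] t unfolding eq by simp
 also have "... <= (LINT x|mu u. sqrt H + min 1 (x\<^sup>2) / sqrt H)"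
 proof (rule integral_mono)
  show "integrable (mu u) (%x. min 1 \<bar>x\<bar>)" by (rule L.integrable_const_bound[of _ 1]) auto
  have "integrable (mu u) (%x. min 1 (x\<^sup>2))" by (rule L.integrable_const_bound[of _ 1]) auto
  then show "integrable (mu u) (%x. sqrt H + min 1 (x\<^sup>2) / sqrt H)" by simp
 qed (rule min_abs_le[OF sH])
 also have "... = sqrt H + (LINT x|mu u. min 1 (x\<^sup>2)) / sqrt H"
 proof -
  have "integrable (mu u) (%x. min 1 (x\<^sup>2))" by (rule L.integrable_const_bound[of _ 1]) auto
  then show ?thesis using L.prob_space by simp
 qed
 also have "... <= sqrt H + (3 * step_const * H) / sqrt H"
 proof (intro add_left_mono divide_right_mono)
  have "3 * step_const * u <= 3 * step_const * H" using t step_const_nonneg by (intro mult_left_mono) auto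
  then show "(LINT x|mu u. min 1 (x\<^sup>2)) <= 3 * step_const * H" using trunc_second_moment[OF t(2)] by linarith
 qed (use sH in simp)
 also have "(3 * step_const * H) / sqrt H = 3 * step_const * (H / sqrt H)" by (rule times_divide_eq_right[symmetric])
 also have "H / sqrt H = sqrt H" using H by (intro real_div_sqrt) simp
 finally show ?thesis by (simp add: algebra_simps)
qed

end

context put_process
begin

lemma payoff_grid_integrable:
 assumes h: "0 < h" and kp: "gstop h n kp" and g[measurable]: "g \<in> borel_measurable borel" and b: "!!x. \<bar>g x\<bar> <= B"
 shows "integrable M (%om. exp (- r * (real (kp om) * h)) * g (y + Y (real (kp om) * h) om))"
proof (rule integrable_const_bound[of _ "1 * B"])
 interpret W: random_walk M "%k. F (real k * h)" "%k. Y (real k * h)" "mu h" by (rule walk) (use h in simp)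
 have km[measurable]: "kp \<in> measurable M (count_space UNIV)" by (rule W.grid_stopping_measurable[OF kp])
 have Ym[measurable]: "(%om. Y (real k * h) om) \<in> borel_measurable M" for k using h by (intro Y_meas) simp
 have "(%om. (%k om. exp (- r * (real k * h)) * g (y + Y (real k * h) om)) (kp om) om) \<in> borel_measurable M"
  by (rule measurable_compose_countable[where g=kp]) measurable
 then show "(%om. exp (- r * (real (kp om) * h)) * g (y + Y (real (kp om) * h) om)) \<in> borel_measurable M" by simp
 have "norm (exp (- r * (real k * h)) * g x) <= 1 * B" for k :: nat and x
  unfolding real_norm_def abs_mult using b r h by (intro mult_mono) auto
 then show "AE om in M. norm (exp (- r * (real (kp om) * h)) * g (y + Y (real (kp om) * h) om)) <= 1 * B" by (intro AE_I2)
qed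

text \<open>Both bounds pass through a fine grid on which the drift is known and return to a coarse
  grid with \<open>N\<close> steps. For the upper bound an arbitrary fine rule is coarsened and the
  payoff majorised; for the lower bound the optimal coarse rule is refined and the payoff
  minorised.\<close>

lemma put_value_asymp:
 assumes y1: "y1 < ln K" and root: "phi0 (exp y1) = 0"
 defines "\<beta> \<equiv> exp y1 * dbar y1"
 obtains A where "0 < A" "!!R N. 1 <= R ==> 0 < N ==> \<forall>\<^sub>F p in at_right 0.
   \<bar>put_value (p ^ 8) (y1 + a * p ^ 4) - (K - exp (y1 + a * p ^ 4))
    - p ^ 12 * \<beta> * stop_value (distr (mu (p ^ 8 / real N)) borel (%x. x / p ^ 4)) (%x. (a + truncr R x) / real N) N 0\<bar>
   <= A * p ^ 12 * (1 / R + p) + p ^ 12 * \<beta> * ((1 + 3 * step_const) / sqrt (real N) + (\<bar>a\<bar> + R) / real N)"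
proof -
 have \<beta>: "0 <= \<beta>" unfolding \<beta>_def using dbar_nonneg by simp
 obtain A where A: "0 < A" and ev: "\<forall>\<^sub>F p in at_right 0. \<forall>R c. 1 <= R \<longrightarrow> R * p ^ 4 <= 1 \<longrightarrow> c = 0 \<or> c = 1 \<longrightarrow>
   (\<forall>\<^sub>F h in at_right 0. \<forall>n kp. real n * h = p ^ 8 \<longrightarrow> gstop h n kp \<longrightarrow>
    \<bar>expectation (%om. exp (- r * (real (kp om) * h)) * smooth_put K c (p ^ 3) (y1 + a * p ^ 4 + Y (real (kp om) * h) om))
     - (K - exp (y1 + a * p ^ 4)) - rew h (%x. h * (\<beta> * (a * p ^ 4 + truncr (R * p ^ 4) x))) n kp\<bar>
    <= A * p ^ 12 * (1 / R + p))"
  using main_grid[OF y1 root, of a] unfolding \<beta>_def by blast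
 have "\<forall>\<^sub>F p in at_right 0.
   \<bar>put_value (p ^ 8) (y1 + a * p ^ 4) - (K - exp (y1 + a * p ^ 4))
    - p ^ 12 * \<beta> * stop_value (distr (mu (p ^ 8 / real N)) borel (%x. x / p ^ 4)) (%x. (a + truncr R x) / real N) N 0\<bar>
   <= A * p ^ 12 * (1 / R + p) + p ^ 12 * \<beta> * ((1 + 3 * step_const) / sqrt (real N) + (\<bar>a\<bar> + R) / real N)"
  if R: "1 <= R" and N: "0 < N" for R and N :: nat
 proof -
  have p0: "0 < 1 / (2 * R)" using R by simp
  have "\<forall>\<^sub>F p in at_right 0. 0 < p \<and> p < min 1 (1 / (2 * R))" using p0 by (auto simp: eventually_at_right_field intro!: exI[of _ "min 1 (1 / (2 * R))"])
  with ev show ?thesis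
  proof eventually_elim
   case (elim p)
   then have p: "0 < p" "p <= 1" "p <= 1 / (2 * R)" by auto
   define rho where "rho = R * p ^ 4"
   define \<alpha> where "\<alpha> = a * p ^ 4"
   have rho: "0 <= rho" "2 * rho <= 1"
   proof -
    show "0 <= rho" using R p by (simp add: rho_def)
    have "p ^ 4 <= p" using power_decreasing[of 1 4 p] p by simp
    then have "p ^ 4 <= 1 / (2 * R)" using p by linarith
    then have "R * p ^ 4 <= R * (1 / (2 * R))" using R by (intro mult_left_mono) auto
    then show "2 * rho <= 1" using R by (simp add: rho_def)
   qed
   define H where "H = p ^ 8 / real N"
   have H: "0 < H" using p N by (simp add: H_def)
   define c where "c x = \<beta> * (\<alpha> + truncr rho x)" for x
   have cm[measurable]: "c \<in> borel_measurable borel" unfolding c_def by measurable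
   have Hcm: "(%x. H * c x) \<in> borel_measurable borel" by measurable
   have cb: "\<bar>H * c x\<bar> <= H * (\<beta> * (\<bar>\<alpha>\<bar> + rho))" for x
    unfolding c_def abs_mult abs_of_nonneg[OF \<beta>] abs_of_pos[OF H] using truncr_bound[OF rho(1), of x] \<beta> H by (intro mult_left_mono) auto
   define V where "V = stop_value (mu H) (%x. H * c x) N 0"
   define s0 where "s0 = K - exp (y1 + \<alpha>)"
   define e1 where "e1 = A * p ^ 12 * (1 / R + p)"
   define e2 where "e2 = real N * H * (\<beta> * (sqrt H * (1 + 3 * step_const))) + H * (\<beta> * (\<bar>\<alpha>\<bar> + rho))"
   have eta: "0 < p ^ 3" "p ^ 3 <= 1" using p by (auto simp: power_le_one)
   \<comment> \<open>Every coarse step is divided into \<open>Suc i\<close> fine ones, so both grids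
     end exactly at the horizon \<open>p ^ 8\<close>.\<close>
   let ?h = "%i. p ^ 8 / real (N * Suc i)"
   have nz: "real (N * Suc i) \<noteq> 0" for i using N by (simp only: of_nat_eq_0_iff) simp
   have hpos: "0 < ?h i" for i using p N by (intro divide_pos_pos) (simp, simp only: of_nat_0_less_iff, simp)
   have nh: "real (N * Suc i) * ?h i = p ^ 8" for i using nz[of i] by (simp del: of_nat_mult of_nat_Suc)
   have HhA: "H = real (Suc i) * ?h i" for i
    using nz[of i] N unfolding H_def of_nat_mult by (simp add: field_simps del: of_nat_Suc)
   have hf: "filterlim ?h (at_right 0) sequentially"
   proof (rule tendsto_imp_filterlim_at_right)
    have "(%i. H / real (Suc i)) \<longlonglongrightarrow> 0" using LIMSEQ_Suc[OF lim_const_over_n[of H]] by simp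
    then show "?h \<longlonglongrightarrow> 0" unfolding H_def by (simp only: divide_divide_eq_left of_nat_mult)
    show "\<forall>\<^sub>F i in sequentially. 0 < ?h i" by (intro always_eventually allI hpos)
   qed
   have ev1: "\<forall>\<^sub>F i in sequentially. \<forall>kp. gstop (?h i) (N * Suc i) kp \<longrightarrow>
     \<bar>expectation (%om. exp (- r * (real (kp om) * ?h i)) * smooth_put K d (p ^ 3) (y1 + \<alpha> + Y (real (kp om) * ?h i) om))
     - s0 - rew (?h i) (%x. ?h i * c x) (N * Suc i) kp\<bar> <= e1" if d: "d = 0 \<or> d = 1" for d
   proof -
    have "R * p ^ 4 <= 1" using rho by (simp add: rho_def)
    with elim(1) R d have "\<forall>\<^sub>F h in at_right 0. \<forall>n kp. real n * h = p ^ 8 \<longrightarrow> gstop h n kp \<longrightarrow>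
      \<bar>expectation (%om. exp (- r * (real (kp om) * h)) * smooth_put K d (p ^ 3) (y1 + \<alpha> + Y (real (kp om) * h) om))
      - s0 - rew h (%x. h * c x) n kp\<bar> <= e1"
     unfolding s0_def c_def e1_def \<alpha>_def rho_def by blast
    from eventually_compose_filterlim[OF this hf]
    show ?thesis
    proof eventually_elim
     case (elim i)
     then show ?case using nh[of i] by blast
    qed
   qed
   have co: "gstop H N (%om. (kp om + Suc i - 1) div Suc i)"
    "\<bar>rew (?h i) (%x. ?h i * c x) (N * Suc i) kp - rew H (%x. H * c x) N (%om. (kp om + Suc i - 1) div Suc i)\<bar> <= e2"
    if "gstop (?h i) (N * Suc i) kp" for i kp
   proof -
    have h: "0 < ?h i" by (rule hpos)
    have Hh: "H = real (Suc i) * ?h i" by (rule HhA)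
    have inc: "expectation (%om. \<bar>truncr rho (Y (t + u) om) - truncr rho (Y t om)\<bar>) <= sqrt H * (1 + 3 * step_const)"
     if "0 <= t" "0 <= u" "u <= H" for t u by (rule truncr_increment[OF that H rho])
    show "gstop H N (%om. (kp om + Suc i - 1) div Suc i)"
     by (rule coarsen(1)[OF h _ Hh that \<beta> rho(1) inc]) simp
    show "\<bar>rew (?h i) (%x. ?h i * c x) (N * Suc i) kp - rew H (%x. H * c x) N (%om. (kp om + Suc i - 1) div Suc i)\<bar> <= e2"
     unfolding e2_def c_def by (rule coarsen(2)[OF h _ Hh that \<beta> rho(1) inc]) simp
   qed
   note gm0 = smooth_put_measurable[OF K eta, of 0, simplified] and gm1 = smooth_put_measurable[OF K eta, of 1, simplified]
   have up: "put_value (p ^ 8) (y1 + \<alpha>) <= s0 + V + e1 + e2"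
   proof (rule put_value_le[where n="%i. N * Suc i" and B="%_. s0 + V + e1 + e2"])
    show "0 < p ^ 8" using p by simp
    show "filterlim (%i. N * Suc i) at_top sequentially"
     unfolding filterlim_at_top
    proof
     fix Z show "\<forall>\<^sub>F i in sequentially. Z <= N * Suc i"
      using eventually_ge_at_top[of Z]
     proof eventually_elim
      case (elim i) then show ?case using N mult_le_mono[of 1 N i "Suc i"] by simp
     qed
    qed
    show "\<forall>\<^sub>F i in sequentially. \<forall>kp. gstop (?h i) (N * Suc i) kp \<longrightarrow>
     expectation (%om. exp (- r * (real (kp om) * ?h i)) * put_payoff K (y1 + \<alpha> + Y (real (kp om) * ?h i) om)) <= s0 + V + e1 + e2"
     using ev1[of 0, simplified]
    proof eventually_elim
     case (elim i)
     show ?case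
     proof (intro allI impI)
      fix kp assume kp: "gstop (?h i) (N * Suc i) kp"
      have h: "0 < ?h i" by (rule hpos)
      have "expectation (%om. exp (- r * (real (kp om) * ?h i)) * put_payoff K (y1 + \<alpha> + Y (real (kp om) * ?h i) om))
        <= expectation (%om. exp (- r * (real (kp om) * ?h i)) * smooth_put K 0 (p ^ 3) (y1 + \<alpha> + Y (real (kp om) * ?h i) om))"
      proof (rule integral_mono)
       show "integrable M (%om. exp (- r * (real (kp om) * ?h i)) * put_payoff K (y1 + \<alpha> + Y (real (kp om) * ?h i) om))"
        by (rule payoff_grid_integrable[OF h kp put_payoff_measurable, of K]) (simp add: payoff_bounds)
       show "integrable M (%om. exp (- r * (real (kp om) * ?h i)) * smooth_put K 0 (p ^ 3) (y1 + \<alpha> + Y (real (kp om) * ?h i) om))"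
        by (rule payoff_grid_integrable[OF h kp gm0, of "6 * K"]) (simp add: smooth_put_bound[OF K eta])
      qed (intro mult_left_mono smooth_put_upper K eta, simp)
      moreover have "\<bar>expectation (%om. exp (- r * (real (kp om) * ?h i)) * smooth_put K 0 (p ^ 3) (y1 + \<alpha> + Y (real (kp om) * ?h i) om))
        - s0 - rew (?h i) (%x. ?h i * c x) (N * Suc i) kp\<bar> <= e1" using elim kp by simp
      moreover have "rew H (%x. H * c x) N (%om. (kp om + Suc i - 1) div Suc i) <= V"
       unfolding V_def by (rule rew_le_stop_value[OF H co(1)[OF kp] _ cb]) simp
      ultimately show "expectation (%om. exp (- r * (real (kp om) * ?h i)) * put_payoff K (y1 + \<alpha> + Y (real (kp om) * ?h i) om)) <= s0 + V + e1 + e2"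
       using co(2)[OF kp] by linarith
     qed
    qed
   qed (use N in auto)
   have lo: "s0 + V - e1 - e2 <= put_value (p ^ 8) (y1 + \<alpha>)"
   proof -
    obtain kpc where kpc: "gstop H N kpc" "rew H (%x. H * c x) N kpc = V"
     unfolding V_def using rew_attains_stop_value[OF H Hcm cb, where N=N] by blast
    \<comment> \<open>For the lower bound a single sufficiently fine grid is enough, since any grid
      rule is an admissible stopping time; the limit in \<open>i\<close> is needed only
      above.\<close>
    obtain i where i: "\<forall>kp. gstop (?h i) (N * Suc i) kp \<longrightarrow>
     \<bar>expectation (%om. exp (- r * (real (kp om) * ?h i)) * smooth_put K 1 (p ^ 3) (y1 + \<alpha> + Y (real (kp om) * ?h i) om))
     - s0 - rew (?h i) (%x. ?h i * c x) (N * Suc i) kp\<bar> <= e1"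
     using eventually_happens'[OF sequentially_bot ev1[of 1, simplified]] by auto
    have h: "0 < ?h i" by (rule hpos)
    have Hh: "H = real (Suc i) * ?h i" by (rule HhA)
    define kp where "kp om = kpc om * Suc i" for om
    have kp: "gstop (?h i) (N * Suc i) kp" unfolding kp_def by (rule refine_stopping(1)[OF h _ Hh kpc(1)]) simp
    have kpeq: "(%om. (kp om + Suc i - 1) div Suc i) = kpc"
     unfolding kp_def by (rule ext) (rule refine_stopping(2)[OF h _ Hh kpc(1)], simp)
    have "expectation (%om. exp (- r * (real (kp om) * ?h i)) * smooth_put K 1 (p ^ 3) (y1 + \<alpha> + Y (real (kp om) * ?h i) om))
      <= expectation (%om. exp (- r * (real (kp om) * ?h i)) * put_payoff K (y1 + \<alpha> + Y (real (kp om) * ?h i) om))"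
    proof (rule integral_mono)
     show "integrable M (%om. exp (- r * (real (kp om) * ?h i)) * put_payoff K (y1 + \<alpha> + Y (real (kp om) * ?h i) om))"
      by (rule payoff_grid_integrable[OF h kp put_payoff_measurable, of K]) (simp add: payoff_bounds)
     show "integrable M (%om. exp (- r * (real (kp om) * ?h i)) * smooth_put K 1 (p ^ 3) (y1 + \<alpha> + Y (real (kp om) * ?h i) om))"
      by (rule payoff_grid_integrable[OF h kp gm1, of "6 * K"]) (simp add: smooth_put_bound[OF K eta])
    qed (intro mult_left_mono smooth_put_lower K eta, simp)
    also have "... <= put_value (p ^ 8) (y1 + \<alpha>)"
     by (rule put_value_ge_grid[OF h kp]) (simp only: nh)
    finally have "expectation (%om. exp (- r * (real (kp om) * ?h i)) * smooth_put K 1 (p ^ 3) (y1 + \<alpha> + Y (real (kp om) * ?h i) om)) <= put_value (p ^ 8) (y1 + \<alpha>)" .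
    moreover have "\<bar>expectation (%om. exp (- r * (real (kp om) * ?h i)) * smooth_put K 1 (p ^ 3) (y1 + \<alpha> + Y (real (kp om) * ?h i) om))
      - s0 - rew (?h i) (%x. ?h i * c x) (N * Suc i) kp\<bar> <= e1" using i kp by blast
    moreover have "\<bar>rew (?h i) (%x. ?h i * c x) (N * Suc i) kp - V\<bar> <= e2"
     using co(2)[OF kp] unfolding kpeq kpc(2) .
    ultimately show ?thesis by linarith
   qed
   have Veq: "V = p ^ 12 * \<beta> * stop_value (distr (mu H) borel (%x. x / p ^ 4)) (%x. (a + truncr R x) / real N) N 0"
   proof -
    interpret L: real_distribution "mu H" by (rule law) (use H in simp)
    have p4: "0 < p ^ 4" using p by simp
    \<comment> \<open>The factor \<open>p ^ 12\<close> is the time \<open>p ^ 8\<close> multiplied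
      by the spatial scale \<open>p ^ 4\<close>.\<close>
    have "H * c x = p ^ 12 * \<beta> * ((a + truncr R (x / p ^ 4)) / real N)" for x
    proof -
     have t: "truncr rho x = p ^ 4 * truncr R (x / p ^ 4)" unfolding rho_def by (rule truncr_scale[OF p4])
     have "p ^ 12 = p ^ 8 * p ^ 4" by (simp flip: power_add)
     then show ?thesis unfolding c_def H_def \<alpha>_def t by (simp add: algebra_simps add_divide_distrib)
    qed
    then have "V = stop_value (mu H) (%x. p ^ 12 * \<beta> * ((a + truncr R (x / p ^ 4)) / real N)) N 0"
     unfolding V_def by simp
    also have "... = p ^ 12 * \<beta> * stop_value (distr (mu H) borel (%x. x / p ^ 4)) (%x. (a + truncr R x) / real N) N (0 / p ^ 4)"
     by (rule L.stop_value_scale[where c="%x. (a + truncr R x) / real N"]) (use p4 p \<beta> in auto)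
    finally show ?thesis by simp
   qed
   have e2eq: "e2 = p ^ 12 * \<beta> * ((1 + 3 * step_const) / sqrt (real N) + (\<bar>a\<bar> + R) / real N)"
   proof -
    have NH: "real N * H = p ^ 8" using N by (simp add: H_def)
    have "sqrt (p ^ 8) = p ^ 4" by (rule real_sqrt_unique) (use p in \<open>auto simp flip: power_mult\<close>)
    then have sH: "sqrt H = p ^ 4 / sqrt (real N)" by (simp add: H_def real_sqrt_divide)
    have al: "\<bar>\<alpha>\<bar> + rho = (\<bar>a\<bar> + R) * p ^ 4" using p by (simp add: \<alpha>_def rho_def abs_mult algebra_simps)
    have p12: "p ^ 12 = p ^ 8 * p ^ 4" by (simp flip: power_add)
    show ?thesis unfolding e2_def NH sH al p12 unfolding H_def by (simp add: algebra_simps add_divide_distrib)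
   qed
   show ?case using up lo unfolding Veq[symmetric, unfolded H_def] e2eq[symmetric] e1_def[symmetric] \<alpha>_def[symmetric] s0_def[symmetric]
    by linarith
  qed
 qed
 with A show ?thesis using that by blast
qed

end

section \<open>The Brownian stopping problem on grids\<close>

text \<open>Written as an image of \<open>gauss\<close>, the law of an increment also makes sense at
  \<open>t = 0\<close>, where \<open>gauss_scaled_0\<close> gives the point mass;
  \<open>grid_process\<close> asks for one family including 0.\<close>

lemma normal_density_as_scaled_gauss:
 assumes t: "0 < t"
 shows "density lborel (normal_density 0 (sqrt t)) = distr gauss borel (%x. sqrt t * x)"
proof -
 have "distributed gauss lborel (%x. x) (normal_density 0 1)"
  unfolding distributed_def by (auto simp: distr_id2 cong: distr_cong)
 then have "distributed gauss lborel (%x. 0 + sqrt t * x) (normal_density (0 + sqrt t * 0) (\<bar>sqrt t\<bar> * 1))"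
  by (rule gauss.normal_density_affine) (use t in auto)
 then have "distr gauss lborel (%x. sqrt t * x) = density lborel (normal_density 0 (sqrt t))"
  using t by (simp add: distributed_def)
 moreover have "distr gauss lborel (%x. sqrt t * x) = distr gauss borel (%x. sqrt t * x)" by (rule distr_cong) auto
 ultimately show ?thesis by simp
qed

lemma gauss_scaled_0: "distr gauss borel (%x. sqrt 0 * x) = return borel 0"
 by (simp add: gauss.distr_const)

context
 fixes M :: "'b measure" and W :: "real \<Rightarrow> 'b \<Rightarrow> real" and N :: "real \<Rightarrow> 'b \<Rightarrow> nat" and L :: "real \<Rightarrow> real \<Rightarrow> 'b \<Rightarrow> real" and lam :: real
 assumes aux: "aux_space M lam W N L"
begin

interpretation prob_space M using aux by (simp add: aux_space_def)

lemma W_measurable: "W t \<in> borel_measurable M"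
 using aux by (simp add: aux_space_def std_brownian_motion_def)

lemma N_measurable: "N t \<in> measurable M (count_space UNIV)"
 using aux by (simp add: aux_space_def poisson_process_def)

lemma W_0: "om \<in> space M ==> W 0 om = 0"
 and W_cont: "om \<in> space M ==> continuous_on {0..} (%t. W t om)"
 using aux by (auto simp: aux_space_def std_brownian_motion_def)

lemma sets_nat_filtration:
 "sets (nat_filtration M W N t) = sigma_sets (space M) ((\<Union>u\<in>{0..t}. rv_events M (W u)) \<union> (\<Union>u\<in>{0..t}. {N u -` A \<inter> space M | A. A \<subseteq> UNIV}))"
 unfolding nat_filtration_def by (rule sets_measure_of) (auto simp: rv_events_def)

lemma space_nat_filtration: "space (nat_filtration M W N t) = space M"
 unfolding nat_filtration_def by (rule space_measure_of) (auto simp: rv_events_def)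

lemma nat_filtration_sub: "subalgebra M (nat_filtration M W N t)"
 unfolding subalgebra_def
proof
 show "space (nat_filtration M W N t) = space M" by (rule space_nat_filtration)
 show "sets (nat_filtration M W N t) \<subseteq> sets M"
  unfolding sets_nat_filtration
 proof (rule sets.sigma_sets_subset, safe)
  fix u x assume "x \<in> rv_events M (W u)"
  then show "x \<in> sets M" unfolding rv_events_def using measurable_sets[OF W_measurable] by auto
 next
  fix u and A :: "nat set"
  show "N u -` A \<inter> space M \<in> sets M" using measurable_sets[OF N_measurable, of A] by simp
 qed
qed

text \<open>The filtration also contains the past of \<open>N\<close>. Intersections of an event of
  the past of \<open>W\<close> with an event of the whole path of \<open>N\<close> form a generating
  class closed under intersection, and on it the product formula follows from two independences used
  in turn.\<close>

lemma W_path_indep: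
 assumes st: "0 <= s" "s < t"
 shows "indep_set (sets (nat_filtration M W N s)) (rv_events M (%om. W t om - W s om))"
proof -
 define VW where "VW = vimage_algebra (space M) (%om t. W t om) (PiM UNIV (%_::real. borel :: real measure))"
 \<comment> \<open>\<open>indep_var\<close> relates maps into one common type, so the hypothesis on
   \<open>W\<close> and \<open>N\<close> concerns \<open>N\<close> coerced to \<open>real\<close>;
   the coercion is repeated here.\<close>
 define VN where "VN = vimage_algebra (space M) (%om t. real (N t om)) (PiM UNIV (%_::real. count_space UNIV :: real measure))"
 have ind: "indep_var (PiM UNIV (%_::real. borel)) (%om t. W t om) (PiM UNIV (%_::real. count_space UNIV)) (%om t. real (N t om))"
  using aux by (simp add: aux_space_def)
 have WN: "indep_set (sets VW) (sets VN)"
  using ind unfolding indep_var_eq VW_def VN_def sets_vimage_algebra by simp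
 have spVW: "space VW = space M" and spVN: "space VN = space M" by (simp_all add: VW_def VN_def)
 have Wm[measurable]: "(%om. W u om) \<in> borel_measurable VW" for u
 proof -
  have "(%om t. W t om) \<in> measurable VW (PiM UNIV (%_::real. borel))"
   unfolding VW_def by (rule measurable_vimage_algebra1) (auto simp: space_PiM)
  from measurable_compose[OF this measurable_component_singleton[of u]] show ?thesis by simp
 qed
 have Nm: "(%om. real (N u om)) \<in> measurable VN (count_space UNIV)" for u
 proof -
  have "(%om t. real (N t om)) \<in> measurable VN (PiM UNIV (%_::real. count_space UNIV))"
   unfolding VN_def by (rule measurable_vimage_algebra1) (auto simp: space_PiM)
  from measurable_compose[OF this measurable_component_singleton[of u]] show ?thesis by simp
 qed
 define AW where "AW = sigma_sets (space M) (\<Union>u\<in>{0..s}. rv_events M (W u))"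
 define C where "C = rv_events M (%om. W t om - W s om)"
 have BM: "indep_set AW C"
  using aux st unfolding AW_def C_def by (simp add: aux_space_def std_brownian_motion_def)
 have rvW: "rv_events M (W u) \<subseteq> sets VW" for u
  unfolding rv_events_def using measurable_sets[OF Wm[of u]] by (auto simp: spVW)
 have AWV: "AW \<subseteq> sets VW"
 proof -
  have "(\<Union>u\<in>{0..s}. rv_events M (W u)) \<subseteq> sets VW" using rvW by blast
  from sets.sigma_sets_subset[OF this] show ?thesis unfolding AW_def spVW .
 qed
 have CV: "C \<subseteq> sets VW"
 proof -
  have "(%om. W t om - W s om) \<in> borel_measurable VW" by measurable
  from measurable_sets[OF this] show ?thesis unfolding C_def rv_events_def by (auto simp: spVW)
 qed
 have AWM: "AW \<subseteq> events" "C \<subseteq> events" "sets VN \<subseteq> events"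
  using BM WN unfolding indep_sets2_eq by auto
 define P where "P = {a \<inter> b | a b. a \<in> AW \<and> b \<in> sets VN}"
 have AW_alg: "sigma_algebra (space M) AW"
  unfolding AW_def by (rule sigma_algebra_sigma_sets) (auto simp: rv_events_def)
 have "indep_set P C"
  unfolding indep_sets2_eq
 proof (intro conjI ballI)
  show "P \<subseteq> events" unfolding P_def using AWM by blast
  show "C \<subseteq> events" by (rule AWM)
  fix x c assume "x \<in> P" and c: "c \<in> C"
  then obtain a b where x: "x = a \<inter> b" "a \<in> AW" "b \<in> sets VN" by (auto simp: P_def)
  have ac: "a \<inter> c \<in> sets VW" using x c AWV CV by blast
  \<comment> \<open>\<open>a \<inter> c\<close> involves only \<open>W\<close>, so \<open>b\<close>
    splits off by independence of the two paths; afterwards \<open>a\<close> and \<open>c\<close>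
    separate by the Brownian property.\<close>
  have "prob (x \<inter> c) = prob ((a \<inter> c) \<inter> b)" unfolding x by (rule arg_cong[where f=prob]) blast
  also have "... = prob (a \<inter> c) * prob b" using WN ac x unfolding indep_sets2_eq by blast
  also have "prob (a \<inter> c) = prob a * prob c" using BM x c unfolding indep_sets2_eq by blast
  also have "prob a * prob c * prob b = (prob a * prob b) * prob c" by simp
  also have "prob a * prob b = prob x" using WN x AWV unfolding indep_sets2_eq by auto
  finally show "prob (x \<inter> c) = prob x * prob c" .
 qed
 moreover have "Int_stable P"
 proof (rule Int_stableI)
  interpret S: sigma_algebra "space M" AW by (rule AW_alg)
  fix x y assume "x \<in> P" "y \<in> P"
  then obtain a b a' b' where "x = a \<inter> b" "y = a' \<inter> b'" "a \<in> AW" "b \<in> sets VN" "a' \<in> AW" "b' \<in> sets VN" by (auto simp: P_def)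
  moreover from this have "a \<inter> a' \<in> AW" by (intro S.Int)
  moreover have "b \<inter> b' \<in> sets VN" using calculation by (intro sets.Int)
  moreover have "x \<inter> y = (a \<inter> a') \<inter> (b \<inter> b')" using calculation by blast
  ultimately show "x \<inter> y \<in> P" unfolding P_def by blast
 qed
 moreover have CI: "Int_stable C"
  unfolding C_def rv_events_eq_vimage by (auto intro!: Int_stableI)
 ultimately have "indep_set (sigma_sets (space M) P) (sigma_sets (space M) C)" by (rule indep_set_sigma_sets)
 then have big: "indep_set (sigma_sets (space M) P) C"
  unfolding indep_sets2_eq by (auto intro: sigma_sets.Basic)
 have gen: "sets (nat_filtration M W N s) \<subseteq> sigma_sets (space M) P"
  unfolding sets_nat_filtration
 proof (rule sigma_sets_mono, safe)
  fix u x assume u: "u \<in> {0..s}" "x \<in> rv_events M (W u)"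
  then have "x \<in> AW" unfolding AW_def by (intro sigma_sets.Basic) auto
  moreover have "space M \<in> sets VN" using sets.top[of VN] by (simp add: spVN)
  moreover have "x = x \<inter> space M" using u by (auto simp: rv_events_def)
  ultimately show "x \<in> sigma_sets (space M) P" unfolding P_def by (intro sigma_sets.Basic) blast
 next
  fix u and A :: "nat set" assume u: "u \<in> {0..s}"
  have "(%om. real (N u om)) -` (real ` A) \<inter> space VN \<in> sets VN" by (rule measurable_sets[OF Nm]) simp
  moreover have "(%om. real (N u om)) -` (real ` A) \<inter> space VN = N u -` A \<inter> space M" by (auto simp: spVN)
  ultimately have b: "N u -` A \<inter> space M \<in> sets VN" by simp
  moreover have "space M \<in> AW" unfolding AW_def by (rule sigma_sets_top)
  moreover have "N u -` A \<inter> space M = space M \<inter> (N u -` A \<inter> space M)" by blast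
  ultimately show "N u -` A \<inter> space M \<in> sigma_sets (space M) P" unfolding P_def by (intro sigma_sets.Basic) blast
 qed
 show ?thesis
  using big gen unfolding indep_sets2_eq C_def by blast
qed

lemma W_increment_law:
 assumes st: "0 <= s" "s <= t"
 shows "distr M borel (%om. W t om - W s om) = distr gauss borel (%x. sqrt (t - s) * x)"
proof (cases "s = t")
 case True
 then show ?thesis using gauss_scaled_0 by (simp add: distr_const)
next
 case False
 then show ?thesis using aux st normal_density_as_scaled_gauss[of "t - s"] by (simp add: aux_space_def std_brownian_motion_def)
qed

lemma aux_grid_process: "grid_process M (nat_filtration M W N) W (%t. distr gauss borel (%x. sqrt t * x))"
proof
 show "subalgebra M (nat_filtration M W N t)" for t by (rule nat_filtration_sub)
 show "sets (nat_filtration M W N s) \<subseteq> sets (nat_filtration M W N t)" if "s <= t" for s t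
  unfolding sets_nat_filtration using that by (intro sigma_sets_mono') force
 show "W t \<in> borel_measurable (nat_filtration M W N t)" if "0 <= t" for t
 proof (rule measurableI)
  fix A :: "real set" assume "A \<in> sets borel"
  then show "W t -` A \<inter> space (nat_filtration M W N t) \<in> sets (nat_filtration M W N t)"
  proof -
   have "W t -` A \<inter> space M \<in> rv_events M (W t)" using \<open>A \<in> sets borel\<close> unfolding rv_events_def by blast
   then show ?thesis
    unfolding sets_nat_filtration space_nat_filtration using that by (intro sigma_sets.Basic UnI1 UN_I[of t]) auto
  qed
 qed simp
 show "AE om in M. W 0 om = 0" using W_0 by (intro AE_I2)
 show "indep_set (sets (nat_filtration M W N s)) (rv_events M (%om. W t om - W s om))" if "0 <= s" "s <= t" for s t
 proof (cases "s = t")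
  case False then show ?thesis using that by (intro W_path_indep) auto
 next
  case True
  have "sets (nat_filtration M W N s) \<subseteq> events" using nat_filtration_sub by (simp add: subalgebra_def)
  \<comment> \<open>For \<open>s = t\<close> the increment is identically 0 and generates only
    trivial events.\<close>
  moreover have "rv_events M (%om. W t om - W s om) \<subseteq> {{}, space M}" using True by (auto simp: rv_events_def)
  ultimately show ?thesis unfolding indep_sets2_eq
   using prob_space by (auto simp: subset_iff Int_absorb2 sets.sets_into_space)
 qed
 show "distr M borel (%om. W t om - W s om) = distr gauss borel (%x. sqrt (t - s) * x)" if "0 <= s" "s <= t" for s t
  by (rule W_increment_law[OF that])
 show "distr M borel (W t) = distr gauss borel (%x. sqrt t * x)" if "0 <= t" for t
 proof -
  have "distr M borel (W t) = distr M borel (%om. W t om - W 0 om)" by (rule distr_cong) (auto simp: W_0)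
  then show ?thesis using W_increment_law[of 0 t] that by simp
 qed
qed

end

text \<open>Uniform continuity bounds the error on each cell by \<open>e / 2\<close> times its
  length, summed by induction over the cells. The right endpoint moves with \<open>i\<close> because
  the sums stop at a grid time that only approximates the stopping time.\<close>

lemma Riemann_sum_tendsto:
 fixes g :: "real \<Rightarrow> real" and h :: "nat \<Rightarrow> real" and k :: "nat \<Rightarrow> nat"
 assumes g: "continuous_on {0..1} g" and h: "!!i. 0 < h i" "h \<longlonglongrightarrow> 0"
  and k: "!!i. real (k i) * h i <= 1" "(%i. real (k i) * h i) \<longlonglongrightarrow> t" and t: "0 <= t" "t <= 1"
 shows "(%i. \<Sum>j<k i. h i * g (real j * h i)) \<longlonglongrightarrow> integral {0..t} g"
proof -
 have gi: "g integrable_on {a..b}" if "0 <= a" "b <= 1" for a b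
  using that by (intro integrable_continuous_real continuous_on_subset[OF g]) auto
 have lim1: "(%i. integral {0..real (k i) * h i} g) \<longlonglongrightarrow> integral {0..t} g"
 proof -
  have "continuous_on {0..1} (%x. integral {0..x} g)"
   by (rule indefinite_integral_continuous_1) (use gi in auto)
  moreover have "\<forall>\<^sub>F i in sequentially. real (k i) * h i \<in> {0..1}"
   using k(1) h(1) by (intro always_eventually allI) (simp add: less_imp_le)
  ultimately show ?thesis using continuous_on_tendsto_compose[OF _ k(2)] t by fastforce
 qed
 have "(%i. (\<Sum>j<k i. h i * g (real j * h i)) - integral {0..real (k i) * h i} g) \<longlonglongrightarrow> 0"
 proof (rule LIMSEQ_I)
  fix e :: real assume e: "0 < e"
  have "uniformly_continuous_on {0..1} g" by (rule compact_uniformly_continuous[OF g]) simp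
  then obtain d where d: "0 < d" "!!x y. x \<in> {0..1} ==> y \<in> {0..1} ==> dist y x < d ==> dist (g y) (g x) < e / 2"
   unfolding uniformly_continuous_on_def using e by (metis half_gt_zero)
  obtain i0 where i0: "!!i. i \<ge> i0 ==> h i < d" using LIMSEQ_D[OF h(2) d(1)] by force
  show "\<exists>no. \<forall>i\<ge>no. norm ((\<Sum>j<k i. h i * g (real j * h i)) - integral {0..real (k i) * h i} g - 0) < e"
  proof (intro exI[of _ i0] allI impI)
   fix i assume i: "i0 <= i"
   have hi: "0 < h i" by (rule h(1))
   have "n <= k i ==> \<bar>(\<Sum>j<n. h i * g (real j * h i)) - integral {0..real n * h i} g\<bar> <= real n * h i * (e / 2)" for n
   proof (induction n)
    case (Suc n)
    have le: "real (Suc n) * h i <= 1"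
    proof -
     have "real (Suc n) * h i <= real (k i) * h i" using Suc.prems hi by (intro mult_right_mono) auto
     then show ?thesis using k(1)[of i] by linarith
    qed
    have ab: "0 <= real n * h i" "real n * h i <= real (Suc n) * h i" using hi by (auto intro: mult_right_mono)
    have sp: "integral {0..real (Suc n) * h i} g = integral {0..real n * h i} g + integral {real n * h i..real (Suc n) * h i} g"
     using Henstock_Kurzweil_Integration.integral_combine[OF ab gi] le by simp
    have len: "real (Suc n) * h i - real n * h i = h i" by (simp add: algebra_simps)
    have "norm (integral {real n * h i..real (Suc n) * h i} (%x. g x - g (real n * h i))) <= (e / 2) * (real (Suc n) * h i - real n * h i)"
    proof (rule integral_bound)
     show "continuous_on {real n * h i..real (Suc n) * h i} (%x. g x - g (real n * h i))"
      using ab le by (intro continuous_intros continuous_on_subset[OF g]) auto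
     fix x assume x: "x \<in> {real n * h i..real (Suc n) * h i}"
     have "dist x (real n * h i) < d" using x len i0[OF i] by (simp add: dist_real_def)
     then have "dist (g x) (g (real n * h i)) < e / 2" using x ab le by (intro d(2)) auto
     then show "norm (g x - g (real n * h i)) <= e / 2" by (simp add: dist_real_def)
    qed (rule ab)
    moreover have "integral {real n * h i..real (Suc n) * h i} (%x. g x - g (real n * h i)) = integral {real n * h i..real (Suc n) * h i} g - h i * g (real n * h i)"
    proof -
     have "g integrable_on {real n * h i..real (Suc n) * h i}" using ab le by (intro gi) auto
     then have "integral {real n * h i..real (Suc n) * h i} (%x. g x - g (real n * h i))
       = integral {real n * h i..real (Suc n) * h i} g - integral {real n * h i..real (Suc n) * h i} (%x. g (real n * h i))"
      by (rule Henstock_Kurzweil_Integration.integral_diff) (rule integrable_const_ivl)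
     then show ?thesis using ab len by simp
    qed
    ultimately have st: "\<bar>integral {real n * h i..real (Suc n) * h i} g - h i * g (real n * h i)\<bar> <= (e / 2) * h i" unfolding len by simp
    have "real (Suc n) * h i * (e / 2) = real n * h i * (e / 2) + (e / 2) * h i" by (simp add: algebra_simps)
    then show ?case unfolding sp sum.lessThan_Suc using st Suc by linarith
   qed simp
   from this[of "k i"] have "\<bar>(\<Sum>j<k i. h i * g (real j * h i)) - integral {0..real (k i) * h i} g\<bar> <= real (k i) * h i * (e / 2)" by simp
   also have "... <= 1 * (e / 2)" using k(1)[of i] e by (intro mult_right_mono) auto
   also have "... < e" using e by simp
   finally show "norm ((\<Sum>j<k i. h i * g (real j * h i)) - integral {0..real (k i) * h i} g - 0) < e" by simp
  qed
 qed
 from tendsto_add[OF this lim1] show ?thesis by simp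
qed

context
 fixes M :: "'b measure" and W :: "real \<Rightarrow> 'b \<Rightarrow> real" and N :: "real \<Rightarrow> 'b \<Rightarrow> nat" and L :: "real \<Rightarrow> real \<Rightarrow> 'b \<Rightarrow> real"
 assumes aux: "aux_space M 0 W N L"
begin

interpretation G: grid_process M "nat_filtration M W N" W "%t. distr gauss borel (%x. sqrt t * x)"
 by (rule aux_grid_process[OF aux])

lemma W_cont01: "om \<in> space M ==> continuous_on {0..1} (%t. W t om)"
 using W_cont[OF aux] by (rule continuous_on_subset) auto

lemma truncr_continuous: "continuous_on UNIV (truncr R)"
 unfolding truncr_def[abs_def] by (intro continuous_intros)

lemma truncr_comp_continuous: "continuous_on S f ==> continuous_on S (%x. truncr R (f x))"
 by (rule continuous_on_compose2[OF truncr_continuous]) auto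

lemma W_second_moment: assumes "0 <= t" shows "G.expectation (%om. (W t om)\<^sup>2) = t" "integrable M (%om. (W t om)\<^sup>2)"
proof -
 have [measurable]: "W t \<in> borel_measurable M" by (rule W_measurable[OF aux])
 have "G.expectation (%om. (W t om)\<^sup>2) = (LINT x|distr gauss borel (%x. sqrt t * x). x\<^sup>2)"
  unfolding G.Y_law[OF assms, symmetric] by (subst integral_distr) auto
 also have "... = (LINT x|gauss. t * x\<^sup>2)" using assms by (subst integral_distr) (auto simp: power_mult_distrib)
 also have "... = t" using gauss_var by simp
 finally show "G.expectation (%om. (W t om)\<^sup>2) = t" .
 have "integrable (distr gauss borel (%x. sqrt t * x)) (%x. x\<^sup>2)"
  using assms gauss_int2 by (subst integrable_distr_eq) (auto simp: power_mult_distrib)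
 then show "integrable M (%om. (W t om)\<^sup>2)"
  unfolding G.Y_law[OF assms, symmetric] by (subst (asm) integrable_distr_eq) auto
qed

lemma W_truncr_increment:
 assumes "0 <= t" "0 <= u" "u <= H"
 shows "G.expectation (%om. \<bar>truncr R (W (t + u) om) - truncr R (W t om)\<bar>) <= sqrt H"
proof -
 have [measurable]: "W s \<in> borel_measurable M" for s by (rule W_measurable[OF aux])
 have eq: "t + u - t = u" by simp
 have dI: "distr M borel (%om. W (t + u) om - W t om) = distr gauss borel (%x. sqrt u * x)"
  using G.Y_incr[OF assms(1), of "t + u"] assms(2) by (simp only: eq le_add_same_cancel1)
 \<comment> \<open>The first absolute moment is bounded through
   \<open>\<bar>x\<bar> <= (1 + x\<^sup>2) / 2\<close> and the unit variance, so its exact value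
   does not occur.\<close>
 have m1: "(LINT x|gauss. \<bar>x\<bar>) <= 1"
 proof -
  have "(LINT x|gauss. \<bar>x\<bar>) <= (LINT x|gauss. (1 + x\<^sup>2) / 2)"
  proof (rule integral_mono)
   show "integrable gauss (%x. \<bar>x\<bar>)" using gauss_int1 by (rule integrable_abs)
   show "integrable gauss (%x. (1 + x\<^sup>2) / 2)" using gauss_int2 by simp
   fix x :: real
   have "0 <= (\<bar>x\<bar> - 1)\<^sup>2" by simp
   then show "\<bar>x\<bar> <= (1 + x\<^sup>2) / 2" unfolding power2_diff by simp
  qed
  also have "... = 1" using gauss_int2 gauss_var gauss.prob_space by simp
  finally show ?thesis .
 qed
 have i: "integrable M (%om. \<bar>W (t + u) om - W t om\<bar>)"
 proof -
  have "integrable (distr M borel (%om. W (t + u) om - W t om)) (%x. \<bar>x\<bar>)"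
   unfolding dI
  proof (subst integrable_distr_eq)
   have "integrable gauss (%x. sqrt u * x)" using gauss_int1 by (rule integrable_mult_right)
   then show "integrable gauss (%x. \<bar>sqrt u * x\<bar>)" by (rule integrable_abs)
  qed auto
  then show ?thesis by (subst (asm) integrable_distr_eq) auto
 qed
 have "G.expectation (%om. \<bar>truncr R (W (t + u) om) - truncr R (W t om)\<bar>) <= G.expectation (%om. \<bar>W (t + u) om - W t om\<bar>)"
  by (rule integral_mono'[OF i]) (rule truncr_Lipschitz, simp)
 also have "... = (LINT x|distr M borel (%om. W (t + u) om - W t om). \<bar>x\<bar>)" by (subst integral_distr) auto
 also have "... = (LINT x|gauss. \<bar>sqrt u * x\<bar>)"
  unfolding dI by (rule integral_distr) auto
 also have "... = (LINT x|gauss. sqrt u * \<bar>x\<bar>)"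
  using assms by (intro Bochner_Integration.integral_cong refl) (simp add: abs_mult)
 also have "... = sqrt u * (LINT x|gauss. \<bar>x\<bar>)" by simp
 also have "... <= sqrt H * 1" using m1 assms by (intro mult_mono) auto
 finally show ?thesis by simp
qed

text \<open>By path continuity the time integral is a limit of Riemann sums, so Fatou's lemma does
  the work of Fubini and only the measurability of each \<open>W t\<close> enters. The excess at
  time \<open>t\<close> is at most \<open>(W t)\<^sup>2 / R\<close>, of mean
  \<open>t / R\<close>.\<close>

lemma trunc_excess:
 assumes R: "0 < R"
 defines "Dl \<equiv> %om. integral {0..1} (%t. \<bar>W t om - truncr R (W t om)\<bar>)"
 shows "integrable M Dl" "G.expectation Dl <= 1 / R"
proof -
 have Wm[measurable]: "W s \<in> borel_measurable M" for s by (rule W_measurable[OF aux])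
 define S where "S i om = (\<Sum>j<Suc i. (1 / real (Suc i)) * \<bar>W (real j * (1 / real (Suc i))) om - truncr R (W (real j * (1 / real (Suc i))) om)\<bar>)" for i om
 have Sm[measurable]: "S i \<in> borel_measurable M" for i unfolding S_def by measurable
 have lim: "(%i. S i om) \<longlonglongrightarrow> Dl om" if "om \<in> space M" for om
  unfolding S_def Dl_def
 proof (rule Riemann_sum_tendsto[where h="%i. 1 / real (Suc i)" and k=Suc])
  show "continuous_on {0..1} (%t. \<bar>W t om - truncr R (W t om)\<bar>)"
   by (intro continuous_intros W_cont01[OF that] truncr_comp_continuous)
  show "(%i. 1 / real (Suc i)) \<longlonglongrightarrow> 0" using LIMSEQ_Suc[OF lim_const_over_n[of 1]] by simp
 qed auto
 have Dlm[measurable]: "Dl \<in> borel_measurable M" by (rule borel_measurable_LIMSEQ_real[OF lim]) auto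
 have S0: "0 <= S i om" for i om unfolding S_def by (intro sum_nonneg mult_nonneg_nonneg) auto
 have Dl0: "0 <= Dl om" if "om \<in> space M" for om
  by (rule LIMSEQ_le_const[OF lim[OF that]]) (use S0 in blast)
 have Si: "integrable M (%om. \<bar>W t om - truncr R (W t om)\<bar>)" "G.expectation (%om. \<bar>W t om - truncr R (W t om)\<bar>) <= t / R" if "0 <= t" for t
 proof -
  have i: "integrable M (%om. (W t om)\<^sup>2 / R)" using W_second_moment(2)[OF that] by simp
  show "integrable M (%om. \<bar>W t om - truncr R (W t om)\<bar>)"
  proof (rule Bochner_Integration.integrable_bound[OF i])
   have "norm \<bar>x - truncr R x\<bar> <= norm (x\<^sup>2 / R)" for x using truncr_error[OF R, of x] R by simp
   then show "AE om in M. norm \<bar>W t om - truncr R (W t om)\<bar> <= norm ((W t om)\<^sup>2 / R)" by (intro AE_I2)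
  qed simp
  have "G.expectation (%om. \<bar>W t om - truncr R (W t om)\<bar>) <= G.expectation (%om. (W t om)\<^sup>2 / R)"
   by (rule integral_mono'[OF i]) (rule truncr_error[OF R], use R in simp)
  then show "G.expectation (%om. \<bar>W t om - truncr R (W t om)\<bar>) <= t / R" using W_second_moment(1)[OF that] by simp
 qed
 have ES: "G.expectation (S i) <= 1 / R" "integrable M (S i)" for i
 proof -
  have ji: "0 <= real j * (1 / real (Suc i))" for j by simp
  show "integrable M (S i)" unfolding S_def by (intro Bochner_Integration.integrable_sum integrable_mult_right Si ji)
  have "G.expectation (S i) = (\<Sum>j<Suc i. (1 / real (Suc i)) * G.expectation (%om. \<bar>W (real j * (1 / real (Suc i))) om - truncr R (W (real j * (1 / real (Suc i))) om)\<bar>))"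
   unfolding S_def
   by (subst Bochner_Integration.integral_sum, intro integrable_mult_right Si ji, simp only: integral_mult_right_zero)
  also have "... <= (\<Sum>j<Suc i. (1 / real (Suc i)) * (1 / R))"
  proof (intro sum_mono mult_left_mono)
   fix j assume "j \<in> {..<Suc i}"
   then have "real j * (1 / real (Suc i)) <= 1" by (simp add: field_simps)
   then have "real j * (1 / real (Suc i)) / R <= 1 / R" using R by (intro divide_right_mono) auto
   then show "G.expectation (%om. \<bar>W (real j * (1 / real (Suc i))) om - truncr R (W (real j * (1 / real (Suc i))) om)\<bar>) <= 1 / R"
    using Si(2)[OF ji[of j]] by linarith
  qed simp
  also have "... = 1 / R" by (simp del: of_nat_Suc)
  finally show "G.expectation (S i) <= 1 / R" .
 qed
 have "(\<integral>\<^sup>+ om. ennreal (Dl om) \<partial>M) <= liminf (%i. \<integral>\<^sup>+ om. ennreal (S i om) \<partial>M)"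
 proof -
  have "(\<integral>\<^sup>+ om. ennreal (Dl om) \<partial>M) = (\<integral>\<^sup>+ om. liminf (%i. ennreal (S i om)) \<partial>M)"
  proof (rule nn_integral_cong)
   fix om assume "om \<in> space M"
   from tendsto_ennrealI[OF lim[OF this]] show "ennreal (Dl om) = liminf (%i. ennreal (S i om))"
    by (rule lim_imp_Liminf[OF sequentially_bot, symmetric])
  qed
  also have "... <= liminf (%i. \<integral>\<^sup>+ om. ennreal (S i om) \<partial>M)" by (rule nn_integral_liminf) measurable
  finally show ?thesis .
 qed
 also have "... <= liminf (%i. ennreal (1 / R))"
 proof (rule Liminf_mono, rule always_eventually, rule allI)
  fix i
  have "(\<integral>\<^sup>+ om. ennreal (S i om) \<partial>M) = ennreal (G.expectation (S i))"
   by (rule nn_integral_eq_integral[OF ES(2)]) (intro AE_I2 S0)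
  also have "... <= ennreal (1 / R)" by (rule ennreal_leI[OF ES(1)])
  finally show "(\<integral>\<^sup>+ om. ennreal (S i om) \<partial>M) <= ennreal (1 / R)" .
 qed
 finally have nn: "(\<integral>\<^sup>+ om. ennreal (Dl om) \<partial>M) <= ennreal (1 / R)" by (simp add: Liminf_const)
 show int: "integrable M Dl"
 proof (rule integrableI_nonneg)
  show "(\<integral>\<^sup>+ om. ennreal (Dl om) \<partial>M) < \<infinity>" using nn by (rule order.strict_trans1) simp
 qed (use Dl0 in \<open>auto intro!: AE_I2\<close>)
 have "ennreal (G.expectation Dl) <= ennreal (1 / R)"
  using nn nn_integral_eq_integral[OF int] Dl0 by (simp add: AE_I2)
 then show "G.expectation Dl <= 1 / R" using R by (subst (asm) ennreal_le_iff) auto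
qed

end

context
 fixes M :: "'b measure" and W :: "real \<Rightarrow> 'b \<Rightarrow> real" and N :: "real \<Rightarrow> 'b \<Rightarrow> nat" and L :: "real \<Rightarrow> real \<Rightarrow> 'b \<Rightarrow> real"
 assumes aux: "aux_space M 0 W N L"
begin

interpretation G: grid_process M "nat_filtration M W N" W "%t. distr gauss borel (%x. sqrt t * x)"
 by (rule aux_grid_process[OF aux])

lemma N_zero_AE: "AE om in M. N 1 om = 0"
proof -
 have N0: "!!om. om \<in> space M ==> N 0 om = 0" using aux by (simp add: aux_space_def poisson_process_def)
 have [measurable]: "N t \<in> measurable M (count_space UNIV)" for t by (rule N_measurable[OF aux])
 have "G.prob {om\<in>space M. N 1 om - N 0 om = k} = exp (- 0 * (1 - 0)) * (0 * (1 - 0)) ^ k / fact k" for k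
  using aux by (simp add: aux_space_def poisson_process_def)
 from this[of 0] have "G.prob {om\<in>space M. N 1 om - N 0 om = 0} = 1" by simp
 moreover have "{om\<in>space M. N 1 om - N 0 om = 0} = {om\<in>space M. N 1 om = 0}" using N0 by auto
 ultimately have "G.prob {om\<in>space M. N 1 om = 0} = 1" by simp
 then show ?thesis by (subst (asm) G.prob_eq_1) auto
qed

lemma N_mono: "om \<in> space M ==> 0 <= s ==> s <= t ==> N s om <= N t om"
 using aux by (auto simp: aux_space_def poisson_process_def mono_on_def)

lemma L_measurable: "L t x \<in> borel_measurable M"
 and L_cont: "om \<in> space M ==> continuous_on {0..} (%t. L t x om)"
 using aux by (auto simp: aux_space_def local_time_of_def)

text \<open>The first jump is the limit of the fraction \<open>c i / Suc i\<close> of grid points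
  without a jump so far, which is measurable; continuity of \<open>L\<close> in time carries this
  over. Paths without a jump up to time 1 are set to 0, since there \<open>first_jump\<close> may
  exceed 1 or be the infimum of the empty set.\<close>

lemma L_first_jump_measurable:
 "(%om. (if N 1 om = 0 then 0 else L (first_jump N om) x om)) \<in> borel_measurable M"
proof -
 have [measurable]: "N t \<in> measurable M (count_space UNIV)" "L t x \<in> borel_measurable M" for t
  by (rule N_measurable[OF aux], rule L_measurable)
 define c where "c i om = (\<Sum>j<Suc i. if N (real j / real (Suc i)) om = 0 then 1 else 0 :: nat)" for i om
 have cm[measurable]: "c i \<in> measurable M (count_space UNIV)" for i unfolding c_def by measurable
 define G where "G i om = (if N 1 om = 0 then 0 else L (real (c i om) / real (Suc i)) x om)" for i om
 show ?thesis
 proof (rule borel_measurable_LIMSEQ_real)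
  have "(%om. L (real (c i om) / real (Suc i)) x om) \<in> borel_measurable M" for i
   by (rule measurable_compose_countable[where g="c i" and f="%k om. L (real k / real (Suc i)) x om"]) measurable
  then show "G i \<in> borel_measurable M" for i unfolding G_def by measurable
  fix om assume w: "om \<in> space M"
  show "(%i. G i om) \<longlonglongrightarrow> (if N 1 om = 0 then 0 else L (first_jump N om) x om)"
  proof (cases "N 1 om = 0")
   case False
   define S where "S = {t. 0 <= t \<and> 1 <= N t om}"
   define f where "f = first_jump N om"
   have fS: "f = Inf S" unfolding f_def first_jump_def S_def ..
   have oneS: "1 \<in> S" using False by (simp add: S_def)
   have bdd: "bdd_below S" by (rule bdd_belowI[of _ 0]) (simp add: S_def)
   have f0: "0 <= f" unfolding fS using oneS by (intro cInf_greatest) (blast, simp add: S_def)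
   have f1: "f <= 1" unfolding fS by (rule cInf_lower[OF oneS bdd])
   have before: "N t om = 0" if "0 <= t" "t < f" for t
   proof (rule ccontr)
    assume "N t om \<noteq> 0"
    then have "t \<in> S" using that by (simp add: S_def)
    then show False using cInf_lower[OF _ bdd] that unfolding fS by fastforce
   qed
   have after: "N t om \<noteq> 0" if ft: "f < t" for t
   proof -
    obtain u where u: "u \<in> S" "u < t" using cInf_lessD[of S t] oneS ft unfolding fS by blast
    then show ?thesis using N_mono[OF w, of u t] by (simp add: S_def)
   qed
   have cb: "f <= real (c i om) / real (Suc i) \<and> real (c i om) / real (Suc i) <= f + 1 / real (Suc i)" for i
   proof -
    define m where "m = real (Suc i)"
    have m: "0 < m" by (simp add: m_def)
    define A where "A = {j \<in> {..<Suc i}. N (real j / m) om = 0}"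
    have cA: "c i om = card A" unfolding c_def A_def m_def by (simp add: sum.If_cases Int_def del: of_nat_Suc sum.lessThan_Suc)
    have fin: "finite A" by (simp add: A_def)
    have "{..<nat \<lceil>m * f\<rceil>} \<subseteq> A"
    proof
     fix j assume "j \<in> {..<nat \<lceil>m * f\<rceil>}"
     then have j: "real j < m * f" by (simp add: less_ceiling_iff zless_nat_eq_int_zless)
     then have "real j / m < f" using m by (simp add: pos_divide_less_eq mult.commute)
     moreover have "m * f <= m" using f1 m by (simp add: mult_left_le)
     ultimately have "real j < real (Suc i)" using j unfolding m_def by linarith
     then show "j \<in> A" using \<open>real j / m < f\<close> before[of "real j / m"] j m unfolding A_def by (auto simp: m_def)
    qed
    from card_mono[OF fin this] have l: "m * f <= real (c i om)" unfolding cA by simp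
    have "A \<subseteq> {..nat \<lfloor>m * f\<rfloor>}"
    proof
     fix j assume "j \<in> A"
     then have "\<not> f < real j / m" using after[of "real j / m"] by (auto simp: A_def)
     then have "real j <= m * f" using m by (simp add: not_less pos_divide_le_eq mult.commute)
     then show "j \<in> {..nat \<lfloor>m * f\<rfloor>}" by (simp add: le_nat_floor)
    qed
    from card_mono[OF _ this] have "c i om <= Suc (nat \<lfloor>m * f\<rfloor>)" unfolding cA by simp
    moreover have "real (nat \<lfloor>m * f\<rfloor>) <= m * f" using f0 m by simp
    ultimately have u: "real (c i om) <= m * f + 1" by linarith
    show ?thesis unfolding m_def[symmetric] using l u m by (simp add: pos_le_divide_eq pos_divide_le_eq mult.commute distrib_left)
   qed
   have lim: "(%i. real (c i om) / real (Suc i)) \<longlonglongrightarrow> f"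
   proof (rule real_tendsto_sandwich[OF _ _ tendsto_const])
    show "\<forall>\<^sub>F i in sequentially. f <= real (c i om) / real (Suc i)" using cb by (simp del: of_nat_Suc)
    show "\<forall>\<^sub>F i in sequentially. real (c i om) / real (Suc i) <= f + 1 / real (Suc i)" using cb by (simp del: of_nat_Suc)
    show "(%i. f + 1 / real (Suc i)) \<longlonglongrightarrow> f" using tendsto_add[OF tendsto_const LIMSEQ_inverse_real_of_nat, of f] by (simp add: inverse_eq_divide)
   qed
   have "(%i. L (real (c i om) / real (Suc i)) x om) \<longlonglongrightarrow> L f x om"
    by (rule continuous_on_tendsto_compose[OF L_cont[OF w] lim]) (use f0 in \<open>auto intro!: always_eventually\<close>)
   then show ?thesis using False unfolding G_def f_def by simp
  qed (simp add: G_def)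
 qed
qed

text \<open>The grid reward is the mean of a Riemann sum along a continuous path, cut off at the
  grid time. All sums are bounded by \<open>\<bar>y\<bar> + R\<close>, so dominated convergence
  applies, and measurability of the stopped integral comes with the pathwise limit.\<close>

lemma truncated_integral_limit:
 fixes y R :: real and n :: nat and tau :: "'b \<Rightarrow> real" and kp :: "nat \<Rightarrow> 'b \<Rightarrow> nat"
 assumes R: "0 < R" and n: "0 < n" and tau: "\<forall>om\<in>space M. 0 <= tau om \<and> tau om <= 1"
 defines "h \<equiv> %i. 1 / real (n * Suc i)"
 assumes kp: "!!i. G.gstop (h i) (n * Suc i) (kp i)"
  and lim: "\<forall>om\<in>space M. (%i. real (kp i om) * h i) \<longlonglongrightarrow> tau om"
 defines "I \<equiv> %om. integral {0..tau om} (%t. y + truncr R (W t om))"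
 shows "integrable M I"
  and "(%i. G.rew (h i) (%x. h i * (1 * (y + truncr R x))) (n * Suc i) (kp i)) \<longlonglongrightarrow> G.expectation I"
proof -
 have [measurable]: "W t \<in> borel_measurable M" for t by (rule W_measurable[OF aux])
 have h: "0 < h i" for i using n by (simp add: h_def del: of_nat_Suc mult_Suc_right)
 have nh: "real (n * Suc i) * h i = 1" for i using n by (simp add: h_def del: of_nat_Suc mult_Suc_right)
 have h_lim: "h \<longlonglongrightarrow> 0"
 proof -
  have "(%i. (1 / real n) * inverse (real (Suc i))) \<longlonglongrightarrow> (1 / real n) * 0" by (intro tendsto_mult tendsto_const LIMSEQ_inverse_real_of_nat)
  then show ?thesis unfolding h_def by (simp add: field_simps)
 qed
 have kb: "om \<in> space M ==> kp i om <= n * Suc i" for i om using kp[of i] unfolding G.gstop_def[OF less_imp_le[OF h]] by blast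
 have km[measurable]: "{om\<in>space M. j < kp i om} \<in> sets M" for i j
 proof -
  have "{om\<in>space M. kp i om <= j} \<in> sets M"
   using kp[of i] G.F_sub unfolding G.gstop_def[OF less_imp_le[OF h]] subalgebra_def by blast
  then have "space M - {om\<in>space M. kp i om <= j} \<in> sets M" by auto
  also have "space M - {om\<in>space M. kp i om <= j} = {om\<in>space M. j < kp i om}" by auto
  finally show ?thesis .
 qed
 define c where "c x = y + truncr R x" for x
 have cb: "\<bar>c x\<bar> <= \<bar>y\<bar> + R" for x using truncr_bound[of R x] R unfolding c_def by simp
 have cm[measurable]: "c \<in> borel_measurable borel" unfolding c_def by measurable
 let ?I = "%i j. indicator {om\<in>space M. j < kp i om} :: 'b \<Rightarrow> real"
 define S where "S i om = (\<Sum>j<n * Suc i. ?I i j om * (h i * (1 * c (W (real j * h i) om))))" for i om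
 have Sm[measurable]: "S i \<in> borel_measurable M" for i unfolding S_def by measurable
 have Sb: "\<bar>S i om\<bar> <= \<bar>y\<bar> + R" for i om
 proof -
  have "\<bar>S i om\<bar> <= (\<Sum>j<n * Suc i. \<bar>?I i j om * (h i * (1 * c (W (real j * h i) om)))\<bar>)" unfolding S_def by (rule sum_abs)
  also have "... <= (\<Sum>j<n * Suc i. h i * (\<bar>y\<bar> + R))"
  proof (rule sum_mono)
   fix j
   have "h i * \<bar>c (W (real j * h i) om)\<bar> <= h i * (\<bar>y\<bar> + R)" by (rule mult_left_mono[OF cb less_imp_le[OF h]])
   moreover have "0 <= h i * (\<bar>y\<bar> + R)" using h[of i] R by simp
   ultimately show "\<bar>?I i j om * (h i * (1 * c (W (real j * h i) om)))\<bar> <= h i * (\<bar>y\<bar> + R)"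
    using h[of i] R by (simp add: abs_mult indicator_def)
  qed
  also have "... = (real (n * Suc i) * h i) * (\<bar>y\<bar> + R)" by (simp add: mult.assoc)
  finally show ?thesis unfolding nh by simp
 qed
 have Slim: "(%i. S i om) \<longlonglongrightarrow> I om" if w: "om \<in> space M" for om
 proof -
  have "S i om = (\<Sum>j<kp i om. h i * c (W (real j * h i) om))" for i
  proof -
   have "S i om = (\<Sum>j<n * Suc i. if j \<in> {..<kp i om} then h i * c (W (real j * h i) om) else 0)"
    unfolding S_def using w by (intro sum.cong refl) (simp add: indicator_def)
   also have "... = (\<Sum>j\<in>{..<n * Suc i} \<inter> {..<kp i om}. h i * c (W (real j * h i) om))" by (rule sum.inter_restrict[symmetric]) simp
   also have "{..<n * Suc i} \<inter> {..<kp i om} = {..<kp i om}" using kb[OF w, of i] by auto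
   finally show ?thesis .
  qed
  moreover have "(%i. \<Sum>j<kp i om. h i * c (W (real j * h i) om)) \<longlonglongrightarrow> integral {0..tau om} (%t. c (W t om))"
  proof (rule Riemann_sum_tendsto[OF _ h h_lim _ bspec[OF lim w]])
   show "continuous_on {0..1} (%t. c (W t om))"
    unfolding c_def by (intro continuous_intros truncr_comp_continuous[OF aux] W_cont01[OF aux] w)
   fix i
   have "real (kp i om) * h i <= real (n * Suc i) * h i" using kb[OF w, of i] h[of i] by (intro mult_right_mono) (simp_all only: of_nat_le_iff less_imp_le)
   then show "real (kp i om) * h i <= 1" unfolding nh .
  qed (use bspec[OF tau w] in auto)
  ultimately show ?thesis unfolding I_def c_def by simp
 qed
 have Im[measurable]: "I \<in> borel_measurable M" by (rule borel_measurable_LIMSEQ_real[OF Slim Sm])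
 have wi: "integrable M (%_. \<bar>y\<bar> + R)" by simp
 have AEl: "AE om in M. (%i. S i om) \<longlonglongrightarrow> I om" by (rule AE_I2[OF Slim])
 have AEb: "!!i. AE om in M. norm (S i om) <= \<bar>y\<bar> + R" unfolding real_norm_def by (rule AE_I2[OF Sb])
 note dc = integral_dominated_convergence[OF Im Sm wi AEl AEb] integrable_dominated_convergence[OF Im Sm wi AEl AEb]
 show "integrable M I" by (rule dc)
 have "G.rew (h i) (%x. h i * (1 * (y + truncr R x))) (n * Suc i) (kp i) = G.expectation (S i)" for i
  unfolding G.rew_def S_def c_def[symmetric]
 proof (rule Bochner_Integration.integral_sum[symmetric])
  fix j
  show "integrable M (%om. ?I i j om * (h i * (1 * c (W (real j * h i) om))))"
  proof (rule G.integrable_const_bound[of _ "h i * (\<bar>y\<bar> + R)"])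
   have "h i * \<bar>c x\<bar> <= h i * (\<bar>y\<bar> + R)" for x by (rule mult_left_mono[OF cb less_imp_le[OF h]])
   moreover have "0 <= h i * (\<bar>y\<bar> + R)" using h[of i] R by simp
   ultimately show "AE om in M. norm (?I i j om * (h i * (1 * c (W (real j * h i) om)))) <= h i * (\<bar>y\<bar> + R)"
    using h[of i] R by (intro AE_I2) (simp add: abs_mult indicator_def)
  qed measurable
 qed
 then show "(%i. G.rew (h i) (%x. h i * (1 * (y + truncr R x))) (n * Suc i) (kp i)) \<longlonglongrightarrow> G.expectation I"
  using dc(1) by simp
qed

text \<open>The factor 1 is the parameter \<open>\<beta>\<close> of \<open>coarsen\<close>, kept so
  that the expressions agree literally. \<open>aux_err\<close> is the error of
  \<open>coarsen\<close> on the unit horizon with \<open>E0 = sqrt (1 / n)\<close>.\<close>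

abbreviation "aux_stop_value R n y \<equiv> stop_value (distr gauss borel (%x. sqrt (1 / real n) * x)) (%x. (1 / real n) * (1 * (y + truncr R x))) n 0"
abbreviation "aux_err R n y \<equiv> sqrt (1 / real n) + (1 / real n) * (\<bar>y\<bar> + R)"

lemma truncated_coarse:
 fixes y R :: real
 assumes R: "0 < R" and n: "0 < n" and kp: "G.gstop (1 / real (n * Suc i)) (n * Suc i) kp"
 defines "h \<equiv> 1 / real (n * Suc i)" and "kp' \<equiv> %om. (kp om + Suc i - 1) div Suc i"
 shows "G.gstop (1 / real n) n kp'"
  and "\<bar>G.rew h (%x. h * (1 * (y + truncr R x))) (n * Suc i) kp - G.rew (1 / real n) (%x. (1 / real n) * (1 * (y + truncr R x))) n kp'\<bar> <= aux_err R n y"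
proof -
 have h: "0 < h" "1 / real n = real (Suc i) * h" using n by (simp_all add: h_def del: of_nat_Suc mult_Suc_right)
 have inc: "!!t u. 0 <= t ==> 0 <= u ==> u <= 1 / real n ==> G.expectation (%om. \<bar>truncr R (W (t + u) om) - truncr R (W t om)\<bar>) <= sqrt (1 / real n)"
  by (rule W_truncr_increment[OF aux])
 note kph = kp[folded h_def]
 show "G.gstop (1 / real n) n kp'"
  unfolding kp'_def by (rule G.coarsen(1)[OF h(1) zero_less_Suc h(2) kph zero_le_one less_imp_le[OF R]]) (rule inc)
 have "\<bar>G.rew h (%x. h * (1 * (y + truncr R x))) (n * Suc i) kp - G.rew (1 / real n) (%x. (1 / real n) * (1 * (y + truncr R x))) n kp'\<bar>
   <= real n * (1 / real n) * (1 * sqrt (1 / real n)) + (1 / real n) * (1 * (\<bar>y\<bar> + R))"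
  unfolding kp'_def by (rule G.coarsen(2)[OF h(1) zero_less_Suc h(2) kph zero_le_one less_imp_le[OF R]]) (rule inc)
 also have "real n * (1 / real n) * (1 * sqrt (1 / real n)) + (1 / real n) * (1 * (\<bar>y\<bar> + R)) = aux_err R n y" using n by simp
 finally show "\<bar>G.rew h (%x. h * (1 * (y + truncr R x))) (n * Suc i) kp - G.rew (1 / real n) (%x. (1 / real n) * (1 * (y + truncr R x))) n kp'\<bar> <= aux_err R n y" .
qed

lemma truncated_running_bounded:
 assumes "0 < R" "0 < n" shows "\<bar>(1 / real n) * (1 * (y + truncr R x))\<bar> <= (1 / real n) * (\<bar>y\<bar> + R)"
 using truncr_bound[of R x] assms by (simp add: abs_mult divide_right_mono)

lemma truncated_integral_upper:
 assumes R: "0 < R" and n: "0 < n" and tau: "stopping_time (nat_filtration M W N) tau" "\<forall>om\<in>space M. 0 <= tau om \<and> tau om <= 1"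
 shows "integrable M (%om. integral {0..tau om} (%t. y + truncr R (W t om)))"
  and "G.expectation (%om. integral {0..tau om} (%t. y + truncr R (W t om))) <= aux_stop_value R n y + aux_err R n y"
proof -
 define h where "h i = 1 / real (n * Suc i)" for i
 have h: "0 < h i" for i using n by (simp add: h_def del: of_nat_Suc mult_Suc_right)
 have nh: "real (n * Suc i) * h i = 1" for i using n by (simp add: h_def del: of_nat_Suc mult_Suc_right)
 have h_lim: "h \<longlonglongrightarrow> 0"
 proof -
  have "(%i. (1 / real n) * inverse (real (Suc i))) \<longlonglongrightarrow> (1 / real n) * 0" by (intro tendsto_mult tendsto_const LIMSEQ_inverse_real_of_nat)
  then show ?thesis unfolding h_def by (simp add: field_simps)
 qed
 define kp where "kp i om = nat \<lceil>tau om / h i\<rceil>" for i om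
 have g: "G.gstop (h i) (n * Suc i) (kp i)" for i
  unfolding kp_def by (rule G.grid_round_up[OF tau(1) _ h]) (use tau(2) nh in simp)
 have lim: "\<forall>om\<in>space M. (%i. real (kp i om) * h i) \<longlonglongrightarrow> tau om"
 proof (rule ballI, rule real_tendsto_sandwich[OF _ _ tendsto_const])
  fix om assume w: "om \<in> space M"
  have b: "tau om <= real (kp i om) * h i \<and> real (kp i om) * h i <= tau om + h i" for i
  proof -
   have "0 <= tau om / h i" using bspec[OF tau(2) w] h[of i] by simp
   then have "real (kp i om) = of_int \<lceil>tau om / h i\<rceil>" unfolding kp_def by simp
   then have "tau om / h i <= real (kp i om)" "real (kp i om) <= tau om / h i + 1" by linarith+
   then show ?thesis using h[of i] by (simp add: field_simps)
  qed
  show "\<forall>\<^sub>F i in sequentially. tau om <= real (kp i om) * h i" "\<forall>\<^sub>F i in sequentially. real (kp i om) * h i <= tau om + h i"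
   using b by auto
  show "(%i. tau om + h i) \<longlonglongrightarrow> tau om" using tendsto_add[OF tendsto_const h_lim, of "tau om"] by simp
 qed
 note L = truncated_integral_limit[where kp=kp, OF R n tau(2), folded h_def, OF g lim]
 show "integrable M (%om. integral {0..tau om} (%t. y + truncr R (W t om)))" by (rule L(1))
 show "G.expectation (%om. integral {0..tau om} (%t. y + truncr R (W t om))) <= aux_stop_value R n y + aux_err R n y"
 proof (rule tendsto_upperbound[OF L(2)])
  show "\<forall>\<^sub>F i in sequentially. G.rew (h i) (%x. h i * (1 * (y + truncr R x))) (n * Suc i) (kp i) <= aux_stop_value R n y + aux_err R n y"
  proof (rule always_eventually, rule allI)
   fix i
   note C1 = truncated_coarse(1)[where i=i, OF R n g[unfolded h_def], folded h_def] and C2 = truncated_coarse(2)[where i=i and y=y, OF R n g[unfolded h_def], folded h_def]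
   have "G.rew (1 / real n) (%x. (1 / real n) * (1 * (y + truncr R x))) n (%om. (kp i om + Suc i - 1) div Suc i) <= aux_stop_value R n y"
    by (rule G.rew_le_stop_value[OF _ C1 _ truncated_running_bounded[OF R n]]) (use n in auto)
   then show "G.rew (h i) (%x. h i * (1 * (y + truncr R x))) (n * Suc i) (kp i) <= aux_stop_value R n y + aux_err R n y"
    using C2 by (simp only: abs_le_iff) linarith
  qed
 qed simp_all
qed

text \<open>The optimal coarse rule is held fixed while the grid on which its reward is evaluated
  gets finer, so the rewards tend to the stopped integral and lose at most
  \<open>aux_err\<close>.\<close>

lemma truncated_integral_lower:
 assumes R: "0 < R" and n: "0 < n"
 obtains kp where "G.gstop (1 / real n) n kp"
  "aux_stop_value R n y - aux_err R n y <= G.expectation (%om. integral {0..real (kp om) * (1 / real n)} (%t. y + truncr R (W t om)))"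
proof -
 have n': "0 < 1 / real n" using n by simp
 have cm: "(%x. (1 / real n) * (1 * (y + truncr R x))) \<in> borel_measurable borel" by measurable
 obtain kp where kp: "G.gstop (1 / real n) n kp" "G.rew (1 / real n) (%x. (1 / real n) * (1 * (y + truncr R x))) n kp = aux_stop_value R n y"
  by (rule G.rew_attains_stop_value[OF n' cm truncated_running_bounded[OF R n, of y], where N=n])
 have kn: "om \<in> space M ==> kp om <= n" for om using kp(1) unfolding G.gstop_def[OF less_imp_le[OF n']] by blast
 define h where "h i = 1 / real (n * Suc i)" for i
 have h: "0 < h i" "1 / real n = real (Suc i) * h i" for i using n by (simp_all add: h_def del: of_nat_Suc mult_Suc_right)
 have g: "G.gstop (h i) (n * Suc i) (%om. kp om * Suc i)" for i by (rule G.refine_stopping(1)[OF h(1) _ h(2) kp(1)]) simp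
 have r: "(kp om * Suc i + Suc i - 1) div Suc i = kp om" for i om by (rule G.refine_stopping(2)[OF h(1)[of i] _ h(2) kp(1)]) simp
 have lim: "\<forall>om\<in>space M. (%i. real (kp om * Suc i) * h i) \<longlonglongrightarrow> real (kp om) * (1 / real n)"
 proof
  fix om
  have "real (kp om * Suc i) * h i = real (kp om) * (1 / real n)" for i unfolding h(2)[of i] by (simp only: of_nat_mult mult.assoc)
  then show "(%i. real (kp om * Suc i) * h i) \<longlonglongrightarrow> real (kp om) * (1 / real n)" by simp
 qed
 have t: "\<forall>om\<in>space M. 0 <= real (kp om) * (1 / real n) \<and> real (kp om) * (1 / real n) <= 1" using kn n by simp
 note L = truncated_integral_limit[where kp="%i om. kp om * Suc i", OF R n t, folded h_def, OF g lim]
 have "aux_stop_value R n y - aux_err R n y <= G.expectation (%om. integral {0..real (kp om) * (1 / real n)} (%t. y + truncr R (W t om)))"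
 proof (rule tendsto_lowerbound[OF L(2)])
  show "\<forall>\<^sub>F i in sequentially. aux_stop_value R n y - aux_err R n y <= G.rew (h i) (%x. h i * (1 * (y + truncr R x))) (n * Suc i) (%om. kp om * Suc i)"
  proof (rule always_eventually, rule allI)
   fix i
   show "aux_stop_value R n y - aux_err R n y <= G.rew (h i) (%x. h i * (1 * (y + truncr R x))) (n * Suc i) (%om. kp om * Suc i)"
    using truncated_coarse(2)[where i=i and y=y, OF R n g[unfolded h_def], folded h_def] unfolding r kp(2) by (simp only: abs_le_iff) linarith
  qed
 qed simp_all
 then show thesis using that kp(1) by blast
qed

text \<open>At intensity 0 there is almost surely no jump, so the reward is almost surely the
  stopped integral of \<open>y + W\<close>; replacing \<open>W\<close> by its truncation changes it
  by at most \<open>Dl\<close>, of mean at most \<open>1 / R\<close>. The lower bound has to exhibit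
  an integrable reward, because integrals of non-integrable functions are 0 by convention; most of
  the measurability work serves this.\<close>

lemma v_aux_approx:
 assumes R: "0 < R" and n: "0 < n"
 shows "\<bar>v_aux M W N L 0 \<beta> y - aux_stop_value R n y\<bar> <= 1 / R + aux_err R n y"
proof -
 have [measurable]: "N t \<in> measurable M (count_space UNIV)" "L t x \<in> borel_measurable M" for t x
  by (rule N_measurable[OF aux], rule L_measurable)
 define J where "J tau om = exp (- 0 * tau om) * (if N (tau om) om = 0 then 1 else 0) *
       integral {0..tau om} (%s. f_aux (0 * \<beta>) (y + W s om))
     + \<beta> * exp (0 * tau om) / 2 * (if N (tau om) om = 1 then 1 else 0) *
       (L (tau om) (- y) om - L (first_jump N om) (- y) om)" for tau om
 define S where "S = {tau. stopping_time (nat_filtration M W N) tau \<and> (\<forall>om\<in>space M. 0 <= tau om \<and> tau om <= 1)}"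
 have v: "v_aux M W N L 0 \<beta> y = (SUP tau\<in>S. G.expectation (J tau))"
  unfolding v_aux_def J_def S_def ..
 define I where "I tau om = integral {0..tau om} (%t. y + truncr R (W t om))" for tau om
 define Dl where "Dl om = integral {0..1} (%t. \<bar>W t om - truncr R (W t om)\<bar>)" for om
 have Dl: "integrable M Dl" "G.expectation Dl <= 1 / R" using trunc_excess[OF aux R] unfolding Dl_def by auto
 have JI: "AE om in M. \<bar>J tau om - I tau om\<bar> <= Dl om" if t: "\<forall>om\<in>space M. 0 <= tau om \<and> tau om <= 1" for tau
  using N_zero_AE
 proof (rule AE_mp, intro AE_I2 impI)
  fix om assume w: "om \<in> space M" and N1: "N 1 om = 0"
  have Nt: "N (tau om) om = 0" using N_mono[OF w, of "tau om" 1] bspec[OF t w] N1 by simp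
  have ci: "(%t. W t om) integrable_on {0..u}" "(%t. truncr R (W t om)) integrable_on {0..u}" if "u <= 1" for u
   using that W_cont01[OF aux w] truncr_comp_continuous[OF aux W_cont01[OF aux w], of R]
   by (auto intro!: integrable_continuous_real elim!: continuous_on_subset)
  have t1: "tau om <= 1" using bspec[OF t w] by simp
  have yi: "(%s. y) integrable_on {0..tau om}" by (rule integrable_const_ivl)
  have J: "J tau om = integral {0..tau om} (%s. y + W s om)" unfolding J_def f_aux_def using Nt by simp
  have "J tau om - I tau om = integral {0..tau om} (%s. (y + W s om) - (y + truncr R (W s om)))"
   unfolding J I_def
   by (rule Henstock_Kurzweil_Integration.integral_diff[symmetric]) (intro integrable_add yi ci t1)+
  also have "(%s. (y + W s om) - (y + truncr R (W s om))) = (%s. W s om - truncr R (W s om))" by auto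
  finally have eq: "J tau om - I tau om = integral {0..tau om} (%s. W s om - truncr R (W s om))" .
  have cd: "continuous_on {0..1} (%s. W s om - truncr R (W s om))"
   by (intro continuous_intros truncr_comp_continuous[OF aux] W_cont01[OF aux w])
  have di: "(%s. W s om - truncr R (W s om)) integrable_on {0..tau om}"
   "(%s. \<bar>W s om - truncr R (W s om)\<bar>) integrable_on {0..tau om}" "(%s. \<bar>W s om - truncr R (W s om)\<bar>) integrable_on {0..1}"
   using t1 by (auto intro!: integrable_continuous_real continuous_on_rabs continuous_on_subset[OF cd])
  have "norm (integral {0..tau om} (%s. W s om - truncr R (W s om))) <= integral {0..tau om} (%s. \<bar>W s om - truncr R (W s om)\<bar>)"
   by (rule integral_norm_bound_integral[OF di(1,2)]) simp
  also have "... <= Dl om" unfolding Dl_def by (rule integral_subset_le[OF _ di(2,3)]) (use t1 in auto)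
  finally show "\<bar>J tau om - I tau om\<bar> <= Dl om" unfolding eq by simp
 qed
 have err0: "0 <= aux_err R n y" using R by simp
 have sv0: "0 <= aux_stop_value R n y" by (rule stop_value_nonneg)
 have R1: "0 <= 1 / R" using R by simp
 have up: "G.expectation (J tau) <= aux_stop_value R n y + aux_err R n y + 1 / R" if "tau \<in> S" for tau
 proof (cases "integrable M (J tau)")
  case False
  \<comment> \<open>A reward that is not integrable counts as 0, which the nonnegative right-hand
    side dominates.\<close>
  then have "G.expectation (J tau) = 0" by (rule not_integrable_integral_eq)
  then show ?thesis using err0 sv0 R1 by linarith
 next
  case True
  have t: "stopping_time (nat_filtration M W N) tau" "\<forall>om\<in>space M. 0 <= tau om \<and> tau om <= 1" using that by (auto simp: S_def)
  note u = truncated_integral_upper[OF R n t, of y, folded I_def]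
  have "G.expectation (J tau) <= G.expectation (%om. I tau om + Dl om)"
  proof (rule integral_mono_AE[OF True Bochner_Integration.integrable_add[OF u(1) Dl(1)]])
   show "AE om in M. J tau om <= I tau om + Dl om" by (rule AE_mp[OF JI[OF t(2)] AE_I2], intro impI, linarith)
  qed
  also have "... = G.expectation (I tau) + G.expectation Dl" by (rule Bochner_Integration.integral_add[OF u(1) Dl(1)])
  finally show ?thesis using u(2) Dl(2) by linarith
 qed
 obtain kp where kp: "G.gstop (1 / real n) n kp" "aux_stop_value R n y - aux_err R n y <= G.expectation (%om. integral {0..real (kp om) * (1 / real n)} (%t. y + truncr R (W t om)))"
  by (rule truncated_integral_lower[OF R n])
 have n': "0 < 1 / real n" using n by simp
 define tau where "tau om = real (kp om) * (1 / real n)" for om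
 have tau: "stopping_time (nat_filtration M W N) tau" unfolding tau_def by (rule G.grid_stopping_time[OF n' kp(1)])
 have tau01: "\<forall>om\<in>space M. 0 <= tau om \<and> tau om <= 1"
 proof
  fix om assume that: "om \<in> space M"
  have "kp om <= n" using kp(1) that unfolding G.gstop_def[OF less_imp_le[OF n']] by blast
  then show "0 <= tau om \<and> tau om <= 1" using n by (simp add: tau_def)
 qed
 have tauS: "tau \<in> S" using tau tau01 by (simp add: S_def)
 note u = truncated_integral_upper[OF R n tau tau01, of y, folded I_def]
 have [measurable]: "kp \<in> measurable M (count_space UNIV)"
  by (rule random_walk.grid_stopping_measurable[OF G.walk[OF less_imp_le[OF n']] kp(1)])
 have Nt[measurable]: "(%om. N (tau om) om) \<in> measurable M (count_space UNIV)"
  unfolding tau_def by (rule measurable_compose_countable[where g=kp and f="%k om. N (real k * (1 / real n)) om"]) measurable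
 have Lt[measurable]: "(%om. L (tau om) (- y) om) \<in> borel_measurable M"
  unfolding tau_def by (rule measurable_compose_countable[where g=kp and f="%k om. L (real k * (1 / real n)) (- y) om"]) measurable
 \<comment> \<open>On each path the truncation is inactive once its level exceeds the maximum of
   \<open>\<bar>W\<bar>\<close> on \<open>{0..1}\<close>, so the integral is an eventually constant
   limit of measurable ones.\<close>
 have It[measurable]: "(%om. integral {0..tau om} (%s. y + W s om)) \<in> borel_measurable M"
 proof (rule borel_measurable_LIMSEQ_real)
  show "(%om. integral {0..tau om} (%t. y + truncr (real (Suc i)) (W t om))) \<in> borel_measurable M" for i
   by (rule borel_measurable_integrable[OF truncated_integral_upper(1)[OF _ n tau tau01]]) auto
  fix om assume w: "om \<in> space M"
  have "compact ((%t. W t om) ` {0..1})" by (rule compact_continuous_image[OF W_cont01[OF aux w]]) simp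
  then obtain B where B: "!!t. t \<in> {0..1} ==> \<bar>W t om\<bar> <= B"
   using compact_imp_bounded bounded_iff by (metis (no_types, lifting) image_eqI real_norm_def)
  obtain i0 where i0: "B <= real i0" using real_arch_simple by blast
  show "(%i. integral {0..tau om} (%t. y + truncr (real (Suc i)) (W t om))) \<longlonglongrightarrow> integral {0..tau om} (%s. y + W s om)"
  proof (rule tendsto_eventually, rule eventually_sequentiallyI[of i0])
   fix i assume i: "i0 <= i"
   show "integral {0..tau om} (%t. y + truncr (real (Suc i)) (W t om)) = integral {0..tau om} (%s. y + W s om)"
   proof (rule Henstock_Kurzweil_Integration.integral_cong)
    fix t assume "t \<in> {0..tau om}"
    then have "\<bar>W t om\<bar> <= real (Suc i)" using B[of t] bspec[OF tau01 w] i0 i by fastforce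
    then show "y + truncr (real (Suc i)) (W t om) = y + W t om" by (auto simp: truncr_def)
   qed
  qed
 qed
 have Jm: "J tau \<in> borel_measurable M"
 proof -
  \<comment> \<open>On the null event of a jump before time 1 the local-time term need not vanish,
    and the space is not assumed complete, so the term itself must be measurable. Setting it to 0 on
    paths without a jump is harmless, since the factor \<open>N (tau om) om = 1\<close> excludes
    them.\<close>
  have eq: "J tau om = (if N (tau om) om = 0 then 1 else 0) * integral {0..tau om} (%s. y + W s om)
    + \<beta> / 2 * (if N (tau om) om = 1 then 1 else 0) * (L (tau om) (- y) om - (if N 1 om = 0 then 0 else L (first_jump N om) (- y) om))"
   if w: "om \<in> space M" for om
  proof -
   have "N (tau om) om <= N 1 om" using N_mono[OF w] bspec[OF tau01 w] by blast
   then show ?thesis unfolding J_def f_aux_def by auto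
  qed
  note [measurable] = L_first_jump_measurable[of "- y"]
  show ?thesis by (subst measurable_cong[OF eq]) measurable
 qed
 have Ji: "integrable M (J tau)"
 proof (rule Bochner_Integration.integrable_bound[OF Bochner_Integration.integrable_add[OF integrable_abs[OF u(1)] integrable_abs[OF Dl(1)]] Jm])
  show "AE om in M. norm (J tau om) <= norm (\<bar>I tau om\<bar> + \<bar>Dl om\<bar>)"
  proof (rule AE_mp[OF JI[OF tau01] AE_I2], rule impI)
   fix om assume "\<bar>J tau om - I tau om\<bar> <= Dl om"
   then have "\<bar>J tau om\<bar> <= \<bar>I tau om\<bar> + \<bar>Dl om\<bar>" by linarith
   then show "norm (J tau om) <= norm (\<bar>I tau om\<bar> + \<bar>Dl om\<bar>)" by simp
  qed
 qed
 have "aux_stop_value R n y - aux_err R n y <= G.expectation (I tau)" using kp(2) unfolding I_def tau_def .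
 also have "... <= G.expectation (%om. J tau om + Dl om)"
 proof (rule integral_mono_AE[OF u(1) Bochner_Integration.integrable_add[OF Ji Dl(1)]])
  show "AE om in M. I tau om <= J tau om + Dl om" by (rule AE_mp[OF JI[OF tau01] AE_I2], intro impI, linarith)
 qed
 also have "... = G.expectation (J tau) + G.expectation Dl" by (rule Bochner_Integration.integral_add[OF Ji Dl(1)])
 finally have lo: "aux_stop_value R n y - aux_err R n y - 1 / R <= G.expectation (J tau)" using Dl(2) by linarith
 have "G.expectation (J tau) <= v_aux M W N L 0 \<beta> y"
  unfolding v by (rule cSUP_upper[OF tauS bdd_aboveI2[OF up]])
 moreover have "v_aux M W N L 0 \<beta> y <= aux_stop_value R n y + aux_err R n y + 1 / R"
  unfolding v by (rule cSUP_least) (use tauS up in auto)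
 ultimately show ?thesis using lo by (intro abs_leI) linarith+
qed

end

section \<open>Immediate continuation at zero interest\<close>

text \<open>Consider the infimum of the times at which \<open>g\<close> exceeds \<open>g 0\<close>.
  By continuity \<open>g\<close> does not yet exceed it there, and the local decrease to the right
  prevents it from doing so shortly afterwards, which contradicts the choice of the infimum.\<close>

lemma le_initial_of_right_slope:
 fixes g :: "real \<Rightarrow> real"
 assumes Lip: "!!t h. 0 <= t ==> 0 <= h ==> \<bar>g (t + h) - g t\<bar> <= C * h" and C: "0 < C"
  and slope: "!!t. 0 <= t ==> \<forall>\<^sub>F h in at_right 0. g (t + h) <= g t" and t: "0 <= t"
 shows "g t <= g 0"
proof (rule ccontr)
 assume "\<not> g t <= g 0"
 define S where "S = {x. 0 <= x \<and> g 0 < g x}"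
 have tS: "t \<in> S" using \<open>\<not> g t <= g 0\<close> t by (simp add: S_def)
 have bdd: "bdd_below S" by (rule bdd_belowI[of _ 0]) (simp add: S_def)
 define t0 where "t0 = Inf S"
 have t00: "0 <= t0" unfolding t0_def using tS by (intro cInf_greatest) (blast, simp add: S_def)
 have below: "g x <= g 0" if "0 <= x" "x < t0" for x
  using that cInf_lower[OF _ bdd, of x] unfolding t0_def S_def by fastforce
 have g0: "g t0 <= g 0"
 proof (cases "t0 = 0")
  case False
  show ?thesis
  proof (rule ccontr)
   assume n: "\<not> g t0 <= g 0"
   define h where "h = min t0 ((g t0 - g 0) / (2 * C))"
   have h: "0 < h" "h <= t0" using n False t00 C by (auto simp: h_def)
   have "C * h <= C * ((g t0 - g 0) / (2 * C))" using C by (intro mult_left_mono) (auto simp: h_def)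
   then have "C * h <= (g t0 - g 0) / 2" using C by simp
   moreover have "\<bar>g (t0 - h + h) - g (t0 - h)\<bar> <= C * h" using h by (intro Lip) auto
   moreover have "g (t0 - h) <= g 0" using h by (intro below) auto
   ultimately show False using n by simp
  qed
 qed simp
 obtain d where d: "0 < d" "!!h. 0 < h ==> h < d ==> g (t0 + h) <= g t0"
  using slope[OF t00] unfolding eventually_at_right_field by auto
 obtain x where x: "x \<in> S" "x < t0 + d" using cInf_lessD[of S "t0 + d"] tS d(1) unfolding t0_def by force
 have "t0 <= x" unfolding t0_def by (rule cInf_lower[OF x(1) bdd])
 then have "g x <= g t0" using d(2)[of "x - t0"] x(2) by (cases "x = t0") auto
 then show False using g0 x(1) by (simp add: S_def)
qed

lemma second_order_quotient_tendsto:
 fixes f f' :: "real \<Rightarrow> real"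
 assumes f: "!!x. (f has_real_derivative f' x) (at x)" and f': "(f' has_real_derivative f2) (at y)"
 shows "((%x. (f (y + x) - f y - f' y * x) / x\<^sup>2) \<longlongrightarrow> f2 / 2) (at 0)"
proof (rule lhopital)
 have c: "isCont f x" for x using DERIV_isCont[OF f] .
 have cy: "isCont (%x. f (y + x)) 0" by (rule isCont_o2[OF _ c]) (intro continuous_intros)
 show "((%x. f (y + x) - f y - f' y * x) \<longlongrightarrow> 0) (at 0)"
  using tendsto_diff[OF tendsto_diff[OF isContD[OF cy] tendsto_const[of "f y"]] tendsto_mult[OF tendsto_const[of "f' y"] tendsto_ident_at]] by simp
 show "((%x::real. x\<^sup>2) \<longlongrightarrow> 0) (at 0)" by (rule tendsto_eq_intros refl)+ simp
 show "\<forall>\<^sub>F x in at (0::real). x\<^sup>2 \<noteq> 0" "\<forall>\<^sub>F x in at (0::real). 2 * x \<noteq> 0" by (auto simp: eventually_at_filter)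
 show "\<forall>\<^sub>F x in at 0. ((%x. f (y + x) - f y - f' y * x) has_real_derivative f' (y + x) - f' y) (at x)"
 proof (rule always_eventually, rule allI)
  fix x
  have "((%x. f (y + x)) has_real_derivative f' (y + x) * 1) (at x)"
   by (rule DERIV_chain2[OF f]) (auto intro!: derivative_eq_intros)
  then show "((%x. f (y + x) - f y - f' y * x) has_real_derivative f' (y + x) - f' y) (at x)"
   by (auto intro!: derivative_eq_intros)
 qed
 show "\<forall>\<^sub>F x in at (0::real). ((%x. x\<^sup>2) has_real_derivative 2 * x) (at x)"
  by (rule always_eventually) (auto intro!: derivative_eq_intros)
 have "((%x. (f' (y + x) - f' y) / x) \<longlongrightarrow> f2) (at 0)" using f' unfolding DERIV_def .
 then have "((%x. (f' (y + x) - f' y) / x / 2) \<longlongrightarrow> f2 / 2) (at 0)" by (intro tendsto_divide tendsto_const) auto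
 then show "((%x. (f' (y + x) - f' y) / (2 * x)) \<longlongrightarrow> f2 / 2) (at 0)" by (simp add: mult.commute)
qed

text \<open>A bounded concave function of the price \<open>exp x\<close>. The variant
  \<open>logistic (ln eps + x) / eps\<close>, which equals \<open>exp x / (1 + eps * exp x)\<close>,
  is a bounded substitute for the price itself.\<close>

definition logistic :: "real \<Rightarrow> real" where "logistic x = exp x / (1 + exp x)"

lemma one_plus_exp_pos: "0 < 1 + exp (x::real)" by (simp add: add_pos_pos)

lemma logistic_bounds: "0 <= logistic x" "logistic x <= 1"
 using one_plus_exp_pos[of x] by (auto simp: logistic_def pos_divide_le_eq)

lemma logistic_DERIV: "(logistic has_real_derivative logistic x * (1 - logistic x)) (at x)"
proof -
 have n: "1 + exp x \<noteq> 0" using one_plus_exp_pos[of x] by simp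
 have "((%x. exp x / (1 + exp x)) has_real_derivative (exp x * (1 + exp x) - exp x * exp x) / ((1 + exp x) * (1 + exp x))) (at x)"
  by (rule derivative_eq_intros refl | use n in simp)+
 moreover have "(exp x * (1 + exp x) - exp x * exp x) / ((1 + exp x) * (1 + exp x)) = logistic x * (1 - logistic x)"
  unfolding logistic_def using n by (simp add: field_simps)
 ultimately show ?thesis unfolding logistic_def[abs_def] by simp
qed

lemma logistic'_DERIV:
 "((%x. logistic x * (1 - logistic x)) has_real_derivative logistic x * (1 - logistic x) * (1 - 2 * logistic x)) (at x)"
 by (rule derivative_eq_intros logistic_DERIV refl)+ (simp add: algebra_simps)

lemma logistic'_bounds: "0 <= logistic x * (1 - logistic x)" "logistic x * (1 - logistic x) <= 1"
 using logistic_bounds[of x] mult_mono[of "logistic x" 1 "1 - logistic x" 1] by auto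

lemma logistic''_bound: "\<bar>logistic x * (1 - logistic x) * (1 - 2 * logistic x)\<bar> <= 1"
proof -
 have "\<bar>1 - 2 * logistic x\<bar> <= 1" using logistic_bounds[of x] by (intro abs_leI) linarith+
 then have "\<bar>logistic x * (1 - logistic x)\<bar> * \<bar>1 - 2 * logistic x\<bar> <= 1 * 1"
  using logistic'_bounds[of x] by (intro mult_mono) auto
 then show ?thesis by (simp add: abs_mult)
qed

text \<open>As a function of the price \<open>w\<close>, the expression \<open>w / (1 + w)\<close>
  is concave and lies below its tangent; the gap is the square
  \<open>(b - a)\<^sup>2 / (a\<^sup>2 * b)\<close>.\<close>

lemma logistic_concave_bound: "logistic (x + z) - logistic x <= logistic x * (1 - logistic x) * (exp z - 1)"
proof -
 define s E where "s = exp x" and "E = exp z"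
 define a b where "a = 1 + s" and "b = 1 + s * E"
 have p: "0 < a" "0 < b" by (auto simp: a_def b_def s_def E_def add_pos_pos)
 have l: "logistic x = 1 - 1 / a" "logistic (x + z) = 1 - 1 / b"
  using p unfolding a_def b_def by (simp_all add: logistic_def s_def E_def exp_add field_simps)
 have "(1 - 1 / a) * (1 / a) * (E - 1) = (a - 1) * (E - 1) / a\<^sup>2" using p by (simp add: field_simps power2_eq_square)
 also have "(a - 1) * (E - 1) = b - a" by (simp add: a_def b_def algebra_simps)
 finally have "logistic x * (1 - logistic x) * (E - 1) - (logistic (x + z) - logistic x) = (b - a) / a\<^sup>2 - (1 / a - 1 / b)"
  unfolding l by simp
 also have "... = (b - a)\<^sup>2 / (a\<^sup>2 * b)" using p by (simp add: field_simps power2_eq_square)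
 also have "... \<ge> 0" using p by simp
 finally show ?thesis unfolding E_def by simp
qed

context put_process
begin

lemma shifted_step:
 assumes t: "0 <= t" "0 <= h" and f[measurable]: "f \<in> borel_measurable borel" and b: "!!x. \<bar>f x\<bar> <= B"
  and A: "A \<in> sets (F t)"
 shows "expectation (%om. indicator A om * f (Y (t + h) om)) = expectation (%om. indicator A om * step_op (mu h) f (Y t om))"
proof -
 have le: "0 <= t + real k * h" "t + real k * h <= t + real (Suc k) * h" for k using t by (auto intro: mult_right_mono)
 have d: "t + real (Suc k) * h - (t + real k * h) = h" for k by (simp add: algebra_simps)
 interpret W: random_walk M "%k. F (t + real k * h)" "%k. Y (t + real k * h)" "mu h"
 proof
  show "subalgebra M (F (t + real k * h))" for k by (rule F_sub)
  show "sets (F (t + real i * h)) \<subseteq> sets (F (t + real j * h))" if "i <= j" for i j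
   using that t by (intro F_mono add_left_mono mult_right_mono) auto
  show "Y (t + real k * h) \<in> borel_measurable (F (t + real k * h))" for k by (rule Y_adapted[OF le(1)])
  show "indep_set (sets (F (t + real k * h))) (rv_events M (%om. Y (t + real (Suc k) * h) om - Y (t + real k * h) om))" for k
   by (rule Y_indep[OF le])
  show "distr M borel (%om. Y (t + real (Suc k) * h) om - Y (t + real k * h) om) = mu h" for k
   using Y_incr[OF le[of k]] unfolding d .
 qed
 have "A \<in> sets (F (t + real 0 * h))" using A by simp
 from W.markov_step[OF this f b] show ?thesis by simp
qed

text \<open>A concave function of a price with nonpositive growth rate has nonpositive generator:
  the tangent bound reduces the jump part to \<open>exp\<close>, \<open>drift\<close> leaves
  \<open>r - \<delta>\<close>, and the diffusion adds \<open>- \<sigma>\<^sup>2\<close> times a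
  nonnegative term. Boundedness of \<open>logistic\<close> is what lets
  \<open>generator_limit\<close> and \<open>step_bound\<close> apply, which would not cover the
  price itself.\<close>

lemma logistic_supermartingale:
 assumes rd: "r <= \<delta>" and t: "0 <= t"
 shows "expectation (%om. logistic (y + Y t om)) <= logistic y"
proof -
 let ?L' = "%x. logistic x * (1 - logistic x)" and ?L'' = "%x. logistic x * (1 - logistic x) * (1 - 2 * logistic x)"
 have Lc: "isCont logistic x" for x by (rule DERIV_isCont[OF logistic_DERIV])
 have Lm[measurable]: "logistic \<in> borel_measurable borel" unfolding logistic_def[abs_def] by measurable
 have Lb: "\<bar>logistic x\<bar> <= 1" for x using logistic_bounds[of x] by simp
 have L'b: "\<bar>?L' x\<bar> <= 1" for x using logistic'_bounds[of x] by simp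
 have Lq: "\<bar>logistic (x + z) - logistic x - ?L' x * z\<bar> <= 1 * z\<^sup>2" for x z
  by (rule quadratic_bound_of_DERIV[OF logistic_DERIV Lipschitz_of_DERIV[OF logistic'_DERIV logistic''_bound]])
 have LL: "\<bar>logistic x - logistic z\<bar> <= 1 * \<bar>x - z\<bar>" for x z by (rule Lipschitz_of_DERIV[OF logistic_DERIV L'b])
 define G where "G x = gam * ?L' x + \<sigma>\<^sup>2 / 2 * ?L'' x + (LINT z|\<nu>. logistic (x + z) - logistic x)" for x
 have G0: "G x <= 0" for x
 proof -
  have "(LINT z|\<nu>. logistic (x + z) - logistic x) <= (LINT z|\<nu>. ?L' x * (exp z - 1))"
  proof (rule integral_mono[OF _ integrable_mult_right[OF exp_int] logistic_concave_bound])
   show "integrable \<nu> (%z. logistic (x + z) - logistic x)"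
   proof (rule Bochner_Integration.integrable_bound[OF nu_int])
    show "(%z. logistic (x + z) - logistic x) \<in> borel_measurable \<nu>"
     unfolding measurable_cong_sets[OF sets_nu refl] by measurable
    have "\<bar>logistic (x + z) - logistic x\<bar> <= min 1 \<bar>z\<bar>" for z
     using LL[of "x + z" x] logistic_bounds[of x] logistic_bounds[of "x + z"] by (intro min.boundedI) (auto intro: abs_leI)
    then show "AE z in \<nu>. norm (logistic (x + z) - logistic x) <= norm (min 1 \<bar>z\<bar>)" by (intro AE_I2) simp
   qed
  qed
  then have "(LINT z|\<nu>. logistic (x + z) - logistic x) <= ?L' x * (LINT z|\<nu>. exp z - 1)" by simp
  then have "G x <= gam * ?L' x + \<sigma>\<^sup>2 / 2 * ?L'' x + ?L' x * (LINT z|\<nu>. exp z - 1)" unfolding G_def by linarith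
  also have "... = (r - \<delta>) * ?L' x - \<sigma>\<^sup>2 * (?L' x * logistic x)"
   unfolding drift by (simp add: field_simps)
  also have "... <= 0 - 0"
  proof (rule diff_mono)
   show "(r - \<delta>) * ?L' x <= 0" using rd logistic'_bounds(1)[of x] by (intro mult_nonpos_nonneg) auto
   show "0 <= \<sigma>\<^sup>2 * (?L' x * logistic x)" using logistic_bounds[of x] by (intro mult_nonneg_nonneg) auto
  qed
  finally show ?thesis by simp
 qed
 define u where "u t = expectation (%om. logistic (y + Y t om))" for t
 define D where "D h x = step_op (mu h) logistic (y + x) - logistic (y + x)" for h x
 define C where "C = \<bar>step_const\<bar> * 13 + 1"
 have Db: "\<bar>D h x\<bar> <= C * h" if "0 <= h" for h x
 proof -
  have "\<bar>D h x\<bar> <= h * step_const * (10 * 1 + 3 * 1)" unfolding D_def by (rule step_bound[OF that Lm Lb L'b Lq])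
  also have "... <= C * h"
  proof -
   have "h * (step_const * 13) <= h * C" using that unfolding C_def by (intro mult_left_mono) auto
   then show ?thesis by (simp add: mult.commute mult.left_commute)
  qed
  finally show ?thesis .
 qed
 have Dm[measurable]: "D h \<in> borel_measurable borel" if "0 <= h" for h
 proof -
  interpret m: real_distribution "mu h" by (rule law[OF that])
  have [measurable]: "step_op (mu h) logistic \<in> borel_measurable borel" by (rule m.step_op_measurable[OF Lm])
  show ?thesis unfolding D_def by measurable
 qed
 have Li: "integrable M (%om. logistic (y + Y t om))" if "0 <= t" for t
 proof -
  have [measurable]: "Y t \<in> borel_measurable M" by (rule Y_meas[OF that])
  show ?thesis by (rule integrable_const_bound[of _ 1]) (auto simp: Lb)
 qed
 have Di: "integrable M (%om. D h (Y t om))" if "0 <= t" "0 <= h" for t h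
 proof -
  note [measurable] = Y_meas[OF that(1)] Dm[OF that(2)]
  show ?thesis by (rule integrable_const_bound[of _ "C * h"]) (auto simp: Db that)
 qed
 have inc: "u (t + h) - u t = expectation (%om. D h (Y t om))" if th: "0 <= t" "0 <= h" for t h
 proof -
  have sp: "space M \<in> sets (F t)" using F_sub[of t] sets.top[of "F t"] by (simp add: subalgebra_def)
  have "expectation (%om. indicator (space M) om * logistic (y + Y (t + h) om)) = expectation (%om. indicator (space M) om * step_op (mu h) (%x. logistic (y + x)) (Y t om))"
   by (rule shifted_step[OF th _ Lb sp]) measurable
  then have "u (t + h) = expectation (%om. step_op (mu h) logistic (y + Y t om))"
   unfolding u_def step_op_shift by (simp cong: Bochner_Integration.integral_cong)
  also have "... = expectation (%om. D h (Y t om) + logistic (y + Y t om))" by (simp add: D_def)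
  also have "... = expectation (%om. D h (Y t om)) + u t" unfolding u_def by (rule Bochner_Integration.integral_add[OF Di[OF th] Li[OF th(1)]])
  finally show ?thesis by simp
 qed
 have C0: "0 < C" unfolding C_def by (simp add: add_nonneg_pos)
 have uL: "\<bar>u (t + h) - u t\<bar> <= C * h" if th: "0 <= t" "0 <= h" for t h
 proof -
  have "\<bar>expectation (%om. D h (Y t om))\<bar> <= expectation (%om. \<bar>D h (Y t om)\<bar>)" by (rule integral_abs_bound)
  also have "... <= expectation (%om. C * h)" by (intro integral_mono integrable_abs Di th Db) auto
  finally show ?thesis unfolding inc[OF th] using prob_space by simp
 qed
 have quot: "((%h. (u (t + h) - u t) / h) \<longlongrightarrow> expectation (%om. G (y + Y t om))) (at_right 0)" if t: "0 <= t" for t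
  unfolding tendsto_at_iff_sequentially
 proof (intro allI impI)
  fix X :: "nat \<Rightarrow> real" assume X: "\<forall>i. X i \<in> {0<..} - {0}" "X \<longlonglongrightarrow> 0"
  have X0: "0 < X i" for i using X(1) by auto
  note [measurable] = Y_meas[OF t] Dm[OF less_imp_le[OF X0]]
  have lim: "(%i. D (X i) (Y t om) / X i) \<longlonglongrightarrow> G (y + Y t om)" for om
  proof -
   have "((%h. (step_op (mu h) logistic (y + Y t om) - logistic (y + Y t om)) / h) \<longlongrightarrow> G (y + Y t om)) (at_right 0)"
    unfolding G_def by (rule generator_limit[OF Lc Lb second_order_quotient_tendsto[OF logistic_DERIV logistic'_DERIV]])
   moreover have "X i \<noteq> 0" for i using X0[of i] by simp
   then have "filterlim X (at_right 0) sequentially" by (simp add: filterlim_at X(2) X0)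
   ultimately show ?thesis unfolding D_def by (rule filterlim_compose)
  qed
  have "(%i. expectation (%om. D (X i) (Y t om) / X i)) \<longlonglongrightarrow> expectation (%om. G (y + Y t om))"
  proof (rule integral_dominated_convergence[where w="%_. C"])
   show "AE om in M. (%i. D (X i) (Y t om) / X i) \<longlonglongrightarrow> G (y + Y t om)" by (intro AE_I2 lim)
   show "AE om in M. norm (D (X i) (Y t om) / X i) <= C" for i
    using Db[OF less_imp_le[OF X0], of i] X0[of i] by (intro AE_I2) (simp add: pos_divide_le_eq)
   show "(%om. G (y + Y t om)) \<in> borel_measurable M" by (rule borel_measurable_LIMSEQ_real[OF lim]) measurable
  qed auto
  moreover have "(u (t + X i) - u t) / X i = expectation (%om. D (X i) (Y t om) / X i)" for i
   using inc[OF t less_imp_le[OF X0[of i]]] by simp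
  ultimately show "((%h. (u (t + h) - u t) / h) \<circ> X) \<longlonglongrightarrow> expectation (%om. G (y + Y t om))" by (simp only: comp_def)
 qed
 have EG: "expectation (%om. G (y + Y t om)) <= 0" for t
  using Bochner_Integration.integral_nonneg[of M "%om. - G (y + Y t om)"] G0 by simp
 \<comment> \<open>The right slope is only known to be nonpositive. Subtracting \<open>e * t\<close>
   makes it strictly negative, and then the limit of quotients yields an actual decrease for small
   \<open>h\<close>.\<close>
 have eps: "u t <= u 0 + e * t" if e: "0 < e" for e
 proof -
  have "u t - e * t <= u 0 - e * 0"
  proof (rule le_initial_of_right_slope[where g="%t. u t - e * t" and C="C + e", OF _ _ _ t])
   show "\<bar>(u (t + h) - e * (t + h)) - (u t - e * t)\<bar> <= (C + e) * h" if "0 <= t" "0 <= h" for t h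
   proof -
    have "(u (t + h) - e * (t + h)) - (u t - e * t) = (u (t + h) - u t) - e * h" by (simp add: algebra_simps)
    moreover have "\<bar>e * h\<bar> = e * h" using e that by simp
    ultimately show ?thesis using uL[OF that] abs_triangle_ineq4[of "u (t + h) - u t" "e * h"] by (simp add: distrib_right)
   qed
   show "0 < C + e" using C0 e by simp
   fix t :: real assume t: "0 <= t"
   have "\<forall>\<^sub>F h in at_right 0. (u (t + h) - u t) / h < e" by (rule order_tendstoD(2)[OF quot[OF t]]) (use EG[of t] e in linarith)
   moreover have "\<forall>\<^sub>F h in at_right (0::real). 0 < h" by (rule eventually_at_right_less)
   ultimately show "\<forall>\<^sub>F h in at_right 0. u (t + h) - e * (t + h) <= u t - e * t"
    by eventually_elim (simp add: pos_divide_less_eq algebra_simps)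
  qed
  then show ?thesis by simp
 qed
 have "u t <= u 0"
 proof (rule field_le_epsilon)
  fix e :: real assume e: "0 < e"
  have "u t <= u 0 + e / (t + 1) * t" using e t by (intro eps) auto
  also have "e / (t + 1) * t <= e" using e t by (simp add: field_simps)
  finally show "u t <= u 0 + e" by simp
 qed
 also have "u 0 = logistic y" unfolding u_def by (subst Y_0_expectation[of "%x. logistic (y + x)"]) auto
 finally show ?thesis unfolding u_def .
qed

text \<open>By weak convergence to a Gaussian, a short step of length \<open>h\<close> rises by
  \<open>sqrt h\<close> with some probability \<open>p > 0\<close>. Independent repetition over
  \<open>k\<close> steps of length \<open>t / k\<close> gives a rise of \<open>sqrt (t * k)\<close>
  with probability at least of the order \<open>p ^ k\<close>, still positive.\<close>

lemma Y_unbounded_above: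
 assumes t: "0 < t" shows "0 < prob {om\<in>space M. c <= Y t om}"
proof -
 \<comment> \<open>A Lipschitz function below the indicator of \<open>{1..}\<close>, so that weak
   convergence gives a lower bound for a probability.\<close>
 define f where "f x = min 1 (max 0 (x - 1))" for x :: real
 have fm[measurable]: "f \<in> borel_measurable borel" unfolding f_def by measurable
 have fL: "\<bar>f x - f y\<bar> <= 1 * \<bar>x - y\<bar>" for x y
 proof -
  have "\<bar>min a u - min a v\<bar> <= \<bar>u - v\<bar>" for a u v :: real by linarith
  moreover have "\<bar>max a u - max a v\<bar> <= \<bar>u - v\<bar>" for a u v :: real by linarith
  ultimately have "\<bar>f x - f y\<bar> <= \<bar>(x - 1) - (y - 1)\<bar>" unfolding f_def by (blast intro: order_trans)
  then show ?thesis by simp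
 qed
 have fb: "0 <= f x" "f x <= 1" for x by (simp_all add: f_def)
 have fi: "f x <= indicator {1..} x" for x by (simp add: f_def indicator_def)
 have fn: "norm (f x) <= 1" for x using fb[of x] by simp
 define th where "th i = t / real (Suc i)" for i
 have th0: "0 < th i" for i using t by (simp add: th_def)
 have thlim: "th \<longlonglongrightarrow> 0" using tendsto_mult[OF tendsto_const LIMSEQ_inverse_real_of_nat, of t] by (simp add: th_def[abs_def] divide_inverse)
 define mu' where "mu' i = distr (mu (th i / 1)) borel (%x. x / sqrt (th i))" for i
 define \<nu>' where "\<nu>' = distr gauss borel (%x. \<sigma> / sqrt 1 * x)"
 have rd: "real_distribution (mu' i)" for i
 proof -
  interpret m: real_distribution "mu (th i)" using th0[of i] by (intro law) simp
  have "real_distribution (distr (mu (th i)) borel (%x. x / sqrt (th i)))" by (rule m.real_distribution_distr) simp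
  then show ?thesis by (simp add: mu'_def)
 qed
 have rd': "real_distribution \<nu>'" unfolding \<nu>'_def by (rule gauss.real_distribution_distr) simp
 have wc: "weak_conv_m mu' \<nu>'" unfolding mu'_def \<nu>'_def by (rule scaled_law_weak_conv[OF thlim th0]) simp
 have lim: "(%i. LINT x|mu' i. f x) \<longlonglongrightarrow> (LINT x|\<nu>'. f x)"
 proof (rule weak_conv_bounded_Lipschitz[OF rd rd' wc])
  fix e :: "nat \<Rightarrow> real"
  assume e: "e \<longlonglongrightarrow> 0"
   "!!n f L B. (!!x y. \<bar>f x - f y\<bar> <= L * \<bar>x - y\<bar>) ==> (!!x. \<bar>f x\<bar> <= B) ==> 0 <= L ==> f \<in> borel_measurable borel ==>
    \<bar>(LINT x|mu' n. f x) - (LINT x|\<nu>'. f x)\<bar> <= (L + 2 * B) * e n"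
  have eb: "\<bar>(LINT x|mu' n. f x) - (LINT x|\<nu>'. f x)\<bar> <= (1 + 2 * 1) * e n" for n
   by (rule e(2)[OF fL fn[unfolded real_norm_def] zero_le_one fm])
  have "(%n. (1 + 2 * 1) * e n) \<longlonglongrightarrow> 0" by (rule tendsto_mult_right_zero[OF e(1)])
  then have "(%n. (LINT x|mu' n. f x) - (LINT x|\<nu>'. f x)) \<longlonglongrightarrow> 0"
   by (rule Lim_null_comparison[rotated]) (unfold real_norm_def, intro always_eventually allI eb)
  then show "(%i. LINT x|mu' i. f x) \<longlonglongrightarrow> (LINT x|\<nu>'. f x)" by (rule LIM_zero_cancel)
 qed
 have pos: "0 < (LINT x|\<nu>'. f x)"
 proof (rule ccontr)
  assume "\<not> 0 < (LINT x|\<nu>'. f x)"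
  moreover have eq: "(LINT x|\<nu>'. f x) = (LINT x|gauss. f (\<sigma> * x))" unfolding \<nu>'_def by (subst integral_distr) simp_all
  moreover have "0 <= (LINT x|gauss. f (\<sigma> * x))" by (intro Bochner_Integration.integral_nonneg fb)
  ultimately have z: "(LINT x|gauss. f (\<sigma> * x)) = 0" by linarith
  have "integrable gauss (%x. f (\<sigma> * x))" by (rule gauss.integrable_const_bound[of _ 1]) (intro AE_I2 fn, measurable)
  then have "AE x in gauss. f (\<sigma> * x) = 0" using z integral_nonneg_eq_0_iff_AE[of gauss "%x. f (\<sigma> * x)"] fb by simp
  then have "AE x in lborel. 0 < ennreal (std_normal_density x) \<longrightarrow> f (\<sigma> * x) = 0"
   using AE_density[of "%x. ennreal (std_normal_density x)" lborel "%x. f (\<sigma> * x) = 0"] by simp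
  then have "AE x in lborel. f (\<sigma> * x) = 0" by (rule AE_mp) (intro AE_I2 impI, simp add: normal_density_pos)
  then have "AE x in lborel. x \<notin> {2 / \<sigma>..3 / \<sigma>}"
  proof eventually_elim
   case (elim x)
   have "\<not> 2 / \<sigma> <= x"
   proof
    assume "2 / \<sigma> <= x"
    then have "2 <= \<sigma> * x" using \<sigma>_pos by (simp add: pos_divide_le_eq mult.commute)
    then show False using elim by (simp add: f_def)
   qed
   then show ?case by simp
  qed
  then have "emeasure lborel {2 / \<sigma>..3 / \<sigma>} = 0"
   by (intro null_setsD1 iffD2[OF AE_iff_null_sets]) simp_all
  moreover have "2 / \<sigma> < 3 / \<sigma>" using \<sigma>_pos by (intro divide_strict_right_mono) auto
  ultimately show False using \<sigma>_pos by (simp add: ennreal_eq_0_iff)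
 qed
 have "\<forall>\<^sub>F i in sequentially. 0 < (LINT x|mu' i. f x)" by (rule order_tendstoD(1)[OF lim pos])
 \<comment> \<open>The total rise is \<open>sqrt (t * Suc i)\<close>, which passes any level
   \<open>c\<close> as the steps get shorter.\<close>
 moreover have "\<forall>\<^sub>F i in sequentially. c <= real (Suc i) * sqrt (th i)"
 proof -
  obtain k where k: "c\<^sup>2 / t <= real k" using real_arch_simple by blast
  show ?thesis
  proof (rule eventually_sequentiallyI[of k])
   fix i assume i: "k <= i"
   have "c\<^sup>2 / t <= real (Suc i)" using k i by linarith
   then have "c\<^sup>2 <= t * real (Suc i)" using t by (simp add: pos_divide_le_eq mult.commute)
   from real_sqrt_le_mono[OF this] have "\<bar>c\<bar> <= sqrt (t * real (Suc i))" by (simp del: of_nat_Suc)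
   also have "t * real (Suc i) = (real (Suc i))\<^sup>2 * th i" unfolding th_def by (simp add: power2_eq_square del: of_nat_Suc)
   finally show "c <= real (Suc i) * sqrt (th i)" by (simp add: real_sqrt_mult)
  qed
 qed
 ultimately have "\<forall>\<^sub>F i in sequentially. 0 < (LINT x|mu' i. f x) \<and> c <= real (Suc i) * sqrt (th i)" by (rule eventually_conj)
 from eventually_happens'[OF sequentially_bot this] obtain i where i: "0 < (LINT x|mu' i. f x)" "c <= real (Suc i) * sqrt (th i)" by blast
 define h where "h = th i"
 have h: "0 < h" "real (Suc i) * h = t" using th0 by (auto simp: h_def th_def simp del: of_nat_Suc)
 interpret m: real_distribution "mu h" using h by (intro law) simp
 define p where "p = measure (mu h) {sqrt h..}"
 have p: "0 < p"
 proof -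
  have "(LINT x|mu' i. f x) = (LINT x|mu h. f (x / sqrt h))" unfolding mu'_def h_def[symmetric] div_by_1 by (rule integral_distr) measurable
  also have "... <= (LINT x|mu h. indicator {sqrt h..} x)"
  proof (rule integral_mono)
   show "integrable (mu h) (%x. f (x / sqrt h))" by (rule m.integrable_const_bound[of _ 1]) (intro AE_I2 fn, measurable)
   fix x
   have "indicator {1..} (x / sqrt h) = (indicator {sqrt h..} x :: real)" using h(1) by (simp add: indicator_def pos_le_divide_eq)
   then show "f (x / sqrt h) <= indicator {sqrt h..} x" using fi[of "x / sqrt h"] by simp
  qed (simp add: m.emeasure_eq_measure)
  also have "... = p" by (simp add: p_def)
  finally show ?thesis using i(1) by linarith
 qed
 have "0 < prob {om\<in>space M. real k * sqrt h <= Y (real k * h) om}" for k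
 proof (induction k)
  case 0
  have [measurable]: "Y 0 \<in> borel_measurable M" by (rule Y_meas) simp
  have "prob {om\<in>space M. 0 <= Y 0 om} = 1" by (subst prob_eq_1) (use Y_0 in \<open>auto elim!: eventually_mono\<close>)
  then show ?case by simp
 next
  case (Suc k)
  have kh: "0 <= real k * h" using h by simp
  have e: "real (Suc k) * h = real k * h + h" by (simp add: algebra_simps)
  note [measurable] = Y_meas[OF kh] Y_meas[of "real k * h + h", OF add_nonneg_nonneg[OF kh less_imp_le[OF h(1)]]]
  define A where "A = {om\<in>space M. real k * sqrt h <= Y (real k * h) om}"
  have sp: "space (F (real k * h)) = space M" using F_sub by (simp add: subalgebra_def)
  have A: "A \<in> sets (F (real k * h))" using Y_adapted[OF kh] unfolding A_def sp[symmetric] by measurable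
  define g where "g x = (indicator {real (Suc k) * sqrt h..} x :: real)" for x
  have gm[measurable]: "g \<in> borel_measurable borel" unfolding g_def by measurable
  have "p * prob A = expectation (%om. p * indicator A om)" by (simp add: A_def)
  also have "... <= expectation (%om. indicator A om * step_op (mu h) g (Y (real k * h) om))"
  proof (rule integral_mono)
   have sg: "0 <= step_op (mu h) g x" "step_op (mu h) g x <= 1" for x
   proof -
    show "0 <= step_op (mu h) g x" unfolding step_op_def g_def by (intro Bochner_Integration.integral_nonneg) simp
    have "step_op (mu h) g x <= (LINT z|mu h. 1)" unfolding step_op_def g_def by (rule integral_mono') (simp_all add: indicator_def)
    then show "step_op (mu h) g x <= 1" using m.prob_space by simp
   qed
   have [measurable]: "step_op (mu h) g \<in> borel_measurable borel" by (rule m.step_op_measurable[OF gm])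
   have [measurable]: "A \<in> sets M" unfolding A_def by measurable
   show "integrable M (%om. p * indicator A om)" by (simp add: emeasure_eq_measure)
   show "integrable M (%om. indicator A om * step_op (mu h) g (Y (real k * h) om))"
    by (rule integrable_const_bound[of _ 1]) (use sg in \<open>auto simp: indicator_def\<close>)
   fix om assume w: "om \<in> space M"
   show "p * indicator A om <= indicator A om * step_op (mu h) g (Y (real k * h) om)"
   proof (cases "om \<in> A")
    case True
    then have yk: "real k * sqrt h <= Y (real k * h) om" by (simp add: A_def)
    have "p = (LINT z|mu h. indicator {sqrt h..} z)" by (simp add: p_def)
    also have "... <= step_op (mu h) g (Y (real k * h) om)" unfolding step_op_def
    proof (rule integral_mono)
     show "integrable (mu h) (%z. g (Y (real k * h) om + z))" by (rule m.integrable_const_bound[of _ 1]) (simp_all add: g_def indicator_def)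
     fix z
     show "indicator {sqrt h..} z <= g (Y (real k * h) om + z)" using yk by (simp add: g_def indicator_def distrib_right)
    qed (simp add: m.emeasure_eq_measure)
    finally show ?thesis using True by simp
   qed simp
  qed
  also have "... = expectation (%om. indicator A om * g (Y (real k * h + h) om))"
   by (rule shifted_step[OF kh less_imp_le[OF h(1)] gm _ A, of 1, symmetric]) (simp add: g_def indicator_def)
  also have "... <= expectation (indicator {om\<in>space M. real (Suc k) * sqrt h <= Y (real k * h + h) om})"
  proof (rule integral_mono')
   show "integrable M (indicator {om\<in>space M. real (Suc k) * sqrt h <= Y (real k * h + h) om} :: 'a \<Rightarrow> real)"
    by (rule integrable_const_bound[of _ 1]) (simp, rule borel_measurable_indicator, measurable)
   fix om assume "om \<in> space M"
   then show "indicator A om * g (Y (real k * h + h) om) <= indicator {om\<in>space M. real (Suc k) * sqrt h <= Y (real k * h + h) om} om"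
    unfolding g_def by (simp add: indicator_def del: of_nat_Suc)
  qed simp
  also have "... = prob {om\<in>space M. real (Suc k) * sqrt h <= Y (real k * h + h) om}" by simp
  finally have "p * prob A <= prob {om\<in>space M. real (Suc k) * sqrt h <= Y (real k * h + h) om}" .
  moreover have "0 < p * prob A" using Suc.IH p unfolding A_def by simp
  ultimately show ?case unfolding e by linarith
 qed
 from this[of "Suc i"] have a: "0 < prob {om\<in>space M. real (Suc i) * sqrt h <= Y t om}" unfolding h(2) .
 have [measurable]: "Y t \<in> borel_measurable M" by (rule Y_meas) (use t in simp)
 have "prob {om\<in>space M. real (Suc i) * sqrt h <= Y t om} <= prob {om\<in>space M. c <= Y t om}"
  by (rule finite_measure_mono) (use i(2) in \<open>auto simp: h_def\<close>)
 then show ?thesis using a by linarith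
qed

text \<open>Without interest, waiting until maturity yields \<open>K - min K S\<close>. The mean of
  \<open>min K S\<close> is strictly below the current price: a bounded version of the price is a
  supermartingale, and the cap at \<open>K\<close> loses a fixed amount on the event, of positive
  probability, that the price exceeds \<open>3 * K\<close>.\<close>

lemma put_value_gt_no_interest:
 assumes r0: "r = 0" and th: "0 < th"
 shows "K - exp y < put_value th y"
proof -
 note [measurable] = Y_meas[OF less_imp_le[OF th]]
 define A where "A = {om\<in>space M. ln (3 * K) - y <= Y th om}"
 have A[measurable]: "A \<in> sets M" unfolding A_def by measurable
 define P where "P = prob A"
 have P: "0 < P" "P <= 1" unfolding P_def A_def by (rule Y_unbounded_above[OF th], rule prob_le_1)
 \<comment> \<open>With this choice the distortion \<open>eps * K\<^sup>2 = K * P / 4\<close> is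
   half of the gain \<open>K / 2 * P\<close>, and \<open>3 * eps * K <= 1\<close> keeps
   \<open>w / (1 + eps * w)\<close> above \<open>3 * K / 2\<close> from \<open>3 * K\<close>
   on.\<close>
 define eps where "eps = P / (4 * K)"
 have eps: "0 < eps" "3 * (eps * K) <= 1" using P K by (auto simp: eps_def)
 let ?L = "%x. exp x / (1 + eps * exp x)"
 have d: "0 < 1 + eps * exp x" for x using eps by (simp add: add_pos_pos)
 have Llog: "?L x = logistic (ln eps + x) / eps" for x using eps d[of x] by (simp add: logistic_def exp_add)
 have EL: "expectation (%om. ?L (y + Y th om)) <= exp y"
 proof -
  have "expectation (%om. logistic ((ln eps + y) + Y th om)) <= logistic (ln eps + y)"
   by (rule logistic_supermartingale) (use r0 \<delta> th in auto)
  then have "expectation (%om. logistic ((ln eps + y) + Y th om)) / eps <= logistic (ln eps + y) / eps" using eps by (intro divide_right_mono) auto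
  also have "expectation (%om. logistic ((ln eps + y) + Y th om)) / eps = expectation (%om. ?L (y + Y th om))"
   unfolding Llog by (simp add: add.assoc)
  also have "logistic (ln eps + y) / eps = ?L y" by (rule Llog[symmetric])
  also have "?L y <= exp y" using d[of y] eps by (simp add: pos_divide_le_eq mult_nonneg_nonneg distrib_left)
  finally show ?thesis .
 qed
 \<comment> \<open>Up to \<open>K\<close> the bounded price differs from \<open>w\<close> by at most
   \<open>eps * K\<^sup>2\<close>, and it is increasing. From \<open>3 * K\<close> on it exceeds the
   cap \<open>K\<close> by at least \<open>K / 2\<close>, the source of the strict gain.\<close>
 have pt: "min K w <= w / (1 + eps * w) + eps * K\<^sup>2 - (if 3 * K <= w then K / 2 + eps * K\<^sup>2 else 0)" if w: "0 < w" for w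
 proof -
  have dw: "0 < 1 + eps * w" using eps w by (simp add: add_pos_pos)
  have small: "v - eps * K\<^sup>2 <= v / (1 + eps * v)" if v: "0 <= v" "v <= K" for v
  proof -
   have dv: "0 < 1 + eps * v" using eps v by (simp add: add_pos_nonneg)
   have "v - v / (1 + eps * v) = eps * v\<^sup>2 / (1 + eps * v)" using dv by (simp add: field_simps power2_eq_square)
   also have "... <= eps * v\<^sup>2" using dv eps v by (simp add: divide_le_eq mult_left_le distrib_left)
   also have "... <= eps * K\<^sup>2" using v eps by (intro mult_left_mono power_mono) auto
   finally show ?thesis by simp
  qed
  have mono: "a / (1 + eps * a) <= w / (1 + eps * w)" if a: "0 <= a" "a <= w" for a
  proof -
   have "0 < 1 + eps * a" using eps a by (simp add: add_pos_nonneg)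
   moreover have "a * (1 + eps * w) <= w * (1 + eps * a)" using a by (simp add: algebra_simps)
   ultimately show ?thesis using dw by (simp add: pos_divide_le_eq pos_le_divide_eq)
  qed
  consider "w <= K" | "K < w" "w < 3 * K" | "3 * K <= w" by linarith
  then show ?thesis
  proof cases
   case 1 then show ?thesis using small[of w] w K by simp
  next
   case 2 then show ?thesis using small[of K] mono[of K] K by simp
  next
   case 3
   have "3 * K / 2 <= 3 * K / (1 + eps * (3 * K))" using eps K by (intro divide_left_mono) (auto simp: algebra_simps add_pos_pos)
   then show ?thesis using mono[of "3 * K"] 3 K by simp
  qed
 qed
 have pay: "K - ?L (y + Y th om) - eps * K\<^sup>2 + (K / 2) * indicator A om <= put_payoff K (y + Y th om)" if "om \<in> space M" for om
 proof -
  have "3 * K <= exp (y + Y th om) \<longleftrightarrow> om \<in> A"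
  proof -
   have "3 * K <= exp (y + Y th om) \<longleftrightarrow> ln (3 * K) <= y + Y th om" using K exp_le_cancel_iff[of "ln (3 * K)" "y + Y th om"] by simp
   then show ?thesis using that by (auto simp: A_def)
  qed
  moreover have "put_payoff K (y + Y th om) = K - min K (exp (y + Y th om))" by (auto simp: put_payoff_def)
  moreover have "0 <= eps * K\<^sup>2" using eps by simp
  ultimately show ?thesis using pt[of "exp (y + Y th om)"] by (auto simp: indicator_def)
 qed
 have Lb: "\<bar>?L x\<bar> <= 1 / eps" for x
  unfolding Llog using logistic_bounds[of "ln eps + x"] eps by (simp add: divide_right_mono)
 have Li: "integrable M (%om. ?L (y + Y th om))" by (rule integrable_const_bound[of _ "1 / eps"]) (unfold real_norm_def, intro AE_I2 Lb, measurable)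
 have Ai: "integrable M (indicator A :: 'a \<Rightarrow> real)" by (simp add: emeasure_eq_measure)
 have ci: "integrable M (%_. K)" "integrable M (%_. eps * K\<^sup>2)" by simp_all
 have "K - exp y < K - exp y - eps * K\<^sup>2 + (K / 2) * P"
 proof -
  have "eps * K\<^sup>2 = K * P / 4" using K by (simp add: eps_def power2_eq_square)
  moreover have "0 < K * P" using K P by simp
  ultimately show ?thesis by simp
 qed
 also have "... <= K - expectation (%om. ?L (y + Y th om)) - eps * K\<^sup>2 + (K / 2) * P" using EL by linarith
 also have "... = expectation (%om. K - ?L (y + Y th om) - eps * K\<^sup>2 + (K / 2) * indicator A om)"
  by (subst Bochner_Integration.integral_add[OF Bochner_Integration.integrable_diff[OF Bochner_Integration.integrable_diff[OF ci(1) Li] ci(2)] integrable_mult_right[OF Ai]],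
    subst Bochner_Integration.integral_diff[OF Bochner_Integration.integrable_diff[OF ci(1) Li] ci(2)],
    subst Bochner_Integration.integral_diff[OF ci(1) Li]) (simp add: P_def prob_space)
 also have "... <= expectation (%om. put_payoff K (y + Y th om))"
 proof (rule integral_mono[OF _ _ pay])
  show "integrable M (%om. K - ?L (y + Y th om) - eps * K\<^sup>2 + (K / 2) * indicator A om)"
   by (intro Bochner_Integration.integrable_add Bochner_Integration.integrable_diff integrable_mult_right ci Li Ai)
  show "integrable M (%om. put_payoff K (y + Y th om))" by (rule integrable_const_bound[of _ K]) (use payoff_bounds in auto)
 qed
 also have "... <= put_value th y"
  using put_value_ge[of "%_. th" th y, OF stopping_time_const] th unfolding r0 by simp
 finally show ?thesis .
qed

end

section \<open>Combination of the limits\<close>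

context put_process
begin

lemma stop_value_limit:
 fixes a :: real
 assumes N: "0 < N" and R: "0 <= R"
 defines "c \<equiv> %x. (a + truncr R x) / real N"
 shows "((%p. stop_value (distr (mu (p ^ 8 / real N)) borel (%x. x / p ^ 4)) c N 0)
   \<longlongrightarrow> stop_value (distr gauss borel (%x. \<sigma> / sqrt (real N) * x)) c N 0) (at_right 0)"
 unfolding tendsto_at_iff_sequentially
proof (intro allI impI)
 fix X :: "nat \<Rightarrow> real" assume X: "\<forall>i. X i \<in> {0<..} - {0}" "X \<longlonglongrightarrow> 0"
 have X0: "0 < X i" for i using X(1) by auto
 have sq: "sqrt (X i ^ 8) = X i ^ 4" for i
 proof -
  have e: "X i ^ 8 = (X i ^ 4)\<^sup>2" by (simp add: power_mult[symmetric])
  show ?thesis unfolding e real_sqrt_abs using X0[of i] by simp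
 qed
 have lim: "(%i. X i ^ 8) \<longlonglongrightarrow> 0" using tendsto_power[OF X(2), of 8] by simp
 have pos: "0 < X i ^ 8" for i using X0[of i] by simp
 have N': "0 < real N" using N by simp
 have wc: "weak_conv_m (%i. distr (mu (X i ^ 8 / real N)) borel (%x. x / X i ^ 4)) (distr gauss borel (%x. \<sigma> / sqrt (real N) * x))"
  using scaled_law_weak_conv[OF lim pos N'] unfolding sq .
 have rd: "real_distribution (distr (mu (X i ^ 8 / real N)) borel (%x. x / X i ^ 4))" for i
 proof -
  interpret m: real_distribution "mu (X i ^ 8 / real N)" using pos[of i] by (intro law) simp
  show ?thesis by (rule m.real_distribution_distr) simp
 qed
 have rd': "real_distribution (distr gauss borel (%x. \<sigma> / sqrt (real N) * x))" by (rule gauss.real_distribution_distr) simp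
 have cm: "c \<in> borel_measurable borel" unfolding c_def by measurable
 have cb: "\<bar>c x\<bar> <= (\<bar>a\<bar> + R) / real N" for x
 proof -
  have "\<bar>a + truncr R x\<bar> <= \<bar>a\<bar> + R" using truncr_bound[OF R, of x] abs_triangle_ineq[of a "truncr R x"] by linarith
  then show ?thesis unfolding c_def abs_divide by (simp add: divide_right_mono)
 qed
 have cL: "\<bar>c x - c y\<bar> <= (1 / real N) * \<bar>x - y\<bar>" for x y
 proof -
  have "c x - c y = (truncr R x - truncr R y) / real N" unfolding c_def by (simp add: diff_divide_distrib add_divide_distrib)
  then show ?thesis using truncr_Lipschitz[of R x y] by (simp add: divide_right_mono)
 qed
 show "((%p. stop_value (distr (mu (p ^ 8 / real N)) borel (%x. x / p ^ 4)) c N 0) \<circ> X)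
   \<longlonglongrightarrow> stop_value (distr gauss borel (%x. \<sigma> / sqrt (real N) * x)) c N 0"
  unfolding comp_def by (rule stop_value_tendsto[OF rd rd' wc cm cb cL])
qed

lemma stop_value_aux_scale:
 assumes N: "0 < N"
 shows "stop_value (distr gauss borel (%x. \<sigma> / sqrt (real N) * x)) (%x. (a + truncr R x) / real N) N 0
  = \<sigma> * stop_value (distr gauss borel (%x. sqrt (1 / real N) * x)) (%x. (1 / real N) * (1 * (a / \<sigma> + truncr (R / \<sigma>) x))) N 0"
proof -
 interpret g: real_distribution "distr gauss borel (%x. \<sigma> / sqrt (real N) * x)" by (rule gauss.real_distribution_distr) simp
 have c: "(%x. (a + truncr R x) / real N) = (%x. \<sigma> * ((1 / real N) * (1 * (a / \<sigma> + truncr (R / \<sigma>) (x / \<sigma>)))))"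
 proof
  fix x
  have "truncr R x = \<sigma> * truncr (R / \<sigma>) (x / \<sigma>)" using truncr_scale[OF \<sigma>_pos, of "R / \<sigma>" x] \<sigma>_pos by simp
  then have "a + truncr R x = \<sigma> * (a / \<sigma> + truncr (R / \<sigma>) (x / \<sigma>))" using \<sigma>_pos by (simp add: distrib_left)
  then show "(a + truncr R x) / real N = \<sigma> * ((1 / real N) * (1 * (a / \<sigma> + truncr (R / \<sigma>) (x / \<sigma>))))" by simp
 qed
 have d: "distr (distr gauss borel (%x. \<sigma> / sqrt (real N) * x)) borel (%x. x / \<sigma>) = distr gauss borel (%x. sqrt (1 / real N) * x)"
  by (subst distr_distr) (use \<sigma>_pos in \<open>auto simp: comp_def real_sqrt_divide intro!: distr_cong\<close>)
 have "stop_value (distr gauss borel (%x. \<sigma> / sqrt (real N) * x)) (%x. \<sigma> * ((1 / real N) * (1 * (a / \<sigma> + truncr (R / \<sigma>) (x / \<sigma>))))) N 0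
  = \<sigma> * stop_value (distr (distr gauss borel (%x. \<sigma> / sqrt (real N) * x)) borel (%x. x / \<sigma>)) (%x. (1 / real N) * (1 * (a / \<sigma> + truncr (R / \<sigma>) x))) N (0 / \<sigma>)"
  by (rule g.stop_value_scale[OF _ \<sigma>_pos less_imp_le[OF \<sigma>_pos]]) measurable
 then show ?thesis unfolding c d by simp
qed

text \<open>A single integer \<open>k\<close> is fixed, giving truncation level \<open>k\<close> and
  a number of coarse steps depending on it, before \<open>p\<close> tends to 0. The allowed error is
  divided into thirds: errors of order \<open>1 / k\<close>, convergence of the coarse dynamic
  program, and the term \<open>A * p\<close>.\<close>

lemma put_value_expansion:
 assumes y1: "y1 < ln K" and root: "phi0 (exp y1) = 0" and aux: "aux_space M' 0 W N L" and c: "0 < c"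
 shows "\<forall>\<^sub>F p in at_right 0. \<bar>put_value (p ^ 8) (y1 + a * p ^ 4) - (K - exp (y1 + a * p ^ 4))
   - p ^ 12 * (exp y1 * dbar y1) * (\<sigma> * v_aux M' W N L 0 \<beta>' (a / \<sigma>))\<bar> <= c * p ^ 12"
proof -
 define \<beta> where "\<beta> = exp y1 * dbar y1"
 have \<beta>: "0 <= \<beta>" unfolding \<beta>_def using dbar_nonneg by simp
 define v where "v = v_aux M' W N L 0 \<beta>' (a / \<sigma>)"
 show ?thesis
 proof (rule put_value_asymp[where a=a, OF y1 root])
 fix A assume A: "0 < A" and asy0: "!!R N. 1 <= R ==> 0 < N ==> \<forall>\<^sub>F p in at_right 0.
   \<bar>put_value (p ^ 8) (y1 + a * p ^ 4) - (K - exp (y1 + a * p ^ 4))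
    - p ^ 12 * (exp y1 * dbar y1) * stop_value (distr (mu (p ^ 8 / real N)) borel (%x. x / p ^ 4)) (%x. (a + truncr R x) / real N) N 0\<bar>
   <= A * p ^ 12 * (1 / R + p) + p ^ 12 * (exp y1 * dbar y1) * ((1 + 3 * step_const) / sqrt (real N) + (\<bar>a\<bar> + R) / real N)"
 note asy = asy0[folded \<beta>_def]
 define C1 where "C1 = 1 + 3 * \<bar>step_const\<bar>"
 define Q where "Q = A + \<beta> * (C1 + (\<bar>a\<bar> + 1)) + \<beta> * (\<sigma> * \<sigma> + \<sigma> + (\<bar>a\<bar> + 1))"
 have Q: "0 < Q" unfolding Q_def C1_def using A \<beta> \<sigma>_pos by (intro add_pos_nonneg mult_nonneg_nonneg add_nonneg_nonneg) auto
 \<comment> \<open>\<open>Q\<close> collects the coefficients of \<open>1 / k\<close> from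
   truncation, the coarse grid of the put and the approximation of the Brownian problem.\<close>
 obtain k0 :: nat where k0: "3 * Q / c <= real k0" using real_arch_simple by blast
 define k where "k = Suc k0"
 have k: "1 <= real k" "0 < real k" by (simp_all add: k_def)
 have Qk: "Q / real k <= c / 3"
 proof -
  have "3 * Q / c <= real k" using k0 by (simp add: k_def)
  then have "3 * Q <= c * real k" using c by (simp add: pos_divide_le_eq mult.commute)
  then show ?thesis using k by (simp add: pos_divide_le_eq)
 qed
 \<comment> \<open>The number of coarse steps must outgrow the truncation level: with the fourth
   power both \<open>1 / sqrt n\<close> and \<open>(\<bar>a\<bar> + k) / n\<close> are of order
   \<open>1 / k\<close>.\<close>
 define n where "n = k ^ 4"
 have n: "0 < n" using k by (simp add: n_def)
 have sn: "sqrt (real n) = (real k)\<^sup>2"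
 proof -
  have e: "real n = ((real k)\<^sup>2)\<^sup>2" by (simp add: n_def power_mult[symmetric])
  show ?thesis unfolding e real_sqrt_abs by simp
 qed
 have inv: "1 / sqrt (real n) <= 1 / real k"
  unfolding sn using k by (intro divide_left_mono) (auto simp: power2_eq_square)
 have arn: "(\<bar>a\<bar> + real k) / real n <= (\<bar>a\<bar> + 1) / real k"
 proof -
  have "\<bar>a\<bar> * 1 <= \<bar>a\<bar> * real k" by (rule mult_left_mono[OF k(1)]) simp
  then have 1: "(\<bar>a\<bar> + real k) * real k <= ((\<bar>a\<bar> + 1) * real k) * real k"
   using k by (intro mult_right_mono) (auto simp: distrib_right)
  have "(real k)\<^sup>2 <= (real k) ^ 4" by (rule power_increasing[OF _ k(1)]) simp
  then have "(\<bar>a\<bar> + 1) * (real k)\<^sup>2 <= (\<bar>a\<bar> + 1) * (real k) ^ 4" by (rule mult_left_mono) simp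
  then have "(\<bar>a\<bar> + real k) * real k <= (\<bar>a\<bar> + 1) * (real k) ^ 4" using 1 by (simp add: power2_eq_square mult.assoc)
  then show ?thesis using k by (simp add: n_def pos_divide_le_eq pos_le_divide_eq)
 qed
 define V0 where "V0 = stop_value (distr gauss borel (%x. \<sigma> / sqrt (real n) * x)) (%x. (a + truncr (real k) x) / real n) n 0"
 define V where "V p = stop_value (distr (mu (p ^ 8 / real n)) borel (%x. x / p ^ 4)) (%x. (a + truncr (real k) x) / real n) n 0" for p
 have limV: "(V \<longlongrightarrow> V0) (at_right 0)" unfolding V_def V0_def by (rule stop_value_limit[OF n]) simp
 \<comment> \<open>Division by \<open>\<beta> + 1\<close> covers the case
   \<open>\<beta> = 0\<close>.\<close>
 define e1 where "e1 = c / (3 * (\<beta> + 1))"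
 have e1: "0 < e1" "\<beta> * e1 <= c / 3"
 proof -
  show "0 < e1" using c \<beta> by (simp add: e1_def)
  have "\<beta> * e1 = (\<beta> / (\<beta> + 1)) * (c / 3)" by (simp add: e1_def)
  also have "... <= 1 * (c / 3)" using \<beta> c by (intro mult_right_mono) (auto simp: divide_le_eq_1)
  finally show "\<beta> * e1 <= c / 3" by simp
 qed
 have ev1: "\<forall>\<^sub>F p in at_right 0. \<bar>V p - V0\<bar> < e1" using tendstoD[OF limV e1(1)] by (simp add: dist_real_def)
 have vb: "\<bar>\<sigma> * v - V0\<bar> <= (\<sigma> * \<sigma> + \<sigma> + (\<bar>a\<bar> + 1)) / real k"
 proof -
  have ks: "0 < real k / \<sigma>" using k \<sigma>_pos by simp
  define q where "q = stop_value (distr gauss borel (%x. sqrt (1 / real n) * x)) (%x. (1 / real n) * (1 * (a / \<sigma> + truncr (real k / \<sigma>) x))) n 0"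
  have "\<bar>v - q\<bar> <= 1 / (real k / \<sigma>) + (sqrt (1 / real n) + (1 / real n) * (\<bar>a / \<sigma>\<bar> + real k / \<sigma>))"
   unfolding v_def q_def by (rule v_aux_approx[OF aux ks n])
  then have "\<sigma> * \<bar>v - q\<bar> <= \<sigma> * (1 / (real k / \<sigma>) + (sqrt (1 / real n) + (1 / real n) * (\<bar>a / \<sigma>\<bar> + real k / \<sigma>)))"
   using \<sigma>_pos by (intro mult_left_mono) auto
  also have "... = \<sigma> * \<sigma> / real k + \<sigma> * (1 / sqrt (real n)) + (\<bar>a\<bar> + real k) / real n"
   using \<sigma>_pos by (simp add: real_sqrt_divide abs_divide distrib_left add_divide_distrib)
  also have "... <= \<sigma> * \<sigma> / real k + \<sigma> * (1 / real k) + (\<bar>a\<bar> + 1) / real k"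
   using inv arn \<sigma>_pos by (intro add_mono order_refl mult_left_mono) auto
  also have "... = (\<sigma> * \<sigma> + \<sigma> + (\<bar>a\<bar> + 1)) / real k" by (simp add: add_divide_distrib)
  finally have "\<sigma> * \<bar>v - q\<bar> <= (\<sigma> * \<sigma> + \<sigma> + (\<bar>a\<bar> + 1)) / real k" .
  moreover have "\<sigma> * v - V0 = \<sigma> * (v - q)" unfolding V0_def q_def stop_value_aux_scale[OF n] by (simp add: right_diff_distrib)
  ultimately show ?thesis using \<sigma>_pos by (simp add: abs_mult)
 qed
 have "0 < c / (3 * A)" using c A by simp
 then have ev2: "\<forall>\<^sub>F p in at_right 0. p < c / (3 * A)" by (rule eventually_mono[OF eventually_at_right_real]) simp
 have ev3: "\<forall>\<^sub>F p in at_right (0::real). 0 < p" by (rule eventually_at_right_less)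
 show ?thesis
  using asy[OF k(1) n, folded V_def] ev1 ev2 ev3 unfolding \<beta>_def[symmetric] v_def[symmetric]
 proof eventually_elim
  case (elim p)
  define D where "D = put_value (p ^ 8) (y1 + a * p ^ 4) - (K - exp (y1 + a * p ^ 4))"
  have p12: "0 <= p ^ 12" using elim(4) by simp
  have Qe: "Q / real k = A / real k + \<beta> * (C1 + (\<bar>a\<bar> + 1)) / real k + \<beta> * (\<sigma> * \<sigma> + \<sigma> + (\<bar>a\<bar> + 1)) / real k"
   by (simp only: Q_def add_divide_distrib)
  have alg2: "P * (u + w + x) + P * (w + x') = P * (2 * w + (u + x + x'))" for P u w x x' :: real by (simp add: algebra_simps)
  have alg: "A' * P * U + P * B' * V' = P * (A' * U + B' * V')" for A' P U B' V' :: real by (simp add: algebra_simps)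
  have b1: "\<bar>D - p ^ 12 * \<beta> * V p\<bar> <= p ^ 12 * (A / real k + c / 3 + \<beta> * (C1 + (\<bar>a\<bar> + 1)) / real k)"
  proof -
   have "A * p <= c / 3" using elim(3) A by (simp add: pos_less_divide_eq mult_ac)
   then have Ap: "A * (1 / real k + p) <= A / real k + c / 3" by (simp add: distrib_left)
   have "(1 + 3 * step_const) / sqrt (real n) <= C1 * (1 / sqrt (real n))" unfolding C1_def by (simp add: divide_right_mono)
   also have "... <= C1 * (1 / real k)" by (rule mult_left_mono[OF inv]) (simp add: C1_def)
   finally have "(1 + 3 * step_const) / sqrt (real n) + (\<bar>a\<bar> + real k) / real n <= (C1 + (\<bar>a\<bar> + 1)) / real k"
    using arn by (simp add: add_divide_distrib)
   then have "\<beta> * ((1 + 3 * step_const) / sqrt (real n) + (\<bar>a\<bar> + real k) / real n) <= \<beta> * ((C1 + (\<bar>a\<bar> + 1)) / real k)"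
    by (rule mult_left_mono[OF _ \<beta>])
   with Ap have s: "A * (1 / real k + p) + \<beta> * ((1 + 3 * step_const) / sqrt (real n) + (\<bar>a\<bar> + real k) / real n)
     <= A / real k + c / 3 + \<beta> * (C1 + (\<bar>a\<bar> + 1)) / real k" by simp
   have "\<bar>D - p ^ 12 * \<beta> * V p\<bar> <= A * p ^ 12 * (1 / real k + p) + p ^ 12 * \<beta> * ((1 + 3 * step_const) / sqrt (real n) + (\<bar>a\<bar> + real k) / real n)"
    unfolding D_def by (rule elim(1))
   also have "... = p ^ 12 * (A * (1 / real k + p) + \<beta> * ((1 + 3 * step_const) / sqrt (real n) + (\<bar>a\<bar> + real k) / real n))"
    by (rule alg)
   also have "... <= p ^ 12 * (A / real k + c / 3 + \<beta> * (C1 + (\<bar>a\<bar> + 1)) / real k)" by (rule mult_left_mono[OF s p12])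
   finally show ?thesis .
  qed
  have b2: "\<bar>p ^ 12 * \<beta> * V p - p ^ 12 * \<beta> * (\<sigma> * v)\<bar> <= p ^ 12 * (c / 3 + \<beta> * (\<sigma> * \<sigma> + \<sigma> + (\<bar>a\<bar> + 1)) / real k)"
  proof -
   have "\<bar>V p - \<sigma> * v\<bar> <= e1 + (\<sigma> * \<sigma> + \<sigma> + (\<bar>a\<bar> + 1)) / real k" using elim(2) vb by linarith
   then have "\<beta> * \<bar>V p - \<sigma> * v\<bar> <= \<beta> * (e1 + (\<sigma> * \<sigma> + \<sigma> + (\<bar>a\<bar> + 1)) / real k)" by (rule mult_left_mono[OF _ \<beta>])
   also have "... <= c / 3 + \<beta> * (\<sigma> * \<sigma> + \<sigma> + (\<bar>a\<bar> + 1)) / real k" using e1(2) unfolding distrib_left[of \<beta> e1] by simp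
   finally have "p ^ 12 * (\<beta> * \<bar>V p - \<sigma> * v\<bar>) <= p ^ 12 * (c / 3 + \<beta> * (\<sigma> * \<sigma> + \<sigma> + (\<bar>a\<bar> + 1)) / real k)" by (rule mult_left_mono[OF _ p12])
   moreover have "\<bar>p ^ 12 * \<beta> * V p - p ^ 12 * \<beta> * (\<sigma> * v)\<bar> = p ^ 12 * (\<beta> * \<bar>V p - \<sigma> * v\<bar>)"
   proof -
    have "p ^ 12 * \<beta> * V p - p ^ 12 * \<beta> * (\<sigma> * v) = (p ^ 12 * \<beta>) * (V p - \<sigma> * v)" by (simp only: right_diff_distrib)
    then show ?thesis using p12 \<beta> by (simp add: abs_mult mult.assoc)
   qed
   ultimately show ?thesis by linarith
  qed
  have "\<bar>D - p ^ 12 * \<beta> * (\<sigma> * v)\<bar> <= \<bar>D - p ^ 12 * \<beta> * V p\<bar> + \<bar>p ^ 12 * \<beta> * V p - p ^ 12 * \<beta> * (\<sigma> * v)\<bar>" by linarith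
  also have "... <= p ^ 12 * (A / real k + c / 3 + \<beta> * (C1 + (\<bar>a\<bar> + 1)) / real k) + p ^ 12 * (c / 3 + \<beta> * (\<sigma> * \<sigma> + \<sigma> + (\<bar>a\<bar> + 1)) / real k)"
   by (rule add_mono[OF b1 b2])
  also have "... = p ^ 12 * (2 * (c / 3) + Q / real k)" unfolding Qe by (rule alg2)
  also have "... <= p ^ 12 * c" by (rule mult_left_mono[OF _ p12]) (use Qk in linarith)
  finally show ?case unfolding D_def by (simp only: mult.commute)
 qed
 qed
qed

end

section \<open>From the Levy process to the log-price locale\<close>

lemma continuous_off_zero_measurable:
 fixes s :: "real \<Rightarrow> real"
 assumes "continuous_on (- {0}) s" shows "s \<in> borel_measurable borel"
proof (rule measurable_piecewise_restrict[of "{- {0}, {0}}"])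
 fix A :: "real set" assume A: "A \<in> {- {0}, {0}}"
 then show "A \<inter> space borel \<in> sets borel" by auto
 have "continuous_on A s" using A assms by auto
 then show "s \<in> borel_measurable (restrict_space borel A)" by (rule borel_measurable_continuous_on_restrict)
qed auto

text \<open>Finite variation of the small jumps and the exponential moment make the compensator and
  \<open>exp z - 1\<close> separately integrable. The triplet can therefore be rewritten with an
  uncompensated exponent, and the martingale condition on \<open>b\<close> becomes the
  \<open>drift\<close> condition of the log-price.\<close>

lemma levy_put_process:
 fixes M :: "'a measure" and X :: "real \<Rightarrow> 'a \<Rightarrow> real"
 assumes levy: "levy_process M F X b \<sigma> \<nu>"
  and r: "0 <= r" and \<delta>: "0 <= \<delta>" and K: "0 < K"
  and exp_moment: "(\<integral>\<^sup>+ z. ennreal (exp z) * indicator {1..} z \<partial>\<nu>) < \<infinity>"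
  and drift: "b = - \<sigma>\<^sup>2 / 2 - (LINT z|\<nu>. exp z - 1 - z * indicator {-1..1} z)"
  and \<sigma>_pos: "0 < \<sigma>"
  and finite_var: "(\<integral>\<^sup>+ z. ennreal \<bar>z\<bar> * indicator ({-1<..<1} - {0}) z \<partial>\<nu>) < \<infinity>"
  and s: "continuous_on (- {0}) s" "!!z. 0 <= s z" "\<nu> = density lborel (%z. ennreal (s z))"
 shows "put_process (b - (LINT z|\<nu>. z * indicator {-1..1} z) + (r - \<delta>)) \<sigma> s \<nu> (%t. distr M borel (%om. (r - \<delta>) * t + X t om)) r \<delta> K M F (%t om. (r - \<delta>) * t + X t om)"
proof -
 interpret prob_space M using levy by (simp add: levy_process_def)
 have F: "!!t. subalgebra M (F t)" "!!s t. s <= t ==> sets (F s) \<subseteq> sets (F t)"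
  using levy by (auto simp: levy_process_def is_filtration_def)
 have XF: "0 <= t ==> X t \<in> borel_measurable (F t)" for t using levy by (simp add: levy_process_def)
 have XM: "0 <= t ==> X t \<in> borel_measurable M" for t by (rule measurable_from_subalg[OF F(1) XF])
 have sets_nu[measurable_cong]: "sets \<nu> = sets borel" by (simp add: s(3))
 have nu_int: "integrable \<nu> (%z. min 1 \<bar>z\<bar>)"
 proof (rule integrableI_nonneg)
  \<comment> \<open>The finite variation hypothesis covers \<open>\<bar>z\<bar> < 1\<close>; from 1
    on \<open>min 1 (z\<^sup>2)\<close> equals 1 and takes over.\<close>
  have "(\<integral>\<^sup>+ z. ennreal (min 1 \<bar>z\<bar>) \<partial>\<nu>) <= (\<integral>\<^sup>+ z. ennreal \<bar>z\<bar> * indicator ({-1<..<1} - {0}) z + ennreal (min 1 (z\<^sup>2)) \<partial>\<nu>)"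
  proof (rule nn_integral_mono)
   fix z :: real
   consider "z = 0" | "z \<noteq> 0" "\<bar>z\<bar> < 1" | "1 <= \<bar>z\<bar>" by linarith
   then show "ennreal (min 1 \<bar>z\<bar>) <= ennreal \<bar>z\<bar> * indicator ({-1<..<1} - {0}) z + ennreal (min 1 (z\<^sup>2))"
   proof cases
    case 2
    then have "indicator ({-1<..<1} - {0}) z = (1::ennreal)" by (auto simp: indicator_def)
    moreover have "ennreal (min 1 \<bar>z\<bar>) = ennreal \<bar>z\<bar>" using 2 by (simp add: min_def)
    ultimately show ?thesis by simp
   next
    case 3
    then have "1 <= z\<^sup>2" by (metis abs_square_le_1 power2_abs one_le_power)
    then show ?thesis using 3 by (simp add: min_def add_increasing)
   qed simp
  qed
  also have "... = (\<integral>\<^sup>+ z. ennreal \<bar>z\<bar> * indicator ({-1<..<1} - {0}) z \<partial>\<nu>) + (\<integral>\<^sup>+ z. ennreal (min 1 (z\<^sup>2)) \<partial>\<nu>)"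
   by (rule nn_integral_add) measurable
  also have "... < \<infinity>" using finite_var levy by (simp add: levy_process_def levy_measure_def)
  finally show "(\<integral>\<^sup>+ z. ennreal (min 1 \<bar>z\<bar>) \<partial>\<nu>) < \<infinity>" .
 qed auto
 have tail: "integrable \<nu> (%z. exp z * indicator {1..} z)"
 proof (rule integrableI_nonneg)
  have "(\<integral>\<^sup>+ z. ennreal (exp z * indicator {1..} z) \<partial>\<nu>) = (\<integral>\<^sup>+ z. ennreal (exp z) * indicator {1..} z \<partial>\<nu>)"
   by (rule nn_integral_cong) (simp add: indicator_def)
  then show "(\<integral>\<^sup>+ z. ennreal (exp z * indicator {1..} z) \<partial>\<nu>) < \<infinity>" using exp_moment by simp
 qed auto
 have exp_int: "integrable \<nu> (%z. exp z - 1)"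
 proof (rule Bochner_Integration.integrable_bound[OF Bochner_Integration.integrable_add[OF integrable_mult_right[OF nu_int, of 3] tail]])
  show "AE z in \<nu>. norm (exp z - 1) <= norm (3 * min 1 \<bar>z\<bar> + exp z * indicator {1..} z)"
  proof (rule AE_I2)
   fix z :: real
   have m0: "0 <= min 1 \<bar>z\<bar>" by simp
   have tr: "x <= m ==> 0 <= m ==> x <= 3 * m" for x m :: real by simp
   consider "z <= 0" | "0 < z" "z < 1" | "1 <= z" by linarith
   then have "\<bar>exp z - 1\<bar> <= 3 * min 1 \<bar>z\<bar> + exp z * indicator {1..} z"
   proof cases
    case 1
    have e: "\<bar>exp z - 1\<bar> = 1 - exp z" using 1 by simp
    have "\<bar>exp z - 1\<bar> <= 1" "\<bar>exp z - 1\<bar> <= \<bar>z\<bar>"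
     unfolding e using 1 exp_ge_add_one_self[of z] exp_ge_zero[of z] by linarith+
    then have "\<bar>exp z - 1\<bar> <= min 1 \<bar>z\<bar>" by (rule min.boundedI)
    from tr[OF this m0] show ?thesis using 1 by simp
   next
    case 2
    have "1 - z <= exp (- z)" using exp_ge_add_one_self[of "- z"] by simp
    then have "(1 - z) * exp z <= exp (- z) * exp z" by (rule mult_right_mono) simp
    then have "exp z - 1 <= z * exp z" by (simp add: exp_minus algebra_simps)
    also have "z * exp z <= z * 3"
    proof -
     have "exp z <= exp 1" using 2 by simp
     then have "exp z <= 3" using exp_le by linarith
     then show ?thesis using 2 by (intro mult_left_mono) auto
    qed
    finally show ?thesis using 2 by simp
   next
    case 3
    have "exp (0::real) <= exp z" using 3 by (subst exp_le_cancel_iff) simp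
    then show ?thesis using 3 m0 by simp
   qed
   then show "norm (exp z - 1) <= norm (3 * min 1 \<bar>z\<bar> + exp z * indicator {1..} z)" by simp
  qed
 qed measurable
 have zi: "integrable \<nu> (%z. z * indicator {-1..1} z)"
 proof (rule Bochner_Integration.integrable_bound[OF nu_int])
  show "AE z in \<nu>. norm (z * indicator {-1..1} z) <= norm (min 1 \<bar>z\<bar>)"
   by (rule AE_I2) (simp add: indicator_def abs_le_iff abs_ge_self abs_ge_minus_self)
 qed measurable
 have ii: "integrable \<nu> (%z. iexp (u * z) - 1)" for u
 proof (rule Bochner_Integration.integrable_bound[OF integrable_mult_right[OF nu_int, of "2 + \<bar>u\<bar>"]])
  show "AE z in \<nu>. norm (iexp (u * z) - 1) <= norm ((2 + \<bar>u\<bar>) * min 1 \<bar>z\<bar>)"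
  proof (rule AE_I2)
   fix z :: real
   have "0 <= (2 + \<bar>u\<bar>) * min 1 \<bar>z\<bar>" by simp
   then show "norm (iexp (u * z) - 1) <= norm ((2 + \<bar>u\<bar>) * min 1 \<bar>z\<bar>)"
    using norm_iexp_minus_one_le[of u z] unfolding real_norm_def by linarith
  qed
 qed measurable
 define gam where "gam = b - (LINT z|\<nu>. z * indicator {-1..1} z) + (r - \<delta>)"
 define Y where "Y t om = (r - \<delta>) * t + X t om" for t om
 define mu where "mu t = distr M borel (Y t)" for t
 have YM: "0 <= t ==> Y t \<in> borel_measurable M" for t using XM[of t] unfolding Y_def[abs_def] by simp
 \<comment> \<open>The compensator leaves the integral and joins the drift, together with the
   deterministic growth \<open>r - \<delta>\<close> of the log-price.\<close>
 have psi: "levy_exponent b \<sigma> \<nu> u + \<i> * complex_of_real ((r - \<delta>) * u) = cf_exponent gam \<sigma> \<nu> u" for u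
 proof -
  have zc: "integrable \<nu> (%z. \<i> * complex_of_real (u * z * indicator {-1..1} z))"
   by (intro integrable_mult_right integrable_of_real) (use integrable_mult_right[OF zi, of u] in \<open>simp add: mult.assoc\<close>)
  have "(CLINT z|\<nu>. \<i> * complex_of_real (u * z * indicator {-1..1} z)) = \<i> * complex_of_real (LINT z|\<nu>. u * z * indicator {-1..1} z)"
   by (simp only: integral_mult_right_zero integral_complex_of_real)
  also have "(LINT z|\<nu>. u * z * indicator {-1..1} z) = u * (LINT z|\<nu>. z * indicator {-1..1} z)"
   unfolding mult.assoc by (rule integral_mult_right_zero)
  finally have "(CLINT z|\<nu>. iexp (u * z) - 1 - \<i> * complex_of_real (u * z * indicator {-1..1} z))
    = (CLINT z|\<nu>. iexp (u * z) - 1) - \<i> * complex_of_real (u * (LINT z|\<nu>. z * indicator {-1..1} z))"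
   using Bochner_Integration.integral_diff[OF ii[of u] zc] by simp
  then show ?thesis unfolding levy_exponent_def cf_exponent_def gam_def by (simp add: algebra_simps)
 qed
 have ll: "levy_law gam \<sigma> s \<nu> mu"
 proof (rule levy_law.intro)
  show "s \<in> borel_measurable borel" by (rule continuous_off_zero_measurable[OF s(1)])
  show "!!z. 0 <= s z" "\<nu> = density lborel (%z. ennreal (s z))" by (rule s)+
  show "0 < \<sigma>" "integrable \<nu> (%z. min 1 \<bar>z\<bar>)" by (rule \<sigma>_pos nu_int)+
  show "real_distribution (mu h)" if "0 <= h" for h unfolding mu_def by (rule real_distribution_distr[OF YM[OF that]])
  show "char (mu h) u = exp (complex_of_real h * cf_exponent gam \<sigma> \<nu> u)" if h: "0 <= h" for h u
  proof -
   note [measurable] = XM[OF h] YM[OF h]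
   have "char (mu h) u = (CLINT om|M. iexp (u * Y h om))" unfolding char_def mu_def by (rule integral_distr) measurable
   also have "... = (CLINT om|M. iexp (u * ((r - \<delta>) * h)) * iexp (u * X h om))"
    unfolding Y_def by (simp add: exp_add[symmetric] distrib_left)
   also have "... = iexp (u * ((r - \<delta>) * h)) * (CLINT om|M. iexp (u * X h om))" by (rule integral_mult_right_zero)
   also have "(CLINT om|M. iexp (u * X h om)) = char (distr M borel (X h)) u"
    unfolding char_def by (rule integral_distr[symmetric]) measurable
   also have "... = exp (complex_of_real h * levy_exponent b \<sigma> \<nu> u)" using levy h by (simp add: levy_process_def)
   also have "iexp (u * ((r - \<delta>) * h)) * exp (complex_of_real h * levy_exponent b \<sigma> \<nu> u)
     = exp (complex_of_real h * (levy_exponent b \<sigma> \<nu> u + \<i> * complex_of_real ((r - \<delta>) * u)))"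
    unfolding exp_add[symmetric] by (rule arg_cong[where f=exp]) (simp add: algebra_simps)
   finally show ?thesis unfolding psi .
  qed
 qed
 have dr: "gam = r - \<delta> - \<sigma>\<^sup>2 / 2 - (LINT z|\<nu>. exp z - 1)"
  unfolding gam_def drift Bochner_Integration.integral_diff[OF exp_int zi] by simp
 have pl: "put_law gam \<sigma> s \<nu> mu r \<delta> K"
  by (rule put_law.intro[OF ll put_law_axioms.intro[OF r \<delta> K exp_int dr s(1)]])
 have gp: "grid_process M F Y mu"
 proof
  show "subalgebra M (F t)" for t by (rule F)
  show "sets (F u) \<subseteq> sets (F t)" if "u <= t" for u t by (rule F(2)[OF that])
  show "Y t \<in> borel_measurable (F t)" if "0 <= t" for t using XF[OF that] unfolding Y_def[abs_def] by simp
  show "AE om in M. Y 0 om = 0" using levy by (simp add: levy_process_def Y_def)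
  fix u t :: real assume ut: "0 <= u" "u <= t"
  have lv: "indep_set (sets (F u)) (rv_events M (%om. X t om - X u om))" "distr M borel (%om. X t om - X u om) = distr M borel (X (t - u))"
   using levy ut by (auto simp: levy_process_def)
  have eqY: "Y t om - Y u om = (r - \<delta>) * (t - u) + (X t om - X u om)" for om by (simp add: Y_def algebra_simps)
  have "rv_events M (%om. Y t om - Y u om) \<subseteq> rv_events M (%om. X t om - X u om)"
  proof
   fix E assume "E \<in> rv_events M (%om. Y t om - Y u om)"
   then obtain A where A: "A \<in> sets borel" "E = (%om. Y t om - Y u om) -` A \<inter> space M" by (auto simp: rv_events_def)
   have "(%x. (r - \<delta>) * (t - u) + x) -` A \<in> sets borel" using measurable_sets[of "%x. (r - \<delta>) * (t - u) + x" borel borel A] A(1) by simp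
   moreover have "E = (%om. X t om - X u om) -` ((%x. (r - \<delta>) * (t - u) + x) -` A) \<inter> space M" unfolding A(2) eqY by auto
   ultimately show "E \<in> rv_events M (%om. X t om - X u om)" unfolding rv_events_def by blast
  qed
  then show "indep_set (sets (F u)) (rv_events M (%om. Y t om - Y u om))"
   using lv(1) unfolding indep_sets2_eq by blast
  have tu: "0 <= t - u" "0 <= t" using ut by auto
  note [measurable] = XM[OF ut(1)] XM[OF tu(1)] XM[OF tu(2)]
  have "distr M borel (%om. Y t om - Y u om) = distr (distr M borel (%om. X t om - X u om)) borel (%x. (r - \<delta>) * (t - u) + x)"
   unfolding eqY by (subst distr_distr) (simp_all add: comp_def)
  also have "... = mu (t - u)" unfolding lv(2) mu_def Y_def[abs_def] by (subst distr_distr) (simp_all add: comp_def)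
  finally show "distr M borel (%om. Y t om - Y u om) = mu (t - u)" .
 next
  show "distr M borel (Y t) = mu t" if "0 <= t" for t by (simp add: mu_def)
 qed
 have "AE om in M. \<forall>t\<ge>0. ((%u. X u om) \<longlongrightarrow> X t om) (at_right t) \<and> (t > 0 \<longrightarrow> (\<exists>l. ((%u. X u om) \<longlongrightarrow> l) (at_left t)))"
  using levy unfolding levy_process_def by blast
 then have rc: "AE om in M. \<forall>t\<ge>0. ((%u. Y u om) \<longlongrightarrow> Y t om) (at_right t)"
  by (rule AE_mp) (intro AE_I2 impI allI, unfold Y_def, intro tendsto_add tendsto_mult tendsto_const tendsto_ident_at, blast)
 have "put_process gam \<sigma> s \<nu> mu r \<delta> K M F Y"
  by (rule put_process.intro[OF pl gp put_process_axioms.intro[OF rc]])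
 then show ?thesis unfolding gam_def mu_def Y_def[abs_def] .
qed

section \<open>The put as a function of the initial price\<close>

context
 fixes M :: "'a measure" and F :: "real \<Rightarrow> 'a measure" and X :: "real \<Rightarrow> 'a \<Rightarrow> real" and r \<delta> K T t :: real
 assumes ps: "prob_space M" and filt: "is_filtration M F" and r: "0 <= r" and K: "0 < K" and tT: "t <= T"
begin

interpretation prob_space M by (rule ps)

definition put_reward :: "real \<Rightarrow> ('a \<Rightarrow> real) \<Rightarrow> 'a \<Rightarrow> real" where
 "put_reward s tau om = exp (- r * tau om) * max 0 (K - s * exp ((r - \<delta>) * tau om + X (tau om) om))"

definition put_times :: "('a \<Rightarrow> real) set" where
 "put_times = {tau. stopping_time F tau \<and> (\<forall>om\<in>space M. 0 <= tau om \<and> tau om <= T - t)}"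

lemma american_put_eq: "american_put M F X r \<delta> K T t s = (SUP tau\<in>put_times. expectation (put_reward s tau))"
 unfolding american_put_def put_reward_def[abs_def] put_times_def ..

lemma zero_put_times: "(%_. 0) \<in> put_times"
 unfolding put_times_def using tT stopping_time_const[of F 0] by simp

lemma put_reward_bounds:
 assumes "0 <= s" "0 <= tau om"
 shows "0 <= put_reward s tau om" "put_reward s tau om <= K"
proof -
 show "0 <= put_reward s tau om" by (simp add: put_reward_def)
 have "exp (- r * tau om) * max 0 (K - s * exp ((r - \<delta>) * tau om + X (tau om) om)) <= 1 * K"
  using assms r K by (intro mult_mono) auto
 then show "put_reward s tau om <= K" by (simp add: put_reward_def)
qed

lemma put_reward_expectation_le: "0 <= s ==> tau \<in> put_times ==> expectation (put_reward s tau) <= K"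
proof -
 assume a: "0 <= s" "tau \<in> put_times"
 have "expectation (put_reward s tau) <= expectation (%_. K)"
  by (rule integral_mono') (use put_reward_bounds[OF a(1)] a(2) K in \<open>auto simp: put_times_def\<close>)
 then show ?thesis using prob_space by simp
qed

lemma american_put_ge:
 assumes s: "0 <= s" and tau: "tau \<in> put_times" shows "expectation (put_reward s tau) <= american_put M F X r \<delta> K T t s"
 unfolding american_put_eq by (rule cSUP_upper[OF tau bdd_aboveI2[OF put_reward_expectation_le[OF s]]])

lemma american_put_0: "american_put M F X r \<delta> K T t 0 = K"
proof (rule antisym)
 show "american_put M F X r \<delta> K T t 0 <= K"
  unfolding american_put_eq by (rule cSUP_least) (use zero_put_times put_reward_expectation_le in auto)
 have "expectation (put_reward 0 (%_. 0)) = K" using K prob_space by (simp add: put_reward_def[abs_def])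
 then show "K <= american_put M F X r \<delta> K T t 0" using american_put_ge[OF _ zero_put_times, of 0] by simp
qed

text \<open>Exercise prices form an interval starting at 0. For \<open>u = q * s\<close> the payoff
  is convex in the price, hence at most \<open>q\<close> times the payoff from \<open>s\<close> plus
  \<open>(1 - q) * K\<close>, and discounting only lowers the second part; the bound at
  \<open>s\<close> then yields \<open>q * (K - s) + (1 - q) * K = K - u\<close>.\<close>

lemma american_put_intrinsic_below:
 assumes s: "0 < s" and le: "american_put M F X r \<delta> K T t s <= K - s" and u: "0 <= u" "u <= s"
 shows "american_put M F X r \<delta> K T t u <= K - u"
proof (cases "u = 0")
 case True then show ?thesis using american_put_0 by simp
next
 case False
 define q where "q = u / s"
 have q: "0 < q" "q <= 1" "u = q * s" using False u s by (auto simp: q_def)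
 have sK: "s <= K"
 proof -
  have "0 <= expectation (put_reward s (%_. 0))" unfolding put_reward_def by (intro Bochner_Integration.integral_nonneg) simp
  then show ?thesis using american_put_ge[OF less_imp_le[OF s] zero_put_times] le by linarith
 qed
 show ?thesis
  unfolding american_put_eq
 proof (rule cSUP_least)
  show "put_times \<noteq> {}" using zero_put_times by blast
  fix tau assume tau: "tau \<in> put_times"
  have tau0: "0 <= tau om" if "om \<in> space M" for om using tau that by (auto simp: put_times_def)
  show "expectation (put_reward u tau) <= K - u"
  proof (cases "integrable M (put_reward u tau)")
   case False
   \<comment> \<open>A reward that is not integrable counts as 0, which is below
     \<open>K - u\<close> because \<open>u <= s <= K\<close>.\<close>
   then have "expectation (put_reward u tau) = 0" by (rule not_integrable_integral_eq)
   then show ?thesis using u sK by simp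
  next
   case True
   have [measurable]: "tau \<in> borel_measurable M"
   proof (rule borel_measurableI_le)
    fix y
    have sub: "subalgebra M (F y)" using filt by (simp add: is_filtration_def)
    have "Measurable.pred (F y) (%om. tau om <= y)" using tau by (auto simp: put_times_def stopping_time_def)
    then show "{om \<in> space M. tau om <= y} \<in> sets M" using sub by (auto simp: pred_def subalgebra_def)
   qed
   note [measurable] = borel_measurable_integrable[OF True]
   \<comment> \<open>The reward from \<open>s\<close> is recovered as a function of
     \<open>tau\<close> and of the reward from \<open>u\<close>, which transfers measurability.
     Where the payoff from \<open>u\<close> is 0, the price from \<open>s\<close> is at least
     \<open>K\<close> as well, and the formula gives \<open>K - K / q <= 0\<close>, again payoff
     0.\<close>
   have eq: "put_reward s tau om = exp (- r * tau om) * max 0 (K - (K - exp (r * tau om) * put_reward u tau om) / q)" for om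
   proof -
    define E where "E = exp ((r - \<delta>) * tau om + X (tau om) om)"
    have "exp (r * tau om) * put_reward u tau om = max 0 (K - u * E)"
     unfolding put_reward_def E_def[symmetric] by (simp add: mult.assoc[symmetric] exp_add[symmetric])
    moreover have "max 0 (K - (K - max 0 (K - u * E)) / q) = max 0 (K - s * E)"
    proof (cases "u * E <= K")
     case True
     then show ?thesis using q by simp
    next
     case False
     have "K * q <= K" using q K by simp
     then have "K <= K / q" using q by (simp add: pos_le_divide_eq)
     moreover have "K <= s * E"
     proof -
      have "q * (s * E) <= 1 * (s * E)" using q s by (intro mult_right_mono) (auto simp: E_def)
      then show ?thesis using False q(3) by (simp add: mult.assoc)
     qed
     ultimately show ?thesis using False by simp
    qed
    ultimately show ?thesis unfolding put_reward_def[of s] E_def[symmetric] by simp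
   qed
   have sm: "put_reward s tau \<in> borel_measurable M" unfolding eq[abs_def] by measurable
   have si: "integrable M (put_reward s tau)"
    by (rule integrable_const_bound[of _ K, OF _ sm]) (use put_reward_bounds[OF less_imp_le[OF s] tau0] in \<open>auto intro!: AE_I2\<close>)
   have "expectation (put_reward u tau) <= expectation (%om. q * put_reward s tau om + (1 - q) * K)"
   proof (rule integral_mono[OF True])
    show "integrable M (%om. q * put_reward s tau om + (1 - q) * K)" using si by simp
    fix om assume w: "om \<in> space M"
    define E where "E = exp ((r - \<delta>) * tau om + X (tau om) om)"
    define d where "d = exp (- r * tau om)"
    have d: "0 <= d" "d <= 1" using r tau0[OF w] by (auto simp: d_def)
    have "max 0 (K - u * E) <= q * max 0 (K - s * E) + (1 - q) * K"
    proof -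
     have 1: "q * (K - s * E) <= q * max 0 (K - s * E)" "0 <= q * max 0 (K - s * E)" "0 <= (1 - q) * K"
      using q K by (auto intro!: mult_left_mono)
     have "K - u * E = q * (K - s * E) + (1 - q) * K" unfolding q(3) by (simp add: algebra_simps)
     then show ?thesis using 1 by (intro max.boundedI) linarith+
    qed
    then have "d * max 0 (K - u * E) <= d * (q * max 0 (K - s * E) + (1 - q) * K)" using d by (intro mult_left_mono)
    also have "... = q * (d * max 0 (K - s * E)) + d * ((1 - q) * K)" by (simp add: algebra_simps)
    also have "... <= q * (d * max 0 (K - s * E)) + 1 * ((1 - q) * K)" using d q K by (intro add_left_mono mult_right_mono) auto
    finally show "put_reward u tau om <= q * put_reward s tau om + (1 - q) * K" unfolding put_reward_def E_def d_def by simp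
   qed
   also have "... = q * expectation (put_reward s tau) + (1 - q) * K" using si prob_space by simp
   also have "... <= q * (K - s) + (1 - q) * K"
    using american_put_ge[OF less_imp_le[OF s] tau] le q by (intro add_right_mono mult_left_mono) auto
   also have "... = K - u" unfolding q(3) by (simp add: algebra_simps)
   finally show ?thesis .
  qed
 qed
qed

end

section \<open>Limit of the critical price and the final expansion\<close>

lemma singleton_null_density:
 assumes "s \<in> borel_measurable borel" shows "measure (density lborel (%z. ennreal (s z))) {x} = 0"
proof -
 have "emeasure (density lborel (%z. ennreal (s z))) {x} = (\<integral>\<^sup>+ z. ennreal (s z) * indicator {x} z \<partial>lborel)"
  using assms by (intro emeasure_density) auto
 also have "... = 0" by (rule nn_integral_null_set) (simp add: null_setsI)
 finally show ?thesis by (simp add: measure_def)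
qed

theorem theorem5p3:
  fixes M :: "'a measure" and F :: "real \<Rightarrow> 'a measure" and X :: "real \<Rightarrow> 'a \<Rightarrow> real"
    and r \<delta> K T b \<sigma> :: real and \<nu> :: "real measure"
    and Maux :: "'b measure" and W :: "real \<Rightarrow> 'b \<Rightarrow> real" and N :: "real \<Rightarrow> 'b \<Rightarrow> nat"
    and L :: "real \<Rightarrow> real \<Rightarrow> 'b \<Rightarrow> real"
    and bT lam \<delta>bar \<beta> a :: real
  assumes complete: "complete_prob_space M"
    and levy: "levy_process M F X b \<sigma> \<nu>"
    and r: "0 \<le> r" and \<delta>: "0 \<le> \<delta>" and K: "0 < K" and T: "0 < T"
    and exp_moment: "(\<integral>\<^sup>+ z. ennreal (exp z) * indicator {1..} z \<partial>\<nu>) < \<infinity>"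
    and drift: "b = - \<sigma>\<^sup>2 / 2 - (LINT z|\<nu>. exp z - 1 - z * indicator {-1..1} z)"
    and \<sigma>_pos: "0 < \<sigma>"
    and finite_var: "(\<integral>\<^sup>+ z. ennreal \<bar>z\<bar> * indicator ({-1<..<1} - {0}) z \<partial>\<nu>) < \<infinity>"
    and dens: "\<exists>s. continuous_on (- {0}) s \<and> (\<forall>z. 0 \<le> s z) \<and> \<nu> = density lborel (\<lambda>z. ennreal (s z))"
    and d_neg: "r - \<delta> - (LINT z:{0<..}|\<nu>. exp z - 1) < 0"
    and bT_def: "bT = Lim (at_left T) (critical_price M F X r \<delta> K T)"
    and lam_def: "lam = measure \<nu> {ln (K / bT)}"
    and \<delta>bar_def: "\<delta>bar = \<delta> + (LINT z:{ln (K / bT)<..}|\<nu>. exp z)"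
    and \<beta>_def: "\<beta> = K / (bT * \<delta>bar)"
    and aux: "aux_space Maux lam W N L"
    and a: "a < 0"
  shows "(\<lambda>\<theta>. american_put M F X r \<delta> K T (T - \<theta>) (bT * exp (a * sqrt \<theta>))
            - (max 0 (K - bT * exp (a * sqrt \<theta>))
               + \<sigma> * bT * \<delta>bar * exp lam * v_aux Maux W N L lam \<beta> (a / \<sigma>) * \<theta> powr (3/2)))
         \<in> o[at_right 0](\<lambda>\<theta>. \<theta> powr (3/2))"
proof -
 obtain s where s: "continuous_on (- {0}) s" "!!z. 0 <= s z" "\<nu> = density lborel (%z. ennreal (s z))" using dens by blast
 note pp = levy_put_process[OF levy r \<delta> K exp_moment drift \<sigma>_pos finite_var s]
 interpret P: put_process "b - (LINT z|\<nu>. z * indicator {-1..1} z) + (r - \<delta>)" \<sigma> s \<nu> "%t. distr M borel (%om. (r - \<delta>) * t + X t om)" r \<delta> K M F "%t om. (r - \<delta>) * t + X t om"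
  by (rule pp)
 have ps: "prob_space M" and filt: "is_filtration M F" using levy by (auto simp: levy_process_def)
 define A where "A = american_put M F X r \<delta> K T"
 define cp where "cp = critical_price M F X r \<delta> K T"
 define C where "C t = {s. 0 <= s \<and> A t s > max 0 (K - s)}" for t
 have cp: "cp t = Inf (C t)" for t unfolding cp_def critical_price_def C_def A_def ..
 have PV: "P.put_value th y = A (T - th) (exp y)" for th y
  unfolding P.put_value_def A_def american_put_def put_payoff_def by (simp add: exp_add)
 have A0: "A t 0 = K" if "t <= T" for t unfolding A_def by (rule american_put_0[OF ps filt r K that])
 have bdd: "bdd_below (C t)" for t by (rule bdd_belowI[of _ 0]) (simp add: C_def)
 have bT: "bT = Lim (at_left T) cp" unfolding bT_def cp_def ..
 have nt: "at_left T \<noteq> bot" by (rule trivial_limit_at_left_real)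
 have lam0: "lam = 0" unfolding lam_def s(3) by (rule singleton_null_density[OF continuous_off_zero_measurable[OF s(1)]])
 have left_of_right: "\<forall>\<^sub>F t in at_left T. Q t" if "\<forall>\<^sub>F th in at_right 0. Q (T - th)" for Q
 proof -
  obtain d where d: "0 < d" "!!th. 0 < th ==> th < d ==> Q (T - th)" using \<open>\<forall>\<^sub>F th in at_right 0. Q (T - th)\<close> unfolding eventually_at_right_field by auto
  have "Q t" if "T - d < t" "t < T" for t using d(2)[of "T - t"] that by simp
  then show ?thesis unfolding eventually_at_left_field using d(1) by (intro exI[of _ "T - d"]) auto
 qed
 have fin: "?thesis" if "!!c. 0 < c ==> \<forall>\<^sub>F th in at_right 0. \<bar>A (T - th) (bT * exp (a * sqrt th)) - (max 0 (K - bT * exp (a * sqrt th))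
   + \<sigma> * bT * \<delta>bar * exp lam * v_aux Maux W N L lam \<beta> (a / \<sigma>) * th powr (3/2))\<bar> <= c * th powr (3/2)"
  by (rule landau_o.smallI) (use that in \<open>simp add: A_def\<close>)
 show ?thesis
 proof (cases "r = 0")
  case True
  have cp0: "cp t = 0" if t: "t < T" for t
  proof -
   have sC: "x \<in> C t" if "0 < x" "x < K" for x
    using P.put_value_gt_no_interest[OF True, of "T - t" "ln x"] t that unfolding PV C_def by simp
   have "K / 2 \<in> C t" using K by (intro sC) auto
   then have "0 <= cp t" unfolding cp by (intro cInf_greatest) (blast, simp add: C_def)
   moreover have "cp t <= 0 + e" if e: "0 < e" for e
   proof -
    have "min e (K / 2) \<in> C t" using K e by (intro sC) auto
    from cInf_lower[OF this bdd] show ?thesis unfolding cp by simp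
   qed
   then have "cp t <= 0" by (rule field_le_epsilon)
   ultimately show ?thesis by simp
  qed
  have "(cp \<longlongrightarrow> 0) (at_left T)"
  proof (rule tendsto_eventually, rule left_of_right)
   show "\<forall>\<^sub>F th in at_right 0. cp (T - th) = 0" by (rule eventually_mono[OF eventually_at_right_less[of 0]]) (simp add: cp0)
  qed
  then have bT0: "bT = 0" unfolding bT by (rule tendsto_Lim[OF nt])
  \<comment> \<open>At price 0 the put is worth exactly \<open>K\<close>, and every remaining term
    carries the factor \<open>bT\<close>, so the difference vanishes identically.\<close>
  show ?thesis
  proof (rule fin)
   fix c :: real assume c: "0 < c"
   show "\<forall>\<^sub>F th in at_right 0. \<bar>A (T - th) (bT * exp (a * sqrt th)) - (max 0 (K - bT * exp (a * sqrt th))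
   + \<sigma> * bT * \<delta>bar * exp lam * v_aux Maux W N L lam \<beta> (a / \<sigma>) * th powr (3/2))\<bar> <= c * th powr (3/2)"
    by (rule eventually_mono[OF eventually_at_right_less[of 0]]) (use K c A0 in \<open>simp add: bT0\<close>)
  qed
 next
  case False
  then have r_pos: "0 < r" using r by simp
  show ?thesis
  proof (rule P.phi0_root[OF r_pos d_neg])
   fix x0 assume x0: "0 < x0" "x0 < K" "P.phi0 x0 = 0" and above: "!!x. 0 <= x ==> x < x0 ==> 0 < P.phi0 x" and below: "!!x. x0 < x ==> x <= K ==> P.phi0 x < 0"
   have inC: "\<forall>\<^sub>F t in at_left T. x \<in> C t" if x: "x0 < x" "x < K" for x
   proof (rule left_of_right)
    have xp: "0 < x" using x x0 by linarith
    have "\<forall>\<^sub>F th in at_right 0. K - exp (ln x) < P.put_value th (ln x)"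
     by (rule P.put_value_gt) (use x xp K below in auto)
    then show "\<forall>\<^sub>F th in at_right 0. x \<in> C (T - th)"
     by (rule eventually_mono) (use x xp in \<open>simp add: PV C_def\<close>)
   qed
   have low: "\<forall>\<^sub>F t in at_left T. x <= cp t" if x: "0 < x" "x < x0" for x
   proof -
    \<comment> \<open>An eighth of the logarithmic distance keeps the whole window around
      \<open>ln x\<close> below \<open>ln x0\<close>, where \<open>phi0\<close> is positive, and
      leaves the margin \<open>4 * eps\<close> below \<open>ln K\<close>.\<close>
    define eps where "eps = min 1 ((ln x0 - ln x) / 8)"
    have lx: "ln x < ln x0" "ln x0 < ln K" using x x0 by auto
    have eps: "0 < eps" "eps <= 1" using lx by (auto simp: eps_def)
    have "eps <= (ln x0 - ln x) / 8" unfolding eps_def by (rule min.cobounded2)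
    then have e8: "8 * eps <= ln x0 - ln x" by simp
    then have e4: "ln x + 4 * eps <= ln K" "ln x + eps < ln x0" using lx eps by linarith+
    have ey: "exp y < x0" if "y <= ln x + eps" for y
    proof -
     have "exp y < exp (ln x0)" using that e4 by (subst exp_less_cancel_iff) linarith
     then show ?thesis using x0 by simp
    qed
    have "continuous_on {ln x - eps..ln x + eps} (%y. P.phi0 (exp y))"
    proof (rule continuous_on_compose2[OF P.phi0_continuous])
     show "continuous_on {ln x - eps..ln x + eps} exp" by (intro continuous_intros)
     show "exp ` {ln x - eps..ln x + eps} \<subseteq> {0..K}"
     proof (rule image_subsetI)
      fix y assume "y \<in> {ln x - eps..ln x + eps}"
      then have "exp y < x0" by (intro ey) simp
      then show "exp y \<in> {0..K}" using x0(2) by simp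
     qed
    qed
    then obtain y0 where y0: "y0 \<in> {ln x - eps..ln x + eps}" "!!y. y \<in> {ln x - eps..ln x + eps} ==> P.phi0 (exp y0) <= P.phi0 (exp y)"
     \<comment> \<open>The minimum over the compact window supplies the positive \<open>q\<close>
       required by \<open>put_value_le_intrinsic\<close>.\<close>
     using continuous_attains_inf[of "{ln x - eps..ln x + eps}" "%y. P.phi0 (exp y)"] eps by auto
    have q: "0 < P.phi0 (exp y0)" using y0(1) ey[of y0] by (intro above) auto
    have "\<forall>\<^sub>F th in at_right 0. P.put_value th (ln x) <= K - exp (ln x)"
     by (rule P.put_value_le_intrinsic[OF eps e4(1) q y0(2)])
    then have a1: "\<forall>\<^sub>F t in at_left T. A t x <= K - x"
     by (intro left_of_right) (simp add: PV x)
    \<comment> \<open>The infimum of the empty set carries no information, so some price has to be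
      in the continuation set before \<open>cp t\<close> can be bounded from below.\<close>
    have a2: "\<forall>\<^sub>F t in at_left T. (x0 + K) / 2 \<in> C t" using x0 by (intro inC) auto
    have a3: "\<forall>\<^sub>F t in at_left T. t < T" by (rule left_of_right) (rule eventually_mono[OF eventually_at_right_less[of 0]], simp)
    show ?thesis
     using a1 a2 a3
    proof eventually_elim
     case (elim t)
     have ne: "C t \<noteq> {}" using elim(2) by blast
     show ?case unfolding cp
     proof (rule cInf_greatest[OF ne])
      fix u assume u: "u \<in> C t"
      show "x <= u"
      proof (rule ccontr)
       assume "\<not> x <= u"
       \<comment> \<open>Continuing at a price below \<open>x\<close> is impossible once immediate
         exercise is optimal at \<open>x\<close>, by convexity in the price.\<close>
       then have ux: "u <= x" by simp
       have u0: "0 <= u" using u by (simp add: C_def)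
       have "A t u <= K - u" unfolding A_def
        by (rule american_put_intrinsic_below[OF ps filt r K less_imp_le[OF elim(3)] x(1) elim(1)[unfolded A_def] u0 ux])
       then show False using u by (simp add: C_def)
      qed
     qed
    qed
   qed
   have "(cp \<longlongrightarrow> x0) (at_left T)"
   proof (rule order_tendstoI)
    fix l assume l: "l < x0"
    define x where "x = (max l 0 + x0) / 2"
    have x: "0 < x" "x < x0" "l < x" using l x0 by (auto simp: x_def)
    show "\<forall>\<^sub>F t in at_left T. l < cp t" using low[OF x(1,2)] by (rule eventually_mono) (use x(3) in linarith)
   next
    fix l assume l: "x0 < l"
    define x where "x = (min l K + x0) / 2"
    have x: "x0 < x" "x < K" "x < l" using l x0 by (auto simp: x_def min_def)
    show "\<forall>\<^sub>F t in at_left T. cp t < l" using inC[OF x(1,2)]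
    proof (rule eventually_mono)
     fix t assume "x \<in> C t"
     then have "cp t <= x" unfolding cp by (rule cInf_lower[OF _ bdd])
     then show "cp t < l" using x(3) by linarith
    qed
   qed
   then have bTx: "bT = x0" unfolding bT by (rule tendsto_Lim[OF nt])
   define y1 where "y1 = ln x0"
   have ey1: "exp y1 = x0" using x0 by (simp add: y1_def)
   have y1K: "y1 < ln K" using x0 by (simp add: y1_def)
   have "ln (K / bT) = ln K - y1" using x0 K unfolding bTx y1_def by (simp add: ln_div)
   then have db: "\<delta>bar = P.dbar y1" unfolding \<delta>bar_def P.dbar_def by simp
   have root: "P.phi0 (exp y1) = 0" unfolding ey1 by (rule x0)
   show ?thesis
   proof (rule fin)
    fix c :: real assume c: "0 < c"
    have "\<forall>\<^sub>F p in at_right 0. \<bar>P.put_value (p ^ 8) (y1 + a * p ^ 4) - (K - exp (y1 + a * p ^ 4))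
     - p ^ 12 * (exp y1 * P.dbar y1) * (\<sigma> * v_aux Maux W N L 0 \<beta> (a / \<sigma>))\<bar> <= c * p ^ 12"
     by (rule P.put_value_expansion[OF y1K root aux[unfolded lam0] c])
    \<comment> \<open>The substitution \<open>p = \<theta> powr (1/8)\<close> turns the powers 8, 4
      and 12 of \<open>p\<close> back into \<open>\<theta>\<close>, \<open>sqrt \<theta>\<close> and
      \<open>\<theta> powr (3/2)\<close>.\<close>
    moreover have "filterlim (%th::real. th powr (1/8)) (at_right 0) (at_right 0)"
    proof -
     have "((%th::real. th powr (1/8)) \<longlongrightarrow> 0) (at_right 0)"
      using tendsto_powr'[of "%th::real. th" 0 "at_right 0" "%_. 1/8" "1/8"] by (simp add: eventually_at_right_less[THEN eventually_mono])
     then show ?thesis unfolding filterlim_at by (auto intro!: eventually_mono[OF eventually_at_right_less[of 0]])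
    qed
    ultimately have "\<forall>\<^sub>F th in at_right 0. \<bar>P.put_value ((th powr (1/8)) ^ 8) (y1 + a * (th powr (1/8)) ^ 4) - (K - exp (y1 + a * (th powr (1/8)) ^ 4))
     - (th powr (1/8)) ^ 12 * (exp y1 * P.dbar y1) * (\<sigma> * v_aux Maux W N L 0 \<beta> (a / \<sigma>))\<bar> <= c * (th powr (1/8)) ^ 12"
     by (rule eventually_compose_filterlim)
    moreover have "\<forall>\<^sub>F th in at_right (0::real). 0 < th" by (rule eventually_at_right_less)
    ultimately show "\<forall>\<^sub>F th in at_right 0. \<bar>A (T - th) (bT * exp (a * sqrt th)) - (max 0 (K - bT * exp (a * sqrt th))
   + \<sigma> * bT * \<delta>bar * exp lam * v_aux Maux W N L lam \<beta> (a / \<sigma>) * th powr (3/2))\<bar> <= c * th powr (3/2)"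
    proof eventually_elim
     case (elim th)
     have p: "(th powr (1/8)) ^ n = th powr (real n / 8)" for n
      using elim(2) by (simp add: powr_realpow[symmetric] powr_powr)
     have p8: "(th powr (1/8)) ^ 8 = th" and p4: "(th powr (1/8)) ^ 4 = sqrt th" and p12: "(th powr (1/8)) ^ 12 = th powr (3/2)"
      using elim(2) unfolding p by (simp_all add: powr_half_sqrt)
     have ex: "exp (y1 + a * sqrt th) = bT * exp (a * sqrt th)" by (simp add: exp_add ey1 bTx)
     \<comment> \<open>For \<open>a < 0\<close> the price stays below \<open>x0 < K\<close>, so the
       positive part in the statement is the intrinsic value used in the expansion.\<close>
     have "a * sqrt th <= 0" using a elim(2) by (intro mult_nonpos_nonneg) auto
     then have "bT * exp (a * sqrt th) <= x0 * 1" unfolding bTx using x0 by (intro mult_left_mono) auto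
     then have mx: "max 0 (K - bT * exp (a * sqrt th)) = K - bT * exp (a * sqrt th)" using x0 by simp
     have tm: "\<sigma> * bT * \<delta>bar * exp lam * v_aux Maux W N L lam \<beta> (a / \<sigma>) * th powr (3/2)
       = th powr (3/2) * (exp y1 * P.dbar y1) * (\<sigma> * v_aux Maux W N L 0 \<beta> (a / \<sigma>))"
      unfolding lam0 db bTx ey1 by simp
     show ?case using elim(1) unfolding p8 p4 p12 PV ex mx tm by (simp only: diff_diff_eq)
    qed
   qed
  qed
 qed
qed

end
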